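(* Let $\Sigma^+$ be a topologically transitive one-sided countable Markov shift with finite Gurevich entropy. Let $\phi$ be a $\theta$-weakly H\"older continuous SPR potential with $\sup\phi<\infty$, and let $m$ be the unique equilibrium measure of $\phi$. If $\beta>0$ and $e^{-\beta}\le\theta$, then there exists $C_{\theta,\beta}(\phi)>0$ such that for every $\psi\in\mathcal H_\beta$ and every $\mu\in\mathscr M(\Sigma^+)$, $$\Big|\int\psi\,d\mu-\int\psi\,dm\Big|\le C_{\theta,\beta}(\phi)\,\|\psi\|_\beta\sqrt{P_G(\phi)-P_\mu(\phi)}.$$
   Context: Let $\mathscr G$ be a countable directed graph with vertex set $S$. The one-sided TMS is $\Sigma^+=\{\underline x=(x_0,x_1,\dots)\in S^{\mathbb N\cup\{0\}}:x_i\to x_{i+1}\ \forall i\}$ with left shift $\sigma$ and metric $d(\underline x,\underline y)=e^{-t(\underline x,\underline y)}$, $t(\underline x,\underline y)=\min\{i:x_i\ne y_i\}$. Topologically transitive means $\mathscr G$ strongly connected; period $p$ is the gcd of loop lengths at a vertex; mixing means period 1. For period $p$, $\Sigma^+=\biguplus_{i<p}\Sigma_i^+$, $\Sigma_i^+=\{x_0\in S_i\}$ with $S_i$ the classes of "$a=b$ or path from $a$ to $b$ of length divisible by $p$", and $\sigma^p|_{\Sigma_0^+}$ is a mixing TMS. $\mathrm{osc}_n(\phi)=\sup\{|\phi(\underline x)-\phi(\underline y)|:x_i=y_i,i<n\}$; $\theta$-weakly H\"older: $\mathrm{osc}_n(\phi)\le A\theta^n$ for $n\ge2$. $\phi_n=\sum_{k<n}\phi\circ\sigma^k$.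 Mixing case: $Z_n(\phi,a)=\sum_{\sigma^n\underline x=\underline x}e^{\phi_n(\underline x)}1_{[a]}(\underline x)$, $P_G(\phi)=\lim\frac1n\log Z_n(\phi,a)$; period $p$: $P_G(\phi)=\frac1pP_G(\phi_p|_{\Sigma_0^+})$ for $\sigma^p$; Gurevich entropy $=P_G(0)$. $\mathscr M(\Sigma^+)$: shift-invariant Borel probabilities; $P_\mu(\phi)=h_\mu(\sigma)+\int\phi d\mu$; equilibrium measures maximize $P_\mu(\phi)$ (the maximum equals $P_G(\phi)$). SPR (mixing case, $\phi$ with summable variations and finite pressure): with $\tau_a(\underline x)=1_{[a]}(\underline x)\min\{n>0:x_n=a\}$, $Z^\ast_n(\phi,a)=\sum_{\sigma^n\underline x=\underline x}e^{\phi_n(\underline x)}1_{[\tau_a=n]}(\underline x)$, $\phi$ is SPR iff $\limsup\frac1n\log Z^\ast_n(\phi,a)<P_G(\phi)$ for some (every) state $a$ (equivalent to the paper's discriminant definition). Period $p$: $\phi$ SPR iff $\phi_p|_{\Sigma_0^+}$ SPR for $\sigma^p$. $\mathcal H_\beta=\{\psi:\|\psi\|_\beta:=\|\psi\|_\infty+\sup_{\underline x\ne\underline y}|\psi(\underline x)-\psi(\underline y)|e^{\beta t(\underline x,\underline y)}<\infty\}$. *)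

theory Defs
  imports "HOL-Probability.Probability"
begin

definition edge :: "'v set \<Rightarrow> ('v \<Rightarrow> 'v \<Rightarrow> bool) \<Rightarrow> 'v \<Rightarrow> 'v \<Rightarrow> bool" where
  "edge S E a b \<longleftrightarrow> a \<in> S \<and> b \<in> S \<and> E a b"

definition tms :: "'v set \<Rightarrow> ('v \<Rightarrow> 'v \<Rightarrow> bool) \<Rightarrow> (nat \<Rightarrow> 'v) set" where
  "tms S E = {x. \<forall>i. edge S E (x i) (x (Suc i))}"

definition shift :: "(nat \<Rightarrow> 'v) \<Rightarrow> (nat \<Rightarrow> 'v)" where
  "shift x = (\<lambda>i. x (Suc i))"

definition agree_time :: "(nat \<Rightarrow> 'v) \<Rightarrow> (nat \<Rightarrow> 'v) \<Rightarrow> nat" where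
  "agree_time x y = (LEAST i. x i \<noteq> y i)"

text \<open>Topological transitivity = strong connectivity of the graph.\<close>
definition top_transitive :: "'v set \<Rightarrow> ('v \<Rightarrow> 'v \<Rightarrow> bool) \<Rightarrow> bool" where
  "top_transitive S E \<longleftrightarrow> S \<noteq> {} \<and>
     (\<forall>a\<in>S. \<forall>b\<in>S. \<exists>n>0. (edge S E ^^ n) a b)"

definition base_vertex :: "'v set \<Rightarrow> 'v" where
  "base_vertex S = (SOME a. a \<in> S)"

definition period :: "'v set \<Rightarrow> ('v \<Rightarrow> 'v \<Rightarrow> bool) \<Rightarrow> nat" where
  "period S E = Gcd {n. n > 0 \<and> (edge S E ^^ n) (base_vertex S) (base_vertex S)}"

definition class0 :: "'v set \<Rightarrow> ('v \<Rightarrow> 'v \<Rightarrow> bool) \<Rightarrow> 'v set" where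
  "class0 S E = {b \<in> S. b = base_vertex S \<or>
      (\<exists>n. period S E dvd n \<and> (edge S E ^^ n) (base_vertex S) b)}"

definition birkhoff :: "((nat \<Rightarrow> 'v) \<Rightarrow> real) \<Rightarrow> nat \<Rightarrow> (nat \<Rightarrow> 'v) \<Rightarrow> real" where
  "birkhoff f n x = (\<Sum>k<n. f ((shift ^^ k) x))"

definition weakly_hoelder :: "'v set \<Rightarrow> ('v \<Rightarrow> 'v \<Rightarrow> bool) \<Rightarrow> real \<Rightarrow> ((nat \<Rightarrow> 'v) \<Rightarrow> real) \<Rightarrow> bool" where
  "weakly_hoelder S E \<theta> \<phi> \<longleftrightarrow> 0 < \<theta> \<and> \<theta> < 1 \<and>
     (\<exists>A. \<forall>n\<ge>2. \<forall>x\<in>tms S E. \<forall>y\<in>tms S E.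
         (\<forall>i<n. x i = y i) \<longrightarrow> \<bar>\<phi> x - \<phi> y\<bar> \<le> A * \<theta> ^ n)"

definition eln :: "ennreal \<Rightarrow> ereal" where
  "eln z = (if z = 0 then -\<infinity> else if z = \<infinity> then \<infinity> else ereal (ln (enn2real z)))"

definition Zn :: "'w set \<Rightarrow> ('w \<Rightarrow> 'w \<Rightarrow> bool) \<Rightarrow> ((nat \<Rightarrow> 'w) \<Rightarrow> real) \<Rightarrow> nat \<Rightarrow> 'w \<Rightarrow> ennreal" where
  "Zn V F f n a = infsum (\<lambda>x. ennreal (exp (birkhoff f n x)))
      {x \<in> tms V F. (shift ^^ n) x = x \<and> x 0 = a}"

definition tau :: "'w \<Rightarrow> (nat \<Rightarrow> 'w) \<Rightarrow> nat" where
  "tau a x = (if x 0 = a then (LEAST n. n > 0 \<and> x n = a) else 0)"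

definition Zstar :: "'w set \<Rightarrow> ('w \<Rightarrow> 'w \<Rightarrow> bool) \<Rightarrow> ((nat \<Rightarrow> 'w) \<Rightarrow> real) \<Rightarrow> nat \<Rightarrow> 'w \<Rightarrow> ennreal" where
  "Zstar V F f n a = infsum (\<lambda>x. ennreal (exp (birkhoff f n x)))
      {x \<in> tms V F. (shift ^^ n) x = x \<and> x 0 = a \<and> tau a x = n}"

text \<open>Gurevich pressure of a mixing TMS (the limit is independent of the state).\<close>
definition gpres_mixing :: "'w set \<Rightarrow> ('w \<Rightarrow> 'w \<Rightarrow> bool) \<Rightarrow> ((nat \<Rightarrow> 'w) \<Rightarrow> real) \<Rightarrow> ereal" where
  "gpres_mixing V F f = lim (\<lambda>n. eln (Zn V F f (Suc n) (SOME a. a \<in> V)) / ereal (real (Suc n)))"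

definition spr_mixing :: "'w set \<Rightarrow> ('w \<Rightarrow> 'w \<Rightarrow> bool) \<Rightarrow> ((nat \<Rightarrow> 'w) \<Rightarrow> real) \<Rightarrow> bool" where
  "spr_mixing V F f \<longleftrightarrow> (\<exists>a\<in>V.
     limsup (\<lambda>n. eln (Zstar V F f (Suc n) a) / ereal (real (Suc n))) < gpres_mixing V F f)"

text \<open>The mixing TMS sigma^p on Sigma_0^+, recoded over the alphabet of admissible
  words of length p starting in S_0.\<close>
definition block_vertices :: "'v set \<Rightarrow> ('v \<Rightarrow> 'v \<Rightarrow> bool) \<Rightarrow> 'v list set" where
  "block_vertices S E = {w. length w = period S E \<and> hd w \<in> class0 S E \<and> set w \<subseteq> S \<and>
       (\<forall>j. Suc j < period S E \<longrightarrow> edge S E (w ! j) (w ! Suc j))}"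

definition block_edge :: "'v set \<Rightarrow> ('v \<Rightarrow> 'v \<Rightarrow> bool) \<Rightarrow> 'v list \<Rightarrow> 'v list \<Rightarrow> bool" where
  "block_edge S E w w' \<longleftrightarrow> edge S E (last w) (hd w')"

definition decode :: "nat \<Rightarrow> (nat \<Rightarrow> 'v list) \<Rightarrow> (nat \<Rightarrow> 'v)" where
  "decode p y = (\<lambda>i. y (i div p) ! (i mod p))"

definition induced_pot :: "'v set \<Rightarrow> ('v \<Rightarrow> 'v \<Rightarrow> bool) \<Rightarrow> ((nat \<Rightarrow> 'v) \<Rightarrow> real) \<Rightarrow> (nat \<Rightarrow> 'v list) \<Rightarrow> real" where
  "induced_pot S E \<phi> y = birkhoff \<phi> (period S E) (decode (period S E) y)"

definition gurevich_pressure :: "'v set \<Rightarrow> ('v \<Rightarrow> 'v \<Rightarrow> bool) \<Rightarrow> ((nat \<Rightarrow> 'v) \<Rightarrow> real) \<Rightarrow> ereal" where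
  "gurevich_pressure S E \<phi> =
     gpres_mixing (block_vertices S E) (block_edge S E) (induced_pot S E \<phi>) / ereal (real (period S E))"

definition gurevich_entropy :: "'v set \<Rightarrow> ('v \<Rightarrow> 'v \<Rightarrow> bool) \<Rightarrow> ereal" where
  "gurevich_entropy S E = gurevich_pressure S E (\<lambda>_. 0)"

definition SPR :: "'v set \<Rightarrow> ('v \<Rightarrow> 'v \<Rightarrow> bool) \<Rightarrow> ((nat \<Rightarrow> 'v) \<Rightarrow> real) \<Rightarrow> bool" where
  "SPR S E \<phi> \<longleftrightarrow> spr_mixing (block_vertices S E) (block_edge S E) (induced_pot S E \<phi>)"

text \<open>Borel sigma-algebra of Sigma^+ (generated by the cylinders).\<close>
definition tms_measure :: "'v set \<Rightarrow> ('v \<Rightarrow> 'v \<Rightarrow> bool) \<Rightarrow> (nat \<Rightarrow> 'v) measure" where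
  "tms_measure S E = sigma (tms S E)
     {{x \<in> tms S E. \<forall>i<n. x i = w i} | n w. True}"

definition inv_prob :: "'v set \<Rightarrow> ('v \<Rightarrow> 'v \<Rightarrow> bool) \<Rightarrow> (nat \<Rightarrow> 'v) measure \<Rightarrow> bool" where
  "inv_prob S E \<mu> \<longleftrightarrow> sets \<mu> = sets (tms_measure S E) \<and> prob_space \<mu> \<and>
     (\<forall>A\<in>sets \<mu>. emeasure \<mu> (shift -` A \<inter> space \<mu>) = emeasure \<mu> A)"

definition finite_partition :: "'a measure \<Rightarrow> 'a set set \<Rightarrow> bool" where
  "finite_partition \<mu> P \<longleftrightarrow> finite P \<and> P \<subseteq> sets \<mu> \<and> disjoint P \<and> \<Union>P = space \<mu>"

definition part_entropy :: "'a measure \<Rightarrow> 'a set set \<Rightarrow> real" where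
  "part_entropy \<mu> P = - (\<Sum>A\<in>P. measure \<mu> A * ln (measure \<mu> A))"

definition join_part :: "(nat \<Rightarrow> 'v) measure \<Rightarrow> (nat \<Rightarrow> 'v) set set \<Rightarrow> nat \<Rightarrow> (nat \<Rightarrow> 'v) set set" where
  "join_part \<mu> P n = {(\<Inter>k<n. (shift ^^ k) -` (A k)) \<inter> space \<mu> | A. \<forall>k<n. A k \<in> P}"

definition entropy_wrt :: "(nat \<Rightarrow> 'v) measure \<Rightarrow> (nat \<Rightarrow> 'v) set set \<Rightarrow> real" where
  "entropy_wrt \<mu> P = lim (\<lambda>n. part_entropy \<mu> (join_part \<mu> P (Suc n)) / real (Suc n))"

definition ks_entropy :: "(nat \<Rightarrow> 'v) measure \<Rightarrow> ereal" where
  "ks_entropy \<mu> = (SUP P\<in>{P. finite_partition \<mu> P}. ereal (entropy_wrt \<mu> P))"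

text \<open>Integral of a function bounded above, with values in [-inf, inf).\<close>
definition ext_integral :: "'a measure \<Rightarrow> ('a \<Rightarrow> real) \<Rightarrow> ereal" where
  "ext_integral \<mu> f = enn2ereal (\<integral>\<^sup>+ x. ennreal (max (f x) 0) \<partial>\<mu>)
                     - enn2ereal (\<integral>\<^sup>+ x. ennreal (max (- f x) 0) \<partial>\<mu>)"

definition meas_pressure :: "(nat \<Rightarrow> 'v) measure \<Rightarrow> ((nat \<Rightarrow> 'v) \<Rightarrow> real) \<Rightarrow> ereal" where
  "meas_pressure \<mu> \<phi> = ks_entropy \<mu> + ext_integral \<mu> \<phi>"

definition equilibrium_measure :: "'v set \<Rightarrow> ('v \<Rightarrow> 'v \<Rightarrow> bool) \<Rightarrow> ((nat \<Rightarrow> 'v) \<Rightarrow> real) \<Rightarrow> (nat \<Rightarrow> 'v) measure \<Rightarrow> bool" where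
  "equilibrium_measure S E \<phi> m \<longleftrightarrow> inv_prob S E m \<and>
     meas_pressure m \<phi> = (SUP \<mu>\<in>{\<mu>. inv_prob S E \<mu>}. meas_pressure \<mu> \<phi>)"

definition hnorm :: "'v set \<Rightarrow> ('v \<Rightarrow> 'v \<Rightarrow> bool) \<Rightarrow> real \<Rightarrow> ((nat \<Rightarrow> 'v) \<Rightarrow> real) \<Rightarrow> real" where
  "hnorm S E \<beta> \<psi> = Sup (insert 0 ((\<lambda>x. \<bar>\<psi> x\<bar>) ` tms S E))
     + Sup (insert 0 {\<bar>\<psi> x - \<psi> y\<bar> * exp (\<beta> * real (agree_time x y)) | x y.
                        x \<in> tms S E \<and> y \<in> tms S E \<and> x \<noteq> y})"

definition in_H :: "'v set \<Rightarrow> ('v \<Rightarrow> 'v \<Rightarrow> bool) \<Rightarrow> real \<Rightarrow> ((nat \<Rightarrow> 'v) \<Rightarrow> real) \<Rightarrow> bool" where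
  "in_H S E \<beta> \<psi> \<longleftrightarrow> bdd_above ((\<lambda>x. \<bar>\<psi> x\<bar>) ` tms S E) \<and>
     bdd_above {\<bar>\<psi> x - \<psi> y\<bar> * exp (\<beta> * real (agree_time x y)) | x y.
                  x \<in> tms S E \<and> y \<in> tms S E \<and> x \<noteq> y}"

end

theory Submission
  imports Defs "HOL-Library.Omega_Words_Fun"
begin

text \<open>
  Write \<open>P(s)\<close> for the Gurevich pressure of \<open>\<phi> + s\<psi>\<close>. Strong positive recurrence makes the induced system of
  first returns to a state have an exponential tail at the pressure of \<open>\<phi>\<close>. The normalised transfer operator
  of the induced system contracts a cone of log-Hoelder functions, so a Poisson equation for the first order term
  in \<open>s\<close> can be solved, and its solution is turned into an explicit positive function on which the perturbed induced operator
  acts with factor at most \<open>1\<close> at level \<open>P(0) + s\<kappa> + C N\<^sup>2 s\<^sup>2\<close>, where \<open>N\<close> is the norm of \<open>\<psi>\<close>. Hence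
  \<open>P(s) \<le> P(0) + s\<kappa> + C N\<^sup>2 s\<^sup>2\<close> for \<open>\<bar>s\<bar> N\<close> small; no analyticity of the pressure is needed.

  By the variational inequality, \<open>P\<^sub>\<mu>(\<phi>) + s \<integral>\<psi> d\<mu> \<le> P(s)\<close> for each invariant \<open>\<mu>\<close>. Taking \<open>\<mu> = m\<close> and both signs of \<open>s\<close>
  forces \<open>\<kappa> = \<integral>\<psi> dm\<close>; here \<open>P\<^sub>m(\<phi>) = P(0)\<close> because the Bernoulli measures on finite families of loops have pressures
  approaching \<open>P(0)\<close>. Therefore \<open>s (\<integral>\<psi> d\<mu> - \<integral>\<psi> dm) \<le> P(0) - P\<^sub>\<mu>(\<phi>) + C N\<^sup>2 s\<^sup>2\<close>, and the choice
  \<open>s = \<plusminus> sqrt (P(0) - P\<^sub>\<mu>(\<phi>)) / N\<close> gives the claim.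
\<close>

section \<open>Cone contraction and perturbed subeigenfunctions\<close>

text \<open>One constant has to serve all \<open>\<psi>\<close>, so \<open>C'\<close> and
  \<open>\<epsilon>0\<close> are chosen before \<open>\<psi>\<close>, and every estimate is
  homogeneous in one number \<open>N\<close> that bounds both the size and the variation of
  \<open>\<psi>\<close>. The set of return words is infinite and \<open>\<phi>\<close> may be
  unbounded below, so only positivity, distortion and monotone or dominated limits are used. The gap
  \<open>P - q0\<close> supplied by strong positive recurrence is used twice: it gives dominated
  convergence as \<open>q\<close> tends to \<open>P\<close>, which yields the eigenfunction at the
  critical exponent, and it gives an exponential moment of the return time, which absorbs the factor
  \<open>tau^2\<close> of the second order term in \<open>s\<close>. Entropy is a supremum over
  arbitrary finite Borel partitions, whereas loop sums see only words; Gibbs' inequality with a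
  noisy prediction of the atoms bridges the two. For period \<open>p\<close> the loop sums live on
  the recoded shift over one cyclic class, but invariant measures live on the whole shift. Measures
  are not decomposed; instead any path between any two vertices is completed to a loop of the
  recoded graph.\<close>

lemma exp_le_quadratic:
  fixes y :: real
  shows "exp y \<le> 1 + y + y\<^sup>2 * exp \<bar>y\<bar>"
proof (cases "0 \<le> y")
  case True
  have "exp (-y) \<ge> 1 - y" using exp_ge_add_one_self[of "-y"] by simp
  then have a: "exp y * (1 - y) \<le> 1"
    using mult_left_mono[of "1 - y" "exp (-y)" "exp y"] by (simp add: exp_minus)
  then have "exp y - 1 \<le> y * exp y" by (simp add: algebra_simps)
  then have "y * (exp y - 1) \<le> y * (y * exp y)" using True by (intro mult_left_mono) auto
  then have "exp y - 1 - y \<le> y\<^sup>2 * exp y" 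
    using \<open>exp y - 1 \<le> y * exp y\<close> by (simp add: algebra_simps power2_eq_square)
  then show ?thesis using True by simp
next
  case False
  define z where "z = - y"
  have z: "z > 0" using False z_def by simp
  have "exp z \<ge> 1 + z" by (rule exp_ge_add_one_self)
  \<comment> \<open>For negative arguments the stronger bound
    \<open>exp (- z) \<le> 1 - z + z^2\<close> holds, because \<open>1 - z + z^2\<close> times
    \<open>1 + z\<close> is \<open>1 + z^3\<close>.\<close>
  then have "1 \<le> (1 - z + z\<^sup>2) * exp z"
  proof -
    have "(1 - z + z\<^sup>2) * (1 + z) = 1 + z ^ 3" by (simp add: algebra_simps power2_eq_square power3_eq_cube)
    moreover have "(1 - z + z\<^sup>2) \<ge> 0" using zero_le_power2[of "z - 1/2"] by (simp add: power2_eq_square algebra_simps)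
    ultimately show ?thesis using \<open>exp z \<ge> 1 + z\<close> z mult_left_mono[of "1+z" "exp z" "1 - z + z\<^sup>2"]
      by (smt (verit) zero_less_power)
  qed
  then have "exp (-z) \<le> 1 - z + z\<^sup>2"
    using mult_right_mono[of 1 "(1 - z + z\<^sup>2) * exp z" "exp (-z)"] by (simp add: mult.assoc flip: exp_add)
  also have "\<dots> \<le> 1 - z + z\<^sup>2 * exp z"
    using z by simp
  finally show ?thesis using z unfolding z_def by simp
qed

text \<open>Model: \<open>X\<close> is the cylinder of a state, \<open>B\<close> the set of
  first-return words, \<open>br v\<close> prepends the word \<open>v\<close>, and
  \<open>tau v\<close> is its length. The weights \<open>g\<close> already have total mass one.
  \<open>tail_le\<close> is an exponential moment of the return time, uniform in the base
  point.\<close>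

locale return_kernel =
  fixes X :: "'x set" and B :: "'b set" and br :: "'b \<Rightarrow> 'x \<Rightarrow> 'x"
    and d :: "'x \<Rightarrow> 'x \<Rightarrow> real" and g :: "'b \<Rightarrow> 'x \<Rightarrow> real" and tau :: "'b \<Rightarrow> nat"
    and \<theta> c3 \<epsilon> M :: real and x0 :: 'x
  assumes x0: "x0 \<in> X"
    and br_X: "v \<in> B \<Longrightarrow> x \<in> X \<Longrightarrow> br v x \<in> X"
    and d_nonneg: "x \<in> X \<Longrightarrow> y \<in> X \<Longrightarrow> 0 \<le> d x y"
    and d_le1: "x \<in> X \<Longrightarrow> y \<in> X \<Longrightarrow> d x y \<le> 1"
    and d_sym: "d x y = d y x"
    and d_contr: "v \<in> B \<Longrightarrow> x \<in> X \<Longrightarrow> y \<in> X \<Longrightarrow> d (br v x) (br v y) \<le> \<theta> * d x y"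
    and \<theta>: "0 \<le> \<theta>" "\<theta> < 1" and c3: "0 \<le> c3" and \<epsilon>: "0 < \<epsilon>"
    and g_nonneg: "v \<in> B \<Longrightarrow> x \<in> X \<Longrightarrow> 0 \<le> g v x"
    and g_int: "x \<in> X \<Longrightarrow> integrable (count_space B) (\<lambda>v. g v x)"
    and g_one: "x \<in> X \<Longrightarrow> (\<integral>v. g v x \<partial>count_space B) = 1"
    and g_dist: "v \<in> B \<Longrightarrow> x \<in> X \<Longrightarrow> y \<in> X \<Longrightarrow> g v x \<le> exp (c3 * d x y) * g v y"
    and tau_ge1: "v \<in> B \<Longrightarrow> 1 \<le> tau v"
    and tail_int: "x \<in> X \<Longrightarrow> integrable (count_space B) (\<lambda>v. g v x * exp (\<epsilon> * tau v))"
    and tail_le: "x \<in> X \<Longrightarrow> (\<integral>v. g v x * exp (\<epsilon> * tau v) \<partial>count_space B) \<le> M"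
begin

definition R :: "('x \<Rightarrow> real) \<Rightarrow> 'x \<Rightarrow> real" where
  "R f x = (\<integral>v. g v x * f (br v x) \<partial>count_space B)"

lemma integrable_weight:
  assumes "x \<in> X" "\<And>v. v \<in> B \<Longrightarrow> \<bar>f v\<bar> \<le> K * exp (\<epsilon> * tau v)"
  shows "integrable (count_space B) (\<lambda>v. g v x * f v)"
proof (rule Bochner_Integration.integrable_bound[of _ "\<lambda>v. K * (g v x * exp (\<epsilon> * tau v))"])
  show "integrable (count_space B) (\<lambda>v. K * (g v x * exp (\<epsilon> * tau v)))"
    using tail_int[OF assms(1)] by simp
  show "AE v in count_space B. norm (g v x * f v) \<le> norm (K * (g v x * exp (\<epsilon> * real (tau v))))"
  proof (rule AE_I2)
    fix v assume v: "v \<in> space (count_space B)"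
    then have "g v x * \<bar>f v\<bar> \<le> g v x * (K * exp (\<epsilon> * tau v))"
      using assms g_nonneg by (intro mult_left_mono) auto
    also have "\<dots> \<le> \<bar>K * (g v x * exp (\<epsilon> * real (tau v)))\<bar>" by (simp add: algebra_simps)
    finally show "norm (g v x * f v) \<le> norm (K * (g v x * exp (\<epsilon> * real (tau v))))"
      using g_nonneg[of v x] v assms by (simp add: abs_mult)
  qed
qed simp

lemma weight_le:
  assumes "x \<in> X" "\<And>v. v \<in> B \<Longrightarrow> \<bar>f v\<bar> \<le> K * exp (\<epsilon> * tau v)" "0 \<le> K"
  shows "\<bar>\<integral>v. g v x * f v \<partial>count_space B\<bar> \<le> K * M"
proof -
  have "\<bar>\<integral>v. g v x * f v \<partial>count_space B\<bar> \<le> (\<integral>v. \<bar>g v x * f v\<bar> \<partial>count_space B)"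
    using integral_norm_bound[of "count_space B" "\<lambda>v. g v x * f v"] by simp
  also have "\<dots> \<le> (\<integral>v. K * (g v x * exp (\<epsilon> * tau v)) \<partial>count_space B)"
  proof (rule integral_mono)
    show "integrable (count_space B) (\<lambda>v. \<bar>g v x * f v\<bar>)"
      using integrable_weight[OF assms(1,2)] by simp
    show "integrable (count_space B) (\<lambda>v. K * (g v x * exp (\<epsilon> * tau v)))"
      using tail_int[OF assms(1)] by simp
    fix v assume "v \<in> space (count_space B)"
    then show "\<bar>g v x * f v\<bar> \<le> K * (g v x * exp (\<epsilon> * tau v))"
      using mult_left_mono[OF assms(2)[of v], of "g v x"] g_nonneg[of v x] assms(1) 
      by (simp add: abs_mult algebra_simps)
  qed
  also have "\<dots> \<le> K * M" using tail_le[OF assms(1)] assms(3) by (simp add: mult_left_mono)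
  finally show ?thesis .
qed

lemma exp_tau_ge1: "1 \<le> exp (\<epsilon> * real (tau v))" using \<epsilon> by simp

lemma integrable_bounded:
  assumes "x \<in> X" "\<And>v. v \<in> B \<Longrightarrow> \<bar>f v\<bar> \<le> K"
  shows "integrable (count_space B) (\<lambda>v. g v x * f v)"
proof (rule integrable_weight[OF assms(1), of _ "\<bar>K\<bar>"])
  fix v assume "v \<in> B"
  have "\<bar>K\<bar> * 1 \<le> \<bar>K\<bar> * exp (\<epsilon> * tau v)" by (intro mult_left_mono exp_tau_ge1) auto
  then show "\<bar>f v\<bar> \<le> \<bar>K\<bar> * exp (\<epsilon> * tau v)" using assms(2)[OF \<open>v \<in> B\<close>] by linarith
qed

lemma M_ge1: "1 \<le> M"
proof -
  have "(\<integral>v. g v x0 \<partial>count_space B) \<le> (\<integral>v. g v x0 * exp (\<epsilon> * tau v) \<partial>count_space B)"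
  proof (rule integral_mono[OF g_int[OF x0] tail_int[OF x0]])
    fix v assume "v \<in> space (count_space B)"
    then show "g v x0 \<le> g v x0 * exp (\<epsilon> * real (tau v))"
      using mult_left_mono[OF exp_tau_ge1[of v] g_nonneg[of v x0]] x0 by simp
  qed
  then show ?thesis using g_one[OF x0] tail_le[OF x0] by linarith
qed

lemma R_bounds:
  assumes "x \<in> X" "\<And>y. y \<in> X \<Longrightarrow> a \<le> f y" "\<And>y. y \<in> X \<Longrightarrow> f y \<le> b"
  shows "a \<le> R f x" "R f x \<le> b"
proof -
  have bd: "\<bar>f (br v x)\<bar> \<le> \<bar>a\<bar> + \<bar>b\<bar>" if "v \<in> B" for v
    using assms(2,3)[OF br_X[OF that assms(1)]] by linarith
  have i: "integrable (count_space B) (\<lambda>v. g v x * f (br v x))"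
    by (rule integrable_bounded[OF assms(1) bd])
  have "(\<integral>v. g v x * a \<partial>count_space B) \<le> R f x" unfolding R_def
    using g_int[OF assms(1)] i g_nonneg assms br_X by (intro integral_mono) (auto intro!: mult_left_mono)
  then show "a \<le> R f x" using g_one[OF assms(1)] by simp
  have "R f x \<le> (\<integral>v. g v x * b \<partial>count_space B)" unfolding R_def
    using g_int[OF assms(1)] i g_nonneg assms br_X by (intro integral_mono) (auto intro!: mult_left_mono)
  then show "R f x \<le> b" using g_one[OF assms(1)] by simp
qed

lemma R_cong: "x \<in> X \<Longrightarrow> (\<And>y. y \<in> X \<Longrightarrow> f y = f' y) \<Longrightarrow> R f x = R f' x"
  unfolding R_def using br_X by (intro Bochner_Integration.integral_cong) auto

lemma R_affine:
  assumes "x \<in> X" "\<And>y. y \<in> X \<Longrightarrow> \<bar>f y\<bar> \<le> K"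
  shows "R (\<lambda>y. a + b * f y) x = a + b * R f x"
proof -
  have i: "integrable (count_space B) (\<lambda>v. g v x * f (br v x))"
    using assms br_X by (intro integrable_bounded) auto
  have "R (\<lambda>y. a + b * f y) x = (\<integral>v. a * g v x + b * (g v x * f (br v x)) \<partial>count_space B)"
    unfolding R_def by (simp add: algebra_simps)
  also have "\<dots> = a + b * R f x"
    using i g_int[OF assms(1)] g_one[OF assms(1)] by (simp add: R_def)
  finally show ?thesis .
qed

section \<open>Contraction of cones of log-Lipschitz functions\<close>

definition cone :: "real \<Rightarrow> ('x \<Rightarrow> real) \<Rightarrow> bool" where
  "cone c f \<longleftrightarrow> (\<forall>x\<in>X. 0 \<le> f x) \<and> (\<forall>x\<in>X. \<forall>y\<in>X. f x \<le> exp (c * d x y) * f y)"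

text \<open>The solution of \<open>c3 + c0 * \<theta> = c0 - 1\<close>: one application of
  \<open>R\<close> lowers the cone constant by one, and this gap pays for splitting off a
  constant.\<close>

definition c0 :: real where "c0 = (c3 + 1) / (1 - \<theta>)"

lemma c0: "c3 + c0 * \<theta> = c0 - 1" "1 \<le> c0"
proof -
  have "c0 * (1 - \<theta>) = c3 + 1" using \<theta> by (simp add: c0_def)
  then show "c3 + c0 * \<theta> = c0 - 1" by (simp add: algebra_simps)
  show "1 \<le> c0" using \<theta> c3 by (simp add: c0_def le_divide_eq)
qed

lemma cone_bounded:
  assumes "cone c f" "0 \<le> c" "y \<in> X"
  shows "\<bar>f y\<bar> \<le> exp c * f x0"
proof -
  have "f y \<le> exp (c * d y x0) * f x0" using assms x0 by (auto simp: cone_def)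
  also have "\<dots> \<le> exp c * f x0"
    using assms x0 d_le1[OF assms(3) x0] mult_left_mono[of "d y x0" 1 c] by (intro mult_right_mono) (auto simp: cone_def)
  finally show ?thesis using assms by (simp add: cone_def)
qed

text \<open>The constant of the image is \<open>c3 + c0 * \<theta>\<close>: distortion of the
  weights plus the contracted distortion of \<open>f\<close>.\<close>

lemma R_cone:
  assumes "cone c0 f"
  shows "cone (c0 - 1) (R f)"
  unfolding cone_def
proof (intro conjI ballI)
  note bd = cone_bounded[OF assms]
  fix x assume x: "x \<in> X"
  show "0 \<le> R f x" using R_bounds(1)[OF x, of 0 f "exp c0 * f x0"] bd assms c0 by (fastforce simp: cone_def)
next
  note bd = cone_bounded[OF assms]
  fix x y assume x: "x \<in> X" and y: "y \<in> X"
  have i: "integrable (count_space B) (\<lambda>v. g v z * f (br v z))" if "z \<in> X" for z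
    using that bd br_X c0 by (intro integrable_bounded[where K = "exp c0 * f x0"]) auto
  have "R f x \<le> (\<integral>v. exp ((c0 - 1) * d x y) * (g v y * f (br v y)) \<partial>count_space B)"
    unfolding R_def
  proof (rule integral_mono)
    fix v assume "v \<in> space (count_space B)"
    then have v: "v \<in> B" by simp
    have "f (br v x) \<le> exp (c0 * d (br v x) (br v y)) * f (br v y)"
      using assms br_X v x y by (auto simp: cone_def)
    also have "\<dots> \<le> exp (c0 * (\<theta> * d x y)) * f (br v y)"
      using d_contr[OF v x y] c0 assms br_X[OF v y] by (intro mult_right_mono) (auto simp: cone_def mult_left_mono)
    finally have "g v x * f (br v x) \<le> (exp (c3 * d x y) * g v y) * (exp (c0 * (\<theta> * d x y)) * f (br v y))"
      using g_dist[OF v x y] g_nonneg[OF v x] g_nonneg[OF v y] assms br_X[OF v x]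
      by (intro mult_mono) (auto simp: cone_def)
    also have "\<dots> = exp (c3 * d x y + c0 * (\<theta> * d x y)) * (g v y * f (br v y))" by (simp add: exp_add)
    also have "c3 * d x y + c0 * (\<theta> * d x y) = (c3 + c0 * \<theta>) * d x y" by (simp add: algebra_simps)
    finally show "g v x * f (br v x) \<le> exp ((c0 - 1) * d x y) * (g v y * f (br v y))" using c0 by simp
  qed (use i[OF x] i[OF y] in auto)
  then show "R f x \<le> exp ((c0 - 1) * d x y) * R f y" by (simp add: R_def)
qed

text \<open>This is \<open>1 - \<eta> * exp (- c0)\<close> for the \<open>\<eta>\<close> of
  \<open>R_split\<close>: at least the fraction \<open>\<eta> * exp (- c0)\<close> of
  \<open>R f\<close> is removed at each point.\<close>

definition rate :: real where "rate = 1 - exp (- c0) * exp (- c0) * exp (- c0) / c0"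

lemma rate: "0 < rate" "rate < 1"
proof -
  have "exp (- c0) * exp (- c0) * exp (- c0) < 1 * 1 * 1"
    using c0 by (intro mult_strict_mono) auto
  then show "0 < rate" using c0 by (simp add: rate_def divide_less_eq)
  show "rate < 1" using c0 by (simp add: rate_def)
qed

text \<open>After one application of the operator the function lies in a strictly smaller cone, so a
  fixed proportion of it can be split off as a constant without leaving the original cone.\<close>

lemma R_split:
  assumes f: "cone c0 f" and s: "\<And>x. x \<in> X \<Longrightarrow> f x \<le> s"
  obtains k f' where "\<And>x. x \<in> X \<Longrightarrow> R f x = k + f' x" "cone c0 f'" "\<And>x. x \<in> X \<Longrightarrow> f' x \<le> rate * s"
proof -
  define T where "T = R f x0"
  \<comment> \<open>Chosen so that \<open>k * (c0 * D * exp c0)\<close> equals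
    \<open>D * (exp (- c0) * T)\<close>, which the gap between the cone constants \<open>c0\<close>
    and \<open>c0 - 1\<close> covers.\<close>
  define \<eta> where "\<eta> = exp (- c0) * exp (- c0) / c0"
  define k where "k = \<eta> * T"
  have \<eta>: "0 < \<eta>" "\<eta> \<le> exp (- c0)" 
    using c0 mult_mono[of "exp (- c0)" 1 "exp (-c0)" "c0 * exp (-c0)"]
    by (auto simp: \<eta>_def divide_le_eq mult.commute)
  have rc: "cone (c0 - 1) (R f)" by (rule R_cone[OF f])
  have T: "0 \<le> T" using rc x0 by (auto simp: cone_def T_def)
  have le: "R f x \<le> exp c0 * R f y" if "x \<in> X" "y \<in> X" for x y
  proof -
    have "R f x \<le> exp ((c0 - 1) * d x y) * R f y" using rc that by (auto simp: cone_def)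
    also have "\<dots> \<le> exp c0 * R f y"
      using rc that d_le1[OF that] d_nonneg[OF that] c0 mult_mono[of "c0 - 1" c0 "d x y" 1]
      by (intro mult_right_mono) (auto simp: cone_def)
    finally show ?thesis .
  qed
  have lowT: "exp (- c0) * T \<le> R f y" if "y \<in> X" for y
    using mult_left_mono[OF le[OF x0 that], of "exp (- c0)"] by (simp add: T_def mult.assoc[symmetric] flip: exp_add)
  have lowR: "exp (- c0) * R f y \<le> T" if "y \<in> X" for y
    using mult_left_mono[OF le[OF that x0], of "exp (- c0)"] by (simp add: T_def mult.assoc[symmetric] flip: exp_add)
  have kT: "k \<le> exp (- c0) * T" unfolding k_def using \<eta> T by (intro mult_right_mono) auto
  show ?thesis
  proof (rule that[of k "\<lambda>x. R f x - k"])
    show "cone c0 (\<lambda>x. R f x - k)" unfolding cone_def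
    proof (intro conjI ballI)
      fix x assume "x \<in> X" then show "0 \<le> R f x - k" using lowT kT by fastforce
    next
      fix x y assume x: "x \<in> X" and y: "y \<in> X"
      \<comment> \<open>With \<open>k\<close> subtracted on both sides, the cone inequality reads
        \<open>k * (exp (c0 * D) - 1) \<le> exp (c0 * D) * R f y - R f x\<close>. The left side is
        at most, the right side at least a multiple of \<open>D\<close>, so small distances cause no
        loss.\<close>
      define D where "D = d x y"
      have D: "0 \<le> D" "D \<le> 1" using d_nonneg d_le1 x y by (auto simp: D_def)
      have "D \<le> exp D - 1" using exp_ge_add_one_self[of D] by linarith
      then have e1: "exp ((c0 - 1) * D) * (exp D - 1) \<ge> 1 * D"
        using D c0 by (intro mult_mono) auto
      have e2: "exp (c0 * D) - exp ((c0 - 1) * D) \<ge> D"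
        using e1 by (simp add: algebra_simps flip: exp_add)
      have e3: "exp (c0 * D) - 1 \<le> c0 * D * exp c0"
      proof -
        have "exp (c0 * D) * (1 - c0 * D) \<le> exp (c0 * D) * exp (- (c0 * D))"
          using exp_ge_add_one_self[of "- (c0 * D)"] by (intro mult_left_mono) auto
        then have "exp (c0 * D) - 1 \<le> c0 * D * exp (c0 * D)" by (simp add: algebra_simps flip: exp_add)
        also have "\<dots> \<le> c0 * D * exp c0" using D c0 by (intro mult_left_mono) (auto simp: mult_le_cancel_left1)
        finally show ?thesis .
      qed
      have "k * (exp (c0 * D) - 1) \<le> k * (c0 * D * exp c0)"
        using e3 \<eta> T by (intro mult_left_mono) (auto simp: k_def)
      also have "\<dots> = D * (exp (- c0) * T)" using c0
        by (simp add: k_def \<eta>_def mult.assoc[symmetric]) (simp add: algebra_simps flip: exp_add)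
      also have "\<dots> \<le> (exp (c0 * D) - exp ((c0 - 1) * D)) * R f y"
        using e2 lowT[OF y] D T by (intro mult_mono) (auto simp: left_diff_distrib)
      also have "\<dots> \<le> exp (c0 * D) * R f y - R f x"
        using rc x y by (auto simp: cone_def D_def algebra_simps)
      finally show "R f x - k \<le> exp (c0 * d x y) * (R f y - k)" by (simp add: D_def algebra_simps)
    qed
    fix x assume x: "x \<in> X"
    have "R f x - k \<le> R f x - \<eta> * (exp (- c0) * R f x)"
      using lowR[OF x] \<eta> by (simp add: k_def mult_left_mono)
    also have "\<dots> = rate * R f x" by (simp add: rate_def \<eta>_def algebra_simps)
    also have "\<dots> \<le> rate * s"
      using R_bounds(2)[OF x, of 0 f s] f s rate by (intro mult_left_mono) (auto simp: cone_def)
    finally show "R f x - k \<le> rate * s" .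
  qed simp
qed

text \<open>\<open>R\<close> fixes constants, so those split off earlier pass through all later
  steps and accumulate in \<open>k\<close>, while the remainder shrinks by \<open>rate\<close> each
  time.\<close>

lemma iterate_split:
  assumes f: "cone c0 f" and s: "\<And>x. x \<in> X \<Longrightarrow> f x \<le> s"
  shows "\<exists>k f'. (\<forall>x\<in>X. (R ^^ n) f x = k + f' x) \<and> cone c0 f' \<and> (\<forall>x\<in>X. f' x \<le> rate ^ n * s)"
proof (induction n)
  case 0
  show ?case using f s by (intro exI[of _ 0] exI[of _ f]) auto
next
  case (Suc n)
  then obtain k f' where kf: "\<And>x. x \<in> X \<Longrightarrow> (R ^^ n) f x = k + f' x" "cone c0 f'"
    "\<And>x. x \<in> X \<Longrightarrow> f' x \<le> rate ^ n * s" by blast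
  obtain k' f'' where kf': "\<And>x. x \<in> X \<Longrightarrow> R f' x = k' + f'' x" "cone c0 f''"
    "\<And>x. x \<in> X \<Longrightarrow> f'' x \<le> rate * (rate ^ n * s)" using R_split[OF kf(2,3)] by blast
  have "(R ^^ Suc n) f x = (k + k') + f'' x" if "x \<in> X" for x
  proof -
    have "(R ^^ Suc n) f x = R (\<lambda>y. k + 1 * f' y) x" using kf(1) by (auto intro!: R_cong that)
    also have "\<dots> = k + 1 * R f' x" by (rule R_affine[OF that cone_bounded[OF kf(2)]]) (use c0 in auto)
    finally show ?thesis using kf'(1)[OF that] by simp
  qed
  with kf'(2,3) show ?case by (intro exI[of _ "k + k'"] exI[of _ f'']) (auto simp: mult.assoc)
qed

lemma iterate_bounds:
  assumes "\<And>y. y \<in> X \<Longrightarrow> a \<le> f y" "\<And>y. y \<in> X \<Longrightarrow> f y \<le> b" "x \<in> X"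
  shows "a \<le> (R ^^ n) f x \<and> (R ^^ n) f x \<le> b"
  using assms(3)
proof (induction n arbitrary: x)
  case (Suc n)
  have "a \<le> R ((R ^^ n) f) x" by (rule R_bounds(1)[OF Suc.prems, of a _ b]) (use Suc.IH in auto)
  moreover have "R ((R ^^ n) f) x \<le> b" by (rule R_bounds(2)[OF Suc.prems, of a _ b]) (use Suc.IH in auto)
  ultimately show ?case by simp
qed (use assms in auto)

lemma iterate_affine:
  assumes "\<And>y. y \<in> X \<Longrightarrow> \<bar>f y\<bar> \<le> K" "x \<in> X"
  shows "(R ^^ n) (\<lambda>y. a + b * f y) x = a + b * (R ^^ n) f x"
  using assms(2)
proof (induction n arbitrary: x)
  case (Suc n)
  have "(R ^^ Suc n) (\<lambda>y. a + b * f y) x = R (\<lambda>y. a + b * (R ^^ n) f y) x"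
    using Suc by (auto intro!: R_cong)
  also have "\<dots> = a + b * R ((R ^^ n) f) x"
  proof (rule R_affine[OF Suc.prems])
    fix y assume "y \<in> X"
    have "- K \<le> f z" "f z \<le> K" if "z \<in> X" for z using assms(1)[OF that] by linarith+
    then show "\<bar>(R ^^ n) f y\<bar> \<le> K"
      using iterate_bounds[of "-K" f K y n] \<open>y \<in> X\<close> by (auto simp: abs_le_iff)
  qed
  finally show ?case by simp
qed simp

text \<open>Adding \<open>2 * N\<close> moves all values between \<open>N\<close> and
  \<open>3 * N\<close>, where Lipschitz constant \<open>N\<close> is a logarithmic constant
  \<open>1 \<le> c0\<close>, so the shifted function lies in the cone. The accumulated constant
  cancels in the difference.\<close>

lemma lipschitz_osc:
  assumes bd: "\<And>x. x \<in> X \<Longrightarrow> \<bar>f x\<bar> \<le> N" and lip: "\<And>x y. x \<in> X \<Longrightarrow> y \<in> X \<Longrightarrow> \<bar>f x - f y\<bar> \<le> N * d x y"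
    and "0 \<le> N" "x \<in> X" "y \<in> X"
  shows "\<bar>(R ^^ n) f x - (R ^^ n) f y\<bar> \<le> 3 * N * rate ^ n"
proof -
  define F where "F = (\<lambda>y. 2 * N + 1 * f y)"
  have F: "N \<le> F x" "F x \<le> 3 * N" if "x \<in> X" for x using bd[OF that] by (auto simp: F_def)
  have "cone c0 F" unfolding cone_def
  proof (intro conjI ballI)
    fix x y assume x: "x \<in> X" and y: "y \<in> X"
    have "F x \<le> F y + N * d x y" using lip[OF x y] by (simp add: F_def)
    also have "\<dots> \<le> F y + F y * d x y" using F(1)[OF y] d_nonneg[OF x y] by (simp add: mult_right_mono)
    also have "\<dots> = (1 + d x y) * F y" by (simp add: algebra_simps)
    also have "\<dots> \<le> exp (c0 * d x y) * F y"
    proof (rule mult_right_mono)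
      have "1 + d x y \<le> exp (d x y)" by (rule exp_ge_add_one_self)
      also have "\<dots> \<le> exp (c0 * d x y)" using c0 d_nonneg[OF x y] mult_right_mono[of 1 c0 "d x y"] by simp
      finally show "1 + d x y \<le> exp (c0 * d x y)" .
      show "0 \<le> F y" using F(1)[OF y] assms(3) by simp
    qed
    finally show "F x \<le> exp (c0 * d x y) * F y" .
  next
    fix x assume "x \<in> X" then show "0 \<le> F x" using F(1) assms(3) by fastforce
  qed
  from iterate_split[OF this F(2), of n] obtain k f' where
    kf: "\<And>x. x \<in> X \<Longrightarrow> (R ^^ n) F x = k + f' x" "cone c0 f'" "\<And>x. x \<in> X \<Longrightarrow> f' x \<le> rate ^ n * (3 * N)" by blast
  have "(R ^^ n) F z = 2 * N + 1 * (R ^^ n) f z" if "z \<in> X" for z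
    unfolding F_def by (rule iterate_affine[OF bd that])
  then have "(R ^^ n) f x - (R ^^ n) f y = f' x - f' y"
    using kf(1)[OF assms(4)] kf(1)[OF assms(5)] assms(4,5) by force
  moreover have "0 \<le> f' x" "0 \<le> f' y" using kf(2) assms by (auto simp: cone_def)
  ultimately show ?thesis using kf(3)[OF assms(4)] kf(3)[OF assms(5)] by (simp add: algebra_simps abs_le_iff)
qed

lemma iterate_lin:
  assumes "\<And>y. y \<in> X \<Longrightarrow> \<bar>f y\<bar> \<le> K" "\<And>y. y \<in> X \<Longrightarrow> \<bar>f' y\<bar> \<le> K'" "x \<in> X"
  shows "(R ^^ n) (\<lambda>y. f y + b * f' y) x = (R ^^ n) f x + b * (R ^^ n) f' x"
  using assms(3)
proof (induction n arbitrary: x)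
  case (Suc n)
  have bdf: "\<bar>(R ^^ n) f y\<bar> \<le> K" if "y \<in> X" for y
    using iterate_bounds[of "-K" f K y n] that assms(1) by (auto simp: abs_le_iff minus_le_iff)
  have bdf': "\<bar>(R ^^ n) f' y\<bar> \<le> K'" if "y \<in> X" for y
    using iterate_bounds[of "-K'" f' K' y n] that assms(2) by (auto simp: abs_le_iff minus_le_iff)
  have i: "integrable (count_space B) (\<lambda>v. g v x * (R ^^ n) f (br v x))"
    using Suc.prems bdf br_X by (intro integrable_bounded) auto
  have i': "integrable (count_space B) (\<lambda>v. g v x * (R ^^ n) f' (br v x))"
    using Suc.prems bdf' br_X by (intro integrable_bounded) auto
  have "(R ^^ Suc n) (\<lambda>y. f y + b * f' y) x = R (\<lambda>y. (R ^^ n) f y + b * (R ^^ n) f' y) x"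
    using Suc by (auto intro!: R_cong)
  also have "\<dots> = (\<integral>v. g v x * (R ^^ n) f (br v x) + b * (g v x * (R ^^ n) f' (br v x)) \<partial>count_space B)"
    unfolding R_def by (simp add: algebra_simps)
  also have "\<dots> = R ((R ^^ n) f) x + b * R ((R ^^ n) f') x"
    using i i' by (simp add: R_def)
  finally show ?case by simp
qed simp

lemma rate_tendsto_0: "(\<lambda>n. K * rate ^ n) \<longlonglongrightarrow> 0"
  by (rule tendsto_mult_right_zero[OF LIMSEQ_realpow_zero]) (use rate in auto)

lemma rate_tendsto:
  assumes "\<And>n. \<bar>a n - l\<bar> \<le> K * rate ^ n"
  shows "a \<longlonglongrightarrow> l"
  by (rule LIM_zero_cancel, rule Lim_null_comparison[OF _ rate_tendsto_0[of K]]) (simp add: assms)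

text \<open>Averaging never leaves the range of values reached at time \<open>n\<close>, so the
  oscillation at time \<open>n\<close> controls all later times. One base point gives a Cauchy
  sequence, and the same estimate carries its limit to every other point.\<close>

lemma lipschitz_limit:
  assumes bd: "\<And>x. x \<in> X \<Longrightarrow> \<bar>f x\<bar> \<le> N" and lip: "\<And>x y. x \<in> X \<Longrightarrow> y \<in> X \<Longrightarrow> \<bar>f x - f y\<bar> \<le> N * d x y"
    and N: "0 \<le> N"
  shows "\<exists>l. \<forall>x\<in>X. \<forall>n. \<bar>(R ^^ n) f x - l\<bar> \<le> 3 * N * rate ^ n"
proof -
  have step: "\<bar>(R ^^ (n + k)) f y - (R ^^ n) f x\<bar> \<le> 3 * N * rate ^ n" if x: "x \<in> X" and y: "y \<in> X" for x y n k
  proof -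
    have "(R ^^ n) f x - 3 * N * rate ^ n \<le> (R ^^ n) f z" "(R ^^ n) f z \<le> (R ^^ n) f x + 3 * N * rate ^ n"
      if "z \<in> X" for z
      using lipschitz_osc[OF bd lip N x that, of n] by (auto simp: abs_le_iff)
    from iterate_bounds[of "(R ^^ n) f x - 3 * N * rate ^ n" "(R ^^ n) f" "(R ^^ n) f x + 3 * N * rate ^ n" y k, OF this y]
    have "(R ^^ n) f x - 3 * N * rate ^ n \<le> (R ^^ k) ((R ^^ n) f) y"
      "(R ^^ k) ((R ^^ n) f) y \<le> (R ^^ n) f x + 3 * N * rate ^ n" by auto
    moreover have "(R ^^ k) ((R ^^ n) f) = (R ^^ (n + k)) f" by (simp add: funpow_add add.commute)
    ultimately show ?thesis by (simp add: abs_le_iff)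
  qed
  note lim0 = rate_tendsto_0[of "3 * N"]
  have "Cauchy (\<lambda>n. (R ^^ n) f x0)"
  proof (rule metric_CauchyI)
    fix e :: real assume "0 < e"
    then obtain n where n: "3 * N * rate ^ n < e / 2"
      using order_tendstoD(2)[OF lim0, of "e / 2"] by (auto simp: eventually_sequentially)
    have "dist ((R ^^ a) f x0) ((R ^^ b) f x0) < e" if "a \<ge> n" "b \<ge> n" for a b
      using step[OF x0 x0, of n "a - n"] step[OF x0 x0, of n "b - n"] that n by (simp add: dist_real_def)
    then show "\<exists>M. \<forall>m\<ge>M. \<forall>n\<ge>M. dist ((R ^^ m) f x0) ((R ^^ n) f x0) < e" by blast
  qed
  then obtain l where l: "(\<lambda>n. (R ^^ n) f x0) \<longlonglongrightarrow> l"
    by (auto simp: Cauchy_convergent_iff convergent_def)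
  show ?thesis
  proof (intro exI[of _ l] ballI allI)
    fix x n assume x: "x \<in> X"
    have "(\<lambda>k. \<bar>(R ^^ (n + k)) f x0 - (R ^^ n) f x\<bar>) \<longlonglongrightarrow> \<bar>l - (R ^^ n) f x\<bar>"
      using LIMSEQ_ignore_initial_segment[OF l, of n] by (intro tendsto_intros) (simp add: add.commute)
    from LIMSEQ_le_const2[OF this] step[OF x x0, of n] show "\<bar>(R ^^ n) f x - l\<bar> \<le> 3 * N * rate ^ n"
      by (auto simp: abs_minus_commute)
  qed
qed

section \<open>The Poisson equation and the second order estimate\<close>

lemma tau_le_exp: "real (tau v) \<le> exp (\<epsilon> * tau v) / \<epsilon>"
proof -
  have "\<epsilon> * tau v \<le> exp (\<epsilon> * tau v)" using exp_ge_add_one_self[of "\<epsilon> * tau v"] by linarith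
  then show ?thesis using \<epsilon> by (simp add: le_divide_eq mult.commute)
qed

text \<open>Common bound, per unit of \<open>N\<close>, for size and Lipschitz constant of a mean
  over return words: \<open>M / \<epsilon>\<close> bounds the mean return time, \<open>D\<close>
  stems from the variation of the integrand, the last summand from that of the weights.\<close>

definition lipc :: "real \<Rightarrow> real" where "lipc D = M / \<epsilon> + D + c3 * exp c3 * (M / \<epsilon>)"

lemma mean_lipschitz:
  fixes \<Psi> :: "'b \<Rightarrow> 'x \<Rightarrow> real" and N D :: real
  assumes bd: "\<And>v x. v \<in> B \<Longrightarrow> x \<in> X \<Longrightarrow> \<bar>\<Psi> v x\<bar> \<le> N * tau v"
    and lip: "\<And>v x y. v \<in> B \<Longrightarrow> x \<in> X \<Longrightarrow> y \<in> X \<Longrightarrow> \<bar>\<Psi> v x - \<Psi> v y\<bar> \<le> N * D * d x y"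
    and N: "0 \<le> N" and D: "0 \<le> D"
  defines "F \<equiv> (\<lambda>x. \<integral>v. g v x * \<Psi> v x \<partial>count_space B)"
  shows "\<And>x y. x \<in> X \<Longrightarrow> y \<in> X \<Longrightarrow> integrable (count_space B) (\<lambda>v. g v x * \<Psi> v y)"
    and "\<And>x. x \<in> X \<Longrightarrow> \<bar>F x\<bar> \<le> N * lipc D"
    and "\<And>x y. x \<in> X \<Longrightarrow> y \<in> X \<Longrightarrow> \<bar>F x - F y\<bar> \<le> N * lipc D * d x y"
proof -
  have bd': "\<bar>\<Psi> v x\<bar> \<le> N / \<epsilon> * exp (\<epsilon> * tau v)" if "v \<in> B" "x \<in> X" for v x
    using bd[OF that] mult_left_mono[OF tau_le_exp N, of v] by simp
  show int: "integrable (count_space B) (\<lambda>v. g v x * \<Psi> v y)" if "x \<in> X" "y \<in> X" for x y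
    by (rule integrable_weight[OF that(1) bd'[OF _ that(2)]])
  have Mp: "0 \<le> M / \<epsilon>" "0 \<le> c3 * exp c3 * (M / \<epsilon>)" using M_ge1 \<epsilon> c3 by auto
  have F1: "\<bar>F x\<bar> \<le> N * (M / \<epsilon>)" if "x \<in> X" for x
    using weight_le[OF that bd'[OF _ that]] N \<epsilon> by (simp add: F_def)
  show "\<bar>F x\<bar> \<le> N * lipc D" if "x \<in> X" for x
  proof -
    have "N * (M / \<epsilon>) \<le> N * lipc D" using N Mp D by (intro mult_left_mono) (auto simp: lipc_def)
    then show ?thesis using F1[OF that] by linarith
  qed
  show "\<bar>F x - F y\<bar> \<le> N * lipc D * d x y" if x: "x \<in> X" and y: "y \<in> X" for x y
  proof -
    define \<delta> where "\<delta> = d x y"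
    have \<delta>: "0 \<le> \<delta>" "\<delta> \<le> 1" using d_nonneg d_le1 x y by (auto simp: \<delta>_def)
    have e3: "exp (c3 * \<delta>) - 1 \<le> c3 * exp c3 * \<delta>"
    proof -
      have "exp (c3 * \<delta>) * (1 - c3 * \<delta>) \<le> exp (c3 * \<delta>) * exp (- (c3 * \<delta>))"
        using exp_ge_add_one_self[of "- (c3 * \<delta>)"] by (intro mult_left_mono) auto
      then have "exp (c3 * \<delta>) - 1 \<le> c3 * \<delta> * exp (c3 * \<delta>)" by (simp add: algebra_simps flip: exp_add)
      also have "\<dots> \<le> c3 * \<delta> * exp c3" using \<delta> c3 by (intro mult_left_mono) (auto simp: mult_left_le)
      finally show ?thesis by (simp add: algebra_simps)
    qed
    \<comment> \<open>The two-sided multiplicative distortion becomes an additive one relative to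
      \<open>g v y\<close>, which can be integrated against the unbounded
      \<open>\<Psi> v y\<close>.\<close>
    have gd: "\<bar>g v x - g v y\<bar> \<le> (c3 * exp c3 * \<delta>) * g v y" if v: "v \<in> B" for v
    proof -
      have "g v x - g v y \<le> (exp (c3 * \<delta>) - 1) * g v y"
        using g_dist[OF v x y] by (simp add: \<delta>_def algebra_simps)
      also have "\<dots> \<le> (c3 * exp c3 * \<delta>) * g v y" using e3 g_nonneg[OF v y] by (intro mult_right_mono)
      finally have 1: "g v x - g v y \<le> (c3 * exp c3 * \<delta>) * g v y" .
      have "exp (- (c3 * \<delta>)) * g v y \<le> g v x"
        using mult_left_mono[OF g_dist[OF v y x], of "exp (- (c3 * \<delta>))"]
        by (simp add: \<delta>_def d_sym[of y x] mult.assoc[symmetric] flip: exp_add)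
      then have "g v y - g v x \<le> (1 - exp (- (c3 * \<delta>))) * g v y" by (simp add: algebra_simps)
      also have "\<dots> \<le> (c3 * exp c3 * \<delta>) * g v y"
      proof (rule mult_right_mono[OF _ g_nonneg[OF v y]])
        have "1 - exp (- (c3 * \<delta>)) \<le> c3 * \<delta>" using exp_ge_add_one_self[of "- (c3 * \<delta>)"] by linarith
        also have "\<dots> \<le> c3 * \<delta> * exp c3" using \<delta> c3 mult_left_mono[of 1 "exp c3" "c3 * \<delta>"] by simp
        finally show "1 - exp (- (c3 * \<delta>)) \<le> c3 * exp c3 * \<delta>" by (simp add: algebra_simps)
      qed
      finally show ?thesis using 1 by linarith
    qed
    have "F x - F y = (\<integral>v. g v x * (\<Psi> v x - \<Psi> v y) \<partial>count_space B) + (\<integral>v. (g v x - g v y) * \<Psi> v y \<partial>count_space B)"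
    proof -
      have "(\<integral>v. g v x * (\<Psi> v x - \<Psi> v y) \<partial>count_space B) = F x - (\<integral>v. g v x * \<Psi> v y \<partial>count_space B)"
        using int[OF x x] int[OF x y] by (simp add: F_def right_diff_distrib)
      moreover have "(\<integral>v. (g v x - g v y) * \<Psi> v y \<partial>count_space B) = (\<integral>v. g v x * \<Psi> v y \<partial>count_space B) - F y"
        using int[OF y y] int[OF x y] by (simp add: F_def left_diff_distrib)
      ultimately show ?thesis by simp
    qed
    moreover have "\<bar>\<integral>v. g v x * (\<Psi> v x - \<Psi> v y) \<partial>count_space B\<bar> \<le> N * D * \<delta>"
    proof -
      have i: "integrable (count_space B) (\<lambda>v. g v x * \<bar>\<Psi> v x - \<Psi> v y\<bar>)"
        using lip[OF _ x y] by (intro integrable_bounded[OF x, where K = "N * D * d x y"]) auto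
      have "\<bar>\<integral>v. g v x * (\<Psi> v x - \<Psi> v y) \<partial>count_space B\<bar> \<le> (\<integral>v. \<bar>g v x * (\<Psi> v x - \<Psi> v y)\<bar> \<partial>count_space B)"
        using integral_norm_bound[of "count_space B" "\<lambda>v. g v x * (\<Psi> v x - \<Psi> v y)"] by simp
      also have "\<dots> = (\<integral>v. g v x * \<bar>\<Psi> v x - \<Psi> v y\<bar> \<partial>count_space B)"
        using g_nonneg x by (intro Bochner_Integration.integral_cong) (auto simp: abs_mult)
      also have "\<dots> \<le> (\<integral>v. g v x * (N * D * \<delta>) \<partial>count_space B)"
        using i g_int[OF x] lip[OF _ x y] g_nonneg x
        by (intro integral_mono) (auto intro!: mult_left_mono simp: \<delta>_def)
      finally show ?thesis using g_one[OF x] by simp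
    qed
    moreover have "\<bar>\<integral>v. (g v x - g v y) * \<Psi> v y \<partial>count_space B\<bar> \<le> N * (c3 * exp c3 * (M / \<epsilon>)) * \<delta>"
    proof -
      have i: "integrable (count_space B) (\<lambda>v. g v y * \<bar>\<Psi> v y\<bar>)"
        using bd'[OF _ y] by (intro integrable_weight[OF y, where K = "N / \<epsilon>"]) auto
      have "\<bar>\<integral>v. (g v x - g v y) * \<Psi> v y \<partial>count_space B\<bar> \<le> (\<integral>v. \<bar>(g v x - g v y) * \<Psi> v y\<bar> \<partial>count_space B)"
        using integral_norm_bound[of "count_space B" "\<lambda>v. (g v x - g v y) * \<Psi> v y"] by simp
      also have "\<dots> \<le> (\<integral>v. (c3 * exp c3 * \<delta>) * (g v y * \<bar>\<Psi> v y\<bar>) \<partial>count_space B)"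
      proof (rule integral_mono)
        show "integrable (count_space B) (\<lambda>v. \<bar>(g v x - g v y) * \<Psi> v y\<bar>)"
          using int[OF x y] int[OF y y] by (simp add: left_diff_distrib)
        show "integrable (count_space B) (\<lambda>v. (c3 * exp c3 * \<delta>) * (g v y * \<bar>\<Psi> v y\<bar>))" using i by simp
        fix v assume "v \<in> space (count_space B)"
        then show "\<bar>(g v x - g v y) * \<Psi> v y\<bar> \<le> (c3 * exp c3 * \<delta>) * (g v y * \<bar>\<Psi> v y\<bar>)"
          using mult_right_mono[OF gd[of v], of "\<bar>\<Psi> v y\<bar>"] by (simp add: abs_mult mult.assoc)
      qed
      also have "\<dots> = (c3 * exp c3 * \<delta>) * (\<integral>v. g v y * \<bar>\<Psi> v y\<bar> \<partial>count_space B)" by simp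
      also have "\<dots> \<le> (c3 * exp c3 * \<delta>) * (N / \<epsilon> * M)"
        using weight_le[OF y, of "\<lambda>v. \<bar>\<Psi> v y\<bar>" "N / \<epsilon>"] bd'[OF _ y] N \<epsilon> c3 \<delta>
        by (intro mult_left_mono) (auto simp: abs_le_iff)
      finally show ?thesis by (simp add: algebra_simps)
    qed
    ultimately have "\<bar>F x - F y\<bar> \<le> N * D * \<delta> + N * (c3 * exp c3 * (M / \<epsilon>)) * \<delta>" by linarith
    also have "\<dots> \<le> N * lipc D * \<delta>"
    proof -
      have "0 \<le> N * (M / \<epsilon>) * \<delta>" using N Mp \<delta> by (intro mult_nonneg_nonneg) auto
      then show ?thesis by (simp add: lipc_def algebra_simps)
    qed
    finally show ?thesis by (simp add: \<delta>_def)
  qed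
qed

text \<open>\<open>\<kappa>\<close> is the stationary mean of \<open>\<Psi>\<close> divided by that
  of the return time, as in Kac's formula; this centres \<open>\<Psi> - \<kappa> * tau\<close>. The
  iterates of its mean decay geometrically and \<open>u\<close> is their sum. All bounds stay linear
  in \<open>N\<close>.\<close>

lemma poisson_equation:
  fixes \<Psi> :: "'b \<Rightarrow> 'x \<Rightarrow> real" and N D :: real
  assumes bd: "\<And>v x. v \<in> B \<Longrightarrow> x \<in> X \<Longrightarrow> \<bar>\<Psi> v x\<bar> \<le> N * tau v"
    and lip: "\<And>v x y. v \<in> B \<Longrightarrow> x \<in> X \<Longrightarrow> y \<in> X \<Longrightarrow> \<bar>\<Psi> v x - \<Psi> v y\<bar> \<le> N * D * d x y"
    and N: "0 \<le> N" and D: "0 \<le> D"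
  shows "\<exists>\<kappa> u. \<bar>\<kappa>\<bar> \<le> N * (4 * lipc D) \<and>
    (\<forall>x\<in>X. \<bar>u x\<bar> \<le> N * (1 + 4 * lipc D) * (3 * lipc D) / (1 - rate)) \<and>
    (\<forall>x\<in>X. (\<integral>v. g v x * (\<Psi> v x - \<kappa> * tau v + u (br v x)) \<partial>count_space B) = u x)"
proof -
  define F1 where "F1 = (\<lambda>x. \<integral>v. g v x * \<Psi> v x \<partial>count_space B)"
  define F2 where "F2 = (\<lambda>x. \<integral>v. g v x * real (tau v) \<partial>count_space B)"
  have m1: "\<And>x. x \<in> X \<Longrightarrow> integrable (count_space B) (\<lambda>v. g v x * \<Psi> v x)"
    "\<And>x. x \<in> X \<Longrightarrow> \<bar>F1 x\<bar> \<le> N * lipc D"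
    "\<And>x y. x \<in> X \<Longrightarrow> y \<in> X \<Longrightarrow> \<bar>F1 x - F1 y\<bar> \<le> N * lipc D * d x y"
    unfolding F1_def
    by (rule mean_lipschitz[OF bd lip N D]; assumption)+
  have m2: "\<And>x. x \<in> X \<Longrightarrow> integrable (count_space B) (\<lambda>v. g v x * real (tau v))"
    "\<And>x. x \<in> X \<Longrightarrow> \<bar>F2 x\<bar> \<le> lipc D"
    "\<And>x y. x \<in> X \<Longrightarrow> y \<in> X \<Longrightarrow> \<bar>F2 x - F2 y\<bar> \<le> lipc D * d x y"
  proof -
    note m = mean_lipschitz[of "\<lambda>v _. real (tau v)" 1 D]
    show "integrable (count_space B) (\<lambda>v. g v x * real (tau v))" if "x \<in> X" for x
      using m(1)[of x x] that D d_nonneg by simp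
    show "\<bar>F2 x\<bar> \<le> lipc D" if "x \<in> X" for x
      using m(2)[of x] that D d_nonneg by (simp add: F2_def)
    show "\<bar>F2 x - F2 y\<bar> \<le> lipc D * d x y" if "x \<in> X" "y \<in> X" for x y
      using m(3)[of x y] that D d_nonneg by (simp add: F2_def)
  qed
  have L: "0 \<le> lipc D" using m2(2)[OF x0] by simp

  have NL: "0 \<le> N * lipc D" using N L by simp
  obtain l1 where l1: "\<And>x n. x \<in> X \<Longrightarrow> \<bar>(R ^^ n) F1 x - l1\<bar> \<le> 3 * (N * lipc D) * rate ^ n"
  proof -
    have "\<exists>l. \<forall>x\<in>X. \<forall>n. \<bar>(R ^^ n) F1 x - l\<bar> \<le> 3 * (N * lipc D) * rate ^ n"
      by (rule lipschitz_limit[OF m1(2) m1(3) NL])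
    then show ?thesis using that by blast
  qed
  obtain l2 where l2: "\<And>x n. x \<in> X \<Longrightarrow> \<bar>(R ^^ n) F2 x - l2\<bar> \<le> 3 * lipc D * rate ^ n"
  proof -
    have "\<exists>l. \<forall>x\<in>X. \<forall>n. \<bar>(R ^^ n) F2 x - l\<bar> \<le> 3 * lipc D * rate ^ n"
      by (rule lipschitz_limit[OF m2(2) m2(3) L])
    then show ?thesis using that by blast
  qed

  have lim1: "(\<lambda>n. (R ^^ n) F1 x0) \<longlonglongrightarrow> l1"
    by (rule rate_tendsto[OF l1[OF x0]])
  have lim2: "(\<lambda>n. (R ^^ n) F2 x0) \<longlonglongrightarrow> l2"
    by (rule rate_tendsto[OF l2[OF x0]])
  \<comment> \<open>Return times are at least one, hence so is the limit \<open>l2\<close>, the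
    denominator of \<open>\<kappa>\<close>.\<close>
  have "1 \<le> F2 x" if "x \<in> X" for x
  proof -
    have "(\<integral>v. g v x * 1 \<partial>count_space B) \<le> F2 x" unfolding F2_def
      using g_int[OF that] m2(1)[OF that] g_nonneg that tau_ge1
      by (intro integral_mono) (auto intro!: mult_left_mono simp del: mult_1_right)
    then show ?thesis using g_one[OF that] by simp
  qed
  then have "1 \<le> (R ^^ n) F2 x0" for n
    using iterate_bounds[of 1 F2 "lipc D" x0 n] m2(2) x0 by (auto simp: abs_le_iff)
  then have l2_ge: "1 \<le> l2" using LIMSEQ_le_const[OF lim2] by blast
  have "\<bar>l1\<bar> \<le> N * (4 * lipc D)" using l1[OF x0, of 0] m1(2)[OF x0] NL by (simp add: abs_le_iff)
  define \<kappa> where "\<kappa> = l1 / l2"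
  have \<kappa>: "\<bar>\<kappa>\<bar> \<le> N * (4 * lipc D)"
  proof -
    have "\<bar>\<kappa>\<bar> \<le> \<bar>l1\<bar>" using l2_ge by (simp add: \<kappa>_def abs_div divide_le_eq mult_le_cancel_left1)
    then show ?thesis using \<open>\<bar>l1\<bar> \<le> N * (4 * lipc D)\<close> by linarith
  qed
  define N' where "N' = N * (1 + 4 * lipc D)"
  have N': "0 \<le> N'" "N \<le> N'" using N L by (auto simp: N'_def algebra_simps)
  define \<Psi>' where "\<Psi>' = (\<lambda>v x. \<Psi> v x - \<kappa> * real (tau v))"
  have bd': "\<bar>\<Psi>' v x\<bar> \<le> N' * tau v" if "v \<in> B" "x \<in> X" for v x
  proof -
    have "\<bar>\<kappa> * real (tau v)\<bar> \<le> N * (4 * lipc D) * tau v" using \<kappa> by (simp add: abs_mult mult_right_mono)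
    moreover have "\<bar>\<Psi>' v x\<bar> \<le> \<bar>\<Psi> v x\<bar> + \<bar>\<kappa> * real (tau v)\<bar>" unfolding \<Psi>'_def by (rule abs_triangle_ineq4)
    ultimately have "\<bar>\<Psi>' v x\<bar> \<le> N * tau v + N * (4 * lipc D) * tau v" using bd[OF that] by linarith
    then show ?thesis by (simp add: N'_def algebra_simps)
  qed
  have lip': "\<bar>\<Psi>' v x - \<Psi>' v y\<bar> \<le> N' * D * d x y" if "v \<in> B" "x \<in> X" "y \<in> X" for v x y
  proof -
    have "N * D * d x y \<le> N' * D * d x y" using N' D d_nonneg that by (intro mult_right_mono) auto
    then show ?thesis using lip[OF that] by (simp add: \<Psi>'_def)
  qed
  define F where "F = (\<lambda>x. \<integral>v. g v x * \<Psi>' v x \<partial>count_space B)"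
  have m: "\<And>x. x \<in> X \<Longrightarrow> integrable (count_space B) (\<lambda>v. g v x * \<Psi>' v x)"
    "\<And>x. x \<in> X \<Longrightarrow> \<bar>F x\<bar> \<le> N' * lipc D"
    "\<And>x y. x \<in> X \<Longrightarrow> y \<in> X \<Longrightarrow> \<bar>F x - F y\<bar> \<le> N' * lipc D * d x y"
    unfolding F_def
    by (rule mean_lipschitz[OF bd' lip' N'(1) D]; assumption)+
  have FF: "F x = F1 x + (- \<kappa>) * F2 x" if "x \<in> X" for x
  proof -
    have "F x = (\<integral>v. g v x * \<Psi> v x - \<kappa> * (g v x * real (tau v)) \<partial>count_space B)"
      unfolding F_def \<Psi>'_def by (simp add: algebra_simps)
    also have "\<dots> = F1 x + (- \<kappa>) * F2 x"
      using m1(1)[OF that] m2(1)[OF that] by (simp add: F1_def F2_def)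
    finally show ?thesis .
  qed
  obtain l where l: "\<And>x n. x \<in> X \<Longrightarrow> \<bar>(R ^^ n) F x - l\<bar> \<le> 3 * (N' * lipc D) * rate ^ n"
  proof -
    have "\<exists>l. \<forall>x\<in>X. \<forall>n. \<bar>(R ^^ n) F x - l\<bar> \<le> 3 * (N' * lipc D) * rate ^ n"
      by (rule lipschitz_limit[OF m(2) m(3) mult_nonneg_nonneg[OF N'(1) L]])
    then show ?thesis using that by blast
  qed
  have "(R ^^ n) F x0 = (R ^^ n) F1 x0 + (- \<kappa>) * (R ^^ n) F2 x0" for n
  proof -
    have "(R ^^ n) F x = (R ^^ n) (\<lambda>y. F1 y + (- \<kappa>) * F2 y) x" if "x \<in> X" for x
      using that FF by (induction n arbitrary: x) (auto intro!: R_cong)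
    then show ?thesis using iterate_lin[OF m1(2) m2(2) x0, where n = n and b = "- \<kappa>"] x0 by simp
  qed
  then have "(\<lambda>n. (R ^^ n) F x0) \<longlonglongrightarrow> l1 + (- \<kappa>) * l2"
    using lim1 lim2 by (auto intro!: tendsto_intros)
  moreover have "l1 + (- \<kappa>) * l2 = 0" using l2_ge by (simp add: \<kappa>_def)
  moreover have "(\<lambda>n. (R ^^ n) F x0) \<longlonglongrightarrow> l"
    by (rule rate_tendsto[OF l[OF x0]])
  ultimately have l0: "l = 0" using LIMSEQ_unique by metis
  have dec: "\<bar>(R ^^ n) F x\<bar> \<le> N' * (3 * lipc D) * rate ^ n" if "x \<in> X" for x n
    using l[OF that, of n] l0 by (simp add: algebra_simps)
  have sg: "summable (\<lambda>n. K * rate ^ n)" for K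
    using rate by (intro summable_mult summable_geometric) auto
  have sa: "summable (\<lambda>n. \<bar>(R ^^ n) F x\<bar>)" if "x \<in> X" for x
    by (rule summable_comparison_test'[OF sg[of "N' * (3 * lipc D)"], of 0]) (use dec[OF that] in auto)
  define u where "u = (\<lambda>x. \<Sum>n. (R ^^ n) F x)"
  have u_bd: "\<bar>u x\<bar> \<le> N * (1 + 4 * lipc D) * (3 * lipc D) / (1 - rate)" if "x \<in> X" for x
  proof -
    have "\<bar>u x\<bar> \<le> (\<Sum>n. \<bar>(R ^^ n) F x\<bar>)" unfolding u_def by (rule summable_rabs[OF sa[OF that]])
    also have "\<dots> \<le> (\<Sum>n. N' * (3 * lipc D) * rate ^ n)" by (rule suminf_le[OF dec[OF that] sa[OF that] sg])
    also have "\<dots> = N' * (3 * lipc D) / (1 - rate)"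
      using rate by (simp add: suminf_mult suminf_geometric summable_geometric)
    finally show ?thesis by (simp add: N'_def)
  qed
  \<comment> \<open>Termwise integration shifts the series by one index, so \<open>R u\<close> is
    the series of \<open>u\<close> without its first term \<open>F\<close>.\<close>
  have u_eq: "u x = F x + R u x" if x: "x \<in> X" for x
  proof -
    have i: "integrable (count_space B) (\<lambda>v. g v x * (R ^^ n) F (br v x))" for n
      using dec[of _ n] br_X[OF _ x] by (intro integrable_bounded[OF x]) auto
    have "R u x = (\<integral>v. g v x * u (br v x) \<partial>count_space B)" by (rule R_def)
    also have "\<dots> = (\<integral>v. (\<Sum>n. g v x * (R ^^ n) F (br v x)) \<partial>count_space B)"
      unfolding u_def
      by (intro Bochner_Integration.integral_cong refl suminf_mult[symmetric])
        (use sa br_X[OF _ x] in \<open>auto intro: summable_rabs_cancel\<close>)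
    also have "\<dots> = (\<Sum>n. \<integral>v. g v x * (R ^^ n) F (br v x) \<partial>count_space B)"
    proof (rule integral_suminf[OF i])
      show "AE v in count_space B. summable (\<lambda>n. norm (g v x * (R ^^ n) F (br v x)))"
        using sa br_X[OF _ x] by (intro AE_I2) (auto simp: abs_mult intro!: summable_mult)
      show "summable (\<lambda>n. \<integral>v. norm (g v x * (R ^^ n) F (br v x)) \<partial>count_space B)"
      proof (rule summable_comparison_test'[OF sg[of "N' * (3 * lipc D)"], of 0])
        fix n
        have "(\<integral>v. norm (g v x * (R ^^ n) F (br v x)) \<partial>count_space B) \<le> (\<integral>v. g v x * (N' * (3 * lipc D) * rate ^ n) \<partial>count_space B)"
        proof (rule integral_mono[OF integrable_norm[OF i]])
          fix v assume "v \<in> space (count_space B)"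
          then show "norm (g v x * (R ^^ n) F (br v x)) \<le> g v x * (N' * (3 * lipc D) * rate ^ n)"
            using dec[of "br v x" n] br_X[OF _ x] g_nonneg[OF _ x] by (auto simp: abs_mult intro!: mult_left_mono)
        qed (use g_int[OF x] in simp)
        then show "norm (\<integral>v. norm (g v x * (R ^^ n) F (br v x)) \<partial>count_space B) \<le> N' * (3 * lipc D) * rate ^ n"
          using g_one[OF x] by simp
      qed
    qed
    also have "\<dots> = (\<Sum>n. (R ^^ Suc n) F x)"
      unfolding funpow.simps comp_def R_def[of "(R ^^ n) F" for n] ..
    also have "\<dots> = u x - F x"
      using suminf_split_head[OF summable_rabs_cancel[OF sa[OF x]]] by (simp add: u_def)
    finally show ?thesis by simp
  qed
  show ?thesis
  proof (rule exI[of _ \<kappa>], rule exI[of _ u], intro conjI ballI)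
    fix x assume x: "x \<in> X"
    have iu: "integrable (count_space B) (\<lambda>v. g v x * u (br v x))"
      using u_bd br_X[OF _ x] by (intro integrable_bounded[OF x]) auto
    have "(\<integral>v. g v x * (\<Psi> v x - \<kappa> * tau v + u (br v x)) \<partial>count_space B) = F x + R u x"
      using m(1)[OF x] iu by (simp add: F_def R_def \<Psi>'_def distrib_left)
    then show "(\<integral>v. g v x * (\<Psi> v x - \<kappa> * tau v + u (br v x)) \<partial>count_space B) = u x" using u_eq[OF x] by simp
  qed (use \<kappa> u_bd in auto)
qed

text \<open>The factor \<open>exp (s * u)\<close> stands in for the eigenfunction of the perturbed
  operator. By the Poisson equation the first order terms integrate to \<open>s * u x\<close>; the
  second order remainder is paid for by the term \<open>C * N^2 * s^2 * tau\<close>. The order of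
  quantifiers, with \<open>C\<close> and \<open>\<epsilon>0\<close> before \<open>\<Psi>\<close> and
  \<open>N\<close>, is what later makes the constant uniform.\<close>

theorem perturbed_subeigenfunction:
  assumes D: "0 \<le> D"
  shows "\<exists>C>0. \<exists>\<epsilon>0>0. \<forall>(\<Psi> :: 'b \<Rightarrow> 'x \<Rightarrow> real) (N :: real). 0 \<le> N \<and> (\<forall>v\<in>B. \<forall>x\<in>X. \<bar>\<Psi> v x\<bar> \<le> N * tau v) \<and>
      (\<forall>v\<in>B. \<forall>x\<in>X. \<forall>y\<in>X. \<bar>\<Psi> v x - \<Psi> v y\<bar> \<le> N * D * d x y) \<longrightarrow>
      (\<exists>\<kappa> u U. (\<forall>x\<in>X. \<bar>u x\<bar> \<le> U) \<and> (\<forall>s x. \<bar>s\<bar> * N \<le> \<epsilon>0 \<and> x \<in> X \<longrightarrow>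
         integrable (count_space B) (\<lambda>v. g v x * exp (s * \<Psi> v x - (s * \<kappa> + C * N\<^sup>2 * s\<^sup>2) * tau v + s * u (br v x))) \<and>
         (\<integral>v. g v x * exp (s * \<Psi> v x - (s * \<kappa> + C * N\<^sup>2 * s\<^sup>2) * tau v + s * u (br v x)) \<partial>count_space B)
            \<le> exp (s * u x)))"
proof -
  have Mp: "0 < M / \<epsilon>" using M_ge1 \<epsilon> by auto
  have "0 \<le> c3 * exp c3 * (M / \<epsilon>)" using Mp c3 by (intro mult_nonneg_nonneg) auto
  then have L: "0 < lipc D" using D Mp unfolding lipc_def by linarith
  define U1 where "U1 = (1 + 4 * lipc D) * (3 * lipc D) / (1 - rate)"
  have U1: "0 \<le> U1" using L rate by (simp add: U1_def)
  \<comment> \<open>\<open>N * C1 * tau v\<close> bounds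
    \<open>\<Psi> v x - \<kappa> * tau v + u (br v x)\<close>; the bounded term \<open>u\<close>
    fits in because \<open>tau v \<ge> 1\<close>. The choice of \<open>\<epsilon>0\<close> keeps the
    exponent below \<open>\<epsilon> / 2 * tau v\<close>, half of the available moment, and the
    other half absorbs \<open>tau^2\<close> at the price \<open>8 / \<epsilon>^2\<close> seen in
    \<open>C\<close>.\<close>
  define C1 where "C1 = 1 + 4 * lipc D + U1"
  have C1: "0 < C1" using L U1 by (simp add: C1_def)
  define C where "C = 8 * C1\<^sup>2 / \<epsilon>\<^sup>2 * M"
  have C: "0 < C" using C1 \<epsilon> M_ge1 by (simp add: C_def)
  define \<epsilon>0 where "\<epsilon>0 = \<epsilon> / (2 * C1)"
  have \<epsilon>0: "0 < \<epsilon>0" using \<epsilon> C1 by (simp add: \<epsilon>0_def)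
  show ?thesis
  proof (rule exI[of _ C], rule conjI[OF C], rule exI[of _ \<epsilon>0], rule conjI[OF \<epsilon>0], intro allI impI, elim conjE)
    fix \<Psi> :: "'b \<Rightarrow> 'x \<Rightarrow> real" and N :: real
    assume N: "0 \<le> N" and bd: "\<forall>v\<in>B. \<forall>x\<in>X. \<bar>\<Psi> v x\<bar> \<le> N * tau v"
      and lip: "\<forall>v\<in>B. \<forall>x\<in>X. \<forall>y\<in>X. \<bar>\<Psi> v x - \<Psi> v y\<bar> \<le> N * D * d x y"
    obtain \<kappa> u where \<kappa>: "\<bar>\<kappa>\<bar> \<le> N * (4 * lipc D)" and u0: "\<And>x. x \<in> X \<Longrightarrow> \<bar>u x\<bar> \<le> N * (1 + 4 * lipc D) * (3 * lipc D) / (1 - rate)"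
      and eq: "\<And>x. x \<in> X \<Longrightarrow> (\<integral>v. g v x * (\<Psi> v x - \<kappa> * tau v + u (br v x)) \<partial>count_space B) = u x"
    proof -
      have "\<exists>\<kappa> u. \<bar>\<kappa>\<bar> \<le> N * (4 * lipc D) \<and>
        (\<forall>x\<in>X. \<bar>u x\<bar> \<le> N * (1 + 4 * lipc D) * (3 * lipc D) / (1 - rate)) \<and>
        (\<forall>x\<in>X. (\<integral>v. g v x * (\<Psi> v x - \<kappa> * tau v + u (br v x)) \<partial>count_space B) = u x)"
        by (rule poisson_equation) (use bd lip N D in auto)
      then show ?thesis using that by blast
    qed
    have u: "\<bar>u x\<bar> \<le> N * U1" if "x \<in> X" for x using u0[OF that] by (simp add: U1_def)
    show "\<exists>\<kappa> u U. (\<forall>x\<in>X. \<bar>u x\<bar> \<le> U) \<and> (\<forall>s x. \<bar>s\<bar> * N \<le> \<epsilon>0 \<and> x \<in> X \<longrightarrow>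
         integrable (count_space B) (\<lambda>v. g v x * exp (s * \<Psi> v x - (s * \<kappa> + C * N\<^sup>2 * s\<^sup>2) * tau v + s * u (br v x))) \<and>
         (\<integral>v. g v x * exp (s * \<Psi> v x - (s * \<kappa> + C * N\<^sup>2 * s\<^sup>2) * tau v + s * u (br v x)) \<partial>count_space B)
            \<le> exp (s * u x))"
    proof (rule exI[of _ \<kappa>], rule exI[of _ u], rule exI[of _ "N * U1"], intro conjI ballI allI impI)
      fix x assume "x \<in> X" then show "\<bar>u x\<bar> \<le> N * U1" by (rule u)
    next
      fix s x assume "\<bar>s\<bar> * N \<le> \<epsilon>0 \<and> x \<in> X"
      then have s: "\<bar>s\<bar> * N \<le> \<epsilon>0" and x: "x \<in> X" by auto
      define Y where "Y = (\<lambda>v. \<Psi> v x - \<kappa> * tau v + u (br v x))"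
      define E where "E = (\<lambda>v. exp (s * \<Psi> v x - (s * \<kappa> + C * N\<^sup>2 * s\<^sup>2) * tau v + s * u (br v x)))"
      have Y: "\<bar>Y v\<bar> \<le> N * C1 * tau v" if v: "v \<in> B" for v
      proof -
        have t: "1 \<le> real (tau v)" using tau_ge1[OF v] by simp
        have "\<bar>\<kappa> * tau v\<bar> \<le> N * (4 * lipc D) * tau v" using \<kappa> by (simp add: abs_mult mult_right_mono)
        moreover have "\<bar>u (br v x)\<bar> \<le> N * U1 * tau v"
          using u[OF br_X[OF v x]] mult_left_mono[OF t, of "N * U1"] N U1 by simp
        moreover have "\<bar>\<Psi> v x\<bar> \<le> N * tau v" using bd v x by blast
        moreover have "\<bar>Y v\<bar> \<le> \<bar>\<Psi> v x\<bar> + \<bar>\<kappa> * tau v\<bar> + \<bar>u (br v x)\<bar>" unfolding Y_def by linarith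
        ultimately have "\<bar>Y v\<bar> \<le> N * tau v + N * (4 * lipc D) * tau v + N * U1 * tau v" by linarith
        then show ?thesis by (simp add: C1_def algebra_simps)
      qed
      have sY: "\<bar>s * Y v\<bar> \<le> \<epsilon> / 2 * tau v" if v: "v \<in> B" for v
      proof -
        have "\<bar>s * Y v\<bar> \<le> \<bar>s\<bar> * (N * C1 * tau v)" using Y[OF v] by (simp add: abs_mult mult_left_mono)
        also have "\<dots> = (\<bar>s\<bar> * N) * (C1 * tau v)" by simp
        also have "\<dots> \<le> \<epsilon>0 * (C1 * tau v)" using s C1 by (intro mult_right_mono) auto
        also have "\<dots> = \<epsilon> / 2 * tau v" using C1 by (simp add: \<epsilon>0_def)
        finally show ?thesis .
      qed
      \<comment> \<open>As \<open>tau v \<ge> 1\<close>, the quadratic penalty is at least its value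
        for \<open>tau v = 1\<close> and comes out of the integral.\<close>
      have E_le: "E v \<le> exp (- (C * N\<^sup>2 * s\<^sup>2)) * exp (s * Y v)" if v: "v \<in> B" for v
      proof -
        have "C * N\<^sup>2 * s\<^sup>2 * 1 \<le> C * N\<^sup>2 * s\<^sup>2 * real (tau v)" using C tau_ge1[OF v] by (intro mult_left_mono) auto
        moreover have "s * \<Psi> v x - (s * \<kappa> + C * N\<^sup>2 * s\<^sup>2) * tau v + s * u (br v x) = s * Y v - C * N\<^sup>2 * s\<^sup>2 * real (tau v)"
          by (simp add: Y_def algebra_simps)
        ultimately show ?thesis by (simp add: E_def flip: exp_add)
      qed
      have half: "\<epsilon> / 2 * tau v \<le> \<epsilon> * tau v" for v using \<epsilon> by simp
      have iexp: "integrable (count_space B) (\<lambda>v. g v x * exp (s * Y v))"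
      proof (rule integrable_weight[OF x, of _ 1])
        fix v assume "v \<in> B"
        from sY[OF this] half[of v] show "\<bar>exp (s * Y v)\<bar> \<le> 1 * exp (\<epsilon> * tau v)" by (auto simp: abs_le_iff)
      qed
      have iE: "integrable (count_space B) (\<lambda>v. g v x * E v)"
      proof (rule integrable_weight[OF x, of _ 1])
        fix v assume v: "v \<in> B"
        have "exp (- (C * N\<^sup>2 * s\<^sup>2)) * exp (s * Y v) \<le> 1 * exp (s * Y v)"
          using C by (intro mult_right_mono) auto
        then have "E v \<le> 1 * exp (s * Y v)" using E_le[OF v] by linarith
        also have "\<dots> \<le> 1 * exp (\<epsilon> * tau v)" using sY[OF v] half[of v] by (auto simp: abs_le_iff)
        finally show "\<bar>E v\<bar> \<le> 1 * exp (\<epsilon> * tau v)" by (simp add: E_def)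
      qed
      define W where "W = (\<lambda>v. N\<^sup>2 * s\<^sup>2 * (8 * C1\<^sup>2 / \<epsilon>\<^sup>2) * exp (\<epsilon> * tau v))"
      have quad: "exp (s * Y v) \<le> 1 + s * Y v + W v" if v: "v \<in> B" for v
      proof -
        define t where "t = real (tau v)"
        have t0: "0 \<le> t" by (simp add: t_def)
        have "\<bar>s * Y v\<bar> \<le> \<bar>s\<bar> * (N * C1 * t)"
          using Y[OF v] by (simp add: abs_mult t_def mult_left_mono)
        then have "(s * Y v)\<^sup>2 \<le> (\<bar>s\<bar> * (N * C1 * t))\<^sup>2" using power_mono[of "\<bar>s * Y v\<bar>" _ 2] by simp
        then have a: "(s * Y v)\<^sup>2 \<le> N\<^sup>2 * s\<^sup>2 * C1\<^sup>2 * t\<^sup>2" by (simp add: power_mult_distrib algebra_simps)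
        have "(\<epsilon> / 2 * t)\<^sup>2 / 2 \<le> exp (\<epsilon> / 2 * t)"
        proof -
          have "0 \<le> \<epsilon> / 2 * t" using \<epsilon> t0 by simp
          from exp_lower_Taylor_quadratic[OF this] this show ?thesis by linarith
        qed
        then have b: "t\<^sup>2 \<le> 8 / \<epsilon>\<^sup>2 * exp (\<epsilon> / 2 * t)" using \<epsilon> by (simp add: field_simps power_mult_distrib power2_eq_square)
        have "(s * Y v)\<^sup>2 * exp \<bar>s * Y v\<bar> \<le> (N\<^sup>2 * s\<^sup>2 * C1\<^sup>2 * (8 / \<epsilon>\<^sup>2 * exp (\<epsilon> / 2 * t))) * exp (\<epsilon> / 2 * t)"
        proof (rule mult_mono)
          show "(s * Y v)\<^sup>2 \<le> N\<^sup>2 * s\<^sup>2 * C1\<^sup>2 * (8 / \<epsilon>\<^sup>2 * exp (\<epsilon> / 2 * t))"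
            using a mult_left_mono[OF b, of "N\<^sup>2 * s\<^sup>2 * C1\<^sup>2"] by (meson order_trans zero_le_mult_iff zero_le_power2)
          show "exp \<bar>s * Y v\<bar> \<le> exp (\<epsilon> / 2 * t)" using sY[OF v] by (simp add: t_def)
        qed (use \<epsilon> in auto)
        also have "\<dots> = W v"
        proof -
          have "exp (\<epsilon> / 2 * t) * exp (\<epsilon> / 2 * t) = exp (\<epsilon> * t)" by (simp flip: exp_add)
          then show ?thesis by (simp add: W_def t_def mult.assoc)
        qed
        finally show ?thesis using exp_le_quadratic[of "s * Y v"] by linarith
      qed
      have iY: "integrable (count_space B) (\<lambda>v. g v x * Y v)"
      proof (rule integrable_weight[OF x, of _ "N * C1 / \<epsilon>"])
        fix v assume "v \<in> B"
        from Y[OF this] mult_left_mono[OF tau_le_exp[of v], of "N * C1"] N C1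
        show "\<bar>Y v\<bar> \<le> N * C1 / \<epsilon> * exp (\<epsilon> * tau v)" by simp
      qed
      have iW: "integrable (count_space B) (\<lambda>v. g v x * W v)"
        by (rule integrable_weight[OF x, of _ "N\<^sup>2 * s\<^sup>2 * (8 * C1\<^sup>2 / \<epsilon>\<^sup>2)"]) (simp add: W_def)
      have W_le: "(\<integral>v. g v x * W v \<partial>count_space B) \<le> C * N\<^sup>2 * s\<^sup>2"
        using weight_le[OF x, of W "N\<^sup>2 * s\<^sup>2 * (8 * C1\<^sup>2 / \<epsilon>\<^sup>2)"]
        unfolding C_def abs_le_iff by (simp add: W_def mult_ac)
      have "(\<integral>v. g v x * exp (s * Y v) \<partial>count_space B) \<le> (\<integral>v. g v x + s * (g v x * Y v) + g v x * W v \<partial>count_space B)"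
      proof (rule integral_mono[OF iexp])
        show "integrable (count_space B) (\<lambda>v. g v x + s * (g v x * Y v) + g v x * W v)"
          using g_int[OF x] iY iW by simp
        fix v assume "v \<in> space (count_space B)"
        then show "g v x * exp (s * Y v) \<le> g v x + s * (g v x * Y v) + g v x * W v"
          using mult_left_mono[OF quad[of v] g_nonneg[of v x]] x by (simp add: algebra_simps)
      qed
      also have "\<dots> = 1 + s * u x + (\<integral>v. g v x * W v \<partial>count_space B)"
        using g_int[OF x] iY iW g_one[OF x] eq[OF x] by (simp add: Y_def)
      also have "\<dots> \<le> 1 + (s * u x + C * N\<^sup>2 * s\<^sup>2)" using W_le by simp
      also have "\<dots> \<le> exp (s * u x + C * N\<^sup>2 * s\<^sup>2)" by (rule exp_ge_add_one_self)
      finally have I: "(\<integral>v. g v x * exp (s * Y v) \<partial>count_space B) \<le> exp (s * u x + C * N\<^sup>2 * s\<^sup>2)" .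
      have "(\<integral>v. g v x * E v \<partial>count_space B) \<le> (\<integral>v. exp (- (C * N\<^sup>2 * s\<^sup>2)) * (g v x * exp (s * Y v)) \<partial>count_space B)"
      proof (rule integral_mono[OF iE])
        fix v assume "v \<in> space (count_space B)"
        then show "g v x * E v \<le> exp (- (C * N\<^sup>2 * s\<^sup>2)) * (g v x * exp (s * Y v))"
          using mult_left_mono[OF E_le[of v] g_nonneg[of v x]] x by (simp add: algebra_simps)
      qed (use iexp in simp)
      also have "\<dots> \<le> exp (- (C * N\<^sup>2 * s\<^sup>2)) * exp (s * u x + C * N\<^sup>2 * s\<^sup>2)"
        using mult_left_mono[OF I, of "exp (- (C * N\<^sup>2 * s\<^sup>2))"] by simp
      finally have "(\<integral>v. g v x * E v \<partial>count_space B) \<le> exp (s * u x)" by (simp flip: exp_add)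
      with iE show "integrable (count_space B) (\<lambda>v. g v x * exp (s * \<Psi> v x - (s * \<kappa> + C * N\<^sup>2 * s\<^sup>2) * tau v + s * u (br v x)))"
        "(\<integral>v. g v x * exp (s * \<Psi> v x - (s * \<kappa> + C * N\<^sup>2 * s\<^sup>2) * tau v + s * u (br v x)) \<partial>count_space B) \<le> exp (s * u x)"
        by (simp_all add: E_def)
    qed
  qed
qed

end

section \<open>Renewal systems\<close>

lemma ennreal_exp_mult: "ennreal (exp a) * ennreal (exp b) = ennreal (exp (a + b))"
  by (simp add: exp_add ennreal_mult)

text \<open>\<open>Z n x\<close> models the total weight of all loops of length \<open>n\<close> put
  in front of \<open>x\<close>, and \<open>Zrec\<close> peels off the return word next to
  \<open>x\<close>. By \<open>conv\<close> and \<open>div\<close>, \<open>P\<close> is the critical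
  exponent of the series; \<open>fin\<close> at some \<open>q0 < P\<close> is the form taken by
  strong positive recurrence.\<close>

locale renewal_system =
  fixes X :: "'x set" and B :: "'b set" and br :: "'b \<Rightarrow> 'x \<Rightarrow> 'x"
    and d :: "'x \<Rightarrow> 'x \<Rightarrow> real" and H :: "'b \<Rightarrow> 'x \<Rightarrow> real" and tau :: "'b \<Rightarrow> nat"
    and Z :: "nat \<Rightarrow> 'x \<Rightarrow> ennreal"
    and \<theta> C q0 P :: real and x0 :: 'x
  assumes x0: "x0 \<in> X"
    and br_X: "v \<in> B \<Longrightarrow> x \<in> X \<Longrightarrow> br v x \<in> X"
    and d_nonneg: "x \<in> X \<Longrightarrow> y \<in> X \<Longrightarrow> 0 \<le> d x y"
    and d_le1: "x \<in> X \<Longrightarrow> y \<in> X \<Longrightarrow> d x y \<le> 1"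
    and d_sym: "d x y = d y x"
    and d_contr: "v \<in> B \<Longrightarrow> x \<in> X \<Longrightarrow> y \<in> X \<Longrightarrow> d (br v x) (br v y) \<le> \<theta> * d x y"
    and \<theta>: "0 \<le> \<theta>" "\<theta> < 1" and C: "0 \<le> C"
    and H_dist: "v \<in> B \<Longrightarrow> x \<in> X \<Longrightarrow> y \<in> X \<Longrightarrow> H v x \<le> C * d x y + H v y"
    and tau_ge1: "v \<in> B \<Longrightarrow> 1 \<le> tau v"
    and q0: "q0 < P"
    and fin: "(\<integral>\<^sup>+v. ennreal (exp (H v x0 - q0 * tau v)) \<partial>count_space B) < \<infinity>"
    and Z0: "x \<in> X \<Longrightarrow> Z 0 x = 1"
    and Zrec: "x \<in> X \<Longrightarrow> 0 < n \<Longrightarrow> Z n x = (\<integral>\<^sup>+v. (if tau v \<le> n then ennreal (exp (H v x)) * Z (n - tau v) (br v x) else 0) \<partial>count_space B)"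
    and conv: "P < q \<Longrightarrow> (\<Sum>n. Z n x0 * ennreal (exp (- q * real n))) < \<infinity>"
    and div: "q0 \<le> q \<Longrightarrow> q < P \<Longrightarrow> (\<Sum>n. Z n x0 * ennreal (exp (- q * real n))) = \<infinity>"
begin

definition L :: "real \<Rightarrow> ('x \<Rightarrow> ennreal) \<Rightarrow> 'x \<Rightarrow> ennreal" where
  "L q f x = (\<integral>\<^sup>+v. ennreal (exp (H v x - q * tau v)) * f (br v x) \<partial>count_space B)"

lemma L_mono: "x \<in> X \<Longrightarrow> (\<And>y. y \<in> X \<Longrightarrow> f y \<le> f' y) \<Longrightarrow> L q f x \<le> L q f' x"
  unfolding L_def using br_X by (intro nn_integral_mono mult_left_mono) auto

lemma L_cmult: "L q (\<lambda>y. a * f y) x = a * L q f x"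
proof -
  have "L q (\<lambda>y. a * f y) x = (\<integral>\<^sup>+v. a * (ennreal (exp (H v x - q * tau v)) * f (br v x)) \<partial>count_space B)"
    unfolding L_def by (intro nn_integral_cong) (simp add: mult_ac)
  then show ?thesis by (simp add: nn_integral_cmult L_def)
qed

lemma L_add: "L q (\<lambda>y. f y + f' y) x = L q f x + L q f' x"
  unfolding L_def by (simp add: distrib_left nn_integral_add)

lemma L_sum: "L q (\<lambda>y. \<Sum>i<(n::nat). f i y) x = (\<Sum>i<n. L q (f i) x)"
proof (induction n)
  case 0 show ?case by (simp add: L_def)
next
  case (Suc n) then show ?case by (simp add: L_add)
qed

lemma L_density: "L q f x = (\<integral>\<^sup>+v. f (br v x) \<partial>density (count_space B) (\<lambda>v. ennreal (exp (H v x - q * tau v))))"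
  unfolding L_def by (subst nn_integral_density) auto

lemma funpow_mono_X:
  assumes "x \<in> X" "\<And>y. y \<in> X \<Longrightarrow> f y \<le> f' y"
  shows "(L q ^^ k) f x \<le> (L q ^^ k) f' x"
  using assms(1) by (induction k arbitrary: x) (auto intro!: L_mono assms(2))

lemma funpow_cmult: "(L q ^^ k) (\<lambda>y. a * f y) x = a * (L q ^^ k) f x"
proof (induction k arbitrary: x)
  case (Suc k)
  then have "(L q ^^ k) (\<lambda>y. a * f y) = (\<lambda>y. a * (L q ^^ k) f y)" by auto
  then show ?case by (simp add: L_cmult)
qed simp

text \<open>The fixed point of \<open>C + c * \<theta> = c\<close>, so that \<open>L q\<close> maps
  the cone with this constant into itself for every \<open>q\<close>.\<close>

definition c :: real where "c = C / (1 - \<theta>)"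

lemma c: "C + c * \<theta> = c" "0 \<le> c"
proof -
  have "c * (1 - \<theta>) = C" using \<theta> by (simp add: c_def)
  then show "C + c * \<theta> = c" by (simp add: algebra_simps)
  show "0 \<le> c" using \<theta> C by (simp add: c_def)
qed

definition cone :: "('x \<Rightarrow> ennreal) \<Rightarrow> bool" where
  "cone f \<longleftrightarrow> (\<forall>x\<in>X. \<forall>y\<in>X. f x \<le> ennreal (exp (c * d x y)) * f y)"

lemma coneD: "cone f \<Longrightarrow> x \<in> X \<Longrightarrow> y \<in> X \<Longrightarrow> f x \<le> ennreal (exp c) * f y"
proof -
  assume a: "cone f" "x \<in> X" "y \<in> X"
  then have "f x \<le> ennreal (exp (c * d x y)) * f y" by (auto simp: cone_def)
  also have "\<dots> \<le> ennreal (exp c) * f y"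
    using d_le1[OF a(2,3)] c mult_left_mono[of "d x y" 1 c] by (intro mult_right_mono ennreal_leI) auto
  finally show ?thesis .
qed

lemma L_cone: assumes "cone f" shows "cone (L q f)"
  unfolding cone_def
proof (intro ballI)
  fix x y assume x: "x \<in> X" and y: "y \<in> X"
  have "L q f x \<le> (\<integral>\<^sup>+v. ennreal (exp (c * d x y)) * (ennreal (exp (H v y - q * tau v)) * f (br v y)) \<partial>count_space B)"
    unfolding L_def
  proof (rule nn_integral_mono)
    fix v assume "v \<in> space (count_space B)"
    then have v: "v \<in> B" by simp
    have "f (br v x) \<le> ennreal (exp (c * d (br v x) (br v y))) * f (br v y)"
      using assms br_X v x y by (auto simp: cone_def)
    also have "\<dots> \<le> ennreal (exp (c * (\<theta> * d x y))) * f (br v y)"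
      using d_contr[OF v x y] c by (intro mult_right_mono ennreal_leI) (auto simp: mult_left_mono)
    finally have "ennreal (exp (H v x - q * tau v)) * f (br v x)
        \<le> ennreal (exp (C * d x y + (H v y - q * tau v))) * (ennreal (exp (c * (\<theta> * d x y))) * f (br v y))"
      using H_dist[OF v x y] by (intro mult_mono ennreal_leI) auto
    also have "\<dots> = ennreal (exp (C * d x y + (H v y - q * tau v) + c * (\<theta> * d x y))) * f (br v y)"
      by (simp add: mult.assoc[symmetric] ennreal_exp_mult)
    also have "C * d x y + (H v y - q * tau v) + c * (\<theta> * d x y) = (C + c * \<theta>) * d x y + (H v y - q * tau v)"
      by (simp add: algebra_simps)
    also have "\<dots> = c * d x y + (H v y - q * tau v)" by (simp only: c(1))
    finally show "ennreal (exp (H v x - q * tau v)) * f (br v x)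
        \<le> ennreal (exp (c * d x y)) * (ennreal (exp (H v y - q * tau v)) * f (br v y))"
      by (simp add: mult.assoc[symmetric] ennreal_exp_mult)
  qed
  then show "L q f x \<le> ennreal (exp (c * d x y)) * L q f y" by (simp add: L_def nn_integral_cmult)
qed

lemma funpow_cone: "cone f \<Longrightarrow> cone ((L q ^^ k) f)"
  by (induction k) (auto intro: L_cone)

lemma cone_one: "cone (\<lambda>_. 1)"
  unfolding cone_def
proof (intro ballI)
  fix x y assume "x \<in> X" "y \<in> X"
  then show "1 \<le> ennreal (exp (c * d x y)) * 1" using c d_nonneg[of x y] by simp
qed

abbreviation one :: "'x \<Rightarrow> ennreal" where "one \<equiv> (\<lambda>_. 1)"

section \<open>Green functions on both sides of the critical exponent\<close>

definition green :: "real \<Rightarrow> 'x \<Rightarrow> ennreal" where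
  "green q x = (\<Sum>n. Z n x * ennreal (exp (- q * real n)))"

definition greenp :: "real \<Rightarrow> nat \<Rightarrow> 'x \<Rightarrow> ennreal" where
  "greenp q n x = (\<Sum>k<n. Z k x * ennreal (exp (- q * real k)))"

lemma Z_Suc:
  assumes "x \<in> X"
  shows "Z (Suc n) x * ennreal (exp (- q * real (Suc n))) =
    (\<integral>\<^sup>+v. ennreal (exp (H v x - q * tau v)) * (if tau v \<le> Suc n then Z (Suc n - tau v) (br v x) * ennreal (exp (- q * real (Suc n - tau v))) else 0) \<partial>count_space B)"
proof -
  have "Z (Suc n) x * ennreal (exp (- q * real (Suc n))) = (\<integral>\<^sup>+v. (if tau v \<le> Suc n then ennreal (exp (H v x)) * Z (Suc n - tau v) (br v x) else 0) * ennreal (exp (- q * real (Suc n))) \<partial>count_space B)"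
    by (simp add: Zrec[OF assms] nn_integral_multc)
  also have "\<dots> = (\<integral>\<^sup>+v. ennreal (exp (H v x - q * tau v)) * (if tau v \<le> Suc n then Z (Suc n - tau v) (br v x) * ennreal (exp (- q * real (Suc n - tau v))) else 0) \<partial>count_space B)"
  proof (rule nn_integral_cong)
    fix v
    show "(if tau v \<le> Suc n then ennreal (exp (H v x)) * Z (Suc n - tau v) (br v x) else 0) * ennreal (exp (- q * real (Suc n)))
      = ennreal (exp (H v x - q * tau v)) * (if tau v \<le> Suc n then Z (Suc n - tau v) (br v x) * ennreal (exp (- q * real (Suc n - tau v))) else 0)"
    proof (cases "tau v \<le> Suc n")
      case True
      have "ennreal (exp (H v x)) * ennreal (exp (- q * real (Suc n))) = ennreal (exp (H v x - q * tau v)) * ennreal (exp (- q * real (Suc n - tau v)))"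
        unfolding ennreal_exp_mult using True by (simp add: of_nat_diff algebra_simps)
      then show ?thesis using True by (simp add: mult_ac) (metis mult.left_commute mult.commute)
    qed simp
  qed
  finally show ?thesis .
qed

text \<open>A first branch of length \<open>tau v\<close> leaves only indices up to
  \<open>n - tau v\<close>, which are below \<open>n\<close> because \<open>tau v \<ge> 1\<close>;
  hence the truncated sum on the right is large enough.\<close>

lemma greenp_step:
  assumes "x \<in> X" shows "greenp q (Suc n) x \<le> 1 + L q (greenp q n) x"
proof -
  have "greenp q (Suc n) x = 1 + (\<Sum>k<n. Z (Suc k) x * ennreal (exp (- q * real (Suc k))))"
    unfolding greenp_def sum.lessThan_Suc_shift using Z0[OF assms] by simp
  also have "(\<Sum>k<n. Z (Suc k) x * ennreal (exp (- q * real (Suc k)))) = (\<integral>\<^sup>+v. (\<Sum>k<n. ennreal (exp (H v x - q * tau v)) * (if tau v \<le> Suc k then Z (Suc k - tau v) (br v x) * ennreal (exp (- q * real (Suc k - tau v))) else 0)) \<partial>count_space B)"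
    unfolding Z_Suc[OF assms] by (simp add: nn_integral_sum)
  also have "\<dots> \<le> L q (greenp q n) x"
    unfolding L_def
  proof (rule nn_integral_mono)
    fix v assume "v \<in> space (count_space B)"
    then have t: "1 \<le> tau v" using tau_ge1 by simp
    let ?f = "\<lambda>m. Z m (br v x) * ennreal (exp (- q * real m))"
    let ?I = "{k. k < n \<and> tau v \<le> Suc k}"
    have "(\<Sum>k<n. (if tau v \<le> Suc k then ?f (Suc k - tau v) else 0)) = (\<Sum>k\<in>?I. ?f (Suc k - tau v))"
      by (rule sum.mono_neutral_cong_right) auto
    also have "\<dots> = (\<Sum>m\<in>(\<lambda>k. Suc k - tau v) ` ?I. ?f m)"
      by (subst sum.reindex) (auto simp: inj_on_def)
    also have "\<dots> \<le> greenp q n (br v x)"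
      unfolding greenp_def using t by (intro sum_mono2) auto
    finally show "(\<Sum>k<n. ennreal (exp (H v x - q * tau v)) * (if tau v \<le> Suc k then ?f (Suc k - tau v) else 0)) \<le> ennreal (exp (H v x - q * tau v)) * greenp q n (br v x)"
      by (simp add: sum_distrib_left[symmetric] mult_left_mono del: if_distrib)
  qed
  finally show ?thesis by (simp add: add_left_mono)
qed

lemma green_step:
  assumes "x \<in> X" shows "1 + L q (green q) x \<le> green q x"
proof -
  have "green q x = 1 + (\<Sum>k. Z (Suc k) x * ennreal (exp (- q * real (Suc k))))"
    unfolding green_def using suminf_offset[of "\<lambda>n. Z n x * ennreal (exp (- q * real n))" 1] Z0[OF assms]
    by (simp add: add.commute)
  also have "(\<Sum>k. Z (Suc k) x * ennreal (exp (- q * real (Suc k)))) = (\<integral>\<^sup>+v. (\<Sum>k. ennreal (exp (H v x - q * tau v)) * (if tau v \<le> Suc k then Z (Suc k - tau v) (br v x) * ennreal (exp (- q * real (Suc k - tau v))) else 0)) \<partial>count_space B)"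
    unfolding Z_Suc[OF assms] by (subst nn_integral_suminf) auto
  finally have eq: "green q x = 1 + (\<integral>\<^sup>+v. (\<Sum>k. ennreal (exp (H v x - q * tau v)) * (if tau v \<le> Suc k then Z (Suc k - tau v) (br v x) * ennreal (exp (- q * real (Suc k - tau v))) else 0)) \<partial>count_space B)" .
  show ?thesis
    unfolding eq L_def
  proof (intro add_left_mono nn_integral_mono)
    fix v assume "v \<in> space (count_space B)"
    then have t: "1 \<le> tau v" using tau_ge1 by simp
    let ?f = "\<lambda>m. Z m (br v x) * ennreal (exp (- q * real m))"
    let ?a = "\<lambda>k. (if tau v \<le> Suc k then ?f (Suc k - tau v) else 0)"
    have "(\<Sum>k. ?a k) = (\<Sum>k. ?a (k + (tau v - 1))) + (\<Sum>k<tau v - 1. ?a k)"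
      by (rule suminf_offset) (rule summableI)
    moreover have "(\<Sum>k. ?a (k + (tau v - 1))) = green q (br v x)"
      unfolding green_def using t by (intro suminf_cong) simp
    ultimately have "green q (br v x) \<le> (\<Sum>k. ?a k)" by simp
    then show "ennreal (exp (H v x - q * tau v)) * green q (br v x) \<le> (\<Sum>k. ennreal (exp (H v x - q * tau v)) * ?a k)"
      by (simp add: mult_left_mono del: if_distrib)
  qed
qed

lemma green_iterate:
  assumes "x \<in> X" "0 < k" shows "1 + (L q ^^ k) (green q) x \<le> green q x"
  using assms
proof (induction k arbitrary: x)
  case (Suc k)
  show ?case
  proof (cases "k = 0")
    case True then show ?thesis using green_step[OF Suc.prems(1)] by simp
  next
    case False
    have "L q ((L q ^^ k) (green q)) x \<le> L q (green q) x"
    proof (rule L_mono[OF Suc.prems(1)])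
      fix y assume "y \<in> X"
      then have "1 + (L q ^^ k) (green q) y \<le> green q y" using Suc.IH False by blast
      then show "(L q ^^ k) (green q) y \<le> green q y" by (rule order_trans[rotated]) simp
    qed
    then have "1 + L q ((L q ^^ k) (green q)) x \<le> 1 + L q (green q) x" by (rule add_left_mono)
    also have "\<dots> \<le> green q x" by (rule green_step[OF Suc.prems(1)])
    finally show ?thesis by simp
  qed
qed simp

text \<open>If the iterate exceeded \<open>exp c\<close> at \<open>x0\<close>, the cone property
  would make it at least \<open>1\<close> everywhere. Then
  \<open>1 + (L q ^^ k) (green q) \<le> green q\<close> would raise any lower bound \<open>m\<close>
  of the Green function to \<open>m + 1\<close>, forcing it to be infinite.\<close>

lemma iterate_le_of_green_finite:
  assumes "green q x0 < \<infinity>"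
  shows "(L q ^^ k) one x0 \<le> ennreal (exp c)"
proof (cases "k = 0")
  case True then show ?thesis using c by simp
next
  case False
  show ?thesis
  proof (rule ccontr)
    assume n: "\<not> (L q ^^ k) one x0 \<le> ennreal (exp c)"
    have ge: "1 \<le> (L q ^^ k) one x" if "x \<in> X" for x
    proof -
      have "ennreal (exp c) * 1 < (L q ^^ k) one x0" using n by simp
      also have "\<dots> \<le> ennreal (exp c) * (L q ^^ k) one x"
        by (rule coneD[OF funpow_cone[OF cone_one] x0 that])
      finally have *: "ennreal (exp c) * 1 < ennreal (exp c) * (L q ^^ k) one x" .
      show ?thesis
      proof (rule ccontr)
        assume "\<not> 1 \<le> (L q ^^ k) one x"
        then have "ennreal (exp c) * (L q ^^ k) one x \<le> ennreal (exp c) * 1"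
          by (intro mult_left_mono) auto
        then show False using * by simp
      qed
    qed
    have "of_nat m \<le> green q x" if "x \<in> X" for m x
      using that
    proof (induction m arbitrary: x)
      case (Suc m)
      have "of_nat m * 1 \<le> of_nat m * (L q ^^ k) one x" using ge[OF Suc.prems] by (intro mult_left_mono) auto
      also have "\<dots> = (L q ^^ k) (\<lambda>y. of_nat m * 1) x" by (simp only: funpow_cmult)
      also have "\<dots> \<le> (L q ^^ k) (green q) x"
        by (rule funpow_mono_X[OF Suc.prems]) (use Suc.IH in simp)
      finally have "1 + of_nat m \<le> 1 + (L q ^^ k) (green q) x" by (intro add_left_mono) simp
      also have "\<dots> \<le> green q x" using green_iterate[OF Suc.prems] False by simp
      finally show ?case by simp
    qed simp
    then have ge_nat: "of_nat m \<le> green q x0" for m using x0 by blast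
    obtain r where r: "green q x0 = ennreal r" "0 \<le> r" using assms by (cases "green q x0") auto
    obtain m :: nat where "r < real m" using reals_Archimedean2 by blast
    moreover have "ennreal (real m) \<le> ennreal r" using ge_nat[of m] r by (simp add: ennreal_of_nat_eq_real_of_nat)
    ultimately show False using r by simp
  qed
qed

lemma L_antimono:
  assumes "q0 \<le> q" "x \<in> X" shows "L q f x \<le> L q0 f x"
  unfolding L_def using assms by (intro nn_integral_mono mult_right_mono ennreal_leI) (auto intro: mult_right_mono)

text \<open>The bound is uniform in \<open>q\<close> and \<open>x\<close>; it supplies the
  dominating function for the limit \<open>q \<longlonglongrightarrow> P\<close>.\<close>

lemma iterate_finite: "\<exists>K::real. \<forall>q\<ge>q0. \<forall>x\<in>X. (L q ^^ k) one x \<le> ennreal K"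
proof -
  obtain K0 where K0: "L q0 one x0 = ennreal K0" "0 \<le> K0"
    using fin by (cases "L q0 one x0") (auto simp: L_def)
  have 1: "L q one x \<le> ennreal (exp c * K0)" if "q0 \<le> q" "x \<in> X" for q x
  proof -
    have "L q one x \<le> L q0 one x" by (rule L_antimono[OF that])
    also have "\<dots> \<le> ennreal (exp c) * L q0 one x0" by (rule coneD[OF L_cone[OF cone_one] that(2) x0])
    finally show ?thesis using K0 by (simp add: ennreal_mult)
  qed
  have "(L q ^^ k) one x \<le> ennreal ((exp c * K0) ^ k)" if "q0 \<le> q" "x \<in> X" for q x
    using that(2)
  proof (induction k arbitrary: x)
    case (Suc k)
    have "(L q ^^ Suc k) one x \<le> L q (\<lambda>_. ennreal ((exp c * K0) ^ k) * 1) x"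
      using Suc by (auto intro!: L_mono)
    also have "\<dots> = ennreal ((exp c * K0) ^ k) * L q one x" by (rule L_cmult)
    also have "\<dots> \<le> ennreal ((exp c * K0) ^ k) * ennreal (exp c * K0)"
      using 1[OF that(1) Suc.prems] by (intro mult_left_mono) auto
    finally show ?case using K0 by (simp add: ennreal_mult mult.commute)
  qed simp
  then show ?thesis by blast
qed

text \<open>If the iterate were below \<open>exp (- c)\<close> at \<open>x0\<close>, it would be at
  most some \<open>r < 1\<close> everywhere. A multiple of the first \<open>k\<close> iterates would
  then be a finite solution of \<open>1 + L q G \<le> G\<close>, and such a \<open>G\<close>
  dominates all partial sums of the Green function.\<close>

lemma iterate_ge_of_green_infinite:
  assumes "q0 \<le> q" "green q x0 = \<infinity>"
  shows "ennreal (exp (- c)) \<le> (L q ^^ k) one x0"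
proof (cases "k = 0")
  case True then show ?thesis using c by simp
next
  case False
  show ?thesis
  proof (rule ccontr)
    assume n: "\<not> ennreal (exp (- c)) \<le> (L q ^^ k) one x0"
    then obtain l where l: "(L q ^^ k) one x0 = ennreal l" "0 \<le> l" "l < exp (- c)"
      by (cases "(L q ^^ k) one x0") (auto simp: not_le ennreal_less_iff)
    define r where "r = exp c * l"
    have r: "0 \<le> r" "r < 1" using l mult_strict_left_mono[OF l(3), of "exp c"] by (auto simp: r_def exp_minus)
    have ler: "(L q ^^ k) one x \<le> ennreal r" if "x \<in> X" for x
      using coneD[OF funpow_cone[OF cone_one] that x0, of k q] l by (simp add: r_def ennreal_mult)
    \<comment> \<open>The solution of \<open>a = 1 + a * r\<close>: after \<open>k\<close> steps the
      loss \<open>a * r\<close> leaves exactly the \<open>1\<close> that the supersolution must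
      pay.\<close>
    define a where "a = 1 / (1 - r)"
    have a: "0 < a" "a = 1 + a * r" using r by (auto simp: a_def field_simps)
    define g where "g = (\<lambda>x. \<Sum>i<k. (L q ^^ i) one x)"
    define G where "G = (\<lambda>x. ennreal a * g x)"
    have LG: "1 + L q G x \<le> G x" if x: "x \<in> X" for x
    proof -
      have "L q g x + 1 = (\<Sum>i<Suc k. (L q ^^ i) one x)"
        unfolding g_def L_sum by (subst sum.lessThan_Suc_shift) (simp add: add.commute)
      also have "\<dots> = g x + (L q ^^ k) one x" by (simp add: g_def)
      also have "\<dots> \<le> g x + ennreal r" using ler[OF x] by (rule add_left_mono)
      finally have "ennreal a * (L q g x + 1) \<le> ennreal a * (g x + ennreal r)" by (intro mult_left_mono) auto
      then have "L q G x + ennreal a \<le> G x + ennreal (a * r)"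
        using a r by (simp add: G_def L_cmult distrib_left ennreal_mult)
      moreover have "ennreal a = 1 + ennreal (a * r)"
        using a r by (metis ennreal_1 ennreal_plus less_imp_le mult_nonneg_nonneg zero_le_one)
      ultimately have "ennreal (a * r) + (1 + L q G x) \<le> ennreal (a * r) + G x" by (simp add: ac_simps)
      then show ?thesis by (simp add: ennreal_add_left_cancel_le)
    qed
    have "greenp q n x \<le> G x" if "x \<in> X" for n x
      using that
    proof (induction n arbitrary: x)
      case (Suc n)
      have "greenp q (Suc n) x \<le> 1 + L q (greenp q n) x" by (rule greenp_step[OF Suc.prems])
      also have "\<dots> \<le> 1 + L q G x" using Suc by (intro add_left_mono L_mono) auto
      finally show ?case using LG[OF Suc.prems] by (rule order_trans)
    qed (simp add: greenp_def)
    then have "green q x0 \<le> G x0"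
      unfolding green_def suminf_eq_SUP greenp_def[symmetric] using x0 by (intro SUP_least) auto
    moreover have "G x0 < \<infinity>"
    proof -
      have "(L q ^^ i) one x0 < \<infinity>" for i
      proof -
        obtain K where "(L q ^^ i) one x0 \<le> ennreal K" using iterate_finite[of i] assms(1) x0 by blast
        then show ?thesis by (rule order_le_less_trans) simp
      qed
      then show ?thesis by (simp add: G_def g_def ennreal_mult_less_top)
    qed
    ultimately show False using assms(2) by simp
  qed
qed

text \<open>Dominated convergence with the weights at \<open>q0\<close>, which are summable although
  \<open>q0\<close> lies strictly below \<open>P\<close>.\<close>

lemma iterate_tendsto:
  assumes "q \<longlonglongrightarrow> P" "\<And>n. q0 \<le> q n" "x \<in> X"
  shows "(\<lambda>n. (L (q n) ^^ k) one x) \<longlonglongrightarrow> (L P ^^ k) one x"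
  using assms(3)
proof (induction k arbitrary: x)
  case (Suc k)
  obtain K where K: "\<And>q x. q0 \<le> q \<Longrightarrow> x \<in> X \<Longrightarrow> (L q ^^ k) one x \<le> ennreal K"
    using iterate_finite[of k] by blast
  obtain K1 where K1: "L q0 one x \<le> ennreal K1" using iterate_finite[of 1] Suc.prems by auto
  have "(\<lambda>n. L (q n) ((L (q n) ^^ k) one) x) \<longlonglongrightarrow> L P ((L P ^^ k) one) x"
    unfolding L_def[of _ "(L _ ^^ k) one"]
  proof (rule nn_integral_dominated_convergence[where w = "\<lambda>v. ennreal (exp (H v x - q0 * tau v)) * ennreal K"])
    show "AE v in count_space B. ennreal (exp (H v x - q j * tau v)) * (L (q j) ^^ k) one (br v x) \<le> ennreal (exp (H v x - q0 * tau v)) * ennreal K" for j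
      using K assms(2) br_X Suc.prems by (intro AE_I2 mult_mono ennreal_leI) (auto intro: mult_right_mono)
    have "(\<integral>\<^sup>+v. ennreal (exp (H v x - q0 * tau v)) * ennreal K \<partial>count_space B) = L q0 one x * ennreal K"
      by (simp add: L_def nn_integral_multc)
    also have "\<dots> \<le> ennreal K1 * ennreal K" using K1 by (rule mult_right_mono) simp
    also have "\<dots> < \<infinity>" by (simp add: ennreal_mult_less_top)
    finally show "(\<integral>\<^sup>+v. ennreal (exp (H v x - q0 * tau v)) * ennreal K \<partial>count_space B) < \<infinity>" .
    show "AE v in count_space B. (\<lambda>i. ennreal (exp (H v x - q i * tau v)) * (L (q i) ^^ k) one (br v x)) \<longlonglongrightarrow> ennreal (exp (H v x - P * tau v)) * (L P ^^ k) one (br v x)"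
    proof (rule AE_I2)
      fix v assume "v \<in> space (count_space B)"
      then have v: "br v x \<in> X" using br_X Suc.prems by simp
      have "(L P ^^ k) one (br v x) \<le> ennreal K" using K[OF _ v, of P] q0 by simp
      then have nt: "(L P ^^ k) one (br v x) \<noteq> \<infinity>" by (metis ennreal_neq_top infinity_ennreal_def top.extremum_uniqueI)
      show "(\<lambda>i. ennreal (exp (H v x - q i * tau v)) * (L (q i) ^^ k) one (br v x)) \<longlonglongrightarrow> ennreal (exp (H v x - P * tau v)) * (L P ^^ k) one (br v x)"
        by (intro tendsto_mult_ennreal Suc.IH[OF v] tendsto_ennrealI tendsto_intros assms(1)) (use nt in auto)
    qed
  qed auto
  then show ?case by simp
qed simp

text \<open>Neither convergence nor divergence is known at \<open>P\<close> itself. The upper bound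
  is passed to the limit from exponents above \<open>P\<close>, the lower bound from exponents below
  \<open>P\<close>, and the cone property extends both from \<open>x0\<close> to
  \<open>x\<close>.\<close>

lemma iterate_bounds:
  assumes "x \<in> X"
  shows "(L P ^^ k) one x \<le> ennreal (exp (2 * c))" "ennreal (exp (- 2 * c)) \<le> (L P ^^ k) one x"
proof -
  have tn: "(\<lambda>n. s * (P - q0) / real (Suc n)) \<longlonglongrightarrow> 0" for s
    by (rule LIMSEQ_Suc) (rule lim_const_over_n)
  have up: "(L P ^^ k) one x0 \<le> ennreal (exp c)"
  proof (rule LIMSEQ_le_const2[OF iterate_tendsto[of "\<lambda>n. P + (P - q0) / real (Suc n)"]])
    show "(\<lambda>n. P + (P - q0) / real (Suc n)) \<longlonglongrightarrow> P" using tendsto_add[OF tendsto_const tn[of 1], of P] by simp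
    show "q0 \<le> P + (P - q0) / real (Suc n)" for n using q0 by (simp add: add_increasing2)
    show "\<exists>N. \<forall>n\<ge>N. (L (P + (P - q0) / real (Suc n)) ^^ k) one x0 \<le> ennreal (exp c)"
    proof (intro exI allI impI iterate_le_of_green_finite)
      fix n show "green (P + (P - q0) / real (Suc n)) x0 < \<infinity>"
        unfolding green_def using q0 by (intro conv) simp
    qed
  qed (rule x0)
  have lo: "ennreal (exp (- c)) \<le> (L P ^^ k) one x0"
  proof (rule LIMSEQ_le_const[OF iterate_tendsto[of "\<lambda>n. P - (P - q0) / real (Suc n)"]])
    show "(\<lambda>n. P - (P - q0) / real (Suc n)) \<longlonglongrightarrow> P" using tendsto_diff[OF tendsto_const tn[of 1], of P] by simp
    have a: "(P - q0) / real (Suc n) \<le> P - q0" for n using q0 by (simp add: divide_le_eq mult_le_cancel_left1)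
    show b: "q0 \<le> P - (P - q0) / real (Suc n)" for n using a[of n] by linarith
    show "\<exists>N. \<forall>n\<ge>N. ennreal (exp (- c)) \<le> (L (P - (P - q0) / real (Suc n)) ^^ k) one x0"
    proof (intro exI allI impI iterate_ge_of_green_infinite b)
      fix n show "green (P - (P - q0) / real (Suc n)) x0 = \<infinity>"
        unfolding green_def using q0 by (intro div b) simp
    qed
  qed (rule x0)
  have "(L P ^^ k) one x \<le> ennreal (exp c) * (L P ^^ k) one x0" by (rule coneD[OF funpow_cone[OF cone_one] assms x0])
  also have "\<dots> \<le> ennreal (exp c) * ennreal (exp c)" using up by (rule mult_left_mono) simp
  finally show "(L P ^^ k) one x \<le> ennreal (exp (2 * c))" by (simp add: ennreal_exp_mult)
  have "ennreal (exp (- c)) * ennreal (exp (- c)) \<le> ennreal (exp (- c)) * (L P ^^ k) one x0"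
    using lo by (rule mult_left_mono) simp
  also have "\<dots> \<le> ennreal (exp (- c)) * (ennreal (exp c) * (L P ^^ k) one x)"
    by (rule mult_left_mono[OF coneD[OF funpow_cone[OF cone_one] x0 assms]]) simp
  finally show "ennreal (exp (- 2 * c)) \<le> (L P ^^ k) one x"
    by (simp add: ennreal_exp_mult mult.assoc[symmetric])
qed

text \<open>By Fatou the lower limit \<open>h0\<close> of the iterates of \<open>1\<close> satisfies
  \<open>L P h0 \<le> h0\<close>, so its iterates decrease, and monotone convergence makes their
  infimum a fixed point. It stays positive because each iterate of \<open>h0\<close> is at least
  \<open>exp (- 2 * c)\<close> times the corresponding iterate of \<open>1\<close>.\<close>

lemma eigenfunction_ennreal:
  "\<exists>h. cone h \<and> (\<forall>x\<in>X. L P h x = h x \<and> h x \<le> ennreal (exp (2 * c)) \<and> ennreal (exp (- 4 * c)) \<le> h x)"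
proof -
  define h0 where "h0 = (\<lambda>x. liminf (\<lambda>n. (L P ^^ n) one x))"
  define hn where "hn = (\<lambda>n. (L P ^^ n) h0)"
  define h where "h = (\<lambda>x. INF n. hn n x)"
  have h0_le: "h0 x \<le> ennreal (exp (2 * c))" if "x \<in> X" for x
    unfolding h0_def using iterate_bounds(1)[OF that] by (intro Liminf_le) (auto intro: always_eventually)
  have h0_ge: "ennreal (exp (- 2 * c)) \<le> h0 x" if "x \<in> X" for x
    unfolding h0_def using iterate_bounds(2)[OF that] by (intro Liminf_bounded) (auto intro: always_eventually)
  have Lh0: "L P h0 x \<le> h0 x" if x: "x \<in> X" for x
  proof -
    let ?M = "density (count_space B) (\<lambda>v. ennreal (exp (H v x - P * tau v)))"
    have "L P h0 x \<le> liminf (\<lambda>n. \<integral>\<^sup>+v. (L P ^^ n) one (br v x) \<partial>?M)"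
      unfolding L_density h0_def by (rule nn_integral_liminf) simp
    also have "(\<lambda>n. \<integral>\<^sup>+v. (L P ^^ n) one (br v x) \<partial>?M) = (\<lambda>n. (L P ^^ (n + 1)) one x)"
      by (simp add: L_density[symmetric])
    also have "liminf (\<lambda>n. (L P ^^ (n + 1)) one x) = h0 x"
      unfolding h0_def by (rule liminf_shift)
    finally show ?thesis .
  qed
  have dec: "hn (Suc n) x \<le> hn n x" if "x \<in> X" for n x
  proof -
    have "(L P ^^ n) (L P h0) x \<le> (L P ^^ n) h0 x" by (rule funpow_mono_X[OF that Lh0])
    then show ?thesis by (simp add: hn_def funpow_swap1)
  qed
  have deq: "decseq (\<lambda>n. hn n x)" if "x \<in> X" for x
    using dec[OF that] by (rule decseq_SucI)
  have lim: "(\<lambda>n. hn n x) \<longlonglongrightarrow> h x" if "x \<in> X" for x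
    unfolding h_def by (rule LIMSEQ_INF[OF deq[OF that]])
  have cone0: "cone h0" unfolding cone_def
  proof (intro ballI)
    fix x y assume x: "x \<in> X" and y: "y \<in> X"
    let ?a = "ennreal (exp (c * d x y))"
    have "h0 x \<le> liminf (\<lambda>n. ?a * (L P ^^ n) one y)"
      unfolding h0_def
    proof (rule Liminf_mono, rule always_eventually, rule allI)
      fix n show "(L P ^^ n) one x \<le> ?a * (L P ^^ n) one y"
        using funpow_cone[OF cone_one, of n P] x y unfolding cone_def by blast
    qed
    also have "\<dots> = ?a * h0 y" unfolding h0_def
    proof (rule Liminf_compose_continuous_mono[where f = "\<lambda>z. ?a * z"])
      show "continuous_on UNIV (\<lambda>z. ?a * z)" by (rule ennreal_continuous_on_cmult) auto
      show "mono (\<lambda>z. ?a * z)" by (rule monoI) (rule mult_left_mono, auto)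
    qed simp
    finally show "h0 x \<le> ?a * h0 y" .
  qed
  have coneh: "cone h" unfolding cone_def
  proof (intro ballI)
    fix x y assume x: "x \<in> X" and y: "y \<in> X"
    show "h x \<le> ennreal (exp (c * d x y)) * h y"
    proof (rule LIMSEQ_le[OF lim[OF x]])
      show "(\<lambda>n. ennreal (exp (c * d x y)) * hn n y) \<longlonglongrightarrow> ennreal (exp (c * d x y)) * h y"
        by (rule tendsto_mult_ennreal[OF tendsto_const lim[OF y]]) auto
      show "\<exists>N. \<forall>n\<ge>N. hn n x \<le> ennreal (exp (c * d x y)) * hn n y"
        using funpow_cone[OF cone0, of _ P] x y unfolding hn_def cone_def by blast
    qed
  qed
  have Lh: "L P h x = h x" if x: "x \<in> X" for x
  proof -
    let ?M = "density (count_space B) (\<lambda>v. ennreal (exp (H v x - P * tau v)))"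
    have "(\<integral>\<^sup>+v. (INF n. hn n (br v x)) \<partial>?M) = (INF n. \<integral>\<^sup>+v. hn n (br v x) \<partial>?M)"
    proof (rule nn_integral_monotone_convergence_INF_AE[where i = 0])
      show "AE v in ?M. hn (Suc i) (br v x) \<le> hn i (br v x)" for i
        using dec br_X x by (subst AE_density) (auto intro!: AE_I2)
      have "(\<integral>\<^sup>+v. hn 0 (br v x) \<partial>?M) = L P h0 x" by (simp add: L_density hn_def)
      also have "\<dots> \<le> ennreal (exp (2 * c))" using Lh0[OF x] h0_le[OF x] by (rule order_trans)
      finally show "(\<integral>\<^sup>+v. hn 0 (br v x) \<partial>?M) < \<infinity>" by (rule order_le_less_trans) simp
    qed simp
    then have "L P h x = (INF n. hn (Suc n) x)" by (simp add: L_density h_def hn_def)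
    also have "\<dots> = h x"
    proof (rule antisym)
      show "(INF n. hn (Suc n) x) \<le> h x" unfolding h_def
        by (rule INF_mono) (use dec[OF x] in blast)
      show "h x \<le> (INF n. hn (Suc n) x)" unfolding h_def
        by (rule INF_mono) blast
    qed
    finally show ?thesis .
  qed
  have "h x \<le> ennreal (exp (2 * c))" if "x \<in> X" for x
    using INF_lower[of 0 UNIV "\<lambda>n. hn n x"] h0_le[OF that] by (simp add: h_def hn_def order_trans)
  moreover have "ennreal (exp (- 4 * c)) \<le> h x" if x: "x \<in> X" for x
    unfolding h_def
  proof (rule INF_greatest)
    fix n
    have "ennreal (exp (- 4 * c)) = ennreal (exp (- 2 * c)) * ennreal (exp (- 2 * c))" by (simp add: ennreal_exp_mult)
    also have "\<dots> \<le> ennreal (exp (- 2 * c)) * (L P ^^ n) one x" using iterate_bounds(2)[OF x] by (rule mult_left_mono) simp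
    also have "\<dots> = (L P ^^ n) (\<lambda>_. ennreal (exp (- 2 * c)) * 1) x" by (simp only: funpow_cmult)
    also have "\<dots> \<le> hn n x" unfolding hn_def by (rule funpow_mono_X[OF x]) (use h0_ge in simp)
    finally show "ennreal (exp (- 4 * c)) \<le> hn n x" .
  qed
  ultimately show ?thesis using coneh Lh by blast
qed

theorem eigenfunction:
  "\<exists>h. (\<forall>x\<in>X. exp (- 4 * c) \<le> h x \<and> h x \<le> exp (2 * c) \<and> (\<forall>y\<in>X. h x \<le> exp (c * d x y) * h y) \<and>
     integrable (count_space B) (\<lambda>v. exp (H v x - P * tau v) * h (br v x)) \<and>
     (\<integral>v. exp (H v x - P * tau v) * h (br v x) \<partial>count_space B) = h x)"
proof -
  obtain h where h: "cone h" "\<And>x. x \<in> X \<Longrightarrow> L P h x = h x" "\<And>x. x \<in> X \<Longrightarrow> h x \<le> ennreal (exp (2 * c))"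
    "\<And>x. x \<in> X \<Longrightarrow> ennreal (exp (- 4 * c)) \<le> h x"
    using eigenfunction_ennreal by blast
  define k where "k = (\<lambda>x. enn2real (h x))"
  have hk: "h x = ennreal (k x)" if "x \<in> X" for x
    using h(3)[OF that] by (cases "h x") (auto simp: k_def top_unique)
  have k0: "0 \<le> k x" for x by (simp add: k_def)
  show ?thesis
  proof (intro exI[of _ k] ballI conjI)
    fix x assume x: "x \<in> X"
    show "exp (- 4 * c) \<le> k x" using h(4)[OF x] hk[OF x] k0 by simp
    show "k x \<le> exp (2 * c)" using h(3)[OF x] hk[OF x] k0 by simp
    show "k x \<le> exp (c * d x y) * k y" if "y \<in> X" for y
      using h(1) x that k0 by (simp add: cone_def hk ennreal_mult[symmetric])
    have e: "(\<integral>\<^sup>+v. ennreal (exp (H v x - P * tau v) * k (br v x)) \<partial>count_space B) = ennreal (k x)"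
    proof -
      have "(\<integral>\<^sup>+v. ennreal (exp (H v x - P * tau v) * k (br v x)) \<partial>count_space B) = L P h x"
        unfolding L_def using hk br_X[OF _ x] k0 by (intro nn_integral_cong) (simp add: ennreal_mult)
      then show ?thesis using h(2)[OF x] hk[OF x] by simp
    qed
    show "integrable (count_space B) (\<lambda>v. exp (H v x - P * tau v) * k (br v x))"
      by (rule integrableI_nonneg) (use e k0 in auto)
    then show "(\<integral>v. exp (H v x - P * tau v) * k (br v x) \<partial>count_space B) = k x"
      using e k0 by (subst integral_eq_nn_integral) auto
  qed
qed

end

section \<open>Growth of perturbed renewal sums\<close>

context renewal_system
begin

text \<open>Any solution \<open>Y\<close> of the perturbed renewal equation is dominated, by
  induction on \<open>n\<close>, by a multiple of a positive function that the perturbed operator at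
  level \<open>Q\<close> does not increase. Only this upper bound on the growth of \<open>Y\<close>
  is claimed.\<close>

theorem perturbed_growth:
  assumes D: "0 \<le> D"
  shows "\<exists>C'>0. \<exists>\<epsilon>0>0. \<forall>(\<Psi> :: 'b \<Rightarrow> 'x \<Rightarrow> real) (N :: real). 0 \<le> N \<and>
      (\<forall>v\<in>B. \<forall>x\<in>X. \<bar>\<Psi> v x\<bar> \<le> N * tau v) \<and>
      (\<forall>v\<in>B. \<forall>x\<in>X. \<forall>y\<in>X. \<bar>\<Psi> v x - \<Psi> v y\<bar> \<le> N * D * d x y) \<longrightarrow>
      (\<exists>\<kappa>. \<forall>s Y. \<bar>s\<bar> * N \<le> \<epsilon>0 \<and> (\<forall>x\<in>X. Y 0 x = 1) \<and>
         (\<forall>x\<in>X. \<forall>n>0. Y n x = (\<integral>\<^sup>+v. (if tau v \<le> n then ennreal (exp (H v x + s * \<Psi> v x)) * Y (n - tau v) (br v x) else 0) \<partial>count_space B)) \<longrightarrow>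
         (\<exists>K>0. \<forall>n. \<forall>x\<in>X. Y n x \<le> ennreal (K * exp (real n * (P + s * \<kappa> + C' * N\<^sup>2 * s\<^sup>2)))))"
proof -
  obtain h where h: "\<And>x. x \<in> X \<Longrightarrow> exp (- 4 * c) \<le> h x" "\<And>x. x \<in> X \<Longrightarrow> h x \<le> exp (2 * c)"
    "\<And>x y. x \<in> X \<Longrightarrow> y \<in> X \<Longrightarrow> h x \<le> exp (c * d x y) * h y"
    "\<And>x. x \<in> X \<Longrightarrow> integrable (count_space B) (\<lambda>v. exp (H v x - P * tau v) * h (br v x))"
    "\<And>x. x \<in> X \<Longrightarrow> (\<integral>v. exp (H v x - P * tau v) * h (br v x) \<partial>count_space B) = h x"
    using eigenfunction by blast
  have hpos: "0 < h x" if "x \<in> X" for x using h(1)[OF that] exp_gt_zero[of "- 4 * c"] by linarith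
  \<comment> \<open>Conjugation by the eigenfunction gives total mass one. Its exponential moment
    for \<open>\<epsilon> = P - q0\<close> is the finite return sum at \<open>q0\<close>, up to
    \<open>exp (6 * c)\<close>, the ratio of the upper and lower bounds of \<open>h\<close>.\<close>
  define g where "g = (\<lambda>v x. exp (H v x - P * tau v) * h (br v x) / h x)"
  define \<epsilon> where "\<epsilon> = P - q0"
  have \<epsilon>: "0 < \<epsilon>" using q0 by (simp add: \<epsilon>_def)
  obtain K0 where K0: "\<And>x. x \<in> X \<Longrightarrow> L q0 one x \<le> ennreal K0" using iterate_finite[of 1] by auto
  define K1 where "K1 = max K0 0"
  have K1: "0 \<le> K1" "\<And>x. x \<in> X \<Longrightarrow> L q0 one x \<le> ennreal K1"
    using K0 by (auto simp: K1_def intro: order_trans[OF _ ennreal_leI])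
  have i0: "integrable (count_space B) (\<lambda>v. exp (H v x - q0 * tau v))"
    "(\<integral>v. exp (H v x - q0 * tau v) \<partial>count_space B) \<le> K1" if "x \<in> X" for x
  proof -
    have n: "(\<integral>\<^sup>+v. ennreal (exp (H v x - q0 * tau v)) \<partial>count_space B) \<le> ennreal K1"
      using K1(2)[OF that] by (simp add: L_def)
    then show "integrable (count_space B) (\<lambda>v. exp (H v x - q0 * tau v))"
      by (intro integrableI_nonneg) (auto intro: order_le_less_trans)
    then show "(\<integral>v. exp (H v x - q0 * tau v) \<partial>count_space B) \<le> K1"
      using n K1(1) by (subst (asm) nn_integral_eq_integral) auto
  qed
  have gt: "g v x * exp (\<epsilon> * tau v) \<le> exp (6 * c) * exp (H v x - q0 * tau v)" "0 \<le> g v x" if v: "v \<in> B" and x: "x \<in> X" for v x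
  proof -
    have "g v x * exp (\<epsilon> * tau v) = exp (H v x - q0 * tau v) * (h (br v x) / h x)"
      by (simp add: g_def \<epsilon>_def algebra_simps flip: exp_add)
    also have "\<dots> \<le> exp (H v x - q0 * tau v) * exp (6 * c)"
    proof (rule mult_left_mono)
      have "h (br v x) \<le> exp (6 * c) * exp (- 4 * c)" using h(2)[OF br_X[OF v x]] by (simp flip: exp_add)
      also have "\<dots> \<le> exp (6 * c) * h x" using h(1)[OF x] by (intro mult_left_mono) auto
      finally show "h (br v x) / h x \<le> exp (6 * c)" using hpos[OF x] by (simp add: divide_le_eq)
    qed simp
    finally show "g v x * exp (\<epsilon> * tau v) \<le> exp (6 * c) * exp (H v x - q0 * tau v)" by (simp add: mult.commute)
    show "0 \<le> g v x" using hpos[OF x] hpos[OF br_X[OF v x]] by (simp add: g_def)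
  qed
  have gi: "integrable (count_space B) (\<lambda>v. g v x * exp (\<epsilon> * tau v))" if x: "x \<in> X" for x
  proof (rule Bochner_Integration.integrable_bound[of _ "\<lambda>v. exp (6 * c) * exp (H v x - q0 * tau v)"])
    show "AE v in count_space B. norm (g v x * exp (\<epsilon> * tau v)) \<le> norm (exp (6 * c) * exp (H v x - q0 * tau v))"
      using gt[OF _ x] by (intro AE_I2) (auto simp: abs_mult)
  qed (use i0(1)[OF x] in auto)
  \<comment> \<open>Distortion \<open>2 * c\<close>: the branch weight and \<open>h (br v x)\<close>
    give \<open>C + c * \<theta> = c\<close>, and dividing by \<open>h x\<close> gives another
    \<open>c\<close>.\<close>
  interpret rk: return_kernel X B br d g tau \<theta> "2 * c" \<epsilon> "exp (6 * c) * K1" x0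
  proof
    show "0 \<le> 2 * c" using c by simp
    fix v x y assume v: "v \<in> B" and x: "x \<in> X" and y: "y \<in> X"
    have "g v x \<le> (exp (C * d x y) * exp (H v y - P * tau v)) * (exp (c * (\<theta> * d x y)) * h (br v y)) * (exp (c * d x y) / h y)"
      unfolding g_def times_divide_eq_right[symmetric]
    proof -
      have 1: "exp (H v x - P * tau v) \<le> exp (C * d x y) * exp (H v y - P * tau v)"
        using H_dist[OF v x y] by (simp flip: exp_add)
      have "h (br v x) \<le> exp (c * d (br v x) (br v y)) * h (br v y)" by (rule h(3)[OF br_X[OF v x] br_X[OF v y]])
      also have "\<dots> \<le> exp (c * (\<theta> * d x y)) * h (br v y)"
        using d_contr[OF v x y] c hpos[OF br_X[OF v y]] by (intro mult_right_mono) (auto simp: mult_left_mono)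
      finally have 2: "h (br v x) \<le> exp (c * (\<theta> * d x y)) * h (br v y)" .
      have 3: "1 / h x \<le> exp (c * d x y) / h y"
        using h(3)[OF y x] hpos[OF x] hpos[OF y] by (simp add: d_sym[of y x] field_simps)
      have "exp (H v x - P * tau v) * h (br v x) * (1 / h x) \<le> (exp (C * d x y) * exp (H v y - P * tau v)) * (exp (c * (\<theta> * d x y)) * h (br v y)) * (exp (c * d x y) / h y)"
        using 1 2 3 hpos[OF x] hpos[OF y] hpos[OF br_X[OF v x]] hpos[OF br_X[OF v y]]
        by (intro mult_mono) auto
      then show "exp (H v x - P * real (tau v)) * (h (br v x) / h x) \<le> (exp (C * d x y) * exp (H v y - P * tau v)) * (exp (c * (\<theta> * d x y)) * h (br v y)) * (exp (c * d x y) / h y)"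
        by simp
    qed
    also have "\<dots> = exp (C * d x y + c * (\<theta> * d x y) + c * d x y) * g v y"
      by (simp add: g_def exp_add)
    also have "C * d x y + c * (\<theta> * d x y) + c * d x y = (C + c * \<theta> + c) * d x y" by (simp add: algebra_simps)
    also have "C + c * \<theta> + c = 2 * c" using c(1) by simp
    finally show "g v x \<le> exp (2 * c * d x y) * g v y" .
  next
    fix x assume x: "x \<in> X"
    show "integrable (count_space B) (\<lambda>v. g v x)" using h(4)[OF x] by (simp add: g_def)
    show "(\<integral>v. g v x \<partial>count_space B) = 1" using h(5)[OF x] hpos[OF x] by (simp add: g_def)
    have "(\<integral>v. g v x * exp (\<epsilon> * tau v) \<partial>count_space B) \<le> (\<integral>v. exp (6 * c) * exp (H v x - q0 * tau v) \<partial>count_space B)"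
      using gi[OF x] i0(1)[OF x] gt[OF _ x] by (intro integral_mono) auto
    also have "\<dots> \<le> exp (6 * c) * K1" using i0(2)[OF x] by simp
    finally show "(\<integral>v. g v x * exp (\<epsilon> * real (tau v)) \<partial>count_space B) \<le> exp (6 * c) * K1" .
  qed (use x0 br_X d_nonneg d_le1 d_sym d_contr \<theta> \<epsilon> gt(2) gi tau_ge1 in auto)
  obtain C' \<epsilon>0 where C': "0 < C'" "0 < \<epsilon>0" and key: "\<forall>(\<Psi> :: 'b \<Rightarrow> 'x \<Rightarrow> real) (N :: real). 0 \<le> N \<and> (\<forall>v\<in>B. \<forall>x\<in>X. \<bar>\<Psi> v x\<bar> \<le> N * tau v) \<and>
      (\<forall>v\<in>B. \<forall>x\<in>X. \<forall>y\<in>X. \<bar>\<Psi> v x - \<Psi> v y\<bar> \<le> N * D * d x y) \<longrightarrow>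
      (\<exists>\<kappa> u U. (\<forall>x\<in>X. \<bar>u x\<bar> \<le> U) \<and> (\<forall>s x. \<bar>s\<bar> * N \<le> \<epsilon>0 \<and> x \<in> X \<longrightarrow>
         integrable (count_space B) (\<lambda>v. g v x * exp (s * \<Psi> v x - (s * \<kappa> + C' * N\<^sup>2 * s\<^sup>2) * tau v + s * u (br v x))) \<and>
         (\<integral>v. g v x * exp (s * \<Psi> v x - (s * \<kappa> + C' * N\<^sup>2 * s\<^sup>2) * tau v + s * u (br v x)) \<partial>count_space B)
            \<le> exp (s * u x)))"
    using rk.perturbed_subeigenfunction[OF D] by (elim exE conjE)
  show ?thesis
  proof (rule exI[of _ C'], rule conjI[OF C'(1)], rule exI[of _ \<epsilon>0], rule conjI[OF C'(2)], intro allI impI)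
    fix \<Psi> :: "'b \<Rightarrow> 'x \<Rightarrow> real" and N :: real
    assume hyp: "0 \<le> N \<and> (\<forall>v\<in>B. \<forall>x\<in>X. \<bar>\<Psi> v x\<bar> \<le> N * tau v) \<and>
      (\<forall>v\<in>B. \<forall>x\<in>X. \<forall>y\<in>X. \<bar>\<Psi> v x - \<Psi> v y\<bar> \<le> N * D * d x y)"
    from key[THEN spec, THEN spec, THEN mp, OF hyp] obtain \<kappa> u U where u: "\<And>x. x \<in> X \<Longrightarrow> \<bar>u x\<bar> \<le> U" and
      i: "\<And>s x. \<bar>s\<bar> * N \<le> \<epsilon>0 \<Longrightarrow> x \<in> X \<Longrightarrow> integrable (count_space B) (\<lambda>v. g v x * exp (s * \<Psi> v x - (s * \<kappa> + C' * N\<^sup>2 * s\<^sup>2) * tau v + s * u (br v x)))" and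
      le: "\<And>s x. \<bar>s\<bar> * N \<le> \<epsilon>0 \<Longrightarrow> x \<in> X \<Longrightarrow> (\<integral>v. g v x * exp (s * \<Psi> v x - (s * \<kappa> + C' * N\<^sup>2 * s\<^sup>2) * tau v + s * u (br v x)) \<partial>count_space B)
            \<le> exp (s * u x)" by blast
    show "\<exists>\<kappa>. \<forall>s Y. \<bar>s\<bar> * N \<le> \<epsilon>0 \<and> (\<forall>x\<in>X. Y 0 x = 1) \<and>
         (\<forall>x\<in>X. \<forall>n>0. Y n x = (\<integral>\<^sup>+v. (if tau v \<le> n then ennreal (exp (H v x + s * \<Psi> v x)) * Y (n - tau v) (br v x) else 0) \<partial>count_space B)) \<longrightarrow>
         (\<exists>K>0. \<forall>n. \<forall>x\<in>X. Y n x \<le> ennreal (K * exp (real n * (P + s * \<kappa> + C' * N\<^sup>2 * s\<^sup>2))))"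
    proof (rule exI[of _ \<kappa>], intro allI impI, elim conjE)
      fix s and Y :: "nat \<Rightarrow> 'x \<Rightarrow> ennreal"
      assume s: "\<bar>s\<bar> * N \<le> \<epsilon>0" and Y0: "\<forall>x\<in>X. Y 0 x = 1" and
        Yrec: "\<forall>x\<in>X. \<forall>n>0. Y n x = (\<integral>\<^sup>+v. (if tau v \<le> n then ennreal (exp (H v x + s * \<Psi> v x)) * Y (n - tau v) (br v x) else 0) \<partial>count_space B)"
      define Q where "Q = P + s * \<kappa> + C' * N\<^sup>2 * s\<^sup>2"
      \<comment> \<open>The subeigenfunction for the unnormalised operator: undoing the conjugation
        multiplies by \<open>h\<close>. Its bounds depend on \<open>s\<close> and \<open>U\<close>,
        which only affects the factor \<open>K\<close> and not the growth rate.\<close>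
      define hs where "hs = (\<lambda>x. h x * exp (s * u x))"
      have su: "\<bar>s * u x\<bar> \<le> \<bar>s\<bar> * U" if "x \<in> X" for x using u[OF that] by (simp add: abs_mult mult_left_mono)
      have hs_lo: "exp (- 4 * c) * exp (- (\<bar>s\<bar> * U)) \<le> hs x" if "x \<in> X" for x
        unfolding hs_def using h(1)[OF that] su[OF that] hpos[OF that] by (intro mult_mono) (auto simp: abs_le_iff)
      have hs_hi: "hs x \<le> exp (2 * c) * exp (\<bar>s\<bar> * U)" if "x \<in> X" for x
        unfolding hs_def using h(2)[OF that] su[OF that] hpos[OF that] by (intro mult_mono) (auto simp: abs_le_iff)
      have hs_pos: "0 < hs x" if "x \<in> X" for x using hpos[OF that] by (simp add: hs_def)
      have sub: "(\<integral>\<^sup>+v. ennreal (exp (H v x + s * \<Psi> v x - Q * tau v)) * ennreal (hs (br v x)) \<partial>count_space B) \<le> ennreal (hs x)" if x: "x \<in> X" for x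
      proof -
        let ?f = "\<lambda>v. h x * (g v x * exp (s * \<Psi> v x - (s * \<kappa> + C' * N\<^sup>2 * s\<^sup>2) * tau v + s * u (br v x)))"
        have eq: "exp (H v x + s * \<Psi> v x - Q * tau v) * hs (br v x) = ?f v" for v
        proof -
          have "exp (H v x + s * \<Psi> v x - Q * tau v) * exp (s * u (br v x)) = exp (H v x - P * tau v) * exp (s * \<Psi> v x - (s * \<kappa> + C' * N\<^sup>2 * s\<^sup>2) * tau v + s * u (br v x))"
            by (simp add: Q_def algebra_simps flip: exp_add)
          then show ?thesis using hpos[OF x] by (simp add: hs_def g_def mult_ac)
        qed
        have nn: "0 \<le> ?f v" if "v \<in> B" for v
          using gt(2)[OF that x] hpos[OF x] by simp
        have "(\<integral>\<^sup>+v. ennreal (exp (H v x + s * \<Psi> v x - Q * tau v)) * ennreal (hs (br v x)) \<partial>count_space B) = (\<integral>\<^sup>+v. ennreal (?f v) \<partial>count_space B)"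
          using hs_pos br_X[OF _ x] by (intro nn_integral_cong) (auto simp: eq[symmetric] ennreal_mult less_imp_le)
        also have "\<dots> = ennreal (\<integral>v. ?f v \<partial>count_space B)"
          using i[OF s x] nn by (intro nn_integral_eq_integral) (auto intro!: AE_I2)
        also have "\<dots> \<le> ennreal (hs x)"
          using mult_left_mono[OF le[OF s x], of "h x"] hpos[OF x] by (intro ennreal_leI) (simp add: hs_def)
        finally show ?thesis .
      qed
      define a where "a = exp (- 4 * c) * exp (- (\<bar>s\<bar> * U))"
      have a: "0 < a" by (simp add: a_def)
      have Yle: "Y n x * ennreal (exp (- Q * real n)) \<le> ennreal (1 / a) * ennreal (hs x)" if "x \<in> X" for n x
        using that
      proof (induction n arbitrary: x rule: less_induct)
        case (less n)
        show ?case
        proof (cases "n = 0")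
          case True
          have "a \<le> hs x" using hs_lo[OF less.prems] by (simp only: a_def)
          then have "1 \<le> 1 / a * hs x" using a by simp
          then have "ennreal 1 \<le> ennreal (1 / a * hs x)" by (rule ennreal_leI)
          then show ?thesis using True Y0 less.prems a hs_pos[OF less.prems] by (simp add: ennreal_mult'[symmetric])
        next
          case False
          have "Y n x * ennreal (exp (- Q * real n)) = (\<integral>\<^sup>+v. (if tau v \<le> n then ennreal (exp (H v x + s * \<Psi> v x)) * Y (n - tau v) (br v x) else 0) * ennreal (exp (- Q * real n)) \<partial>count_space B)"
            using Yrec less.prems False by (simp add: nn_integral_multc)
          also have "\<dots> \<le> (\<integral>\<^sup>+v. ennreal (1 / a) * (ennreal (exp (H v x + s * \<Psi> v x - Q * tau v)) * ennreal (hs (br v x))) \<partial>count_space B)"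
          proof (rule nn_integral_mono)
            fix v assume "v \<in> space (count_space B)"
            then have v: "v \<in> B" by simp
            show "(if tau v \<le> n then ennreal (exp (H v x + s * \<Psi> v x)) * Y (n - tau v) (br v x) else 0) * ennreal (exp (- Q * real n))
              \<le> ennreal (1 / a) * (ennreal (exp (H v x + s * \<Psi> v x - Q * tau v)) * ennreal (hs (br v x)))"
            proof (cases "tau v \<le> n")
              case True
              have lt: "n - tau v < n" using tau_ge1[OF v] False by simp
              have "ennreal (exp (H v x + s * \<Psi> v x)) * ennreal (exp (- Q * real n)) = ennreal (exp (H v x + s * \<Psi> v x - Q * tau v)) * ennreal (exp (- Q * real (n - tau v)))"
                unfolding ennreal_exp_mult using True by (simp add: of_nat_diff algebra_simps)
              then have "ennreal (exp (H v x + s * \<Psi> v x)) * Y (n - tau v) (br v x) * ennreal (exp (- Q * real n))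
                = ennreal (exp (H v x + s * \<Psi> v x - Q * tau v)) * (Y (n - tau v) (br v x) * ennreal (exp (- Q * real (n - tau v))))"
                by (metis mult.assoc mult.commute)
              also have "\<dots> \<le> ennreal (exp (H v x + s * \<Psi> v x - Q * tau v)) * (ennreal (1 / a) * ennreal (hs (br v x)))"
                by (rule mult_left_mono[OF less.IH[OF lt br_X[OF v less.prems]]]) simp
              finally show ?thesis using True by (simp add: mult_ac)
            qed simp
          qed
          also have "\<dots> = ennreal (1 / a) * (\<integral>\<^sup>+v. ennreal (exp (H v x + s * \<Psi> v x - Q * tau v)) * ennreal (hs (br v x)) \<partial>count_space B)"
            by (simp add: nn_integral_cmult)
          also have "\<dots> \<le> ennreal (1 / a) * ennreal (hs x)" using sub[OF less.prems] by (rule mult_left_mono) simp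
          finally show ?thesis .
        qed
      qed
      define K where "K = 1 / a * (exp (2 * c) * exp (\<bar>s\<bar> * U))"
      have K: "0 < K" using a by (simp add: K_def)
      have "Y n x \<le> ennreal (K * exp (real n * Q))" if x: "x \<in> X" for n x
      proof -
        have "Y n x = Y n x * (ennreal (exp (- Q * real n)) * ennreal (exp (real n * Q)))" by (simp add: ennreal_exp_mult)
        also have "\<dots> = (Y n x * ennreal (exp (- Q * real n))) * ennreal (exp (real n * Q))" by (simp add: mult.assoc)
        also have "\<dots> \<le> (ennreal (1 / a) * ennreal (hs x)) * ennreal (exp (real n * Q))" using Yle[OF x] by (rule mult_right_mono) simp
        also have "\<dots> \<le> ennreal K * ennreal (exp (real n * Q))"
          using hs_hi[OF x] a hs_pos[OF x] by (intro mult_right_mono) (auto simp: K_def ennreal_mult'[symmetric] divide_right_mono)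
        finally show ?thesis using K by (simp add: ennreal_mult)
      qed
      then show "\<exists>K>0. \<forall>n. \<forall>x\<in>X. Y n x \<le> ennreal (K * exp (real n * (P + s * \<kappa> + C' * N\<^sup>2 * s\<^sup>2)))"
        using K unfolding Q_def by blast
    qed
  qed
qed

end

section \<open>Words, paths and partition functions\<close>

declare build_cons [simp del]

lemma shift_funpow: "(shift ^^ k) x = suffix k x"
  by (induction k) (auto simp: shift_def)

lemma birkhoff_suffix: "birkhoff f n x = (\<Sum>k<n. f (suffix k x))"
  by (simp add: birkhoff_def shift_funpow)

lemma birkhoff_add: "birkhoff f (m + n) x = birkhoff f m x + birkhoff f n (suffix m x)"
proof (induction n)
  case (Suc n)
  then show ?case by (simp add: birkhoff_suffix suffix_def add.assoc)
qed (simp add: birkhoff_suffix)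

lemma birkhoff_lin: "birkhoff (\<lambda>x. f x + s * g x) n x = birkhoff f n x + s * birkhoff g n x"
  by (simp add: birkhoff_def sum.distrib sum_distrib_left)

lemma tms_edge: "x \<in> tms S E \<Longrightarrow> edge S E (x i) (x (Suc i))"
  by (simp add: tms_def)

lemma tms_in: "x \<in> tms S E \<Longrightarrow> x i \<in> S"
  using tms_edge[of x S E i] by (simp add: edge_def)

lemma tms_suffix: "x \<in> tms S E \<Longrightarrow> suffix k x \<in> tms S E"
  by (simp add: tms_def)

lemma conc_tms:
  assumes "x \<in> tms S E"
  shows "c \<frown> x \<in> tms S E \<longleftrightarrow> successively (edge S E) (c @ [x 0])"
proof
  assume a: "c \<frown> x \<in> tms S E"
  show "successively (edge S E) (c @ [x 0])"
    unfolding successively_conv_nth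
  proof (intro allI impI)
    fix i assume "Suc i < length (c @ [x 0])"
    then show "edge S E ((c @ [x 0]) ! i) ((c @ [x 0]) ! Suc i)"
      using tms_edge[OF a, of i] by (auto simp: nth_append conc_def split: if_splits)
  qed
next
  assume s: "successively (edge S E) (c @ [x 0])"
  show "c \<frown> x \<in> tms S E"
    unfolding tms_def
  proof (intro CollectI allI)
    fix i
    show "edge S E ((c \<frown> x) i) ((c \<frown> x) (Suc i))"
    proof (cases "i < length c")
      case True
      then show ?thesis using successively_nth[OF s, of i] by (auto simp: nth_append conc_def split: if_splits)
    next
      case False
      then show ?thesis using tms_edge[OF assms, of "i - length c"] by (simp add: Suc_diff_le)
    qed
  qed
qed

text \<open>The final vertex \<open>b\<close> is left out of the word. Composition of paths is then
  plain list append, and a path can be put in front of any point starting at \<open>b\<close>; a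
  loop of length \<open>n\<close> is a word of length \<open>n\<close>.\<close>

definition paths :: "'v set \<Rightarrow> ('v \<Rightarrow> 'v \<Rightarrow> bool) \<Rightarrow> 'v \<Rightarrow> 'v \<Rightarrow> nat \<Rightarrow> 'v list set" where
  "paths S E a b n = {c. length c = n \<and> hd (c @ [b]) = a \<and> successively (edge S E) (c @ [b])}"

lemma paths_length: "c \<in> paths S E a b n \<Longrightarrow> length c = n"
  by (simp add: paths_def)

lemma paths_set: "c \<in> paths S E a b n \<Longrightarrow> set c \<subseteq> S"
  unfolding paths_def
proof (intro subsetI, elim CollectE conjE)
  fix v assume "v \<in> set c" and s: "successively (edge S E) (c @ [b])"
  then obtain i where "i < length c" "c ! i = v" by (auto simp: in_set_conv_nth)
  then show "v \<in> S" using successively_nth[OF s, of i] by (auto simp: edge_def nth_append)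
qed

lemma countable_paths: "countable S \<Longrightarrow> countable (paths S E a b n)"
  by (rule countable_subset[of _ "lists S"]) (auto dest: paths_set)

lemma paths_append:
  assumes "c \<in> paths S E a b n" "c' \<in> paths S E b e m"
  shows "c @ c' \<in> paths S E a e (n + m)"
proof (cases "c = []")
  case True then show ?thesis using assms by (auto simp: paths_def)
next
  case False
  show ?thesis
  proof (cases "c' = []")
    case True then show ?thesis using assms by (auto simp: paths_def)
  next
    case c': False
    show ?thesis using assms False c' by (auto simp: paths_def successively_append_iff)
  qed
qed

lemma paths_split:
  assumes "c @ c' \<in> paths S E a e n"
  shows "c \<in> paths S E a (hd (c' @ [e])) (length c)" "c' \<in> paths S E (hd (c' @ [e])) e (length c')"
  using assms by (cases "c' = []"; auto simp: paths_def successively_append_iff hd_append)+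

lemma paths_conc:
  assumes "c \<in> paths S E a b n" "x \<in> tms S E" "x 0 = b"
  shows "c \<frown> x \<in> tms S E" "(c \<frown> x) 0 = a"
  using assms conc_tms[OF assms(2), of c] by (auto simp: paths_def conc_def hd_append hd_conv_nth)

lemma conc_paths:
  assumes "c \<frown> x \<in> tms S E"
  shows "c \<in> paths S E ((c \<frown> x) 0) (x 0) (length c)"
proof -
  have "x \<in> tms S E" using tms_suffix[OF assms, of "length c"] by simp
  then show ?thesis using conc_tms[of x S E c] assms by (auto simp: paths_def conc_def hd_append hd_conv_nth)
qed

lemma prefix_paths: "x \<in> tms S E \<Longrightarrow> prefix n x \<in> paths S E (x 0) (x n) n"
  using conc_paths[of "prefix n x" "suffix n x" S E] by (simp flip: prefix_suffix)

lemma paths_relpowp: "b \<in> S \<Longrightarrow> (edge S E ^^ n) a b \<longleftrightarrow> paths S E a b n \<noteq> {}"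
proof (induction n arbitrary: a)
  case 0
  show ?case by (auto simp: paths_def)
next
  case (Suc n)
  show ?case
  proof
    assume "(edge S E ^^ Suc n) a b"
    then obtain z where z: "edge S E a z" "(edge S E ^^ n) z b" by (metis relpowp_Suc_D2)
    then obtain c where "c \<in> paths S E z b n" using Suc by blast
    moreover have "[a] \<in> paths S E a z 1" using z by (simp add: paths_def)
    ultimately have "[a] @ c \<in> paths S E a b (1 + n)" by (intro paths_append)
    then show "paths S E a b (Suc n) \<noteq> {}" by auto
  next
    assume "paths S E a b (Suc n) \<noteq> {}"
    then obtain c where c: "c \<in> paths S E a b (Suc n)" by blast
    then obtain v c' where cc: "c = v # c'" by (cases c) (auto simp: paths_def)
    then have [simp]: "v = a" using c by (simp add: paths_def)
    from paths_split[of "[v]" c' S E a b "Suc n"] c cc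
    have "[a] \<in> paths S E a (hd (c' @ [b])) 1" "c' \<in> paths S E (hd (c' @ [b])) b n" by (auto simp: paths_def)
    then have "edge S E a (hd (c' @ [b]))" "(edge S E ^^ n) (hd (c' @ [b])) b"
      using Suc by (auto simp: paths_def)
    then show "(edge S E ^^ Suc n) a b" by (rule relpowp_Suc_I2)
  qed
qed

lemma iter_tms:
  assumes "c \<in> paths S E a a n" "0 < n"
  shows "c\<^sup>\<omega> \<in> tms S E" "(c\<^sup>\<omega>) 0 = a" "c \<frown> c\<^sup>\<omega> = c\<^sup>\<omega>"
proof -
  have l: "length c = n" "c \<noteq> []" using assms by (auto simp: paths_def)
  show 3: "c \<frown> c\<^sup>\<omega> = c\<^sup>\<omega>" using iter_unroll[of c] l by (metis length_greater_0_conv)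
  show "(c\<^sup>\<omega>) 0 = a" using assms l by (auto simp: paths_def hd_append hd_conv_nth)
  then have a: "(c\<^sup>\<omega>) 0 = a" .
  have s: "successively (edge S E) (c @ [a])" using assms by (simp add: paths_def)
  show "c\<^sup>\<omega> \<in> tms S E" unfolding tms_def
  proof (intro CollectI allI)
    fix i
    let ?j = "i mod n"
    have j: "?j < n" using assms by simp
    have "(c\<^sup>\<omega>) i = (c @ [a]) ! ?j" using l j by (simp add: nth_append)
    moreover have "(c\<^sup>\<omega>) (Suc i) = (c @ [a]) ! Suc ?j"
    proof (cases "Suc ?j < n")
      case True then show ?thesis using l by (simp add: nth_append mod_Suc)
    next
      case False
      then have "Suc ?j = n" using j by simp
      then show ?thesis using l a by (simp add: nth_append mod_Suc hd_conv_nth)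
    qed
    ultimately show "edge S E ((c\<^sup>\<omega>) i) ((c\<^sup>\<omega>) (Suc i))"
      using successively_nth[OF s, of ?j] j l by simp
  qed
qed

lemma periodic_paths_bij:
  assumes "0 < n"
  shows "bij_betw iter (paths S E a a n) {x \<in> tms S E. (shift ^^ n) x = x \<and> x 0 = a}"
proof (rule bij_betw_byWitness[where f' = "prefix n"])
  show "\<forall>c\<in>paths S E a a n. prefix n (c\<^sup>\<omega>) = c"
  proof
    fix c assume c: "c \<in> paths S E a a n"
    have "prefix n (c \<frown> c\<^sup>\<omega>) = c" using prefix_conc_length[of c "c\<^sup>\<omega>"] paths_length[OF c] by simp
    then show "prefix n (c\<^sup>\<omega>) = c" by (simp only: iter_tms(3)[OF c assms])
  qed
  show "\<forall>x\<in>{x \<in> tms S E. (shift ^^ n) x = x \<and> x 0 = a}. (prefix n x)\<^sup>\<omega> = x"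
  proof
    fix x assume "x \<in> {x \<in> tms S E. (shift ^^ n) x = x \<and> x 0 = a}"
    then have "suffix n x = x" by (simp add: shift_funpow)
    then have per: "x (n + i) = x i" for i by (metis suffix_nth)
    have perk: "x (k * n + i) = x i" for k i
    proof (induction k)
      case (Suc k)
      have "x (Suc k * n + i) = x (n + (k * n + i))" by (simp add: add.assoc)
      then show ?case using per[of "k * n + i"] Suc by simp
    qed simp
    show "(prefix n x)\<^sup>\<omega> = x"
    proof
      fix i
      have "((prefix n x)\<^sup>\<omega>) i = x (i mod n)" using assms by simp
      also have "\<dots> = x i" using perk[of "i div n" "i mod n"] by simp
      finally show "((prefix n x)\<^sup>\<omega>) i = x i" .
    qed
  qed
  show "iter ` paths S E a a n \<subseteq> {x \<in> tms S E. (shift ^^ n) x = x \<and> x 0 = a}"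
  proof (rule image_subsetI)
    fix c assume c: "c \<in> paths S E a a n"
    have "suffix n (c \<frown> c\<^sup>\<omega>) = c\<^sup>\<omega>" using suffix_conc_length[of c "c\<^sup>\<omega>"] paths_length[OF c] by simp
    then have "suffix n (c\<^sup>\<omega>) = c\<^sup>\<omega>" by (simp only: iter_tms(3)[OF c assms])
    then show "c\<^sup>\<omega> \<in> {x \<in> tms S E. (shift ^^ n) x = x \<and> x 0 = a}"
      using iter_tms(1,2)[OF c assms] by (simp add: shift_funpow)
  qed
  show "prefix n ` {x \<in> tms S E. (shift ^^ n) x = x \<and> x 0 = a} \<subseteq> paths S E a a n"
  proof (rule image_subsetI)
    fix x assume x: "x \<in> {x \<in> tms S E. (shift ^^ n) x = x \<and> x 0 = a}"
    then have "x n = x 0" by (metis (mono_tags, lifting) add.right_neutral mem_Collect_eq shift_funpow suffix_nth)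
    then show "prefix n x \<in> paths S E a a n" using prefix_paths[of x S E n] x by simp
  qed
qed

text \<open>Turns the sums over periodic points into integrals over counting measure, so that Fubini
  and the monotone and dominated limit theorems apply.\<close>

lemma infsum_ennreal_nn_integral:
  fixes f :: "'a \<Rightarrow> ennreal"
  assumes "countable A"
  shows "infsum f A = (\<integral>\<^sup>+x. f x \<partial>count_space A)"
proof (rule antisym)
  have le: "sum f F \<le> (\<integral>\<^sup>+x. f x \<partial>count_space A)" if "finite F" "F \<subseteq> A" for F
  proof -
    have "sum f F = (\<integral>\<^sup>+x. f x * indicator F x \<partial>count_space A)"
      using that by (subst nn_integral_count_space'[of F]) (auto simp: indicator_def)
    also have "\<dots> \<le> (\<integral>\<^sup>+x. f x \<partial>count_space A)"
      by (intro nn_integral_mono) (auto simp: indicator_def)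
    finally show ?thesis .
  qed
  have eq: "infsum f A = (SUP F\<in>{F. finite F \<and> F \<subseteq> A}. sum f F)"
    by (rule nonneg_infsum_complete) simp
  show "infsum f A \<le> (\<integral>\<^sup>+x. f x \<partial>count_space A)"
    unfolding eq using le by (intro SUP_least) auto
  show "(\<integral>\<^sup>+x. f x \<partial>count_space A) \<le> infsum f A"
  proof (cases "A = {}")
    case False
    define F where "F = (\<lambda>n::nat. from_nat_into A ` {..<n})"
    have F: "finite (F n)" "F n \<subseteq> A" for n using from_nat_into[OF False] by (auto simp: F_def)
    have "(\<integral>\<^sup>+x. f x \<partial>count_space A) = (\<integral>\<^sup>+x. (SUP n. f x * indicator (F n) x) \<partial>count_space A)"
    proof (rule nn_integral_cong)
      fix x assume "x \<in> space (count_space A)"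
      then obtain k where "x = from_nat_into A k" using assms by (metis from_nat_into_surj space_count_space)
      then have "x \<in> F (Suc k)" by (auto simp: F_def)
      then have "f x \<le> (SUP n. f x * indicator (F n) x)"
        by (intro SUP_upper2[of "Suc k"]) auto
      moreover have "(SUP n. f x * indicator (F n) x) \<le> f x" by (intro SUP_least) (auto simp: indicator_def)
      ultimately show "f x = (SUP n. f x * indicator (F n) x)" by (rule antisym)
    qed
    also have "\<dots> = (SUP n. \<integral>\<^sup>+x. f x * indicator (F n) x \<partial>count_space A)"
      by (rule nn_integral_monotone_convergence_SUP) (auto simp: incseq_def le_fun_def F_def indicator_def)
    also have "\<dots> \<le> infsum f A"
    proof (rule SUP_least)
      fix n
      have "(\<integral>\<^sup>+x. f x * indicator (F n) x \<partial>count_space A) = sum f (F n)"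
        using F by (subst nn_integral_count_space'[of "F n"]) (auto simp: indicator_def)
      then show "(\<integral>\<^sup>+x. f x * indicator (F n) x \<partial>count_space A) \<le> infsum f A"
        unfolding eq using F[of n] by (intro SUP_upper2[of "F n"]) auto
    qed
    finally show ?thesis .
  qed (simp add: nn_integral_empty)
qed

lemma Zn_paths:
  assumes "countable S" "0 < n"
  shows "Zn S E f n a = (\<integral>\<^sup>+c. ennreal (exp (birkhoff f n (c\<^sup>\<omega>))) \<partial>count_space (paths S E a a n))"
  unfolding Zn_def
  by (subst infsum_reindex_bij_betw[OF periodic_paths_bij[OF assms(2)], symmetric])
    (rule infsum_ennreal_nn_integral[OF countable_paths[OF assms(1)]])

text \<open>The word starts with \<open>a\<close> and its closing \<open>a\<close> is omitted, so
  the absence of an earlier return is a condition on the tail alone.\<close>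

definition first_returns :: "'v set \<Rightarrow> ('v \<Rightarrow> 'v \<Rightarrow> bool) \<Rightarrow> 'v \<Rightarrow> 'v list set" where
  "first_returns S E a = {v. v \<noteq> [] \<and> v \<in> paths S E a a (length v) \<and> a \<notin> set (tl v)}"

lemma bij_betw_subset_Collect:
  assumes "bij_betw f A B" "\<And>x. x \<in> A \<Longrightarrow> Q (f x) \<longleftrightarrow> P x"
  shows "bij_betw f {x \<in> A. P x} {y \<in> B. Q y}"
  using assms unfolding bij_betw_def by (auto intro: inj_on_subset)

lemma Zstar_paths:
  assumes "countable S" "0 < n"
  shows "Zstar S E f n a = (\<integral>\<^sup>+c. ennreal (exp (birkhoff f n (c\<^sup>\<omega>))) \<partial>count_space {c \<in> first_returns S E a. length c = n})"
proof -
  have tau: "tau a (c\<^sup>\<omega>) = n \<longleftrightarrow> a \<notin> set (tl c)" if c: "c \<in> paths S E a a n" for c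
  proof -
    note it = iter_tms[OF c assms(2)]
    have l: "length c = n" by (rule paths_length[OF c])
    have nth: "(c\<^sup>\<omega>) k = c ! k" if "k < n" for k using that l assms by simp
    have n: "0 < n \<and> (c\<^sup>\<omega>) n = a" using it(2) l assms by simp
    have set: "a \<in> set (tl c) \<longleftrightarrow> (\<exists>k. 0 < k \<and> k < n \<and> c ! k = a)"
    proof
      assume "a \<in> set (tl c)"
      then obtain j where "j < length (tl c)" "tl c ! j = a" by (auto simp: in_set_conv_nth)
      then show "\<exists>k. 0 < k \<and> k < n \<and> c ! k = a" using l by (intro exI[of _ "Suc j"]) (auto simp: nth_tl)
    next
      assume "\<exists>k. 0 < k \<and> k < n \<and> c ! k = a"
      then obtain k where k: "0 < k" "k < n" "c ! k = a" by blast
      then have "tl c ! (k - 1) = a" "k - 1 < length (tl c)" using l by (auto simp: nth_tl)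
      then show "a \<in> set (tl c)" by (metis nth_mem)
    qed
    have "tau a (c\<^sup>\<omega>) = (LEAST k. k > 0 \<and> (c\<^sup>\<omega>) k = a)" using it(2) by (simp add: tau_def)
    also have "\<dots> = n \<longleftrightarrow> \<not> (\<exists>k. 0 < k \<and> k < n \<and> c ! k = a)"
    proof
      assume L: "(LEAST k. k > 0 \<and> (c\<^sup>\<omega>) k = a) = n"
      show "\<not> (\<exists>k. 0 < k \<and> k < n \<and> c ! k = a)"
        using not_less_Least[of _ "\<lambda>k. k > 0 \<and> (c\<^sup>\<omega>) k = a"] L nth by metis
    next
      assume no: "\<not> (\<exists>k. 0 < k \<and> k < n \<and> c ! k = a)"
      show "(LEAST k. k > 0 \<and> (c\<^sup>\<omega>) k = a) = n"
      proof (rule Least_equality)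
        fix k assume "0 < k \<and> (c\<^sup>\<omega>) k = a"
        then show "n \<le> k" using nth no by (metis not_less)
      qed (rule n)
    qed
    finally show ?thesis using set by simp
  qed
  have "bij_betw iter {c \<in> paths S E a a n. a \<notin> set (tl c)} {x \<in> {x \<in> tms S E. (shift ^^ n) x = x \<and> x 0 = a}. tau a x = n}"
  proof (rule bij_betw_subset_Collect)
    show "bij_betw iter (paths S E a a n) {x \<in> tms S E. (shift ^^ n) x = x \<and> x 0 = a}"
      by (rule periodic_paths_bij[OF assms(2)])
  qed (rule tau)
  moreover have "{c \<in> paths S E a a n. a \<notin> set (tl c)} = {c \<in> first_returns S E a. length c = n}"
    using assms(2) by (auto simp: first_returns_def dest: paths_length)
  moreover have "{x \<in> {x \<in> tms S E. (shift ^^ n) x = x \<and> x 0 = a}. tau a x = n} = {x \<in> tms S E. (shift ^^ n) x = x \<and> x 0 = a \<and> tau a x = n}" by auto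
  ultimately have bij: "bij_betw iter {c \<in> first_returns S E a. length c = n} {x \<in> tms S E. (shift ^^ n) x = x \<and> x 0 = a \<and> tau a x = n}" by simp
  have "countable {c \<in> first_returns S E a. length c = n}"
    by (rule countable_subset[OF _ countable_paths[OF assms(1), of E a a n]]) (auto simp: first_returns_def)
  then show ?thesis unfolding Zstar_def
    by (subst infsum_reindex_bij_betw[OF bij, symmetric]) (rule infsum_ennreal_nn_integral)
qed

text \<open>Weak Hoelder continuity with a named nonnegative constant, so that constants can be
  added, scaled and compared with the norm of \<open>\<psi>\<close>.\<close>

definition hoelder_const :: "'v set \<Rightarrow> ('v \<Rightarrow> 'v \<Rightarrow> bool) \<Rightarrow> real \<Rightarrow> real \<Rightarrow> ((nat \<Rightarrow> 'v) \<Rightarrow> real) \<Rightarrow> bool" where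
  "hoelder_const S E \<theta> A f \<longleftrightarrow> 0 \<le> A \<and> 0 < \<theta> \<and> \<theta> < 1 \<and> (\<forall>n\<ge>2. \<forall>x\<in>tms S E. \<forall>y\<in>tms S E.
     (\<forall>i<n. x i = y i) \<longrightarrow> \<bar>f x - f y\<bar> \<le> A * \<theta> ^ n)"

lemma weakly_hoelder_const: "weakly_hoelder S E \<theta> f \<longleftrightarrow> (\<exists>A. hoelder_const S E \<theta> A f)"
proof
  assume "weakly_hoelder S E \<theta> f"
  then obtain A where A: "0 < \<theta>" "\<theta> < 1" "\<And>n x y. n \<ge> 2 \<Longrightarrow> x \<in> tms S E \<Longrightarrow> y \<in> tms S E \<Longrightarrow> (\<forall>i<n. x i = y i) \<Longrightarrow> \<bar>f x - f y\<bar> \<le> A * \<theta> ^ n"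
    unfolding weakly_hoelder_def by blast
  have "\<bar>f x - f y\<bar> \<le> \<bar>A\<bar> * \<theta> ^ n" if "n \<ge> 2" "x \<in> tms S E" "y \<in> tms S E" "\<forall>i<n. x i = y i" for n x y
  proof -
    have "A * \<theta> ^ n \<le> \<bar>A\<bar> * \<theta> ^ n" using A(1) by (intro mult_right_mono) auto
    then show ?thesis using A(3)[OF that] by linarith
  qed
  then have "hoelder_const S E \<theta> \<bar>A\<bar> f" unfolding hoelder_const_def using A(1,2) by auto
  then show "\<exists>A. hoelder_const S E \<theta> A f" by blast
next
  assume "\<exists>A. hoelder_const S E \<theta> A f"
  then show "weakly_hoelder S E \<theta> f" unfolding hoelder_const_def weakly_hoelder_def by blast
qed

lemma hoelder_const_lin:
  assumes "hoelder_const S E \<theta> A f" "hoelder_const S E \<theta> A' g"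
  shows "hoelder_const S E \<theta> (A + \<bar>s\<bar> * A') (\<lambda>x. f x + s * g x)"
  unfolding hoelder_const_def
proof (intro conjI allI impI ballI)
  fix n x y assume a: "2 \<le> (n::nat)" "x \<in> tms S E" "y \<in> tms S E" "\<forall>i<n. x i = y i"
  have 1: "\<bar>f x - f y\<bar> \<le> A * \<theta> ^ n" and 2: "\<bar>g x - g y\<bar> \<le> A' * \<theta> ^ n"
    using assms a unfolding hoelder_const_def by blast+
  have "\<bar>(f x + s * g x) - (f y + s * g y)\<bar> \<le> \<bar>f x - f y\<bar> + \<bar>s * (g x - g y)\<bar>"
    by (simp add: right_diff_distrib)
  also have "\<dots> \<le> A * \<theta> ^ n + \<bar>s\<bar> * (A' * \<theta> ^ n)"
    using 1 2 by (auto simp: abs_mult intro!: add_mono mult_left_mono)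
  finally show "\<bar>(f x + s * g x) - (f y + s * g y)\<bar> \<le> (A + \<bar>s\<bar> * A') * \<theta> ^ n" by (simp add: algebra_simps)
qed (use assms in \<open>auto simp: hoelder_const_def\<close>)

text \<open>Agreement beyond the summed stretch by \<open>t \<ge> 1\<close> symbols leaves at least
  two common symbols even in the last summand, which is the least that weak Hoelder continuity can
  use. The errors form a geometric series, so the bound does not depend on \<open>n\<close>.\<close>

lemma birkhoff_distortion:
  assumes h: "hoelder_const S E \<theta> A f" and x: "x \<in> tms S E" and y: "y \<in> tms S E"
    and eq: "\<And>i. i < n + t \<Longrightarrow> x i = y i" and t: "1 \<le> t"
  shows "\<bar>birkhoff f n x - birkhoff f n y\<bar> \<le> A / (1 - \<theta>) * \<theta> ^ t"
proof -
  have A: "0 \<le> A" "0 < \<theta>" "\<theta> < 1" using h by (auto simp: hoelder_const_def)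
  have "\<bar>birkhoff f n x - birkhoff f n y\<bar> \<le> (\<Sum>k<n. \<bar>f (suffix k x) - f (suffix k y)\<bar>)"
    unfolding birkhoff_suffix sum_subtractf[symmetric] by (rule sum_abs)
  also have "\<dots> \<le> (\<Sum>k<n. A * \<theta> ^ t * \<theta> ^ (n - Suc k))"
  proof (rule sum_mono)
    fix k assume k: "k \<in> {..<n}"
    have "\<bar>f (suffix k x) - f (suffix k y)\<bar> \<le> A * \<theta> ^ (n - k + t)"
      using h[unfolded hoelder_const_def] tms_suffix[OF x] tms_suffix[OF y] eq k t by auto
    also have "n - k + t = t + Suc (n - Suc k)" using k by simp
    also have "A * \<theta> ^ (t + Suc (n - Suc k)) = A * \<theta> ^ t * (\<theta> * \<theta> ^ (n - Suc k))"
      by (simp add: power_add)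
    also have "\<dots> \<le> A * \<theta> ^ t * (1 * \<theta> ^ (n - Suc k))" using A by (intro mult_left_mono mult_right_mono) auto
    finally show "\<bar>f (suffix k x) - f (suffix k y)\<bar> \<le> A * \<theta> ^ t * \<theta> ^ (n - Suc k)" by (simp add: suffix_def)
  qed
  also have "\<dots> = A * \<theta> ^ t * (\<Sum>k<n. \<theta> ^ k)"
    unfolding sum_distrib_left by (rule sum.nat_diff_reindex)
  also have "\<dots> \<le> A * \<theta> ^ t * (1 / (1 - \<theta>))"
  proof (rule mult_left_mono)
    show "(\<Sum>k<n. \<theta> ^ k) \<le> 1 / (1 - \<theta>)" using A by (simp add: sum_gp_strict divide_right_mono)
  qed (use A in auto)
  finally show ?thesis by (simp add: algebra_simps)
qed

section \<open>Inducing on first returns\<close>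

text \<open>The case \<open>x = y\<close> is separate because \<open>agree_time\<close> is then the
  least element of an empty set and carries no information.\<close>

definition cyl_dist :: "real \<Rightarrow> (nat \<Rightarrow> 'v) \<Rightarrow> (nat \<Rightarrow> 'v) \<Rightarrow> real" where
  "cyl_dist \<theta> x y = (if x = y then 0 else \<theta> ^ agree_time x y)"

lemma agree_time_less: "i < agree_time x y \<Longrightarrow> x i = y i"
  unfolding agree_time_def using not_less_Least by blast

lemma agree_time_neq: "x \<noteq> y \<Longrightarrow> x (agree_time x y) \<noteq> y (agree_time x y)"
  unfolding agree_time_def by (rule LeastI_ex) auto

lemma agree_time_ge: "x \<noteq> y \<Longrightarrow> (\<And>i. i < n \<Longrightarrow> x i = y i) \<Longrightarrow> n \<le> agree_time x y"
  using agree_time_neq by (metis not_less)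

lemma agree_time_conc: "x \<noteq> y \<Longrightarrow> agree_time (v \<frown> x) (v \<frown> y) = length v + agree_time x y"
  unfolding agree_time_def[of "v \<frown> x"]
proof (rule Least_equality)
  assume "x \<noteq> y"
  then show "(v \<frown> x) (length v + agree_time x y) \<noteq> (v \<frown> y) (length v + agree_time x y)"
    using agree_time_neq by simp
  fix k assume k: "(v \<frown> x) k \<noteq> (v \<frown> y) k"
  show "length v + agree_time x y \<le> k"
  proof (rule ccontr)
    assume "\<not> length v + agree_time x y \<le> k"
    then have "k < length v \<or> k - length v < agree_time x y" by linarith
    then show False using k agree_time_less[of "k - length v" x y] by (auto simp: conc_def split: if_splits)
  qed
qed

lemma cyl_dist_conc:
  assumes "0 < \<theta>" "\<theta> < 1" "v \<noteq> []"
  shows "cyl_dist \<theta> (v \<frown> x) (v \<frown> y) \<le> \<theta> * cyl_dist \<theta> x y"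
proof (cases "x = y")
  case False
  have "\<theta> ^ length v \<le> \<theta> ^ 1" using assms by (intro power_decreasing) (auto simp: Suc_le_eq)
  then show ?thesis using False assms by (simp add: cyl_dist_def agree_time_conc power_add mult_right_mono)
qed (simp add: cyl_dist_def)

lemma birkhoff_conc_dist:
  assumes h: "hoelder_const S E \<theta> A f" and x: "v \<frown> x \<in> tms S E" and y: "v \<frown> y \<in> tms S E" and 0: "x 0 = y 0"
  shows "\<bar>birkhoff f (length v) (v \<frown> x) - birkhoff f (length v) (v \<frown> y)\<bar> \<le> A / (1 - \<theta>) * cyl_dist \<theta> x y"
proof (cases "x = y")
  case False
  have "1 \<le> agree_time x y" using 0 agree_time_neq[OF False] by (metis One_nat_def Suc_leI neq0_conv)
  then have "\<bar>birkhoff f (length v) (v \<frown> x) - birkhoff f (length v) (v \<frown> y)\<bar> \<le> A / (1 - \<theta>) * \<theta> ^ agree_time x y"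
    using agree_time_less[of _ x y] by (intro birkhoff_distortion[OF h x y]) (auto simp: conc_def)
  then show ?thesis using False by (simp add: cyl_dist_def)
qed (simp add: cyl_dist_def)

lemma birkhoff_conc:
  "birkhoff f (length c + n) (c \<frown> x) = birkhoff f (length c) (c \<frown> x) + birkhoff f n x"
  by (simp add: birkhoff_add)

text \<open>For a point \<open>x\<close> starting at \<open>a\<close> this is the
  \<open>n\<close>-th power of the Ruelle operator of \<open>f\<close>, applied to the indicator of
  the cylinder of \<open>a\<close> and evaluated at \<open>x\<close>. Unlike the sum over periodic
  points it obeys an exact renewal equation.\<close>

definition loop_sum :: "'v set \<Rightarrow> ('v \<Rightarrow> 'v \<Rightarrow> bool) \<Rightarrow> ((nat \<Rightarrow> 'v) \<Rightarrow> real) \<Rightarrow> 'v \<Rightarrow> nat \<Rightarrow> (nat \<Rightarrow> 'v) \<Rightarrow> ennreal" where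
  "loop_sum S E f a n x = (\<integral>\<^sup>+c. ennreal (exp (birkhoff f n (c \<frown> x))) \<partial>count_space (paths S E a a n))"

text \<open>The cut is made at the last occurrence of \<open>a\<close> in the loop, not at the first
  return: the first-return word \<open>v\<close> then stands next to the base point and the
  remaining loop acts on \<open>v \<frown> x\<close>, as the renewal equation demands.\<close>

lemma last_return_bij:
  assumes "0 < n"
  shows "bij_betw (\<lambda>(v, c). c @ v) {(v, c). v \<in> first_returns S E a \<and> length v \<le> n \<and> c \<in> paths S E a a (n - length v)} (paths S E a a n)"
  unfolding bij_betw_def
proof
  let ?D = "{(v, c). v \<in> first_returns S E a \<and> length v \<le> n \<and> c \<in> paths S E a a (n - length v)}"
  show "inj_on (\<lambda>(v, c). c @ v) ?D"
  proof (rule inj_onI, clarify)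
    fix v c v' c'
    assume v: "v \<in> first_returns S E a" and v': "v' \<in> first_returns S E a" and eq: "c @ v = c' @ v'"
    have ends: "hd v = a" "v \<noteq> []" "a \<notin> set (tl v)" "hd v' = a" "v' \<noteq> []" "a \<notin> set (tl v')"
      using v v' by (auto simp: first_returns_def paths_def)
    from eq consider us where "c = c' @ us" "us @ v = v'" | us where "c @ us = c'" "v = us @ v'"
      by (auto simp: append_eq_append_conv2)
    then show "v = v' \<and> c = c'"
    proof cases
      case 1
      \<comment> \<open>Both words begin with \<open>a\<close>; if one properly extended the other
        to the left, the inner \<open>a\<close> would lie in its tail.\<close>
      have "us = []"
      proof (rule ccontr)
        assume "us \<noteq> []"
        then have "tl v' = tl us @ v" using 1 by auto
        then show False using ends by (metis hd_in_set in_set_conv_decomp Un_iff set_append)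
      qed
      then show ?thesis using 1 by simp
    next
      case 2
      have "us = []"
      proof (rule ccontr)
        assume "us \<noteq> []"
        then have "tl v = tl us @ v'" using 2 by auto
        then show False using ends by (metis hd_in_set in_set_conv_decomp Un_iff set_append)
      qed
      then show ?thesis using 2 by simp
    qed
  qed
  show "(\<lambda>(v, c). c @ v) ` ?D = paths S E a a n"
  proof (intro equalityI subsetI)
    fix w assume "w \<in> (\<lambda>(v, c). c @ v) ` ?D"
    then obtain v c where w: "w = c @ v" "v \<in> first_returns S E a" "length v \<le> n" "c \<in> paths S E a a (n - length v)" by auto
    then have "c @ v \<in> paths S E a a ((n - length v) + length v)"
      by (intro paths_append) (auto simp: first_returns_def)
    then show "w \<in> paths S E a a n" using w by simp
  next
    fix w assume w: "w \<in> paths S E a a n"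
    have l: "length w = n" by (rule paths_length[OF w])
    then have "a \<in> set w" using w assms by (cases w) (auto simp: paths_def)
    then obtain ys zs where yz: "w = ys @ a # zs" "a \<notin> set zs" by (metis split_list_last)
    define v where "v = a # zs"
    have w': "ys @ v \<in> paths S E a a n" using w yz by (simp add: v_def)
    have "ys \<in> paths S E a a (length ys)" "v \<in> paths S E a a (length v)"
      using paths_split[OF w'] by (auto simp: v_def)
    moreover have "length ys = n - length v" "length v \<le> n" using l yz by (auto simp: v_def)
    ultimately have "(v, ys) \<in> ?D" using yz by (auto simp: first_returns_def v_def)
    then show "w \<in> (\<lambda>(v, c). c @ v) ` ?D" using yz by (force simp: v_def)
  qed
qed

lemma loop_sum_renewal:
  assumes "0 < n"
  shows "loop_sum S E f a n x = (\<integral>\<^sup>+v. (if length v \<le> n then ennreal (exp (birkhoff f (length v) (v \<frown> x))) * loop_sum S E f a (n - length v) (v \<frown> x) else 0) \<partial>count_space (first_returns S E a))"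
proof -
  let ?B = "first_returns S E a"
  let ?D = "{(v, c). v \<in> ?B \<and> length v \<le> n \<and> c \<in> paths S E a a (n - length v)}"
  let ?w = "\<lambda>c. ennreal (exp (birkhoff f n (c \<frown> x)))"
  let ?h = "\<lambda>v c. ennreal (exp (birkhoff f (length v) (v \<frown> x))) * ennreal (exp (birkhoff f (n - length v) (c \<frown> (v \<frown> x))))"
  have "loop_sum S E f a n x = (\<integral>\<^sup>+p. ?w ((\<lambda>(v, c). c @ v) p) \<partial>count_space ?D)"
    unfolding loop_sum_def by (rule nn_integral_bij_count_space[OF last_return_bij[OF assms], symmetric])
  also have "\<dots> = (\<integral>\<^sup>+p. (case p of (v, c) \<Rightarrow> ?h v c) \<partial>count_space ?D)"
  proof (rule nn_integral_cong, clarsimp)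
    fix v c assume v: "v \<in> ?B" "length v \<le> n" "c \<in> paths S E a a (n - length v)"
    have "birkhoff f n ((c @ v) \<frown> x) = birkhoff f (length c + length v) (c \<frown> (v \<frown> x))"
      using v paths_length[OF v(3)] by simp
    also have "\<dots> = birkhoff f (n - length v) (c \<frown> (v \<frown> x)) + birkhoff f (length v) (v \<frown> x)"
      unfolding birkhoff_conc using paths_length[OF v(3)] by simp
    finally show "ennreal (exp (birkhoff f n ((c @ v) \<frown> x))) = ennreal (exp (birkhoff f (length v) (v \<frown> x))) * ennreal (exp (birkhoff f (n - length v) ((c @ v) \<frown> x)))"
      by (simp add: ennreal_exp_mult add.commute)
  qed
  also have "\<dots> = (\<integral>\<^sup>+p. (case p of (v, c) \<Rightarrow> ?h v c) * indicator ?D p \<partial>count_space UNIV)"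
    by (rule nn_integral_count_space_indicator) simp
  also have "\<dots> = (\<integral>\<^sup>+v. \<integral>\<^sup>+c. ?h v c * indicator ?D (v, c) \<partial>count_space UNIV \<partial>count_space UNIV)"
    by (subst nn_integral_fst_count_space[symmetric]) simp
  also have "\<dots> = (\<integral>\<^sup>+v. (if length v \<le> n then ennreal (exp (birkhoff f (length v) (v \<frown> x))) * loop_sum S E f a (n - length v) (v \<frown> x) else 0) * indicator ?B v \<partial>count_space UNIV)"
  proof (rule nn_integral_cong)
    fix v
    show "(\<integral>\<^sup>+c. ?h v c * indicator ?D (v, c) \<partial>count_space UNIV) = (if length v \<le> n then ennreal (exp (birkhoff f (length v) (v \<frown> x))) * loop_sum S E f a (n - length v) (v \<frown> x) else 0) * indicator ?B v"
    proof (cases "v \<in> ?B \<and> length v \<le> n")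
      case True
      have "(\<integral>\<^sup>+c. ?h v c * indicator ?D (v, c) \<partial>count_space UNIV) = (\<integral>\<^sup>+c. ?h v c * indicator (paths S E a a (n - length v)) c \<partial>count_space UNIV)"
        using True by (intro nn_integral_cong) (auto simp: indicator_def)
      also have "\<dots> = (\<integral>\<^sup>+c. ?h v c \<partial>count_space (paths S E a a (n - length v)))"
        by (rule nn_integral_count_space_indicator[symmetric]) simp
      finally show ?thesis using True by (simp add: nn_integral_cmult loop_sum_def)
    next
      case False
      then show ?thesis by (auto simp: indicator_def)
    qed
  qed
  also have "\<dots> = (\<integral>\<^sup>+v. (if length v \<le> n then ennreal (exp (birkhoff f (length v) (v \<frown> x))) * loop_sum S E f a (n - length v) (v \<frown> x) else 0) \<partial>count_space ?B)"
    by (rule nn_integral_count_space_indicator[symmetric]) simp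
  finally show ?thesis .
qed

lemma loop_sum_0: "loop_sum S E f a 0 x = 1"
proof -
  have "paths S E a a 0 = {[]}" by (auto simp: paths_def)
  then show ?thesis by (simp add: loop_sum_def birkhoff_def nn_integral_count_space_finite)
qed

text \<open>A loop is followed by \<open>x\<close> in one sum and by its own repetition in the
  other. Both continuations start with \<open>a\<close>, so the exponents differ by at most
  \<open>A / (1 - \<theta>)\<close>, whatever the length.\<close>

lemma loop_sum_Zn:
  assumes S: "countable S" and h: "hoelder_const S E \<theta> A f" and x: "x \<in> tms S E" "x 0 = a" and n: "0 < n"
  shows "loop_sum S E f a n x \<le> ennreal (exp (A / (1 - \<theta>))) * Zn S E f n a"
    "Zn S E f n a \<le> ennreal (exp (A / (1 - \<theta>))) * loop_sum S E f a n x"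
proof -
  have A: "0 \<le> A" "0 < \<theta>" "\<theta> < 1" using h by (auto simp: hoelder_const_def)
  have d: "\<bar>birkhoff f n (c \<frown> x) - birkhoff f n (c\<^sup>\<omega>)\<bar> \<le> A / (1 - \<theta>)" if c: "c \<in> paths S E a a n" for c
  proof -
    note it = iter_tms[OF c n]
    have "\<bar>birkhoff f (length c) (c \<frown> x) - birkhoff f (length c) (c \<frown> c\<^sup>\<omega>)\<bar> \<le> A / (1 - \<theta>) * cyl_dist \<theta> x (c\<^sup>\<omega>)"
      using paths_conc(1)[OF c x] it x by (intro birkhoff_conc_dist[OF h]) auto
    also have "\<dots> \<le> A / (1 - \<theta>) * 1"
      using A by (intro mult_left_mono) (auto simp: cyl_dist_def power_le_one)
    finally show ?thesis using it(3) paths_length[OF c] by simp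
  qed
  show "loop_sum S E f a n x \<le> ennreal (exp (A / (1 - \<theta>))) * Zn S E f n a"
    unfolding loop_sum_def Zn_paths[OF S n] 
    by (subst nn_integral_cmult[symmetric], simp, rule nn_integral_mono)
      (use d in \<open>force simp: ennreal_exp_mult abs_le_iff diff_le_eq add.commute\<close>)
  show "Zn S E f n a \<le> ennreal (exp (A / (1 - \<theta>))) * loop_sum S E f a n x"
    unfolding loop_sum_def Zn_paths[OF S n] 
    by (subst nn_integral_cmult[symmetric], simp, rule nn_integral_mono)
      (use d in \<open>force simp: ennreal_exp_mult abs_le_iff diff_le_eq add.commute\<close>)
qed

text \<open>Instance of the renewal estimate with first-return words as branches and Birkhoff sums
  along them as weights. Summing \<open>g\<close> over a return word keeps a distortion constant
  \<open>N / (1 - \<theta>)\<close> that does not grow with the length of the word, hence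
  \<open>D = 1 / (1 - \<theta>)\<close>.\<close>

theorem perturbed_loop_sums:
  fixes f :: "(nat \<Rightarrow> 'v) \<Rightarrow> real" and q0 P :: real
  assumes S: "countable S" and h: "hoelder_const S E \<theta> A f" and q0: "q0 < P"
    and x0: "x0 \<in> tms S E" "x0 0 = a"
    and fin: "(\<integral>\<^sup>+v. ennreal (exp (birkhoff f (length v) (v\<^sup>\<omega>) - q0 * length v)) \<partial>count_space (first_returns S E a)) < \<infinity>"
    and conv: "\<And>q. P < q \<Longrightarrow> (\<Sum>n. Zn S E f (Suc n) a * ennreal (exp (- q * real (Suc n)))) < \<infinity>"
    and div: "\<And>q. q0 \<le> q \<Longrightarrow> q < P \<Longrightarrow> (\<Sum>n. Zn S E f (Suc n) a * ennreal (exp (- q * real (Suc n)))) = \<infinity>"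
  shows "\<exists>C'>0. \<exists>\<epsilon>0>0. \<forall>g N. hoelder_const S E \<theta> N g \<and> (\<forall>x\<in>tms S E. \<bar>g x\<bar> \<le> N) \<longrightarrow>
     (\<exists>\<kappa>. \<forall>s. \<bar>s\<bar> * N \<le> \<epsilon>0 \<longrightarrow> (\<exists>K>0. \<forall>n. \<forall>x\<in>tms S E. x 0 = a \<longrightarrow>
        loop_sum S E (\<lambda>x. f x + s * g x) a n x \<le> ennreal (K * exp (real n * (P + s * \<kappa> + C' * N\<^sup>2 * s\<^sup>2)))))"
proof -
  define X where "X = {x \<in> tms S E. x 0 = a}"
  define B where "B = first_returns S E a"
  define C where "C = A / (1 - \<theta>)"
  define H where "H = (\<lambda>v x. birkhoff f (length v) (v \<frown> x))"
  have A: "0 \<le> A" "0 < \<theta>" "\<theta> < 1" using h by (auto simp: hoelder_const_def)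
  have C0: "0 \<le> C" using A by (simp add: C_def)
  have B: "v \<in> paths S E a a (length v)" "v \<noteq> []" if "v \<in> B" for v using that by (auto simp: B_def first_returns_def)
  have brX: "v \<frown> x \<in> X" if "v \<in> B" "x \<in> X" for v x
    using paths_conc[OF B(1)[OF that(1)], of x] that(2) by (simp add: X_def)
  have Hd: "\<bar>H v x - H v y\<bar> \<le> C * cyl_dist \<theta> x y" if "v \<in> B" "x \<in> X" "y \<in> X" for v x y
    unfolding H_def C_def using brX[OF that(1,2)] brX[OF that(1,3)] that by (intro birkhoff_conc_dist[OF h]) (auto simp: X_def)
  have d1: "0 \<le> cyl_dist \<theta> x y" "cyl_dist \<theta> x y \<le> 1" for x y :: "nat \<Rightarrow> 'v"
    using A by (auto simp: cyl_dist_def power_le_one)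
  have suminf_eq: "(\<Sum>n. loop_sum S E f a n x0 * ennreal (exp (- q * real n))) = 1 + (\<Sum>n. loop_sum S E f a (Suc n) x0 * ennreal (exp (- q * real (Suc n))))" for q
    using suminf_offset[of "\<lambda>n. loop_sum S E f a n x0 * ennreal (exp (- q * real n))" 1]
    by (simp add: loop_sum_0 add.commute)
  interpret renewal_system X B conc "cyl_dist \<theta>" H length "loop_sum S E f a" \<theta> C q0 P x0
  proof
    show "x0 \<in> X" using x0 by (simp add: X_def)
    show "cyl_dist \<theta> x y = cyl_dist \<theta> y x" for x y :: "nat \<Rightarrow> 'v"
      by (simp add: cyl_dist_def agree_time_def eq_commute)
    show "cyl_dist \<theta> (v \<frown> x) (v \<frown> y) \<le> \<theta> * cyl_dist \<theta> x y" if "v \<in> B" for v and x y :: "nat \<Rightarrow> 'v"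
      by (rule cyl_dist_conc[OF A(2,3) B(2)[OF that]])
    show "H v x \<le> C * cyl_dist \<theta> x y + H v y" if "v \<in> B" "x \<in> X" "y \<in> X" for v x y
      using Hd[OF that] by linarith
    show "1 \<le> length v" if "v \<in> B" for v using B(2)[OF that] by (simp add: Suc_le_eq)
    have "(\<integral>\<^sup>+v. ennreal (exp (H v x0 - q0 * length v)) \<partial>count_space B) \<le> (\<integral>\<^sup>+v. ennreal (exp C) * ennreal (exp (birkhoff f (length v) (v\<^sup>\<omega>) - q0 * length v)) \<partial>count_space B)"
    proof (rule nn_integral_mono)
      fix v assume "v \<in> space (count_space B)"
      then have v: "v \<in> B" by simp
      have l: "0 < length v" using B(2)[OF v] by simp
      note it = iter_tms[OF B(1)[OF v] l]
      have "v\<^sup>\<omega> \<in> X" using it by (simp add: X_def)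
      then have "\<bar>H v x0 - H v (v\<^sup>\<omega>)\<bar> \<le> C * cyl_dist \<theta> x0 (v\<^sup>\<omega>)"
        using x0 by (intro Hd[OF v]) (auto simp: X_def)
      also have "\<dots> \<le> C * 1" using C0 d1 by (intro mult_left_mono) auto
      finally have "H v x0 \<le> C + birkhoff f (length v) (v\<^sup>\<omega>)" using it(3) by (simp add: H_def)
      then show "ennreal (exp (H v x0 - q0 * length v)) \<le> ennreal (exp C) * ennreal (exp (birkhoff f (length v) (v\<^sup>\<omega>) - q0 * length v))"
        unfolding ennreal_exp_mult by (intro ennreal_leI) simp
    qed
    also have "\<dots> < \<infinity>" using fin by (simp add: nn_integral_cmult ennreal_mult_less_top B_def)
    finally show "(\<integral>\<^sup>+v. ennreal (exp (H v x0 - q0 * real (length v))) \<partial>count_space B) < \<infinity>" .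
    show "loop_sum S E f a n x = (\<integral>\<^sup>+v. (if length v \<le> n then ennreal (exp (H v x)) * loop_sum S E f a (n - length v) (v \<frown> x) else 0) \<partial>count_space B)" if "0 < n" for n x
      unfolding B_def H_def by (rule loop_sum_renewal[OF that])
  next
    fix q assume q: "P < q"
    have "(\<Sum>n. loop_sum S E f a (Suc n) x0 * ennreal (exp (- q * real (Suc n)))) \<le> (\<Sum>n. ennreal (exp C) * (Zn S E f (Suc n) a * ennreal (exp (- q * real (Suc n)))))"
      using loop_sum_Zn(1)[OF S h x0] unfolding mult.assoc[symmetric] C_def
      by (intro suminf_le mult_right_mono) auto
    also have "\<dots> < \<infinity>" using conv[OF q] by (simp add: ennreal_mult_less_top)
    finally show "(\<Sum>n. loop_sum S E f a n x0 * ennreal (exp (- q * real n))) < \<infinity>"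
      unfolding suminf_eq by simp
  next
    fix q assume q: "q0 \<le> q" "q < P"
    have "\<infinity> = (\<Sum>n. Zn S E f (Suc n) a * ennreal (exp (- q * real (Suc n))))" using div[OF q] by simp
    also have "\<dots> \<le> (\<Sum>n. ennreal (exp C) * (loop_sum S E f a (Suc n) x0 * ennreal (exp (- q * real (Suc n)))))"
      using loop_sum_Zn(2)[OF S h x0] unfolding mult.assoc[symmetric] C_def
      by (intro suminf_le mult_right_mono) auto
    finally have "ennreal (exp C) * (\<Sum>n. loop_sum S E f a (Suc n) x0 * ennreal (exp (- q * real (Suc n)))) = \<infinity>"
      by (simp add: top_unique)
    then show "(\<Sum>n. loop_sum S E f a n x0 * ennreal (exp (- q * real n))) = \<infinity>"
      unfolding suminf_eq by (auto simp: ennreal_mult_eq_top_iff)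
  qed (use A C0 d1 brX q0 loop_sum_0 in auto)
  define D where "D = 1 / (1 - \<theta>)"
  have "0 \<le> D" using A by (simp add: D_def)
  from perturbed_growth[OF this] obtain C' \<epsilon>0 where C': "0 < C'" "0 < \<epsilon>0" and
    key: "\<forall>(\<Psi> :: 'v list \<Rightarrow> (nat \<Rightarrow> 'v) \<Rightarrow> real) (N :: real). 0 \<le> N \<and>
      (\<forall>v\<in>B. \<forall>x\<in>X. \<bar>\<Psi> v x\<bar> \<le> N * length v) \<and>
      (\<forall>v\<in>B. \<forall>x\<in>X. \<forall>y\<in>X. \<bar>\<Psi> v x - \<Psi> v y\<bar> \<le> N * D * cyl_dist \<theta> x y) \<longrightarrow>
      (\<exists>\<kappa>. \<forall>s Y. \<bar>s\<bar> * N \<le> \<epsilon>0 \<and> (\<forall>x\<in>X. Y 0 x = 1) \<and>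
         (\<forall>x\<in>X. \<forall>n>0. Y n x = (\<integral>\<^sup>+v. (if length v \<le> n then ennreal (exp (H v x + s * \<Psi> v x)) * Y (n - length v) (v \<frown> x) else 0) \<partial>count_space B)) \<longrightarrow>
         (\<exists>K>0. \<forall>n. \<forall>x\<in>X. Y n x \<le> ennreal (K * exp (real n * (P + s * \<kappa> + C' * N\<^sup>2 * s\<^sup>2)))))"
    by (elim exE conjE)
  show ?thesis
  proof (rule exI[of _ C'], rule conjI[OF C'(1)], rule exI[of _ \<epsilon>0], rule conjI[OF C'(2)], intro allI impI, elim conjE)
    fix g :: "(nat \<Rightarrow> 'v) \<Rightarrow> real" and N :: real
    assume hg: "hoelder_const S E \<theta> N g" and bd: "\<forall>x\<in>tms S E. \<bar>g x\<bar> \<le> N"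
    define \<Psi> where "\<Psi> = (\<lambda>v x. birkhoff g (length v) (v \<frown> x))"
    have hyp: "0 \<le> N \<and> (\<forall>v\<in>B. \<forall>x\<in>X. \<bar>\<Psi> v x\<bar> \<le> N * length v) \<and>
      (\<forall>v\<in>B. \<forall>x\<in>X. \<forall>y\<in>X. \<bar>\<Psi> v x - \<Psi> v y\<bar> \<le> N * D * cyl_dist \<theta> x y)"
    proof (intro conjI ballI)
      show "0 \<le> N" using hg by (simp add: hoelder_const_def)
      fix v x assume vx: "v \<in> B" "x \<in> X"
      have "\<bar>\<Psi> v x\<bar> \<le> (\<Sum>k<length v. \<bar>g (suffix k (v \<frown> x))\<bar>)"
        unfolding \<Psi>_def birkhoff_suffix by (rule sum_abs)
      also have "\<dots> \<le> (\<Sum>k<length v. N)"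
        using brX[OF vx] by (intro sum_mono bd[rule_format] tms_suffix) (simp add: X_def)
      finally show "\<bar>\<Psi> v x\<bar> \<le> N * length v" by (simp add: mult.commute)
      fix y assume y: "y \<in> X"
      have "\<bar>\<Psi> v x - \<Psi> v y\<bar> \<le> N / (1 - \<theta>) * cyl_dist \<theta> x y"
        unfolding \<Psi>_def using brX[OF vx] brX[OF vx(1) y] vx y by (intro birkhoff_conc_dist[OF hg]) (auto simp: X_def)
      then show "\<bar>\<Psi> v x - \<Psi> v y\<bar> \<le> N * D * cyl_dist \<theta> x y" by (simp add: D_def)
    qed
    from key[THEN spec, THEN spec, THEN mp, OF hyp] obtain \<kappa> where
      \<kappa>: "\<And>s Y. \<bar>s\<bar> * N \<le> \<epsilon>0 \<and> (\<forall>x\<in>X. Y 0 x = 1) \<and>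
         (\<forall>x\<in>X. \<forall>n>0. Y n x = (\<integral>\<^sup>+v. (if length v \<le> n then ennreal (exp (H v x + s * \<Psi> v x)) * Y (n - length v) (v \<frown> x) else 0) \<partial>count_space B)) \<Longrightarrow>
         (\<exists>K>0. \<forall>n. \<forall>x\<in>X. Y n x \<le> ennreal (K * exp (real n * (P + s * \<kappa> + C' * N\<^sup>2 * s\<^sup>2))))" by blast
    show "\<exists>\<kappa>. \<forall>s. \<bar>s\<bar> * N \<le> \<epsilon>0 \<longrightarrow> (\<exists>K>0. \<forall>n. \<forall>x\<in>tms S E. x 0 = a \<longrightarrow>
        loop_sum S E (\<lambda>x. f x + s * g x) a n x \<le> ennreal (K * exp (real n * (P + s * \<kappa> + C' * N\<^sup>2 * s\<^sup>2))))"
    proof (rule exI[of _ \<kappa>], intro allI impI)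
      fix s assume s: "\<bar>s\<bar> * N \<le> \<epsilon>0"
      have "\<exists>K>0. \<forall>n. \<forall>x\<in>X. loop_sum S E (\<lambda>x. f x + s * g x) a n x \<le> ennreal (K * exp (real n * (P + s * \<kappa> + C' * N\<^sup>2 * s\<^sup>2)))"
      proof (rule \<kappa>, intro conjI ballI allI impI)
        fix x n assume "0 < (n::nat)"
        then show "loop_sum S E (\<lambda>x. f x + s * g x) a n x = (\<integral>\<^sup>+v. (if length v \<le> n then ennreal (exp (H v x + s * \<Psi> v x)) * loop_sum S E (\<lambda>x. f x + s * g x) a (n - length v) (v \<frown> x) else 0) \<partial>count_space B)"
          unfolding B_def H_def \<Psi>_def birkhoff_lin[symmetric] by (rule loop_sum_renewal)
      qed (use s loop_sum_0 in auto)
      then show "\<exists>K>0. \<forall>n. \<forall>x\<in>tms S E. x 0 = a \<longrightarrow> loop_sum S E (\<lambda>x. f x + s * g x) a n x \<le> ennreal (K * exp (real n * (P + s * \<kappa> + C' * N\<^sup>2 * s\<^sup>2)))"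
        unfolding X_def by blast
    qed
  qed
qed

section \<open>Pressure of mixing shifts\<close>

lemma eln_le_iff: "eln z \<le> ereal t \<longleftrightarrow> z \<le> ennreal (exp t)"
proof (cases z)
  case (real r)
  show ?thesis
  proof (cases "r = 0")
    case False
    then have "ln r \<le> t \<longleftrightarrow> r \<le> exp t" using real by (metis exp_le_cancel_iff exp_ln less_le)
    then show ?thesis using real False by (simp add: eln_def)
  qed (use real in \<open>simp add: eln_def\<close>)
qed (auto simp: eln_def top_unique)

lemma le_eln_iff: "ereal t \<le> eln z \<longleftrightarrow> ennreal (exp t) \<le> z"
proof (cases z)
  case (real r)
  show ?thesis
  proof (cases "r = 0")
    case False
    then have "t \<le> ln r \<longleftrightarrow> exp t \<le> r" using real by (metis exp_le_cancel_iff exp_ln less_le)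
    then show ?thesis using real False by (simp add: eln_def)
  qed (use real in \<open>simp add: eln_def\<close>)
qed (auto simp: eln_def)

lemma eln_pow_lower:
  fixes z :: "nat \<Rightarrow> ennreal"
  assumes super: "\<And>m n. 1 \<le> m \<Longrightarrow> 1 \<le> n \<Longrightarrow> z m * z n \<le> z (m + n)" and k: "1 \<le> k" and r: "1 \<le> r"
  shows "z k ^ q * z r \<le> z (q * k + r)"
proof (induction q)
  case (Suc q)
  have "z k ^ Suc q * z r = z k * (z k ^ q * z r)" by (simp add: mult.assoc)
  also have "\<dots> \<le> z k * z (q * k + r)" using Suc by (rule mult_left_mono) simp
  also have "\<dots> \<le> z (k + (q * k + r))" using k r by (intro super) auto
  finally show ?case by (simp add: add.assoc)
qed simp

text \<open>Fekete's lemma for supermultiplicative sequences that may take the value infinity and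
  may vanish for small indices. A large index is written as a multiple of a good \<open>k\<close>
  plus a remainder kept beyond \<open>n0\<close>, where nothing vanishes.\<close>

lemma fekete:
  fixes z :: "nat \<Rightarrow> ennreal"
  assumes super: "\<And>m n. 1 \<le> m \<Longrightarrow> 1 \<le> n \<Longrightarrow> z m * z n \<le> z (m + n)"
    and pos: "\<And>n. n0 \<le> n \<Longrightarrow> 0 < z n"
  defines "L \<equiv> (SUP n. eln (z (Suc n)) / ereal (real (Suc n)))"
  shows "(\<lambda>n. eln (z (Suc n)) / ereal (real (Suc n))) \<longlonglongrightarrow> L"
proof (rule order_tendstoI)
  fix a assume "L < a"
  then show "\<forall>\<^sub>F n in sequentially. eln (z (Suc n)) / ereal (real (Suc n)) < a"
    unfolding L_def by (auto intro!: always_eventually dest: SUP_lessD)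
next
  fix a assume aL: "a < L"
  obtain el2 where l2: "a < ereal el2" "ereal el2 < L" using ereal_dense2[OF aL] by blast
  obtain el where l: "ereal el2 < ereal el" "ereal el < L" using ereal_dense2[OF l2(2)] by blast
  obtain j where j: "ereal el < eln (z (Suc j)) / ereal (real (Suc j))"
    using l(2) unfolding L_def less_SUP_iff by blast
  define k where "k = Suc j"
  have k: "1 \<le> k" by (simp add: k_def)
  have "ereal (el * k) \<le> eln (z k)"
  proof (cases "eln (z k)")
    case (real t) then show ?thesis using j by (simp add: k_def field_simps)
  next
    case PInf then show ?thesis by simp
  next
    case MInf then show ?thesis using j by (simp add: k_def)
  qed
  then have zk: "ennreal (exp (el * k)) \<le> z k" by (simp add: le_eln_iff)
  define r0 where "r0 = max n0 1"
  \<comment> \<open>The window of \<open>k\<close> consecutive indices represents every residue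
    modulo \<open>k\<close>. The cap by \<open>1\<close> keeps \<open>\<delta>\<close> finite even
    if some \<open>z r\<close> is infinite, so that its logarithm can be taken.\<close>
  define \<delta> where "\<delta> = Min ((\<lambda>r. min (z r) 1) ` {r0..<r0 + k})"
  have ne: "{r0..<r0 + k} \<noteq> {}" using k by simp
  have \<delta>0: "0 < \<delta>" unfolding \<delta>_def using ne pos by (subst Min_gr_iff) (auto simp: r0_def)
  have \<delta>r: "\<delta> \<le> z r" if "r0 \<le> r" "r < r0 + k" for r
  proof -
    have "\<delta> \<le> min (z r) 1" unfolding \<delta>_def using that by (intro Min_le) auto
    then show ?thesis by simp
  qed
  have "\<delta> \<le> min (z r0) 1" unfolding \<delta>_def using k by (intro Min_le) auto
  then have "\<delta> \<le> 1" by simp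
  then obtain dd where dd: "\<delta> = ennreal dd" "0 < dd" using \<delta>0 by (cases \<delta>) (auto simp: top_unique)
  have low: "ennreal (exp (el * n - \<bar>el\<bar> * (r0 + k) + ln dd)) \<le> z n" if n: "r0 \<le> n" for n
  proof -
    define q where "q = (n - r0) div k"
    define r where "r = r0 + (n - r0) mod k"
    have nq: "n = q * k + r" using n by (simp add: q_def r_def)
    have r: "r0 \<le> r" "r < r0 + k" using k by (auto simp: r_def)
    have "ennreal (exp (el * k)) ^ q * ennreal dd \<le> z k ^ q * z r"
      using zk \<delta>r[OF r] dd by (intro mult_mono power_mono) auto
    also have "\<dots> \<le> z n" unfolding nq using k r by (intro eln_pow_lower super) (auto simp: r0_def)
    finally have "ennreal (exp (el * k) ^ q * dd) \<le> z n" using dd by (simp add: ennreal_power ennreal_mult)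
    moreover have "exp (el * n - \<bar>el\<bar> * (r0 + k) + ln dd) \<le> exp (el * k) ^ q * dd"
    proof -
      have "el * n = el * k * q + el * r" by (simp add: nq algebra_simps)
      moreover have "el * r \<le> \<bar>el\<bar> * (r0 + k)" using r by (intro mult_mono) auto
      ultimately have "exp (el * n - \<bar>el\<bar> * (r0 + k) + ln dd) \<le> exp (real q * (el * k) + ln dd)" by (simp add: mult.commute)
      then show ?thesis using dd by (simp add: exp_add exp_of_nat_mult)
    qed
    ultimately show ?thesis by (meson ennreal_leI order_trans)
  qed
  define b where "b = - \<bar>el\<bar> * (r0 + k) + ln dd"
  have "(\<lambda>n. b / real (Suc n)) \<longlonglongrightarrow> 0"
    by (rule LIMSEQ_Suc) (rule lim_const_over_n)
  then have "\<forall>\<^sub>F n in sequentially. el2 - el < b / real (Suc n)"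
    using l(1) by (intro order_tendstoD(1)) auto
  then show "\<forall>\<^sub>F n in sequentially. a < eln (z (Suc n)) / ereal (real (Suc n))"
    using eventually_ge_at_top[of r0]
  proof eventually_elim
    case (elim n)
    have "ereal (el * Suc n + b) \<le> eln (z (Suc n))"
      using low[of "Suc n"] elim(2) by (simp add: le_eln_iff b_def algebra_simps)
    then have "ereal (el * Suc n + b) / ereal (real (Suc n)) \<le> eln (z (Suc n)) / ereal (real (Suc n))"
      by (rule ereal_divide_right_mono) simp
    moreover have "ereal (el * Suc n + b) / ereal (real (Suc n)) = ereal (el + b / Suc n)" by (simp add: field_simps)
    moreover have "a < ereal (el + b / Suc n)"
    proof -
      have "ereal el2 < ereal (el + b / Suc n)" using elim(1) by simp
      then show ?thesis using l2(1) by (rule less_trans[rotated])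
    qed
    ultimately show ?case by simp
  qed
qed

lemma eln_divide_cmult_tendsto:
  assumes "(\<lambda>n. eln (ennreal (exp c) * z (Suc n)) / ereal (real (Suc n))) \<longlonglongrightarrow> L"
  shows "(\<lambda>n. eln (z (Suc n)) / ereal (real (Suc n))) \<longlonglongrightarrow> L"
proof -
  have e: "eln y = ereal (- c) + eln (ennreal (exp c) * y)" for y
  proof (cases y)
    case (real r)
    then show ?thesis by (cases "r = 0") (auto simp: eln_def ennreal_mult'[symmetric] ln_mult)
  next
    case top
    then show ?thesis by (simp add: eln_def ennreal_mult_top)
  qed
  have d: "eln (z (Suc n)) / ereal (real (Suc n)) = ereal (- c / Suc n) + eln (ennreal (exp c) * z (Suc n)) / ereal (real (Suc n))" for n
    by (subst e) (cases "eln (ennreal (exp c) * z (Suc n))"; simp add: add_divide_distrib diff_divide_distrib)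
  have "(\<lambda>n. ereal (- c / Suc n)) \<longlonglongrightarrow> ereal 0"
    using LIMSEQ_Suc[OF lim_const_over_n[of "- c"]] by (simp add: zero_ereal_def)
  then have "(\<lambda>n. ereal (- c / Suc n) + eln (ennreal (exp c) * z (Suc n)) / ereal (real (Suc n))) \<longlonglongrightarrow> ereal 0 + L"
    using assms by (intro tendsto_add_ereal_general2) auto
  then show ?thesis unfolding d by simp
qed

text \<open>Only two junctions cost anything: \<open>u\<close> is followed by another point than
  \<open>z\<close>, and \<open>c\<close> by another point than \<open>y\<close>, each with the same
  first symbol. The last stretch \<open>t \<frown> x\<close> occurs unchanged on both sides.\<close>

lemma birkhoff_glue:
  assumes h: "hoelder_const S E \<theta> A f"
    and u: "u \<in> paths S E b a k" and c: "c \<in> paths S E a e n" and t: "t \<in> paths S E e b' l"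
    and x: "x \<in> tms S E" "x 0 = b'" and y: "y \<in> tms S E" "y 0 = e" and z: "z \<in> tms S E" "z 0 = a"
  shows "\<bar>birkhoff f (k + n + l) ((u @ c @ t) \<frown> x) - (birkhoff f k (u \<frown> z) + birkhoff f n (c \<frown> y) + birkhoff f l (t \<frown> x))\<bar> \<le> 2 * (A / (1 - \<theta>))"
proof -
  have A: "0 \<le> A" "0 < \<theta>" "\<theta> < 1" using h by (auto simp: hoelder_const_def)
  note l = paths_length[OF u] paths_length[OF c] paths_length[OF t]
  note tx = paths_conc[OF t x]
  note ctx = paths_conc[OF c tx]
  note cy = paths_conc[OF c y]
  note uctx = paths_conc[OF u ctx]
  note uz = paths_conc[OF u z]
  have "birkhoff f (k + n + l) ((u @ c @ t) \<frown> x) = birkhoff f (k + (n + l)) (u \<frown> (c \<frown> (t \<frown> x)))" by (simp add: add.assoc)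
  also have "\<dots> = birkhoff f k (u \<frown> (c \<frown> (t \<frown> x))) + (birkhoff f n (c \<frown> (t \<frown> x)) + birkhoff f l (t \<frown> x))"
    unfolding birkhoff_add using l by simp
  finally have e: "birkhoff f (k + n + l) ((u @ c @ t) \<frown> x) = \<dots>" .
  have w: "A / (1 - \<theta>) * \<theta> ^ 1 \<le> A / (1 - \<theta>)" using A by (simp add: divide_right_mono mult_left_le)
  have 1: "\<bar>birkhoff f k (u \<frown> (c \<frown> (t \<frown> x))) - birkhoff f k (u \<frown> z)\<bar> \<le> A / (1 - \<theta>) * \<theta> ^ 1"
    using uctx uz l ctx(2) z(2) by (intro birkhoff_distortion[OF h]) (auto simp: conc_def)
  have 2: "\<bar>birkhoff f n (c \<frown> (t \<frown> x)) - birkhoff f n (c \<frown> y)\<bar> \<le> A / (1 - \<theta>) * \<theta> ^ 1"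
    using ctx cy l tx(2) y(2) by (intro birkhoff_distortion[OF h]) (auto simp: conc_def)
  show ?thesis unfolding e using 1 2 w by linarith
qed

lemma nn_integral_count_space_inj_le:
  assumes "inj_on j A" "j ` A \<subseteq> B" "\<And>x. x \<in> A \<Longrightarrow> f x \<le> g (j x)"
  shows "(\<integral>\<^sup>+x. f x \<partial>count_space A) \<le> (\<integral>\<^sup>+y. (g y :: ennreal) \<partial>count_space B)"
proof -
  have "(\<integral>\<^sup>+x. f x \<partial>count_space A) \<le> (\<integral>\<^sup>+x. g (j x) \<partial>count_space A)"
    using assms(3) by (intro nn_integral_mono) auto
  also have "\<dots> = (\<integral>\<^sup>+y. g y \<partial>count_space (j ` A))"
    using assms(1) by (intro nn_integral_bij_count_space) (auto simp: bij_betw_def)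
  also have "\<dots> = (\<integral>\<^sup>+y. g y * indicator (j ` A) y \<partial>count_space UNIV)"
    by (rule nn_integral_count_space_indicator) simp
  also have "\<dots> \<le> (\<integral>\<^sup>+y. g y * indicator B y \<partial>count_space UNIV)"
    using assms(2) by (intro nn_integral_mono) (auto simp: indicator_def)
  also have "\<dots> = (\<integral>\<^sup>+y. g y \<partial>count_space B)"
    by (rule nn_integral_count_space_indicator[symmetric]) simp
  finally show ?thesis .
qed

lemma nn_integral_count_space_prod:
  fixes f :: "'a \<Rightarrow> 'b \<Rightarrow> ennreal"
  shows "(\<integral>\<^sup>+x. \<integral>\<^sup>+y. f x y \<partial>count_space B \<partial>count_space A) = (\<integral>\<^sup>+p. f (fst p) (snd p) \<partial>count_space (A \<times> B))"
proof -
  have "(\<integral>\<^sup>+p. f (fst p) (snd p) \<partial>count_space (A \<times> B)) = (\<integral>\<^sup>+p. f (fst p) (snd p) * indicator (A \<times> B) p \<partial>count_space UNIV)"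
    by (rule nn_integral_count_space_indicator) simp
  also have "\<dots> = (\<integral>\<^sup>+x. \<integral>\<^sup>+y. f x y * indicator (A \<times> B) (x, y) \<partial>count_space UNIV \<partial>count_space UNIV)"
    by (subst nn_integral_fst_count_space[symmetric]) simp
  also have "\<dots> = (\<integral>\<^sup>+x. (\<integral>\<^sup>+y. f x y * indicator B y \<partial>count_space UNIV) * indicator A x \<partial>count_space UNIV)"
    by (intro nn_integral_cong) (auto simp: indicator_times mult.commute mult.left_commute nn_integral_cmult indicator_def)
  also have "\<dots> = (\<integral>\<^sup>+x. (\<integral>\<^sup>+y. f x y * indicator B y \<partial>count_space UNIV) \<partial>count_space A)"
    by (rule nn_integral_count_space_indicator[symmetric]) simp
  also have "\<dots> = (\<integral>\<^sup>+x. \<integral>\<^sup>+y. f x y \<partial>count_space B \<partial>count_space A)"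
    by (intro nn_integral_cong nn_integral_count_space_indicator[symmetric]) simp
  finally show ?thesis by simp
qed

lemma ennreal_top_of_nat_le:
  assumes "\<And>m. of_nat m \<le> (z :: ennreal)"
  shows "z = \<infinity>"
proof (cases z)
  case (real r)
  obtain m :: nat where "r < real m" using reals_Archimedean2 by blast
  moreover have "ennreal (real m) \<le> ennreal r" using assms[of m] real by (simp add: ennreal_of_nat_eq_real_of_nat)
  ultimately show ?thesis using real by simp
qed simp

section \<open>Growth exponents of loops in a mixing shift\<close>

locale mixing_tms =
  fixes S :: "'v set" and E :: "'v \<Rightarrow> 'v \<Rightarrow> bool" and f :: "(nat \<Rightarrow> 'v) \<Rightarrow> real" and \<theta> A :: real
  assumes S: "countable S" "S \<noteq> {}" and h: "hoelder_const S E \<theta> A f"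
    and mix: "\<And>a b. a \<in> S \<Longrightarrow> b \<in> S \<Longrightarrow> \<exists>n0. \<forall>n\<ge>n0. paths S E a b n \<noteq> {}"
begin

definition C :: real where "C = A / (1 - \<theta>)"

lemma A: "0 \<le> A" "0 < \<theta>" "\<theta> < 1" "0 \<le> C"
  using h by (auto simp: hoelder_const_def C_def)

lemma point: assumes "a \<in> S" shows "\<exists>x\<in>tms S E. x 0 = a"
proof -
  obtain n0 where "\<forall>n\<ge>n0. paths S E a a n \<noteq> {}" using mix[OF assms assms] by blast
  then obtain c where c: "c \<in> paths S E a a (Suc n0)" by (metis all_not_in_conv le_SucI order_refl)
  then show ?thesis using iter_tms[OF c] by blast
qed

text \<open>The exponent \<open>5 * C\<close> collects \<open>2 * C\<close> for glueing two loops
  and three conversions between \<open>Zn\<close> and \<open>loop_sum\<close>, two on the left and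
  one on the right.\<close>

lemma Zn_super:
  assumes a: "a \<in> S" and m: "1 \<le> m" and n: "1 \<le> n"
  shows "ennreal (exp (- 5 * C)) * Zn S E f m a * (ennreal (exp (- 5 * C)) * Zn S E f n a) \<le> ennreal (exp (- 5 * C)) * Zn S E f (m + n) a"
proof -
  obtain x where x: "x \<in> tms S E" "x 0 = a" using point[OF a] by blast
  let ?W = "\<lambda>n. loop_sum S E f a n x"
  have "?W m * ?W n = (\<integral>\<^sup>+c. \<integral>\<^sup>+t. ennreal (exp (birkhoff f m (c \<frown> x))) * ennreal (exp (birkhoff f n (t \<frown> x))) \<partial>count_space (paths S E a a n) \<partial>count_space (paths S E a a m))"
    unfolding loop_sum_def by (simp add: nn_integral_cmult nn_integral_multc)
  also have "\<dots> = (\<integral>\<^sup>+p. ennreal (exp (birkhoff f m (fst p \<frown> x) + birkhoff f n (snd p \<frown> x))) \<partial>count_space (paths S E a a m \<times> paths S E a a n))"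
    by (simp add: nn_integral_count_space_prod ennreal_exp_mult)
  also have "\<dots> \<le> (\<integral>\<^sup>+c. ennreal (exp (2 * C)) * ennreal (exp (birkhoff f (m + n) (c \<frown> x))) \<partial>count_space (paths S E a a (m + n)))"
  proof (rule nn_integral_count_space_inj_le[where j = "\<lambda>p. fst p @ snd p"])
    show "inj_on (\<lambda>p. fst p @ snd p) (paths S E a a m \<times> paths S E a a n)"
    proof (rule inj_onI)
      fix p p' assume "p \<in> paths S E a a m \<times> paths S E a a n" "p' \<in> paths S E a a m \<times> paths S E a a n" "fst p @ snd p = fst p' @ snd p'"
      moreover from this have "length (fst p) = m" "length (fst p') = m" by (auto simp: paths_length)
      ultimately show "p = p'" by (simp add: prod_eq_iff)
    qed
    show "(\<lambda>p. fst p @ snd p) ` (paths S E a a m \<times> paths S E a a n) \<subseteq> paths S E a a (m + n)"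
      by (auto intro: paths_append)
    fix p assume "p \<in> paths S E a a m \<times> paths S E a a n"
    then have p: "fst p \<in> paths S E a a m" "snd p \<in> paths S E a a n" by auto
    have "[] \<in> paths S E a a 0" by (simp add: paths_def)
    from birkhoff_glue[OF h this p x x x]
    show "ennreal (exp (birkhoff f m (fst p \<frown> x) + birkhoff f n (snd p \<frown> x))) \<le> ennreal (exp (2 * C)) * ennreal (exp (birkhoff f (m + n) ((fst p @ snd p) \<frown> x)))"
      unfolding ennreal_exp_mult by (intro ennreal_leI) (simp add: C_def birkhoff_def abs_le_iff)
  qed
  also have "\<dots> = ennreal (exp (2 * C)) * ?W (m + n)" by (simp add: nn_integral_cmult loop_sum_def)
  finally have W: "?W m * ?W n \<le> ennreal (exp (2 * C)) * ?W (m + n)" .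
  have "ennreal (exp (- 5 * C)) * Zn S E f m a * (ennreal (exp (- 5 * C)) * Zn S E f n a)
      \<le> ennreal (exp (- 5 * C)) * (ennreal (exp C) * ?W m) * (ennreal (exp (- 5 * C)) * (ennreal (exp C) * ?W n))"
    using loop_sum_Zn(2)[OF S(1) h x] m n by (intro mult_mono) (auto simp: C_def)
  also have "\<dots> = (ennreal (exp (- 5 * C)) * ennreal (exp C) * (ennreal (exp (- 5 * C)) * ennreal (exp C))) * (?W m * ?W n)"
    by (simp only: mult_ac)
  also have "\<dots> = ennreal (exp (- 8 * C)) * (?W m * ?W n)"
    by (simp add: ennreal_exp_mult)
  also have "\<dots> \<le> ennreal (exp (- 8 * C)) * (ennreal (exp (2 * C)) * (ennreal (exp C) * Zn S E f (m + n) a))"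
    using loop_sum_Zn(1)[OF S(1) h x, of "m + n"] m
    by (intro mult_left_mono order_trans[OF W]) (auto simp: C_def)
  also have "\<dots> = ennreal (exp (- 5 * C)) * Zn S E f (m + n) a"
    by (simp add: ennreal_exp_mult mult.assoc[symmetric])
  finally show ?thesis .
qed

lemma Zn_pos:
  assumes "a \<in> S" shows "\<exists>n0. \<forall>n\<ge>n0. 0 < Zn S E f n a"
proof -
  obtain n0 where n0: "\<forall>n\<ge>n0. paths S E a a n \<noteq> {}" using mix[OF assms assms] by blast
  have "0 < Zn S E f n a" if "n \<ge> max n0 1" for n
  proof -
    have n: "0 < n" using that by simp
    have "paths S E a a n \<noteq> {}" using n0 that by simp
    then obtain c where c: "c \<in> paths S E a a n" by blast
    have "0 < ennreal (exp (birkhoff f n (c\<^sup>\<omega>)))" by simp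
    also have "\<dots> = (\<integral>\<^sup>+c. ennreal (exp (birkhoff f n (c\<^sup>\<omega>))) \<partial>count_space {c})" by (simp add: nn_integral_count_space_finite)
    also have "\<dots> \<le> Zn S E f n a"
      unfolding Zn_paths[OF S(1) n] using c by (intro nn_integral_count_space_inj_le[where j = id]) auto
    finally show ?thesis .
  qed
  then show ?thesis by blast
qed

text \<open>In Fekete's lemma the limit is a supremum, so the exponential bound holds for every
  \<open>n \<ge> 1\<close> and not just asymptotically; \<open>5 * C\<close> undoes the
  normalisation.\<close>

lemma Zn_growth:
  assumes "a \<in> S"
  shows "\<exists>L. (\<lambda>n. eln (Zn S E f (Suc n) a) / ereal (real (Suc n))) \<longlonglongrightarrow> L \<and> L \<noteq> - \<infinity> \<and>
     (\<forall>q n. L \<le> ereal q \<longrightarrow> 1 \<le> n \<longrightarrow> Zn S E f n a \<le> ennreal (exp (5 * C + q * real n)))"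
proof -
  define z where "z = (\<lambda>n. ennreal (exp (- 5 * C)) * Zn S E f n a)"
  obtain n0 where n0: "\<forall>n\<ge>n0. 0 < Zn S E f n a" using Zn_pos[OF assms] by blast
  define L where "L = (SUP n. eln (z (Suc n)) / ereal (real (Suc n)))"
  have lim: "(\<lambda>n. eln (z (Suc n)) / ereal (real (Suc n))) \<longlonglongrightarrow> L"
    unfolding L_def
  proof (rule fekete)
    show "z m * z n \<le> z (m + n)" if "1 \<le> m" "1 \<le> n" for m n
      unfolding z_def by (rule Zn_super[OF assms that])
    show "0 < z n" if "n0 \<le> n" for n using n0 that by (simp add: z_def ennreal_zero_less_mult_iff)
  qed
  have le: "eln (z (Suc n)) / ereal (real (Suc n)) \<le> L" for n unfolding L_def by (rule SUP_upper) simp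
  have "L \<noteq> - \<infinity>"
  proof
    assume "L = - \<infinity>"
    then have "eln (z (Suc n0)) / ereal (real (Suc n0)) = - \<infinity>" using le[of n0] by simp
    then have "eln (z (Suc n0)) = - \<infinity>" by (cases "eln (z (Suc n0))") auto
    then have "z (Suc n0) = 0" by (auto simp: eln_def split: if_splits)
    moreover have "0 < z (Suc n0)" using n0 by (simp add: z_def ennreal_zero_less_mult_iff)
    ultimately show False by simp
  qed
  moreover have "Zn S E f n a \<le> ennreal (exp (5 * C + q * real n))" if q: "L \<le> ereal q" and n: "1 \<le> n" for q n
  proof -
    obtain m where m: "n = Suc m" using n by (cases n) auto
    have "eln (z n) / ereal (real n) \<le> ereal q" using le[of m] q m by simp
    then have "eln (z n) \<le> ereal (q * n)"
    proof (cases "eln (z n)")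
      case (real t) then show ?thesis using \<open>eln (z n) / ereal (real n) \<le> ereal q\<close> n by (simp add: divide_le_eq)
    next
      case PInf then show ?thesis using \<open>eln (z n) / ereal (real n) \<le> ereal q\<close> n by simp
    qed simp
    then have "z n \<le> ennreal (exp (q * n))" by (simp add: eln_le_iff)
    then have "ennreal (exp (5 * C)) * z n \<le> ennreal (exp (5 * C)) * ennreal (exp (q * n))" by (intro mult_left_mono) auto
    then show ?thesis by (simp add: z_def mult.assoc[symmetric] ennreal_exp_mult)
  qed
  moreover have "(\<lambda>n. eln (Zn S E f (Suc n) a) / ereal (real (Suc n))) \<longlonglongrightarrow> L"
    using lim unfolding z_def by (rule eln_divide_cmult_tendsto)
  ultimately show ?thesis by blast
qed

lemma suminf_geometric_finite:
  assumes "q' < q"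
  shows "(\<Sum>n. ennreal (K * exp (q' * real (Suc n))) * ennreal (exp (- q * real (Suc n)))) < \<infinity>"
proof -
  have e: "ennreal (K * exp (q' * real (Suc n))) * ennreal (exp (- q * real (Suc n))) = ennreal (K * exp (q' - q)) * ennreal (exp (q' - q) ^ n)" for n
  proof -
    have "exp (q' * real (Suc n)) * exp (- q * real (Suc n)) = exp (q' - q) * exp (q' - q) ^ n"
      by (simp add: exp_of_nat_mult[symmetric] algebra_simps flip: exp_add)
    then show ?thesis by (simp add: ennreal_mult''[symmetric] mult.assoc)
  qed
  have "(\<Sum>n. ennreal (exp (q' - q) ^ n)) \<noteq> top"
    using assms by (intro ennreal_suminf_neq_top summable_geometric) auto
  then show ?thesis unfolding e by (simp add: ennreal_mult_less_top less_top)
qed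

lemma Zn_series:
  assumes a: "a \<in> S" and lim: "(\<lambda>n. eln (Zn S E f (Suc n) a) / ereal (real (Suc n))) \<longlonglongrightarrow> L"
  shows "L < ereal q \<Longrightarrow> (\<Sum>n. Zn S E f (Suc n) a * ennreal (exp (- q * real (Suc n)))) < \<infinity>"
    and "ereal q < L \<Longrightarrow> (\<Sum>n. Zn S E f (Suc n) a * ennreal (exp (- q * real (Suc n)))) = \<infinity>"
proof -
  assume Lq: "L < ereal q"
  obtain q' where q': "L < ereal q'" "q' < q" using ereal_dense2[OF Lq] by auto
  obtain L' where L': "(\<lambda>n. eln (Zn S E f (Suc n) a) / ereal (real (Suc n))) \<longlonglongrightarrow> L'"
    "\<And>q n. L' \<le> ereal q \<Longrightarrow> 1 \<le> n \<Longrightarrow> Zn S E f n a \<le> ennreal (exp (5 * C + q * real n))"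
    using Zn_growth[OF a] by blast
  have "L' = L" using LIMSEQ_unique[OF L'(1) lim] .
  then have bd: "Zn S E f (Suc n) a \<le> ennreal (exp (5 * C) * exp (q' * real (Suc n)))" for n
    using L'(2)[of q' "Suc n"] q'(1) by (simp add: exp_add less_imp_le)
  have "(\<Sum>n. Zn S E f (Suc n) a * ennreal (exp (- q * real (Suc n)))) \<le> (\<Sum>n. ennreal (exp (5 * C) * exp (q' * real (Suc n))) * ennreal (exp (- q * real (Suc n))))"
    using bd by (intro suminf_le mult_right_mono) auto
  also have "\<dots> < \<infinity>" by (rule suminf_geometric_finite[OF q'(2)])
  finally show "(\<Sum>n. Zn S E f (Suc n) a * ennreal (exp (- q * real (Suc n)))) < \<infinity>" .
next
  assume qL: "ereal q < L"
  have "\<forall>\<^sub>F n in sequentially. ereal q < eln (Zn S E f (Suc n) a) / ereal (real (Suc n))"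
    by (rule order_tendstoD(1)[OF lim qL])
  then obtain N where N: "\<And>n. n \<ge> N \<Longrightarrow> ereal q < eln (Zn S E f (Suc n) a) / ereal (real (Suc n))"
    by (auto simp: eventually_sequentially)
  have ge: "1 \<le> Zn S E f (Suc n) a * ennreal (exp (- q * real (Suc n)))" if n: "n \<ge> N" for n
  proof -
    have "ereal (q * Suc n) \<le> eln (Zn S E f (Suc n) a)"
    proof (cases "eln (Zn S E f (Suc n) a)")
      case (real t) then show ?thesis using N[OF n] by (simp add: less_divide_eq less_imp_le)
    next
      case MInf then show ?thesis using N[OF n] by simp
    qed simp
    then have "ennreal (exp (q * Suc n)) \<le> Zn S E f (Suc n) a" by (simp add: le_eln_iff)
    then have "ennreal (exp (q * Suc n)) * ennreal (exp (- q * real (Suc n))) \<le> Zn S E f (Suc n) a * ennreal (exp (- q * real (Suc n)))"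
      by (rule mult_right_mono) simp
    then show ?thesis by (simp add: ennreal_exp_mult)
  qed
  show "(\<Sum>n. Zn S E f (Suc n) a * ennreal (exp (- q * real (Suc n)))) = \<infinity>"
  proof (rule ennreal_top_of_nat_le)
    fix m
    have "(of_nat m :: ennreal) = (\<Sum>n\<in>{N..<N + m}. 1)" by simp
    also have "\<dots> \<le> (\<Sum>n\<in>{N..<N + m}. Zn S E f (Suc n) a * ennreal (exp (- q * real (Suc n))))"
      using ge by (intro sum_mono) auto
    also have "\<dots> \<le> (\<Sum>n. Zn S E f (Suc n) a * ennreal (exp (- q * real (Suc n))))"
      by (rule sum_le_suminf) auto
    finally show "of_nat m \<le> (\<Sum>n. Zn S E f (Suc n) a * ennreal (exp (- q * real (Suc n))))" .
  qed
qed

text \<open>Fixed connecting paths from \<open>b\<close> to \<open>a\<close> and back embed the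
  loops at \<open>a\<close> injectively into longer loops at \<open>b\<close>.\<close>

lemma Zn_compare:
  assumes a: "a \<in> S" and b: "b \<in> S"
  shows "\<exists>\<kappa> s. \<forall>n\<ge>1. Zn S E f n a \<le> ennreal (exp \<kappa>) * Zn S E f (n + s) b"
proof -
  obtain x z where x: "x \<in> tms S E" "x 0 = b" and z: "z \<in> tms S E" "z 0 = a" using point a b by metis
  obtain u k where u: "u \<in> paths S E b a k" using mix[OF b a] by blast
  obtain t l where t: "t \<in> paths S E a b l" using mix[OF a b] by blast
  define \<kappa> where "\<kappa> = 2 * C - birkhoff f k (u \<frown> z) - birkhoff f l (t \<frown> x)"
  have "Zn S E f n a \<le> ennreal (exp (\<kappa> + 2 * C)) * Zn S E f (n + (k + l)) b" if n: "1 \<le> n" for n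
  proof -
    have "loop_sum S E f a n z \<le> (\<integral>\<^sup>+c. ennreal (exp \<kappa>) * ennreal (exp (birkhoff f (n + (k + l)) (c \<frown> x))) \<partial>count_space (paths S E b b (n + (k + l))))"
      unfolding loop_sum_def
    proof (rule nn_integral_count_space_inj_le[where j = "\<lambda>c. u @ c @ t"])
      show "(\<lambda>c. u @ c @ t) ` paths S E a a n \<subseteq> paths S E b b (n + (k + l))"
      proof (rule image_subsetI)
        fix c assume "c \<in> paths S E a a n"
        from paths_append[OF u paths_append[OF this t]] show "u @ c @ t \<in> paths S E b b (n + (k + l))"
          by (simp add: add.left_commute)
      qed
      fix c assume c: "c \<in> paths S E a a n"
      have "k + n + l = n + (k + l)" by simp
      with birkhoff_glue[OF h u c t x z z]
      have "birkhoff f n (c \<frown> z) \<le> \<kappa> + birkhoff f (n + (k + l)) ((u @ c @ t) \<frown> x)"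
        by (simp add: \<kappa>_def C_def abs_le_iff)
      then show "ennreal (exp (birkhoff f n (c \<frown> z))) \<le> ennreal (exp \<kappa>) * ennreal (exp (birkhoff f (n + (k + l)) ((u @ c @ t) \<frown> x)))"
        unfolding ennreal_exp_mult by (intro ennreal_leI) simp
    qed (auto simp: inj_on_def)
    also have "\<dots> = ennreal (exp \<kappa>) * loop_sum S E f b (n + (k + l)) x" by (simp add: nn_integral_cmult loop_sum_def)
    finally have 1: "loop_sum S E f a n z \<le> ennreal (exp \<kappa>) * loop_sum S E f b (n + (k + l)) x" .
    have "Zn S E f n a \<le> ennreal (exp C) * loop_sum S E f a n z" using loop_sum_Zn(2)[OF S(1) h z, of n] n by (simp add: C_def)
    also have "\<dots> \<le> ennreal (exp C) * (ennreal (exp \<kappa>) * (ennreal (exp C) * Zn S E f (n + (k + l)) b))"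
      using loop_sum_Zn(1)[OF S(1) h x, of "n + (k + l)"] n
      by (intro mult_left_mono order_trans[OF 1]) (auto simp: C_def)
    also have "\<dots> = ennreal (exp (\<kappa> + 2 * C)) * Zn S E f (n + (k + l)) b"
      by (simp add: mult.assoc[symmetric] ennreal_exp_mult add.commute add.left_commute)
    finally show ?thesis .
  qed
  then show ?thesis by blast
qed

text \<open>The shift of index in \<open>Zn_compare\<close> multiplies the terms of the series by a
  constant, so divergence at \<open>a\<close> would contradict convergence at \<open>b\<close> for
  an exponent strictly between the two limits.\<close>

lemma Zn_limit_indep:
  assumes a: "a \<in> S" and la: "(\<lambda>n. eln (Zn S E f (Suc n) a) / ereal (real (Suc n))) \<longlonglongrightarrow> La"
    and b: "b \<in> S" and lb: "(\<lambda>n. eln (Zn S E f (Suc n) b) / ereal (real (Suc n))) \<longlonglongrightarrow> Lb"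
  shows "La \<le> Lb"
proof (rule ccontr)
  assume "\<not> La \<le> Lb"
  then have "Lb < La" by simp
  from ereal_dense2[OF this] obtain q where q: "Lb < ereal q" "ereal q < La" by blast
  obtain \<kappa> s where \<kappa>: "\<And>n. 1 \<le> n \<Longrightarrow> Zn S E f n a \<le> ennreal (exp \<kappa>) * Zn S E f (n + s) b"
    using Zn_compare[OF a b] by blast
  let ?g = "\<lambda>n. Zn S E f (Suc n) b * ennreal (exp (- q * real (Suc n)))"
  have "\<infinity> = (\<Sum>n. Zn S E f (Suc n) a * ennreal (exp (- q * real (Suc n))))"
    using Zn_series(2)[OF a la q(2)] by simp
  also have "\<dots> \<le> (\<Sum>n. ennreal (exp (\<kappa> + q * s)) * ?g (n + s))"
  proof (rule suminf_le)
    fix n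
    have ex: "- q * real (Suc n) = q * s + - q * real (Suc (n + s))" by (simp add: algebra_simps)
    have "Zn S E f (Suc n) a * ennreal (exp (- q * real (Suc n))) \<le> ennreal (exp \<kappa>) * Zn S E f (Suc n + s) b * ennreal (exp (- q * real (Suc n)))"
      using \<kappa>[of "Suc n"] by (intro mult_right_mono) auto
    also have "ennreal (exp (- q * real (Suc n))) = ennreal (exp (q * s)) * ennreal (exp (- q * real (Suc (n + s))))"
      unfolding ennreal_exp_mult by (simp add: algebra_simps)
    also have "ennreal (exp \<kappa>) * Zn S E f (Suc n + s) b * \<dots> = (ennreal (exp \<kappa>) * ennreal (exp (q * s))) * ?g (n + s)" by (simp add: mult_ac)
    finally show "Zn S E f (Suc n) a * ennreal (exp (- q * real (Suc n))) \<le> ennreal (exp (\<kappa> + q * s)) * ?g (n + s)"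
      by (simp only: ennreal_exp_mult ex)
  qed auto
  also have "\<dots> = ennreal (exp (\<kappa> + q * s)) * (\<Sum>n. ?g (n + s))" by simp
  also have "\<dots> \<le> ennreal (exp (\<kappa> + q * s)) * (\<Sum>n. ?g n)"
    using suminf_offset[of ?g s] by (intro mult_left_mono) auto
  also have "\<dots> < \<infinity>" using Zn_series(1)[OF b lb q(1)] by (simp add: ennreal_mult_less_top)
  finally show False by simp
qed

theorem pressure_limit:
  shows "\<And>a. a \<in> S \<Longrightarrow> (\<lambda>n. eln (Zn S E f (Suc n) a) / ereal (real (Suc n))) \<longlonglongrightarrow> gpres_mixing S E f"
    and "gpres_mixing S E f \<noteq> - \<infinity>"
    and "\<And>a q n. a \<in> S \<Longrightarrow> gpres_mixing S E f \<le> ereal q \<Longrightarrow> 1 \<le> n \<Longrightarrow> Zn S E f n a \<le> ennreal (exp (5 * C + q * real n))"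
proof -
  define b where "b = (SOME a. a \<in> S)"
  have b: "b \<in> S" unfolding b_def using S(2) by (simp add: some_in_eq)
  obtain Lb where Lb: "(\<lambda>n. eln (Zn S E f (Suc n) b) / ereal (real (Suc n))) \<longlonglongrightarrow> Lb" "Lb \<noteq> - \<infinity>"
    using Zn_growth[OF b] by blast
  have g: "gpres_mixing S E f = Lb" unfolding gpres_mixing_def b_def[symmetric] by (rule limI[OF Lb(1)])
  then show "gpres_mixing S E f \<noteq> - \<infinity>" using Lb by simp
  fix a assume a: "a \<in> S"
  obtain La where La: "(\<lambda>n. eln (Zn S E f (Suc n) a) / ereal (real (Suc n))) \<longlonglongrightarrow> La"
    "\<And>q n. La \<le> ereal q \<Longrightarrow> 1 \<le> n \<Longrightarrow> Zn S E f n a \<le> ennreal (exp (5 * C + q * real n))"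
    using Zn_growth[OF a] by blast
  have "La = Lb" using Zn_limit_indep[OF a La(1) b Lb(1)] Zn_limit_indep[OF b Lb(1) a La(1)] by (rule antisym)
  then show "(\<lambda>n. eln (Zn S E f (Suc n) a) / ereal (real (Suc n))) \<longlonglongrightarrow> gpres_mixing S E f"
    and "\<And>q n. gpres_mixing S E f \<le> ereal q \<Longrightarrow> 1 \<le> n \<Longrightarrow> Zn S E f n a \<le> ennreal (exp (5 * C + q * real n))"
    using La g by auto
qed

text \<open>With \<open>q1 < q0\<close> strictly between the growth rate of first returns and the
  pressure, the return sum at \<open>q0\<close> is dominated by a geometric series.\<close>

lemma first_returns_finite:
  assumes a: "a \<in> S" and P: "gpres_mixing S E f = ereal P"
    and spr: "limsup (\<lambda>n. eln (Zstar S E f (Suc n) a) / ereal (real (Suc n))) < gpres_mixing S E f"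
  shows "\<exists>q0<P. (\<integral>\<^sup>+v. ennreal (exp (birkhoff f (length v) (v\<^sup>\<omega>) - q0 * length v)) \<partial>count_space (first_returns S E a)) < \<infinity>"
proof -
  let ?B = "first_returns S E a"
  obtain q0 where q0: "limsup (\<lambda>n. eln (Zstar S E f (Suc n) a) / ereal (real (Suc n))) < ereal q0" "q0 < P"
    using ereal_dense2[OF spr] P by auto
  obtain q1 where q1: "limsup (\<lambda>n. eln (Zstar S E f (Suc n) a) / ereal (real (Suc n))) < ereal q1" "q1 < q0"
    using ereal_dense2[OF q0(1)] by auto
  have "\<forall>\<^sub>F n in sequentially. eln (Zstar S E f (Suc n) a) / ereal (real (Suc n)) < ereal q1"
    by (rule Limsup_lessD[OF q1(1)])
  then obtain N where N: "\<And>n. n \<ge> N \<Longrightarrow> eln (Zstar S E f (Suc n) a) / ereal (real (Suc n)) < ereal q1"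
    by (auto simp: eventually_sequentially)
  \<comment> \<open>Covers the finitely many lengths before the upper limit takes effect; there
    first returns are bounded by all loops.\<close>
  define K where "K = exp (5 * C + \<bar>P - q1\<bar> * real (Suc N))"
  have K1: "1 \<le> K" using A by (simp add: K_def)
  have bd: "Zstar S E f (Suc n) a \<le> ennreal (K * exp (q1 * real (Suc n)))" for n
  proof (cases "N \<le> n")
    case True
    have "eln (Zstar S E f (Suc n) a) \<le> ereal (q1 * Suc n)"
    proof (cases "eln (Zstar S E f (Suc n) a)")
      case (real t) then show ?thesis using N[OF True] by (simp add: divide_less_eq less_imp_le)
    next
      case PInf then show ?thesis using N[OF True] by simp
    qed simp
    then have "Zstar S E f (Suc n) a \<le> ennreal (exp (q1 * Suc n))" by (simp add: eln_le_iff)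
    also have "\<dots> \<le> ennreal (K * exp (q1 * real (Suc n)))" using K1 by (intro ennreal_leI) simp
    finally show ?thesis .
  next
    case False
    have "Zstar S E f (Suc n) a \<le> Zn S E f (Suc n) a"
      unfolding Zstar_paths[OF S(1) zero_less_Suc] Zn_paths[OF S(1) zero_less_Suc]
      by (intro nn_integral_count_space_inj_le[where j = id]) (auto simp: first_returns_def)
    also have "\<dots> \<le> ennreal (exp (5 * C + P * real (Suc n)))" using pressure_limit(3)[OF a, of P "Suc n"] P by simp
    also have "\<dots> \<le> ennreal (K * exp (q1 * real (Suc n)))"
    proof (rule ennreal_leI)
      have "(P - q1) * real (Suc n) \<le> \<bar>P - q1\<bar> * real (Suc N)" using False by (intro mult_mono) auto
      then show "exp (5 * C + P * real (Suc n)) \<le> K * exp (q1 * real (Suc n))"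
        by (simp add: K_def algebra_simps flip: exp_add)
    qed
    finally show ?thesis .
  qed
  have split: "ennreal (exp (birkhoff f (length v) (v\<^sup>\<omega>) - q0 * length v)) = (\<Sum>n. ennreal (exp (birkhoff f (length v) (v\<^sup>\<omega>) - q0 * length v)) * indicator {v. length v = Suc n} v)" if "v \<in> ?B" for v
  proof -
    have "v \<noteq> []" using that by (simp add: first_returns_def)
    then obtain m where m: "length v = Suc m" by (cases v) auto
    have "(\<Sum>n. ennreal (exp (birkhoff f (length v) (v\<^sup>\<omega>) - q0 * length v)) * indicator {v. length v = Suc n} v)
      = (\<Sum>n\<in>{m}. ennreal (exp (birkhoff f (length v) (v\<^sup>\<omega>) - q0 * length v)) * indicator {v. length v = Suc n} v)"
      by (rule suminf_finite) (auto simp: m indicator_def)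
    then show ?thesis using m by simp
  qed
  have "(\<integral>\<^sup>+v. ennreal (exp (birkhoff f (length v) (v\<^sup>\<omega>) - q0 * length v)) \<partial>count_space ?B)
     = (\<integral>\<^sup>+v. (\<Sum>n. ennreal (exp (birkhoff f (length v) (v\<^sup>\<omega>) - q0 * length v)) * indicator {v. length v = Suc n} v) \<partial>count_space ?B)"
    using split by (intro nn_integral_cong) simp
  also have "\<dots> = (\<Sum>n. \<integral>\<^sup>+v. ennreal (exp (birkhoff f (length v) (v\<^sup>\<omega>) - q0 * length v)) * indicator {v. length v = Suc n} v \<partial>count_space ?B)"
    by (rule nn_integral_suminf) simp
  also have "\<dots> = (\<Sum>n. Zstar S E f (Suc n) a * ennreal (exp (- q0 * real (Suc n))))"
  proof (rule suminf_cong)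
    fix n
    let ?Bn = "{c \<in> ?B. length c = Suc n}"
    have "(\<integral>\<^sup>+v. ennreal (exp (birkhoff f (length v) (v\<^sup>\<omega>) - q0 * length v)) * indicator {v. length v = Suc n} v \<partial>count_space ?B)
      = (\<integral>\<^sup>+v. ennreal (exp (birkhoff f (length v) (v\<^sup>\<omega>) - q0 * length v)) * indicator {v. length v = Suc n} v * indicator ?B v \<partial>count_space UNIV)"
      by (rule nn_integral_count_space_indicator) simp
    also have "\<dots> = (\<integral>\<^sup>+v. (ennreal (exp (birkhoff f (Suc n) (v\<^sup>\<omega>))) * ennreal (exp (- q0 * real (Suc n)))) * indicator ?Bn v \<partial>count_space UNIV)"
      by (intro nn_integral_cong) (auto simp: indicator_def ennreal_exp_mult)
    also have "\<dots> = (\<integral>\<^sup>+v. ennreal (exp (birkhoff f (Suc n) (v\<^sup>\<omega>))) * ennreal (exp (- q0 * real (Suc n))) \<partial>count_space ?Bn)"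
      by (rule nn_integral_count_space_indicator[symmetric]) simp
    also have "\<dots> = Zstar S E f (Suc n) a * ennreal (exp (- q0 * real (Suc n)))"
      by (simp add: Zstar_paths[OF S(1)] nn_integral_multc)
    finally show "(\<integral>\<^sup>+v. ennreal (exp (birkhoff f (length v) (v\<^sup>\<omega>) - q0 * length v)) * indicator {v. length v = Suc n} v \<partial>count_space ?B) = Zstar S E f (Suc n) a * ennreal (exp (- q0 * real (Suc n)))" .
  qed
  also have "\<dots> \<le> (\<Sum>n. ennreal (K * exp (q1 * real (Suc n))) * ennreal (exp (- q0 * real (Suc n))))"
    using bd by (intro suminf_le mult_right_mono) auto
  also have "\<dots> < \<infinity>" by (rule suminf_geometric_finite[OF q1(2)])
  finally show ?thesis using q0(2) by blast
qed

theorem spr_perturbation: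
  assumes P: "gpres_mixing S E f = ereal P" and spr: "spr_mixing S E f"
  shows "\<exists>a\<in>S. \<exists>C'>0. \<exists>\<epsilon>0>0. \<forall>g N. hoelder_const S E \<theta> N g \<and> (\<forall>x\<in>tms S E. \<bar>g x\<bar> \<le> N) \<longrightarrow>
     (\<exists>\<kappa>. \<forall>s. \<bar>s\<bar> * N \<le> \<epsilon>0 \<longrightarrow> (\<exists>K>0. \<forall>n. \<forall>x\<in>tms S E. x 0 = a \<longrightarrow>
        loop_sum S E (\<lambda>x. f x + s * g x) a n x \<le> ennreal (K * exp (real n * (P + s * \<kappa> + C' * N\<^sup>2 * s\<^sup>2)))))"
proof -
  obtain a where a: "a \<in> S" "limsup (\<lambda>n. eln (Zstar S E f (Suc n) a) / ereal (real (Suc n))) < gpres_mixing S E f"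
    using spr by (auto simp: spr_mixing_def)
  obtain x where x: "x \<in> tms S E" "x 0 = a" using point[OF a(1)] by blast
  obtain q0 where q0: "q0 < P" "(\<integral>\<^sup>+v. ennreal (exp (birkhoff f (length v) (v\<^sup>\<omega>) - q0 * length v)) \<partial>count_space (first_returns S E a)) < \<infinity>"
    using first_returns_finite[OF a(1) P a(2)] by blast
  show ?thesis
  proof (rule bexI[OF _ a(1)], rule perturbed_loop_sums[OF S(1) h q0(1) x q0(2)])
    fix q assume "P < q"
    then show "(\<Sum>n. Zn S E f (Suc n) a * ennreal (exp (- q * real (Suc n)))) < \<infinity>"
      using P by (intro Zn_series(1)[OF a(1) pressure_limit(1)[OF a(1)]]) simp
  next
    fix q assume "q < P"
    then show "(\<Sum>n. Zn S E f (Suc n) a * ennreal (exp (- q * real (Suc n)))) = \<infinity>"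
      using P by (intro Zn_series(2)[OF a(1) pressure_limit(1)[OF a(1)]]) simp
  qed
qed

end

section \<open>Entropy of invariant measures and the variational upper bound\<close>

lemma space_tms_measure: "space (tms_measure S E) = tms S E"
  unfolding tms_measure_def by (rule space_measure_of) auto

lemma sets_tms_measure: "sets (tms_measure S E) = sigma_sets (tms S E) {{x \<in> tms S E. \<forall>i<n. x i = w i} | n w. True}"
  unfolding tms_measure_def by (rule sets_measure_of) auto

definition coord_dep :: "(nat \<Rightarrow> 'v) set \<Rightarrow> nat \<Rightarrow> (nat \<Rightarrow> 'v) set \<Rightarrow> bool" where
  "coord_dep \<Omega> k A \<longleftrightarrow> (\<forall>x\<in>\<Omega>. \<forall>y\<in>\<Omega>. (\<forall>i<k. x i = y i) \<longrightarrow> x \<in> A \<longrightarrow> y \<in> A)"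

lemma coord_dep_mono: "coord_dep \<Omega> k A \<Longrightarrow> k \<le> l \<Longrightarrow> coord_dep \<Omega> l A"
  unfolding coord_dep_def by (meson order_less_le_trans)

text \<open>Over a countable alphabet there are countably many words of length \<open>k\<close>, so
  an arbitrary condition on \<open>k\<close> coordinates is a countable union of cylinders.\<close>

lemma coord_dep_sets:
  assumes S: "countable S" and A: "A \<subseteq> tms S E" and dep: "coord_dep (tms S E) k A"
  shows "A \<in> sets (tms_measure S E)"
proof -
  let ?cyl = "\<lambda>c. {x \<in> tms S E. \<forall>i<k. x i = c ! i}"
  have eq: "A = (\<Union>c\<in>prefix k ` A. ?cyl c)"
  proof (intro equalityI subsetI)
    fix x assume "x \<in> A" then show "x \<in> (\<Union>c\<in>prefix k ` A. ?cyl c)" using A by auto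
  next
    fix x assume "x \<in> (\<Union>c\<in>prefix k ` A. ?cyl c)"
    then obtain y where "y \<in> A" "x \<in> tms S E" "\<forall>i<k. x i = y i" by auto
    then show "x \<in> A" using dep A unfolding coord_dep_def by (metis subsetD)
  qed
  have c: "countable (prefix k ` A)"
  proof (rule countable_subset)
    show "prefix k ` A \<subseteq> lists S" using A tms_in by (fastforce simp: lists_eq_set)
  qed (use S in simp)
  have cs: "?cyl c \<in> sets (tms_measure S E)" for c
    unfolding sets_tms_measure by (rule sigma_sets.Basic) blast
  have "(\<Union>c\<in>prefix k ` A. ?cyl c) \<in> sets (tms_measure S E)"
    by (rule sets.countable_UN'[OF c]) (use cs in blast)
  then show ?thesis by (simp only: eq[symmetric])
qed

section \<open>Measurability and invariance under iterates of the shift\<close>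

locale inv_tms =
  fixes S :: "'v set" and E :: "'v \<Rightarrow> 'v \<Rightarrow> bool" and \<mu> :: "(nat \<Rightarrow> 'v) measure"
  assumes S: "countable S" and inv: "inv_prob S E \<mu>"

sublocale inv_tms \<subseteq> prob_space \<mu>
  using inv by (simp add: inv_prob_def)

context inv_tms
begin

lemma sets_mu: "sets \<mu> = sets (tms_measure S E)"
  using inv by (simp add: inv_prob_def)

lemma space_mu: "space \<mu> = tms S E"
  using sets_eq_imp_space_eq[OF sets_mu] by (simp add: space_tms_measure)

lemma dep_sets: "A \<subseteq> tms S E \<Longrightarrow> coord_dep (tms S E) k A \<Longrightarrow> A \<in> sets \<mu>"
  unfolding sets_mu by (rule coord_dep_sets[OF S])

lemma measurable_shift: "shift \<in> measurable \<mu> \<mu>"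
proof -
  have "shift \<in> measurable \<mu> (sigma (tms S E) {{x \<in> tms S E. \<forall>i<n. x i = w i} | n w. True})"
  proof (rule measurable_sigma_sets)
    show "sets (sigma (tms S E) {{x \<in> tms S E. \<forall>i<n. x i = w i} | n w. True}) = sigma_sets (tms S E) {{x \<in> tms S E. \<forall>i<n. x i = w i} | n w. True}"
      by (rule sets_measure_of) auto
    show "{{x \<in> tms S E. \<forall>i<n. x i = w i} | n w. True} \<subseteq> Pow (tms S E)" by auto
    show "shift \<in> space \<mu> \<rightarrow> tms S E" unfolding space_mu by (auto simp: tms_def shift_def)
    fix A assume "A \<in> {{x \<in> tms S E. \<forall>i<n. x i = w i} | n w. True}"
    then obtain n w where A: "A = {x \<in> tms S E. \<forall>i<n. x i = w i}" by blast
    show "shift -` A \<inter> space \<mu> \<in> sets \<mu>"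
    proof (rule dep_sets[of _ "Suc n"])
      show "coord_dep (tms S E) (Suc n) (shift -` A \<inter> space \<mu>)"
        unfolding coord_dep_def A space_mu by (auto simp: shift_def tms_def)
    qed (auto simp: space_mu)
  qed
  then show ?thesis
    by (subst measurable_cong_sets[OF refl sets_mu]) (simp add: tms_measure_def)
qed

lemma distr_shift: "distr \<mu> \<mu> shift = \<mu>"
  by (rule measure_eqI) (use inv measurable_shift in \<open>auto simp: emeasure_distr inv_prob_def\<close>)

lemma measurable_suffix: "suffix k \<in> measurable \<mu> \<mu>" and distr_suffix: "distr \<mu> \<mu> (suffix k) = \<mu>"
proof -
  have "(shift ^^ k) \<in> measurable \<mu> \<mu> \<and> distr \<mu> \<mu> (shift ^^ k) = \<mu>"
  proof (induction k)
    case 0 then show ?case using distr_id[of \<mu>] by (auto simp: id_def)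
  next
    case (Suc k)
    then have m: "(shift ^^ k) \<in> measurable \<mu> \<mu>" by simp
    have "distr \<mu> \<mu> (shift ^^ Suc k) = distr (distr \<mu> \<mu> (shift ^^ k)) \<mu> shift"
      by (subst distr_distr[OF measurable_shift m]) (simp add: comp_def)
    then show ?case using Suc measurable_comp[OF m measurable_shift] distr_shift by (simp add: comp_def)
  qed
  note * = this
  have eq: "suffix k = (shift ^^ k)" by (rule ext) (rule shift_funpow[symmetric])
  show "suffix k \<in> measurable \<mu> \<mu>" unfolding eq by (rule *[THEN conjunct1])
  show "distr \<mu> \<mu> (suffix k) = \<mu>" unfolding eq by (rule *[THEN conjunct2])
qed

lemma integrable_suffix:
  fixes f :: "_ \<Rightarrow> real"
  assumes "integrable \<mu> f" shows "integrable \<mu> (\<lambda>x. f (suffix k x))"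
  by (rule integrable_distr[OF measurable_suffix]) (simp only: distr_suffix assms)

lemma integral_suffix:
  fixes f :: "_ \<Rightarrow> real"
  assumes "integrable \<mu> f" shows "(\<integral>x. f (suffix k x) \<partial>\<mu>) = (\<integral>x. f x \<partial>\<mu>)"
proof -
  have "(\<integral>x. f x \<partial>distr \<mu> \<mu> (suffix k)) = (\<integral>x. f (suffix k x) \<partial>\<mu>)"
    by (rule integral_distr[OF measurable_suffix borel_measurable_integrable[OF assms]])
  then show ?thesis by (simp only: distr_suffix)
qed

lemma integrable_birkhoff:
  assumes "integrable \<mu> f"
  shows "integrable \<mu> (birkhoff f n)" "(\<integral>x. birkhoff f n x \<partial>\<mu>) = real n * (\<integral>x. f x \<partial>\<mu>)"
proof -
  have e: "birkhoff f n = (\<lambda>x. \<Sum>k<n. f (suffix k x))" by (rule ext) (rule birkhoff_suffix)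
  show "integrable \<mu> (birkhoff f n)" unfolding e
    by (rule Bochner_Integration.integrable_sum) (rule integrable_suffix[OF assms])
  show "(\<integral>x. birkhoff f n x \<partial>\<mu>) = real n * (\<integral>x. f x \<partial>\<mu>)"
    unfolding e by (subst Bochner_Integration.integral_sum[OF integrable_suffix[OF assms]])
      (simp add: integral_suffix[OF assms] del: suffix_nth)
qed

section \<open>Itineraries and the entropy of a finite partition\<close>

definition atom :: "(nat \<Rightarrow> 'v) set set \<Rightarrow> (nat \<Rightarrow> 'v) \<Rightarrow> (nat \<Rightarrow> 'v) set" where
  "atom P x = (THE A. A \<in> P \<and> x \<in> A)"

text \<open>The itinerary of \<open>x\<close> through the partition. Indexing the join by
  itineraries rather than by its cells makes product weights and concatenation easy to
  handle.\<close>

definition name :: "(nat \<Rightarrow> 'v) set set \<Rightarrow> nat \<Rightarrow> (nat \<Rightarrow> 'v) \<Rightarrow> (nat \<Rightarrow> 'v) set list" where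
  "name P n x = map (\<lambda>k. atom P (suffix k x)) [0..<n]"

definition names :: "(nat \<Rightarrow> 'v) set set \<Rightarrow> nat \<Rightarrow> (nat \<Rightarrow> 'v) set list set" where
  "names P n = {xs. set xs \<subseteq> P \<and> length xs = n}"

definition ncyl :: "(nat \<Rightarrow> 'v) set list \<Rightarrow> (nat \<Rightarrow> 'v) set" where
  "ncyl xs = {x \<in> space \<mu>. \<forall>k<length xs. suffix k x \<in> xs ! k}"

definition pm :: "(nat \<Rightarrow> 'v) set list \<Rightarrow> real" where
  "pm xs = measure \<mu> (ncyl xs)"

definition HP :: "(nat \<Rightarrow> 'v) set set \<Rightarrow> nat \<Rightarrow> real" where
  "HP P n = part_entropy \<mu> (join_part \<mu> P n)"

context
  fixes P :: "(nat \<Rightarrow> 'v) set set"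
  assumes P: "finite_partition \<mu> P"
begin

lemma P_facts: "finite P" "A \<in> P \<Longrightarrow> A \<in> sets \<mu>" "A \<in> P \<Longrightarrow> B \<in> P \<Longrightarrow> x \<in> A \<Longrightarrow> x \<in> B \<Longrightarrow> A = B"
  "x \<in> space \<mu> \<Longrightarrow> \<exists>A\<in>P. x \<in> A" "A \<in> P \<Longrightarrow> A \<subseteq> space \<mu>"
  using P unfolding finite_partition_def disjoint_def by blast+

lemma P_ne: "P \<noteq> {}" using P_facts(4) not_empty by blast

lemma atom_eq: "A \<in> P \<Longrightarrow> x \<in> A \<Longrightarrow> atom P x = A"
  unfolding atom_def using P_facts(3) by (intro the_equality) blast+

lemma atom_in: "x \<in> space \<mu> \<Longrightarrow> atom P x \<in> P \<and> x \<in> atom P x"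
  using P_facts(4) atom_eq by metis

lemma suffix_space: "x \<in> space \<mu> \<Longrightarrow> suffix k x \<in> space \<mu>"
  unfolding space_mu by (rule tms_suffix)

lemma name_in: "x \<in> space \<mu> \<Longrightarrow> name P n x \<in> names P n"
  using atom_in suffix_space by (auto simp: name_def names_def)

lemma ncyl_iff: assumes "x \<in> space \<mu>" "xs \<in> names P n" shows "x \<in> ncyl xs \<longleftrightarrow> xs = name P n x"
proof
  assume x: "x \<in> ncyl xs"
  show "xs = name P n x"
  proof (rule nth_equalityI)
    show "length xs = length (name P n x)" using assms by (simp add: names_def name_def)
    fix i assume i: "i < length xs"
    then have "xs ! i \<in> P" "suffix i x \<in> xs ! i" using assms x by (auto simp: names_def ncyl_def)
    then show "xs ! i = name P n x ! i" using assms i atom_eq by (simp add: name_def names_def)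
  qed
next
  assume "xs = name P n x"
  then show "x \<in> ncyl xs" using assms atom_in suffix_space by (auto simp: ncyl_def name_def)
qed

lemma finite_names: "finite (names P n)"
  unfolding names_def using finite_lists_length_eq[OF P_facts(1)] by simp

lemma ncyl_sets: assumes "set xs \<subseteq> P" shows "ncyl xs \<in> sets \<mu>"
proof -
  have s: "suffix k -` (xs ! k) \<inter> space \<mu> \<in> sets \<mu>" if "k < length xs" for k
  proof (rule measurable_sets[OF measurable_suffix])
    show "xs ! k \<in> sets \<mu>" using that assms nth_mem[OF that] by (intro P_facts(2)) blast
  qed
  show ?thesis
  proof (cases "xs = []")
    case False
    have e: "ncyl xs = (\<Inter>k\<in>{..<length xs}. suffix k -` (xs ! k) \<inter> space \<mu>) \<inter> space \<mu>"
      by (auto simp: ncyl_def)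
    have ne: "{..<length xs} \<noteq> {}" using False by (simp add: lessThan_empty_iff)
    have "(\<Inter>k\<in>{..<length xs}. suffix k -` (xs ! k) \<inter> space \<mu>) \<in> sets \<mu>"
      by (rule sets.finite_INT[OF finite_lessThan ne]) (rule s, simp)
    then show ?thesis unfolding e by (rule sets.Int) (rule sets.top)
  qed (simp add: ncyl_def)
qed

lemma sum_names_integral:
  shows "integrable \<mu> (\<lambda>x. g (name P n x))" "(\<Sum>xs\<in>names P n. pm xs * g xs) = (\<integral>x. (g (name P n x) :: real) \<partial>\<mu>)"
proof -
  have e: "(\<Sum>xs\<in>names P n. g xs * indicator (ncyl xs) x) = g (name P n x)" if "x \<in> space \<mu>" for x
  proof -
    have "(\<Sum>xs\<in>names P n. g xs * indicator (ncyl xs) x) = (\<Sum>xs\<in>names P n. if xs = name P n x then g xs else 0)"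
      using ncyl_iff[OF that] by (intro sum.cong) (auto simp: indicator_def)
    then show ?thesis using name_in[OF that] finite_names by simp
  qed
  have i: "integrable \<mu> (\<lambda>x. g xs * indicator (ncyl xs) x)" if "xs \<in> names P n" for xs
    using ncyl_sets[of xs] that by (auto simp: names_def emeasure_eq_measure)
  have "integrable \<mu> (\<lambda>x. \<Sum>xs\<in>names P n. g xs * indicator (ncyl xs) x)" using i by (rule Bochner_Integration.integrable_sum)
  then show "integrable \<mu> (\<lambda>x. g (name P n x))"
    using Bochner_Integration.integrable_cong[of \<mu> \<mu> "\<lambda>x. \<Sum>xs\<in>names P n. g xs * indicator (ncyl xs) x" "\<lambda>x. g (name P n x)", OF refl e] by blast
  have "(\<integral>x. g (name P n x) \<partial>\<mu>) = (\<integral>x. (\<Sum>xs\<in>names P n. g xs * indicator (ncyl xs) x) \<partial>\<mu>)"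
    using e by (intro Bochner_Integration.integral_cong) auto
  also have "\<dots> = (\<Sum>xs\<in>names P n. \<integral>x. g xs * indicator (ncyl xs) x \<partial>\<mu>)" by (rule Bochner_Integration.integral_sum) (rule i)
  also have "\<dots> = (\<Sum>xs\<in>names P n. pm xs * g xs)"
    using ncyl_sets by (intro sum.cong) (auto simp: names_def pm_def mult.commute)
  finally show "(\<Sum>xs\<in>names P n. pm xs * g xs) = (\<integral>x. g (name P n x) \<partial>\<mu>)" by simp
qed

lemma sum_pm: "(\<Sum>xs\<in>names P n. pm xs) = 1"
  using sum_names_integral(2)[where g = "\<lambda>_. 1" and n = n] by (simp add: prob_space)

text \<open>The join is a set, so different itineraries may yield the same cell; this happens only
  for the empty cell, whose summand vanishes.\<close>

lemma HP_names: "HP P n = (\<Sum>xs\<in>names P n. - (pm xs * ln (pm xs)))"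
proof -
  have "join_part \<mu> P n = ncyl ` names P n"
  proof (intro equalityI subsetI)
    fix C assume "C \<in> join_part \<mu> P n"
    then obtain A where A: "C = (\<Inter>k<n. (shift ^^ k) -` (A k)) \<inter> space \<mu>" "\<forall>k<n. A k \<in> P" by (auto simp: join_part_def)
    then have "C = ncyl (map A [0..<n])" "map A [0..<n] \<in> names P n"
      by (auto simp: ncyl_def shift_funpow names_def)
    then show "C \<in> ncyl ` names P n" by blast
  next
    fix C assume "C \<in> ncyl ` names P n"
    then obtain xs where xs: "C = ncyl xs" "set xs \<subseteq> P" "length xs = n" by (auto simp: names_def)
    then have "C = (\<Inter>k<n. (shift ^^ k) -` (xs ! k)) \<inter> space \<mu>" "\<forall>k<n. xs ! k \<in> P"
      by (auto simp: ncyl_def shift_funpow)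
    then show "C \<in> join_part \<mu> P n" unfolding join_part_def by blast
  qed
  then have "HP P n = - (\<Sum>C\<in>ncyl ` names P n. measure \<mu> C * ln (measure \<mu> C))"
    by (simp add: HP_def part_entropy_def)
  also have "(\<Sum>C\<in>ncyl ` names P n. measure \<mu> C * ln (measure \<mu> C)) = (\<Sum>xs\<in>names P n. pm xs * ln (pm xs))"
    unfolding pm_def
  proof (subst sum.reindex_nontrivial[OF finite_names])
    fix xs ys assume xy: "xs \<in> names P n" "ys \<in> names P n" "xs \<noteq> ys" "ncyl xs = ncyl ys"
    have "ncyl xs = {}"
    proof (rule ccontr)
      assume "ncyl xs \<noteq> {}"
      then obtain x where x: "x \<in> ncyl xs" by blast
      then have "x \<in> space \<mu>" by (simp add: ncyl_def)
      then show False using x xy ncyl_iff by metis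
    qed
    then show "measure \<mu> (ncyl xs) * ln (measure \<mu> (ncyl xs)) = 0" by simp
  qed simp
  finally show ?thesis by (simp add: sum_negf)
qed

lemma pm_bounds: "0 \<le> pm xs" "pm xs \<le> 1"
  by (auto simp: pm_def)

lemma HP_nonneg: "0 \<le> HP P n"
  unfolding HP_names
proof (rule sum_nonneg)
  fix xs assume "xs \<in> names P n"
  show "0 \<le> - (pm xs * ln (pm xs))" 
    by (cases "pm xs = 0") (use pm_bounds[of xs] in \<open>auto simp: mult_nonneg_nonpos\<close>)
qed

text \<open>Gibbs' inequality, from \<open>ln t \<le> t - 1\<close>. Every entropy bound from above
  below is obtained by choosing suitable trial weights \<open>r\<close> of total mass at most
  one.\<close>

lemma HP_gibbs:
  assumes r: "\<And>xs. xs \<in> names P n \<Longrightarrow> pm xs \<noteq> 0 \<Longrightarrow> 0 < r xs" "\<And>xs. xs \<in> names P n \<Longrightarrow> 0 \<le> r xs"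
    and sum: "(\<Sum>xs\<in>names P n. r xs) \<le> 1"
  shows "HP P n \<le> (\<integral>x. - ln (r (name P n x)) \<partial>\<mu>)"
proof -
  have "HP P n - (\<Sum>xs\<in>names P n. pm xs * (- ln (r xs))) = (\<Sum>xs\<in>names P n. pm xs * (ln (r xs) - ln (pm xs)))"
    unfolding HP_names by (simp add: sum_subtractf[symmetric] algebra_simps)
  also have "\<dots> \<le> (\<Sum>xs\<in>names P n. r xs - pm xs)"
  proof (rule sum_mono)
    fix xs assume xs: "xs \<in> names P n"
    show "pm xs * (ln (r xs) - ln (pm xs)) \<le> r xs - pm xs"
    proof (cases "pm xs = 0")
      case False
      then have p: "0 < pm xs" "0 < r xs" using pm_bounds[of xs] r(1)[OF xs] by auto
      have "ln (r xs) - ln (pm xs) = ln (r xs / pm xs)" using p by (simp add: ln_div)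
      also have "\<dots> \<le> r xs / pm xs - 1" using p by (intro ln_le_minus_one) simp
      finally have "pm xs * (ln (r xs) - ln (pm xs)) \<le> pm xs * (r xs / pm xs - 1)" using p by (intro mult_left_mono) auto
      then show ?thesis using p by (simp add: algebra_simps)
    qed (use r(2)[OF xs] in simp)
  qed
  also have "\<dots> \<le> 0" using sum sum_pm[of n] by (simp add: sum_subtractf)
  finally show ?thesis using sum_names_integral(2)[where g = "\<lambda>xs. - ln (r xs)" and n = n] by simp
qed

lemma sum_names_append:
  "(\<Sum>xs\<in>names P (m + n). F (take m xs) * G (drop m xs)) = (\<Sum>xs\<in>names P m. F xs) * (\<Sum>ys\<in>names P n. (G ys :: real))"
proof -
  have "(\<Sum>xs\<in>names P m. F xs) * (\<Sum>ys\<in>names P n. G ys) = (\<Sum>(xs, ys)\<in>names P m \<times> names P n. F xs * G ys)"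
    by (simp add: sum_product sum.cartesian_product)
  also have "\<dots> = (\<Sum>xs\<in>names P (m + n). F (take m xs) * G (drop m xs))"
    by (rule sum.reindex_bij_witness[of _ "\<lambda>xs. (take m xs, drop m xs)" "\<lambda>(xs, ys). xs @ ys"])
      (auto simp: names_def dest: in_set_takeD in_set_dropD)
  finally show ?thesis by simp
qed

lemma HP_eq_integral: "HP P n = (\<integral>x. - ln (pm (name P n x)) \<partial>\<mu>)"
  using sum_names_integral(2)[where g = "\<lambda>xs. - ln (pm xs)" and n = n] by (simp add: HP_names)

lemma name_take_drop: "take m (name P (m + n) x) = name P m x" "drop m (name P (m + n) x) = name P n (suffix m x)"
  by (auto simp: name_def take_map drop_map intro!: nth_equalityI)

text \<open>Gibbs' inequality with the product of the weights of the two parts of the itinerary.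
  Invariance of the measure identifies the weight of the second part and keeps it positive wherever
  \<open>pm\<close> is.\<close>

lemma HP_subadd: "HP P (m + n) \<le> HP P m + HP P n"
proof -
  define r where "r = (\<lambda>xs. pm (take m xs) * pm (drop m xs))"
  have pos: "0 < pm (take m xs)" "0 < pm (drop m xs)" if xs: "xs \<in> names P (m + n)" and p: "pm xs \<noteq> 0" for xs
  proof -
    have px: "0 < pm xs" using p pm_bounds[of xs] by simp
    have sub: "set (take m xs) \<subseteq> P" "set (drop m xs) \<subseteq> P" using xs by (auto simp: names_def dest: in_set_takeD in_set_dropD)
    have "ncyl xs \<subseteq> ncyl (take m xs)"
    proof
      fix x assume "x \<in> ncyl xs"
      then show "x \<in> ncyl (take m xs)" unfolding ncyl_def by simp
    qed
    then have "pm xs \<le> pm (take m xs)"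
      unfolding pm_def using ncyl_sets[OF sub(1)] by (rule finite_measure_mono)
    then show "0 < pm (take m xs)" using px by linarith
    have "ncyl xs \<subseteq> suffix m -` ncyl (drop m xs) \<inter> space \<mu>"
    proof
      fix x assume x: "x \<in> ncyl xs"
      then have "x \<in> space \<mu>" by (simp add: ncyl_def)
      moreover have "suffix k (suffix m x) \<in> drop m xs ! k" if "k < length (drop m xs)" for k
        using x that unfolding ncyl_def by simp
      ultimately show "x \<in> suffix m -` ncyl (drop m xs) \<inter> space \<mu>"
        using suffix_space[of x m] unfolding ncyl_def by blast
    qed
    then have "pm xs \<le> measure \<mu> (suffix m -` ncyl (drop m xs) \<inter> space \<mu>)"
      unfolding pm_def using ncyl_sets[OF sub(2)] measurable_suffix[of m]
      by (intro finite_measure_mono measurable_sets) auto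
    also have "\<dots> = measure (distr \<mu> \<mu> (suffix m)) (ncyl (drop m xs))"
      using ncyl_sets[OF sub(2)] measurable_suffix[of m] by (simp add: measure_distr)
    also have "\<dots> = pm (drop m xs)" by (simp add: distr_suffix pm_def)
    finally show "0 < pm (drop m xs)" using px by linarith
  qed
  have "HP P (m + n) \<le> (\<integral>x. - ln (r (name P (m + n) x)) \<partial>\<mu>)"
  proof (rule HP_gibbs)
    show "0 < r xs" if "xs \<in> names P (m + n)" "pm xs \<noteq> 0" for xs using pos[OF that] by (simp add: r_def)
    show "0 \<le> r xs" for xs using pm_bounds by (simp add: r_def)
    show "(\<Sum>xs\<in>names P (m + n). r xs) \<le> 1" unfolding r_def sum_names_append by (simp add: sum_pm)
  qed
  also have "\<dots> = (\<Sum>xs\<in>names P (m + n). pm xs * (- ln (r xs)))"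
    by (rule sum_names_integral(2)[symmetric])
  also have "\<dots> = (\<Sum>xs\<in>names P (m + n). pm xs * (- ln (pm (take m xs)) - ln (pm (drop m xs))))"
  proof (rule sum.cong[OF refl])
    fix xs assume "xs \<in> names P (m + n)"
    then show "pm xs * (- ln (r xs)) = pm xs * (- ln (pm (take m xs)) - ln (pm (drop m xs)))"
      using pos[of xs] by (cases "pm xs = 0") (auto simp: r_def ln_mult)
  qed
  also have "\<dots> = (\<integral>x. - ln (pm (take m (name P (m + n) x))) - ln (pm (drop m (name P (m + n) x))) \<partial>\<mu>)"
    by (rule sum_names_integral(2))
  also have "\<dots> = (\<integral>x. - ln (pm (name P m x)) + - ln (pm (name P n (suffix m x))) \<partial>\<mu>)"
    by (simp add: name_take_drop)
  also have "\<dots> = HP P m + HP P n"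
    using sum_names_integral(1)[where g = "\<lambda>xs. - ln (pm xs)"]
      integrable_suffix[OF sum_names_integral(1)[where g = "\<lambda>xs. - ln (pm xs)"]]
      integral_suffix[OF sum_names_integral(1)[where g = "\<lambda>xs. - ln (pm xs)"]]
    by (subst Bochner_Integration.integral_add) (auto simp: HP_eq_integral)
  finally show ?thesis .
qed

text \<open>Fekete's lemma applied to \<open>exp (- HP P n)\<close>; it shows that the
  \<open>lim\<close> in the definition of the entropy is a genuine limit.\<close>

lemma entropy_tendsto: "(\<lambda>n. HP P (Suc n) / real (Suc n)) \<longlonglongrightarrow> entropy_wrt \<mu> P"
proof -
  define z where "z = (\<lambda>n. ennreal (exp (- HP P n)))"
  have eln: "eln (z (Suc n)) / ereal (real (Suc n)) = ereal (- HP P (Suc n) / real (Suc n))" for n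
    by (simp add: z_def eln_def)
  define L where "L = (SUP n. eln (z (Suc n)) / ereal (real (Suc n)))"
  have lim: "(\<lambda>n. eln (z (Suc n)) / ereal (real (Suc n))) \<longlonglongrightarrow> L"
    unfolding L_def
  proof (rule fekete[where ?n0.0 = 0])
    show "z m * z n \<le> z (m + n)" for m n
      unfolding z_def ennreal_exp_mult using HP_subadd[of m n] by (intro ennreal_leI) simp
  qed (simp add: z_def)
  have "L \<le> ereal 0" unfolding L_def eln
    by (rule SUP_least) (use HP_nonneg in \<open>auto simp: divide_nonneg_nonneg\<close>)
  moreover have "ereal (- HP P 1 / 1) \<le> L" unfolding L_def eln by (rule SUP_upper2[of 0]) auto
  ultimately obtain l where "L = ereal l" by (cases L) auto
  then have "(\<lambda>n. ereal (- HP P (Suc n) / real (Suc n))) \<longlonglongrightarrow> ereal l" using lim by (simp only: eln)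
  then have "(\<lambda>n. - HP P (Suc n) / real (Suc n)) \<longlonglongrightarrow> l" by (simp only: lim_ereal)
  then have t: "(\<lambda>n. HP P (Suc n) / real (Suc n)) \<longlonglongrightarrow> - l" using tendsto_minus by fastforce
  then have "entropy_wrt \<mu> P = - l" unfolding entropy_wrt_def HP_def by (rule limI)
  then show ?thesis using t by simp
qed

end

end

section \<open>Approximation of partitions and words by finite data\<close>

context inv_tms
begin

text \<open>Induction over the generated sigma-algebra. For a countable union, half of the error
  pays for truncating the union and the other half is spread evenly over the sets that
  remain.\<close>

lemma approx_coord_dep:
  assumes "A \<in> sets \<mu>" "0 < (\<epsilon>::real)"
  shows "\<exists>k A'. A' \<in> sets \<mu> \<and> coord_dep (tms S E) k A' \<and> measure \<mu> ((A - A') \<union> (A' - A)) < \<epsilon>"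
proof -
  have "A \<in> sigma_sets (tms S E) {{x \<in> tms S E. \<forall>i<n. x i = w i} | n w. True}"
    using assms(1) unfolding sets_mu sets_tms_measure .
  then show ?thesis using assms(2)
  proof (induction arbitrary: \<epsilon> rule: sigma_sets.induct)
    case (Basic a)
    then obtain n w where a: "a = {x \<in> tms S E. \<forall>i<n. x i = w i}" by blast
    have d: "coord_dep (tms S E) n a" unfolding coord_dep_def a by auto
    then have "a \<in> sets \<mu>" by (rule dep_sets[rotated]) (auto simp: a)
    then show ?case using d Basic.prems by (intro exI[of _ n] exI[of _ a]) auto
  next
    case Empty
    show ?case using Empty by (intro exI[of _ 0] exI[of _ "{}"]) (auto simp: coord_dep_def)
  next
    case (Compl a)
    then obtain k A' where A': "A' \<in> sets \<mu>" "coord_dep (tms S E) k A'" "measure \<mu> ((a - A') \<union> (A' - a)) < \<epsilon>" by blast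
    have a: "a \<in> sets \<mu>" using Compl.hyps unfolding sets_mu sets_tms_measure .
    have "a \<subseteq> tms S E" "A' \<subseteq> tms S E" using sets.sets_into_space[OF a] sets.sets_into_space[OF A'(1)] by (auto simp: space_mu)
    then have "(tms S E - a - (tms S E - A')) \<union> (tms S E - A' - (tms S E - a)) = (a - A') \<union> (A' - a)" by blast
    moreover have "tms S E - A' \<in> sets \<mu>" using sets.compl_sets[OF A'(1)] by (simp add: space_mu)
    moreover have "coord_dep (tms S E) k (tms S E - A')" using A'(2) unfolding coord_dep_def by (metis DiffD1 DiffD2 DiffI)
    ultimately show ?case using A'(3) by metis
  next
    case (Union a)
    have a: "a i \<in> sets \<mu>" for i using Union.hyps unfolding sets_mu sets_tms_measure .
    have "(\<lambda>n. measure \<mu> (\<Union>i<n. a i)) \<longlonglongrightarrow> measure \<mu> (\<Union>n. \<Union>i<n. a i)"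
      using a by (intro finite_Lim_measure_incseq) (auto simp: incseq_def, meson lessThan_iff order_less_le_trans)
    moreover have "(\<Union>n. \<Union>i<n. a i) = (\<Union>i. a i)" by blast
    ultimately have lim: "(\<lambda>n. measure \<mu> (\<Union>i<n. a i)) \<longlonglongrightarrow> measure \<mu> (\<Union>i. a i)" by simp
    have "\<forall>\<^sub>F n in sequentially. measure \<mu> (\<Union>i. a i) - \<epsilon> / 2 < measure \<mu> (\<Union>i<n. a i)"
      using Union.prems by (intro order_tendstoD(1)[OF lim]) simp
    then obtain n where n: "measure \<mu> (\<Union>i. a i) - \<epsilon> / 2 < measure \<mu> (\<Union>i<n. a i)" by (auto simp: eventually_sequentially)
    define e where "e = \<epsilon> / (2 * real (Suc n))"
    have e: "0 < e" using Union.prems by (simp add: e_def)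
    have "\<forall>i. \<exists>k A'. A' \<in> sets \<mu> \<and> coord_dep (tms S E) k A' \<and> measure \<mu> ((a i - A') \<union> (A' - a i)) < e"
      using Union.IH[OF e] by blast
    then obtain k A' where A': "\<And>i. A' i \<in> sets \<mu>" "\<And>i. coord_dep (tms S E) (k i) (A' i)" "\<And>i. measure \<mu> ((a i - A' i) \<union> (A' i - a i)) < e"
      by metis
    define K where "K = Max (insert 0 (k ` {..<n}))"
    have K: "k i \<le> K" if "i < n" for i unfolding K_def using that by (intro Max_ge) auto
    let ?A = "\<Union>i<n. A' i"
    have dep: "coord_dep (tms S E) K ?A"
      unfolding coord_dep_def
    proof (intro ballI impI)
      fix x y assume xy: "x \<in> tms S E" "y \<in> tms S E" "\<forall>i<K. x i = y i" "x \<in> ?A"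
      then obtain i where i: "i < n" "x \<in> A' i" by blast
      then have "y \<in> A' i" using coord_dep_mono[OF A'(2) K[OF i(1)]] xy unfolding coord_dep_def by blast
      then show "y \<in> ?A" using i by blast
    qed
    let ?T = "(\<Union>i. a i) - (\<Union>i<n. a i)"
    have s1: "?T \<in> sets \<mu>" using a by auto
    have s2: "(a i - A' i) \<union> (A' i - a i) \<in> sets \<mu>" for i using a A'(1) by auto
    have "measure \<mu> (((\<Union>i. a i) - ?A) \<union> (?A - (\<Union>i. a i))) \<le> measure \<mu> (?T \<union> (\<Union>i<n. (a i - A' i) \<union> (A' i - a i)))"
      using s1 s2 by (intro finite_measure_mono) auto
    also have "\<dots> \<le> measure \<mu> ?T + measure \<mu> (\<Union>i<n. (a i - A' i) \<union> (A' i - a i))"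
      using s1 s2 by (intro measure_Un_le) auto
    also have "measure \<mu> ?T = measure \<mu> (\<Union>i. a i) - measure \<mu> (\<Union>i<n. a i)"
      using a by (intro finite_measure_Diff) auto
    also have "measure \<mu> (\<Union>i<n. (a i - A' i) \<union> (A' i - a i)) \<le> (\<Sum>i<n. measure \<mu> ((a i - A' i) \<union> (A' i - a i)))"
      using s2 by (intro finite_measure_subadditive_finite) auto
    also have "\<dots> \<le> (\<Sum>i<n. e)" using A'(3) by (intro sum_mono) (simp add: less_imp_le)
    also have "\<dots> \<le> \<epsilon> / 2" using Union.prems by (simp add: e_def field_simps)
    finally have "measure \<mu> (((\<Union>i. a i) - ?A) \<union> (?A - (\<Union>i. a i))) < \<epsilon>" using n by linarith
    moreover have "?A \<in> sets \<mu>" using A'(1) by auto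
    ultimately show ?case using dep by blast
  qed
qed

text \<open>Continuity of the measure along an exhaustion of the countable range; used to replace
  infinitely many vertices or words by finitely many up to small measure.\<close>

lemma finite_range_approx:
  assumes c: "countable C" and g: "\<And>x. x \<in> space \<mu> \<Longrightarrow> g x \<in> C" and m: "\<And>c. {x \<in> space \<mu>. g x = c} \<in> sets \<mu>"
    and e: "0 < (\<epsilon>::real)"
  shows "\<exists>F. finite F \<and> F \<subseteq> C \<and> 1 - \<epsilon> \<le> measure \<mu> {x \<in> space \<mu>. g x \<in> F}"
proof -
  have ne: "C \<noteq> {}" using g not_empty by blast
  define F where "F = (\<lambda>n::nat. from_nat_into C ` {..<n})"
  have F: "finite (F n)" "F n \<subseteq> C" for n using from_nat_into[OF ne] by (auto simp: F_def)
  have s: "{x \<in> space \<mu>. g x \<in> F n} \<in> sets \<mu>" for n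
  proof -
    have "{x \<in> space \<mu>. g x \<in> F n} = (\<Union>c\<in>F n. {x \<in> space \<mu>. g x = c})" by blast
    then show ?thesis using m F(1)[of n] by (metis (no_types, lifting) sets.finite_UN)
  qed
  have "(\<lambda>n. measure \<mu> {x \<in> space \<mu>. g x \<in> F n}) \<longlonglongrightarrow> measure \<mu> (\<Union>n. {x \<in> space \<mu>. g x \<in> F n})"
    using s by (intro finite_Lim_measure_incseq) (auto simp: incseq_def F_def)
  moreover have "(\<Union>n. {x \<in> space \<mu>. g x \<in> F n}) = space \<mu>"
  proof -
    have "\<exists>n. g x \<in> F n" if x: "x \<in> space \<mu>" for x
    proof -
      obtain k where "from_nat_into C k = g x" using from_nat_into_surj[OF c g[OF x]] by blast
      then show ?thesis by (intro exI[of _ "Suc k"]) (auto simp: F_def intro!: image_eqI[of _ _ k])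
    qed
    then show ?thesis by auto
  qed
  ultimately have "(\<lambda>n. measure \<mu> {x \<in> space \<mu>. g x \<in> F n}) \<longlonglongrightarrow> 1" by (simp add: prob_space)
  then have "\<forall>\<^sub>F n in sequentially. 1 - \<epsilon> < measure \<mu> {x \<in> space \<mu>. g x \<in> F n}"
    using e by (intro order_tendstoD(1)) auto
  then obtain n where "1 - \<epsilon> < measure \<mu> {x \<in> space \<mu>. g x \<in> F n}" by (auto simp: eventually_sequentially)
  then show ?thesis using F[of n] by (intro exI[of _ "F n"]) auto
qed

lemma coord_sets: "{x \<in> space \<mu>. Q (x k)} \<in> sets \<mu>"
  by (rule dep_sets[of _ "Suc k"]) (auto simp: coord_dep_def space_mu)

lemma word_sets: "{x \<in> space \<mu>. Q (prefix k x) (x k)} \<in> sets \<mu>"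
proof (rule dep_sets[of _ "Suc k"])
  have "prefix k x = prefix k y" if "\<forall>i<Suc k. x i = y i" for x y :: "nat \<Rightarrow> 'v"
    using that by (auto simp: subsequence_def)
  then show "coord_dep (tms S E) (Suc k) {x \<in> space \<mu>. Q (prefix k x) (x k)}"
    unfolding coord_dep_def space_mu by (metis (mono_tags, lifting) lessI mem_Collect_eq)
qed (auto simp: space_mu)

lemma sum_names_prod:
  fixes G :: "nat \<Rightarrow> (nat \<Rightarrow> 'v) set \<Rightarrow> real"
  assumes "finite P" "\<And>l A. A \<in> P \<Longrightarrow> 0 \<le> G l A" "\<And>l. (\<Sum>A\<in>P. G l A) \<le> 1"
  shows "(\<Sum>xs\<in>names P n. \<Prod>l<n. G l (xs ! l)) \<le> 1"
proof (induction n)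
  case 0
  have "names P 0 = {[]}" by (auto simp: names_def)
  then show ?case by simp
next
  case (Suc n)
  have "(\<Sum>xs\<in>names P (Suc n). \<Prod>l<Suc n. G l (xs ! l)) = (\<Sum>(xs, A)\<in>names P n \<times> P. (\<Prod>l<n. G l (xs ! l)) * G n A)"
  proof (rule sum.reindex_bij_witness[of _ "\<lambda>(xs, A). xs @ [A]" "\<lambda>xs. (butlast xs, last xs)"])
    fix xs assume "xs \<in> names P (Suc n)"
    then have xs: "set xs \<subseteq> P" "length xs = Suc n" by (auto simp: names_def)
    then have ne: "xs \<noteq> []" by auto
    show "(case (butlast xs, last xs) of (xs, A) \<Rightarrow> xs @ [A]) = xs" using ne by simp
    show "(butlast xs, last xs) \<in> names P n \<times> P" using xs ne by (auto simp: names_def dest: in_set_butlastD)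
    have "last xs = xs ! n" using xs ne by (simp add: last_conv_nth)
    then show "(case (butlast xs, last xs) of (xs, A) \<Rightarrow> (\<Prod>l<n. G l (xs ! l)) * G n A) = (\<Prod>l<Suc n. G l (xs ! l))"
      using xs by (simp add: nth_butlast)
  qed (auto simp: names_def nth_append)
  also have "\<dots> = (\<Sum>xs\<in>names P n. \<Prod>l<n. G l (xs ! l)) * (\<Sum>A\<in>P. G n A)"
    by (simp add: sum_product sum.cartesian_product)
  also have "\<dots> \<le> 1 * 1"
    using Suc assms by (intro mult_mono sum_nonneg) auto
  finally show ?case by simp
qed

text \<open>\<open>R\<close> predicts the atom of a point from its first \<open>k\<close> symbols
  and is wrong only on \<open>Bad\<close>, the union of the approximation errors of the
  atoms.\<close>

lemma partition_approx:
  assumes P: "finite_partition \<mu> P" and \<delta>: "0 < (\<delta>::real)"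
  shows "\<exists>k R Bad. (\<forall>x\<in>tms S E. \<forall>y\<in>tms S E. (\<forall>i<k. x i = y i) \<longrightarrow> R x = R y) \<and> (\<forall>x. R x \<in> P) \<and> Bad \<in> sets \<mu> \<and>
    measure \<mu> Bad \<le> \<delta> \<and> (\<forall>x\<in>space \<mu>. x \<notin> Bad \<longrightarrow> R x = atom P x)"
proof -
  note Pf = P_facts[OF P]
  have ne: "P \<noteq> {}" by (rule P_ne[OF P])
  define e where "e = \<delta> / real (card P)"
  have cP: "0 < card P" using ne Pf(1) by (simp add: card_gt_0_iff)
  have e: "0 < e" using \<delta> cP by (simp add: e_def)
  have "\<forall>B. \<exists>k A'. B \<in> P \<longrightarrow> A' \<in> sets \<mu> \<and> coord_dep (tms S E) k A' \<and> measure \<mu> ((B - A') \<union> (A' - B)) < e"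
    using approx_coord_dep[OF Pf(2) e] by blast
  then obtain k A' where A': "\<And>B. B \<in> P \<Longrightarrow> A' B \<in> sets \<mu>" "\<And>B. B \<in> P \<Longrightarrow> coord_dep (tms S E) (k B) (A' B)"
    "\<And>B. B \<in> P \<Longrightarrow> measure \<mu> ((B - A' B) \<union> (A' B - B)) < e" by metis
  define K where "K = Max (k ` P)"
  have K: "k B \<le> K" if "B \<in> P" for B unfolding K_def using that Pf(1) by (intro Max_ge) auto
  \<comment> \<open>The approximating sets need not be disjoint or cover the space. The choice
    depends on \<open>x\<close> only through its memberships in them, hence only on finitely many
    symbols, and off \<open>Bad\<close> just one of them contains \<open>x\<close>.\<close>
  define R where "R = (\<lambda>x. SOME B. B \<in> P \<and> (x \<in> A' B \<or> \<not> (\<exists>B'\<in>P. x \<in> A' B')))"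
  define Bad where "Bad = (\<Union>B\<in>P. (B - A' B) \<union> (A' B - B))"
  have Rex: "\<exists>B. B \<in> P \<and> (x \<in> A' B \<or> \<not> (\<exists>B'\<in>P. x \<in> A' B'))" for x using ne by blast
  have RP: "R x \<in> P" "R x \<in> P \<and> (x \<in> A' (R x) \<or> \<not> (\<exists>B'\<in>P. x \<in> A' B'))" for x
    using someI_ex[OF Rex[of x]] unfolding R_def by blast+
  have Rdep: "R x = R y" if "x \<in> tms S E" "y \<in> tms S E" "\<forall>i<K. x i = y i" for x y
  proof -
    have "x \<in> A' B \<longleftrightarrow> y \<in> A' B" if "B \<in> P" for B
      using coord_dep_mono[OF A'(2)[OF that] K[OF that]] \<open>x \<in> tms S E\<close> \<open>y \<in> tms S E\<close> \<open>\<forall>i<K. x i = y i\<close>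
      unfolding coord_dep_def by metis
    then have "(\<lambda>B. B \<in> P \<and> (x \<in> A' B \<or> \<not> (\<exists>B'\<in>P. x \<in> A' B'))) = (\<lambda>B. B \<in> P \<and> (y \<in> A' B \<or> \<not> (\<exists>B'\<in>P. y \<in> A' B')))" by (auto simp: fun_eq_iff)
    then show ?thesis by (simp add: R_def)
  qed
  have s: "(B - A' B) \<union> (A' B - B) \<in> sets \<mu>" if "B \<in> P" for B using Pf(2)[OF that] A'(1)[OF that] by auto
  have Bs: "Bad \<in> sets \<mu>" unfolding Bad_def using s Pf(1) by (intro sets.finite_UN) auto
  have "measure \<mu> Bad \<le> (\<Sum>B\<in>P. measure \<mu> ((B - A' B) \<union> (A' B - B)))"
    unfolding Bad_def using s Pf(1) by (intro finite_measure_subadditive_finite) auto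
  also have "\<dots> \<le> (\<Sum>B\<in>P. e)" using A'(3) by (intro sum_mono) (simp add: less_imp_le)
  also have "\<dots> = \<delta>" using cP by (simp add: e_def)
  finally have Bm: "measure \<mu> Bad \<le> \<delta>" .
  have "R x = atom P x" if x: "x \<in> space \<mu>" "x \<notin> Bad" for x
  proof -
    have a: "atom P x \<in> P" "x \<in> atom P x" using atom_in[OF P x(1)] by auto
    have iff: "x \<in> A' B \<longleftrightarrow> x \<in> B" if "B \<in> P" for B using x(2) that unfolding Bad_def by blast
    then have "x \<in> R x" using RP(2)[of x] a by blast
    then show ?thesis using atom_eq[OF P RP(1)] by simp
  qed
  note Req = this
  show ?thesis
  proof (rule exI[of _ K], rule exI[of _ R], rule exI[of _ Bad], intro conjI ballI allI impI)
    show "R x = R y" if "x \<in> tms S E" "y \<in> tms S E" "\<forall>i<K. x i = y i" for x y by (rule Rdep[OF that])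
    show "R x = atom P x" if "x \<in> space \<mu>" "x \<notin> Bad" for x by (rule Req[OF that])
  qed (rule RP(1) Bs Bm)+
qed

section \<open>Entropy plus integral is bounded by the growth rate of path sums\<close>

lemma word_weight_sum:
  assumes F: "finite F" and D: "finite D" and Kpos: "\<And>a b. 0 \<le> K a b"
    and DF: "\<And>c b. (c, b) \<in> D \<Longrightarrow> \<exists>a\<in>F. b \<in> F \<and> c \<in> paths S E a b n" and n: "0 < n"
    and bound: "\<And>a b W. a \<in> F \<Longrightarrow> b \<in> F \<Longrightarrow> finite W \<Longrightarrow> W \<subseteq> paths S E a b n \<Longrightarrow> (\<Sum>c\<in>W. w c b) \<le> K a b * (e::real)"
  shows "(\<Sum>(c, b)\<in>D. w c b) \<le> (\<Sum>a\<in>F. \<Sum>b\<in>F. K a b) * e"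
proof -
  \<comment> \<open>For \<open>n > 0\<close> the starting vertex is the head of the word, so the
    pairs can be grouped by both end points.\<close>
  have im: "(\<lambda>(c, b). (hd c, b)) ` D \<subseteq> F \<times> F"
  proof (clarsimp)
    fix c b assume "(c, b) \<in> D"
    then obtain a where "a \<in> F" "b \<in> F" "c \<in> paths S E a b n" using DF by blast
    then show "hd c \<in> F \<and> b \<in> F" using n by (auto simp: paths_def hd_append split: if_splits)
  qed
  have "(\<Sum>(c, b)\<in>D. w c b) = (\<Sum>p\<in>F \<times> F. \<Sum>q\<in>{q\<in>D. (\<lambda>(c, b). (hd c, b)) q = p}. (\<lambda>(c, b). w c b) q)"
    by (rule sum.group[symmetric, OF D _ im]) (use F in simp)
  also have "\<dots> \<le> (\<Sum>p\<in>F \<times> F. (\<lambda>(a, b). K a b * e) p)"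
  proof (rule sum_mono)
    fix p assume "p \<in> F \<times> F"
    then obtain a b where p: "p = (a, b)" "a \<in> F" "b \<in> F" by auto
    let ?Q = "{q\<in>D. (\<lambda>(c, b). (hd c, b)) q = p}"
    have "(\<Sum>q\<in>?Q. (\<lambda>(c, b). w c b) q) = (\<Sum>c\<in>fst ` ?Q. w c b)"
      by (subst sum.reindex) (auto simp: inj_on_def p split: prod.splits intro!: sum.cong)
    also have "\<dots> \<le> K a b * e"
    proof (rule bound[OF p(2,3)])
      show "finite (fst ` ?Q)" using D by simp
      show "fst ` ?Q \<subseteq> paths S E a b n"
      proof
        fix c assume "c \<in> fst ` ?Q"
        then have c: "(c, b) \<in> D" "hd c = a" by (auto simp: p)
        then obtain a' where "c \<in> paths S E a' b n" using DF by blast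
        moreover have "a' = a" using calculation c(2) n by (auto simp: paths_def hd_append split: if_splits)
        ultimately show "c \<in> paths S E a b n" by simp
      qed
    qed
    finally show "(\<Sum>q\<in>?Q. (\<lambda>(c, b). w c b) q) \<le> (\<lambda>(a, b). K a b * e) p" by (simp add: p)
  qed
  also have "\<dots> = (\<Sum>a\<in>F. \<Sum>b\<in>F. K a b) * e" by (simp add: sum.cartesian_product[symmetric] sum_distrib_right)
  finally show ?thesis .
qed

text \<open>Gibbs' inequality with trial weights built in two stages: choose a word with weight
  proportional to \<open>exp\<close> of its Birkhoff sum, then read off an itinerary by predicting
  each atom from the word, with a small probability of error. The growth bound keeps the total mass
  of the words below one; the entropy is then bounded by the mean of minus the Birkhoff sum, plus
  \<open>n * Q\<close> and small errors.\<close>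

lemma HP_le_of_path_growth:
  assumes P: "finite_partition \<mu> P" and h: "hoelder_const S E \<theta> A \<phi>"
    and M: "\<And>x. x \<in> tms S E \<Longrightarrow> \<phi> x \<le> M" and int: "integrable \<mu> \<phi>"
    and pt: "\<And>b. b \<in> S \<Longrightarrow> xb b \<in> tms S E \<and> xb b 0 = b"
    and Kpos: "\<And>a b. 0 \<le> K a b"
    and growth: "\<And>a b n W. a \<in> S \<Longrightarrow> b \<in> S \<Longrightarrow> finite W \<Longrightarrow> W \<subseteq> paths S E a b n \<Longrightarrow>
       (\<Sum>c\<in>W. exp (birkhoff \<phi> n (c \<frown> xb b))) \<le> K a b * exp (real n * Q)"
    and \<epsilon>: "0 < \<epsilon>" "\<epsilon> < 1 / 2"
  defines "p \<equiv> real (card P)"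
  shows "\<exists>c0. \<forall>n>0. HP P n \<le> c0 + real n * (Q - (\<integral>x. \<phi> x \<partial>\<mu>) + (- ln (1 - \<epsilon>) + \<epsilon> + 3 * \<epsilon> * (ln p + \<bar>Q - M\<bar>)))"
proof -
  note Pf = P_facts[OF P]
  have p1: "1 \<le> p" using P_ne[OF P] Pf(1) by (simp add: p_def card_gt_0_iff Suc_le_eq)
  have A: "0 \<le> A" "0 < \<theta>" "\<theta> < 1" using h by (auto simp: hoelder_const_def)
  \<comment> \<open>The price of one wrong prediction. Taking
    \<open>\<delta> = \<epsilon> / cm\<close> for the measure of \<open>Bad\<close> limits the mean
    price per time step to \<open>\<epsilon>\<close>.\<close>
  define cm where "cm = ln (p / \<epsilon>)"
  have "1 < p / \<epsilon>" using p1 \<epsilon> by (simp add: less_divide_eq)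
  then have cm: "0 < cm" by (simp add: cm_def)
  define \<delta> where "\<delta> = \<epsilon> / cm"
  have \<delta>: "0 < \<delta>" "\<delta> * cm = \<epsilon>" using cm \<epsilon> by (auto simp: \<delta>_def)
  obtain k R Bad where R: "\<forall>x\<in>tms S E. \<forall>y\<in>tms S E. (\<forall>i<k. x i = y i) \<longrightarrow> R x = R y" "\<forall>x. R x \<in> P"
    and Bad: "Bad \<in> sets \<mu>" "measure \<mu> Bad \<le> \<delta>" "\<forall>x\<in>space \<mu>. x \<notin> Bad \<longrightarrow> R x = atom P x"
    using partition_approx[OF P \<delta>(1)] by (elim exE conjE)
  have "\<exists>F. finite F \<and> F \<subseteq> S \<and> 1 - \<epsilon> \<le> measure \<mu> {x \<in> space \<mu>. x 0 \<in> F}"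
    by (rule finite_range_approx[OF S _ coord_sets \<epsilon>(1)]) (simp add: space_mu tms_in)
  then obtain F where F: "finite F" "F \<subseteq> S" "1 - \<epsilon> \<le> measure \<mu> {x \<in> space \<mu>. x 0 \<in> F}" by blast
  define T where "T = 1 + (\<Sum>a\<in>F. \<Sum>b\<in>F. K a b)"
  have T: "1 \<le> T" using Kpos by (simp add: T_def sum_nonneg)
  \<comment> \<open>Noisy channel: the predicted atom receives nearly all the mass, but no atom gets
    zero, so the logarithm stays bounded by \<open>cm\<close>.\<close>
  define kap where "kap = (\<lambda>A B :: (nat \<Rightarrow> 'v) set. if A = B then 1 - \<epsilon> else \<epsilon> / p)"
  have kap_pos: "0 < kap X Y" for X Y using \<epsilon> p1 by (simp add: kap_def)
  have kap_ge: "exp (- cm) \<le> kap X Y" for X Y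
  proof -
    have "exp (- cm) = \<epsilon> / p" using p1 \<epsilon> by (simp add: cm_def exp_minus)
    moreover have "\<epsilon> / p \<le> \<epsilon>" using p1 \<epsilon> by (simp add: divide_le_eq mult_le_cancel_left1)
    ultimately show ?thesis using \<epsilon> by (simp add: kap_def)
  qed
  have kap_sum: "(\<Sum>X\<in>P. kap X Y) \<le> 1" for Y
  proof -
    have "(\<Sum>X\<in>P. kap X Y) \<le> (\<Sum>X\<in>P. (if X = Y then 1 - \<epsilon> else 0) + \<epsilon> / p)"
      using \<epsilon> p1 by (intro sum_mono) (auto simp: kap_def)
    also have "\<dots> = (if Y \<in> P then 1 - \<epsilon> else 0) + \<epsilon>"
      using Pf(1) P_ne[OF P] by (simp add: sum.distrib p_def)
    also have "\<dots> \<le> 1" using \<epsilon> by simp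
    finally show ?thesis .
  qed
  define c0 where "c0 = ln 2 + ln T + A / (1 - \<theta>) + real k * cm"
  have "HP P n \<le> c0 + real n * (Q - (\<integral>x. \<phi> x \<partial>\<mu>) + (- ln (1 - \<epsilon>) + \<epsilon> + 3 * \<epsilon> * (ln p + \<bar>Q - M\<bar>)))" if n: "0 < n" for n
  proof -
    define g where "g = (\<lambda>x :: nat \<Rightarrow> 'v. (prefix n x, x n))"
    have "\<exists>D. finite D \<and> D \<subseteq> lists S \<times> S \<and> 1 - \<epsilon> \<le> measure \<mu> {x \<in> space \<mu>. g x \<in> D}"
    proof (rule finite_range_approx[OF _ _ _ \<epsilon>(1)])
      show "countable (lists S \<times> S)" using S by simp
      show "g x \<in> lists S \<times> S" if "x \<in> space \<mu>" for x
        using that tms_in unfolding space_mu g_def by (fastforce simp: lists_eq_set)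
      show "{x \<in> space \<mu>. g x = c} \<in> sets \<mu>" for c
        using word_sets[of "\<lambda>a b. (a, b) = c" n] by (simp add: g_def)
    qed
    then obtain D0 where D0: "finite D0" "1 - \<epsilon> \<le> measure \<mu> {x \<in> space \<mu>. g x \<in> D0}" by blast
    \<comment> \<open>The intersection ensures that every pair is an actual path between vertices of
      the finite set \<open>F\<close>; thus one constant \<open>T\<close>, independent of
      \<open>n\<close>, dominates the relevant \<open>K a b\<close>.\<close>
    define D where "D = D0 \<inter> g ` {x \<in> space \<mu>. x 0 \<in> F \<and> x n \<in> F}"
    have Dfin: "finite D" using D0 by (simp add: D_def)
    have DF: "\<exists>a\<in>F. b \<in> F \<and> c \<in> paths S E a b n" if cb: "(c, b) \<in> D" for c b
    proof -
      obtain x where x: "x \<in> tms S E" "x 0 \<in> F" "x n \<in> F" "c = prefix n x" "b = x n"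
        using cb by (auto simp: D_def g_def space_mu)
      then show ?thesis using prefix_paths[OF x(1), of n] by blast
    qed
    define G where "G = {x \<in> space \<mu>. g x \<in> D}"
    have Gs: "G \<in> sets \<mu>" unfolding G_def g_def by (rule word_sets)
    have Fs: "{x \<in> space \<mu>. x 0 \<in> F} \<in> sets \<mu>" "{x \<in> space \<mu>. x n \<in> F} \<in> sets \<mu>"
      by (rule coord_sets)+
    have D0s: "{x \<in> space \<mu>. g x \<in> D0} \<in> sets \<mu>" unfolding g_def by (rule word_sets)
    have Fn: "measure \<mu> {x \<in> space \<mu>. x n \<in> F} = measure \<mu> {x \<in> space \<mu>. x 0 \<in> F}"
    proof -
      have "measure \<mu> {x \<in> space \<mu>. x 0 \<in> F} = measure (distr \<mu> \<mu> (suffix n)) {x \<in> space \<mu>. x 0 \<in> F}" by (simp only: distr_suffix)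
      also have "\<dots> = measure \<mu> (suffix n -` {x \<in> space \<mu>. x 0 \<in> F} \<inter> space \<mu>)"
        by (rule measure_distr[OF measurable_suffix Fs(1)])
      also have "suffix n -` {x \<in> space \<mu>. x 0 \<in> F} \<inter> space \<mu> = {x \<in> space \<mu>. x n \<in> F}"
        using tms_suffix by (auto simp: space_mu)
      finally show ?thesis by simp
    qed
    have Gc: "measure \<mu> (space \<mu> - G) \<le> 3 * \<epsilon>"
    proof -
      have "space \<mu> - G \<subseteq> (space \<mu> - {x \<in> space \<mu>. x 0 \<in> F}) \<union> ((space \<mu> - {x \<in> space \<mu>. x n \<in> F}) \<union> (space \<mu> - {x \<in> space \<mu>. g x \<in> D0}))"
        by (auto simp: G_def D_def)
      then have "measure \<mu> (space \<mu> - G) \<le> measure \<mu> ((space \<mu> - {x \<in> space \<mu>. x 0 \<in> F}) \<union> ((space \<mu> - {x \<in> space \<mu>. x n \<in> F}) \<union> (space \<mu> - {x \<in> space \<mu>. g x \<in> D0})))"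
        using Fs D0s by (intro finite_measure_mono) auto
      also have "\<dots> \<le> measure \<mu> (space \<mu> - {x \<in> space \<mu>. x 0 \<in> F}) + (measure \<mu> (space \<mu> - {x \<in> space \<mu>. x n \<in> F}) + measure \<mu> (space \<mu> - {x \<in> space \<mu>. g x \<in> D0}))"
        using Fs D0s by (intro order_trans[OF measure_Un_le] add_left_mono measure_Un_le) auto
      also have "\<dots> \<le> 3 * \<epsilon>"
        using prob_compl[OF Fs(1)] prob_compl[OF Fs(2)] prob_compl[OF D0s] F(3) D0(2) Fn by linarith
      finally show ?thesis .
    qed
    define \<rho> where "\<rho> = (\<lambda>c b. exp (birkhoff \<phi> n (c \<frown> xb b)) / (T * exp (real n * Q)))"
    define pr where "pr = (\<lambda>xs c b. \<Prod>l<n. kap (xs ! l) (R (suffix l (c \<frown> xb b))))"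
    \<comment> \<open>The uniform half covers points outside \<open>G\<close>, where no listed word
      is available; it costs \<open>n * ln p\<close> on a set of measure at most
      \<open>3 * \<epsilon>\<close>. Each half costs only an additive \<open>ln 2\<close>.\<close>
    define r where "r = (\<lambda>xs. 1 / 2 * (1 / p) ^ n + 1 / 2 * (\<Sum>(c, b)\<in>D. \<rho> c b * pr xs c b))"
    have \<rho>pos: "0 < \<rho> c b" for c b using T by (simp add: \<rho>_def)
    have prpos: "0 < pr xs c b" for xs c b unfolding pr_def using kap_pos by (intro prod_pos) auto
    have r_pos: "0 < r xs" for xs
    proof -
      have "0 \<le> (\<Sum>(c, b)\<in>D. \<rho> c b * pr xs c b)" using \<rho>pos prpos by (intro sum_nonneg) (auto simp: less_imp_le)
      moreover have "0 < (1 / p) ^ n" using p1 by simp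
      ultimately show ?thesis by (simp add: r_def add_pos_nonneg)
    qed
    have \<rho>sum: "(\<Sum>(c, b)\<in>D. \<rho> c b) \<le> 1"
    proof -
      have "(\<Sum>(c, b)\<in>D. exp (birkhoff \<phi> n (c \<frown> xb b))) \<le> (\<Sum>a\<in>F. \<Sum>b\<in>F. K a b) * exp (real n * Q)"
        using F by (intro word_weight_sum[OF F(1) Dfin Kpos DF n] growth) auto
      also have "\<dots> \<le> T * exp (real n * Q)" by (simp add: T_def)
      finally have "(\<Sum>(c, b)\<in>D. exp (birkhoff \<phi> n (c \<frown> xb b))) / (T * exp (real n * Q)) \<le> 1"
        using T by (simp add: divide_le_eq)
      then show ?thesis by (simp add: \<rho>_def sum_divide_distrib case_prod_beta)
    qed
    have r_sum: "(\<Sum>xs\<in>names P n. r xs) \<le> 1"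
    proof -
      have c1: "(\<Sum>xs\<in>names P n. (1 / p) ^ n) = 1"
      proof -
        have "card (names P n) = card P ^ n" unfolding names_def by (rule card_lists_length_eq[OF Pf(1)])
        then show ?thesis using p1 by (simp add: p_def power_divide)
      qed
      have "(\<Sum>xs\<in>names P n. \<Sum>(c, b)\<in>D. \<rho> c b * pr xs c b) = (\<Sum>(c, b)\<in>D. \<rho> c b * (\<Sum>xs\<in>names P n. pr xs c b))"
        by (subst sum.swap) (simp add: case_prod_beta sum_distrib_left)
      also have "\<dots> \<le> (\<Sum>(c, b)\<in>D. \<rho> c b * 1)"
        unfolding pr_def using \<rho>pos kap_pos
        by (intro sum_mono) (auto intro!: mult_left_mono sum_names_prod Pf(1) kap_sum simp: less_imp_le)
      also have "\<dots> \<le> 1" using \<rho>sum by simp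
      finally have "(\<Sum>xs\<in>names P n. \<Sum>(c, b)\<in>D. \<rho> c b * pr xs c b) \<le> 1" .
      moreover have "(\<Sum>xs\<in>names P n. r xs) = 1 / 2 * (\<Sum>xs\<in>names P n. (1 / p) ^ n) + 1 / 2 * (\<Sum>xs\<in>names P n. \<Sum>(c, b)\<in>D. \<rho> c b * pr xs c b)"
        unfolding r_def by (simp only: sum.distrib sum_distrib_left)
      ultimately show ?thesis using c1 by linarith
    qed
    define cost where "cost = (\<lambda>x. \<Sum>l<n. (- ln (1 - \<epsilon>) + cm * indicator Bad (suffix l x)))"
    \<comment> \<open>One integrable majorant for both cases. As \<open>\<phi>\<close> is bounded
      only above, the Birkhoff sum is kept in the nonnegative combination with \<open>n * M\<close>,
      so that outside \<open>G\<close> it may be arbitrarily negative without harm; the term with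
      \<open>\<bar>Q - M\<bar>\<close> compensates \<open>Q - M\<close> there.\<close>
    define J where "J = (\<lambda>x. c0 + cost x + (real n * M - birkhoff \<phi> n x) + real n * (Q - M) + real n * (ln p + \<bar>Q - M\<bar>) * indicator (space \<mu> - G) x)"
    have lneps: "0 \<le> - ln (1 - \<epsilon>)" using \<epsilon> by simp
    have cost0: "0 \<le> cost x" for x unfolding cost_def using lneps cm by (intro sum_nonneg add_nonneg_nonneg) (auto simp: indicator_def)
    have bM: "birkhoff \<phi> n x \<le> real n * M" if "x \<in> space \<mu>" for x
    proof -
      have "birkhoff \<phi> n x \<le> (\<Sum>k<n. M)" unfolding birkhoff_suffix
        using that tms_suffix by (intro sum_mono M) (simp add: space_mu)
      then show ?thesis by simp
    qed
    have c0n: "ln 2 \<le> c0" using T A cm by (simp add: c0_def)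
    have main: "- ln (r (name P n x)) \<le> J x" if x: "x \<in> space \<mu>" for x
    proof (cases "x \<in> G")
      case False
      have "1 / 2 * (1 / p) ^ n \<le> r (name P n x)"
        unfolding r_def using \<rho>pos prpos by (simp add: sum_nonneg case_prod_beta less_imp_le)
      then have "ln (1 / 2 * (1 / p) ^ n) \<le> ln (r (name P n x))" using p1 r_pos by (subst ln_le_cancel_iff) auto
      moreover have "ln (1 / 2 * (1 / p) ^ n) = - ln 2 - real n * ln p"
        using p1 by (simp add: ln_mult ln_realpow ln_div)
      moreover have "ln 2 + real n * ln p \<le> J x"
      proof -
        have "real n * \<bar>Q - M\<bar> + real n * (Q - M) \<ge> 0" by (simp add: distrib_left[symmetric])
        then show ?thesis using False x cost0[of x] bM[OF x] c0n by (simp add: J_def algebra_simps)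
      qed
      ultimately show ?thesis by linarith
    next
      case True
      define c where "c = prefix n x"
      define b where "b = x n"
      have cb: "(c, b) \<in> D" using True by (simp add: G_def g_def c_def b_def)
      have xt: "x \<in> tms S E" using x by (simp add: space_mu)
      have bS: "b \<in> S" using DF[OF cb] F by blast
      define y where "y = c \<frown> xb b"
      have yt: "y \<in> tms S E" unfolding y_def using prefix_paths[OF xt, of n] pt[OF bS]
        by (intro paths_conc(1)) (auto simp: c_def b_def)
      have agree: "x i = y i" if "i < n + 1" for i
        using that pt[OF bS] by (cases "i < n") (auto simp: y_def c_def b_def conc_def less_Suc_eq)
      have dist: "\<bar>birkhoff \<phi> n x - birkhoff \<phi> n y\<bar> \<le> A / (1 - \<theta>)"
      proof -
        have "\<bar>birkhoff \<phi> n x - birkhoff \<phi> n y\<bar> \<le> A / (1 - \<theta>) * \<theta> ^ 1"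
          by (rule birkhoff_distortion[OF h xt yt agree]) auto
        also have "\<dots> \<le> A / (1 - \<theta>)" using A by (simp add: divide_right_mono mult_left_le)
        finally show ?thesis .
      qed
      have nl: "name P n x ! l = atom P (suffix l x)" if "l < n" for l using that by (simp add: name_def)
      \<comment> \<open>In the last \<open>k\<close> positions the prediction looks beyond the word,
        where \<open>x\<close> and \<open>y\<close> may differ. These positions are charged the full
        price, a total of at most \<open>k * cm\<close> that does not depend on \<open>n\<close> and
        sits in \<open>c0\<close>.\<close>
      have kl: "exp (- (- ln (1 - \<epsilon>) + cm * indicator Bad (suffix l x) + (if n < l + k then cm else 0))) \<le> kap (name P n x ! l) (R (suffix l y))" if l: "l < n" for l
      proof (cases "n < l + k \<or> suffix l x \<in> Bad")
        case True
        have "- (- ln (1 - \<epsilon>) + cm * indicator Bad (suffix l x) + (if n < l + k then cm else 0)) \<le> - cm"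
          using True lneps cm by (auto simp: indicator_def)
        then show ?thesis using kap_ge[of "name P n x ! l" "R (suffix l y)"] by (meson exp_le_cancel_iff order_trans)
      next
        case False
        have "R (suffix l y) = R (suffix l x)"
        proof -
          have "\<forall>i<k. suffix l y i = suffix l x i" using False agree by auto
          then show ?thesis using R(1) tms_suffix[OF yt] tms_suffix[OF xt] by blast
        qed
        also have "\<dots> = atom P (suffix l x)" using Bad(3) False tms_suffix[OF xt, of l] by (simp add: space_mu)
        finally have "kap (name P n x ! l) (R (suffix l y)) = 1 - \<epsilon>" using nl[OF l] by (simp add: kap_def)
        then show ?thesis using False \<epsilon> by simp
      qed
      have prge: "exp (- (cost x + real k * cm)) \<le> pr (name P n x) c b"
      proof -
        have "(\<Sum>l<n. (if n < l + k then cm else 0)) = cm * real (card {l. l < n \<and> n < l + k})"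
          by (simp add: sum.If_cases Int_def lessThan_def mult.commute)
        also have "\<dots> \<le> cm * real k"
        proof -
          have "{l. l < n \<and> n < l + k} \<subseteq> {n - k..<n}" by auto
          then have "card {l. l < n \<and> n < l + k} \<le> card {n - k..<n}" by (rule card_mono[rotated]) simp
          then show ?thesis using cm by (intro mult_left_mono) auto
        qed
        finally have "exp (- (cost x + real k * cm)) \<le> exp (\<Sum>l<n. - (- ln (1 - \<epsilon>) + cm * indicator Bad (suffix l x) + (if n < l + k then cm else 0)))"
          unfolding sum_negf sum.distrib[of "\<lambda>l. - ln (1 - \<epsilon>) + cm * indicator Bad (suffix l x)"] cost_def by (simp add: mult.commute)
        also have "\<dots> = (\<Prod>l<n. exp (- (- ln (1 - \<epsilon>) + cm * indicator Bad (suffix l x) + (if n < l + k then cm else 0))))"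
          by (rule exp_sum) simp
        also have "\<dots> \<le> pr (name P n x) c b"
          unfolding pr_def using kl by (intro prod_mono) (auto simp: y_def)
        finally show ?thesis .
      qed
      have rge: "exp (birkhoff \<phi> n x - A / (1 - \<theta>) - real n * Q - ln T) \<le> \<rho> c b"
      proof -
        have "\<rho> c b = exp (birkhoff \<phi> n y - real n * Q - ln T)"
          using T by (simp add: \<rho>_def y_def exp_diff mult.commute)
        then show ?thesis using dist by simp
      qed
      have "1 / 2 * (exp (birkhoff \<phi> n x - A / (1 - \<theta>) - real n * Q - ln T) * exp (- (cost x + real k * cm))) \<le> 1 / 2 * (\<rho> c b * pr (name P n x) c b)"
        using rge prge \<rho>pos[of c b] by (intro mult_left_mono mult_mono) auto
      also have "\<dots> \<le> 1 / 2 * (\<Sum>(c, b)\<in>D. \<rho> c b * pr (name P n x) c b)"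
      proof -
        have "(\<lambda>(c, b). \<rho> c b * pr (name P n x) c b) (c, b) \<le> (\<Sum>q\<in>D. (\<lambda>(c, b). \<rho> c b * pr (name P n x) c b) q)"
          using \<rho>pos prpos by (intro member_le_sum[OF cb _ Dfin]) (auto simp: less_imp_le)
        then show ?thesis by simp
      qed
      also have "\<dots> \<le> r (name P n x)" using p1 by (simp add: r_def)
      finally have "1 / 2 * exp (birkhoff \<phi> n x - A / (1 - \<theta>) - real n * Q - ln T + - (cost x + real k * cm)) \<le> r (name P n x)"
        by (simp only: exp_add)
      then have "ln (1 / 2 * exp (birkhoff \<phi> n x - A / (1 - \<theta>) - real n * Q - ln T + - (cost x + real k * cm))) \<le> ln (r (name P n x))"
        using r_pos by (subst ln_le_cancel_iff) auto
      then have "- ln (r (name P n x)) \<le> ln 2 - (birkhoff \<phi> n x - A / (1 - \<theta>) - real n * Q - ln T + - (cost x + real k * cm))"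
        by (simp add: ln_mult ln_div)
      also have "\<dots> = c0 + cost x + (real n * M - birkhoff \<phi> n x) + real n * (Q - M)" by (simp add: c0_def algebra_simps)
      also have "\<dots> = J x" using True by (simp add: J_def)
      finally show ?thesis .
    qed
    have ibad: "integrable \<mu> (\<lambda>x. indicator Bad (suffix l x) :: real)" for l
      using Bad(1) by (intro integrable_suffix) (simp add: emeasure_eq_measure)
    have icost: "integrable \<mu> cost" unfolding cost_def using ibad by (intro Bochner_Integration.integrable_sum) simp
    have ecost: "(\<integral>x. cost x \<partial>\<mu>) = real n * (- ln (1 - \<epsilon>) + cm * measure \<mu> Bad)"
    proof -
      have "(\<integral>x. indicator Bad (suffix l x) \<partial>\<mu>) = measure \<mu> Bad" for l
        using integral_suffix[of "indicator Bad" l] Bad(1) by (simp add: emeasure_eq_measure)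
      then show ?thesis unfolding cost_def using ibad
        by (subst Bochner_Integration.integral_sum) (auto simp: prob_space)
    qed
    note ib = integrable_birkhoff[OF int, of n]
    have iG: "integrable \<mu> (\<lambda>x. indicator (space \<mu> - G) x :: real)" using Gs by (simp add: emeasure_eq_measure)
    have iJ: "integrable \<mu> J" unfolding J_def using icost ib(1) iG by simp
    have "HP P n \<le> (\<integral>x. - ln (r (name P n x)) \<partial>\<mu>)"
      using r_pos r_sum by (intro HP_gibbs[OF P]) (auto simp: less_imp_le)
    also have "\<dots> \<le> (\<integral>x. J x \<partial>\<mu>)"
      by (rule integral_mono[OF sum_names_integral(1)[OF P, where g = "\<lambda>xs. - ln (r xs)"] iJ main])
    also have "\<dots> = c0 + real n * (- ln (1 - \<epsilon>) + cm * measure \<mu> Bad) + (real n * M - real n * (\<integral>x. \<phi> x \<partial>\<mu>)) + real n * (Q - M) + real n * (ln p + \<bar>Q - M\<bar>) * measure \<mu> (space \<mu> - G)"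
      unfolding J_def using icost ib iG Gs by (simp add: ecost prob_space)
    also have "\<dots> \<le> c0 + real n * (- ln (1 - \<epsilon>) + \<epsilon>) + (real n * M - real n * (\<integral>x. \<phi> x \<partial>\<mu>)) + real n * (Q - M) + real n * (ln p + \<bar>Q - M\<bar>) * (3 * \<epsilon>)"
    proof -
      have "cm * measure \<mu> Bad \<le> \<epsilon>" using mult_left_mono[OF Bad(2), of cm] cm \<delta>(2) by (simp add: mult.commute)
      then have 1: "real n * (- ln (1 - \<epsilon>) + cm * measure \<mu> Bad) \<le> real n * (- ln (1 - \<epsilon>) + \<epsilon>)" by (intro mult_left_mono) auto
      have 2: "real n * (ln p + \<bar>Q - M\<bar>) * measure \<mu> (space \<mu> - G) \<le> real n * (ln p + \<bar>Q - M\<bar>) * (3 * \<epsilon>)"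
        using Gc p1 by (intro mult_left_mono) auto
      show ?thesis using 1 2 by linarith
    qed
    also have "\<dots> = c0 + real n * (Q - (\<integral>x. \<phi> x \<partial>\<mu>) + (- ln (1 - \<epsilon>) + \<epsilon> + 3 * \<epsilon> * (ln p + \<bar>Q - M\<bar>)))" by (simp add: algebra_simps)
    finally show ?thesis .
  qed
  then show ?thesis by blast
qed

text \<open>Divide by \<open>n\<close>, let \<open>n\<close> grow, then let
  \<open>\<epsilon>\<close> tend to zero. The constants \<open>K a b\<close> may depend on the end
  points without any uniform bound, because each \<open>\<epsilon>\<close> involves only finitely
  many vertices.\<close>

theorem variational_upper:
  assumes P: "finite_partition \<mu> P" and h: "hoelder_const S E \<theta> A \<phi>"
    and M: "\<And>x. x \<in> tms S E \<Longrightarrow> \<phi> x \<le> M" and int: "integrable \<mu> \<phi>"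
    and pt: "\<And>b. b \<in> S \<Longrightarrow> xb b \<in> tms S E \<and> xb b 0 = b"
    and Kpos: "\<And>a b. 0 \<le> K a b"
    and growth: "\<And>a b n W. a \<in> S \<Longrightarrow> b \<in> S \<Longrightarrow> finite W \<Longrightarrow> W \<subseteq> paths S E a b n \<Longrightarrow>
       (\<Sum>c\<in>W. exp (birkhoff \<phi> n (c \<frown> xb b))) \<le> K a b * exp (real n * Q)"
  shows "entropy_wrt \<mu> P + (\<integral>x. \<phi> x \<partial>\<mu>) \<le> Q"
proof -
  define p where "p = real (card P)"
  define ee where "ee = (\<lambda>\<epsilon>. - ln (1 - \<epsilon>) + \<epsilon> + 3 * \<epsilon> * (ln p + \<bar>Q - M\<bar>))"
  have le: "entropy_wrt \<mu> P \<le> Q - (\<integral>x. \<phi> x \<partial>\<mu>) + ee \<epsilon>" if \<epsilon>: "0 < \<epsilon>" "\<epsilon> < 1 / 2" for \<epsilon>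
  proof -
    have "\<exists>c0. \<forall>n>0. HP P n \<le> c0 + real n * (Q - (\<integral>x. \<phi> x \<partial>\<mu>) + (- ln (1 - \<epsilon>) + \<epsilon> + 3 * \<epsilon> * (ln (real (card P)) + \<bar>Q - M\<bar>)))"
      by (rule HP_le_of_path_growth[OF P h M int pt Kpos growth \<epsilon>]; assumption)
    then obtain c0 where c0: "\<And>n. 0 < n \<Longrightarrow> HP P n \<le> c0 + real n * (Q - (\<integral>x. \<phi> x \<partial>\<mu>) + ee \<epsilon>)"
      unfolding ee_def p_def by blast
    have "(\<lambda>n. c0 / real (Suc n) + (Q - (\<integral>x. \<phi> x \<partial>\<mu>) + ee \<epsilon>)) \<longlonglongrightarrow> 0 + (Q - (\<integral>x. \<phi> x \<partial>\<mu>) + ee \<epsilon>)"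
      by (intro tendsto_add tendsto_const LIMSEQ_Suc lim_const_over_n)
    then have "entropy_wrt \<mu> P \<le> 0 + (Q - (\<integral>x. \<phi> x \<partial>\<mu>) + ee \<epsilon>)"
    proof (rule LIMSEQ_le[OF entropy_tendsto[OF P]])
      have "HP P (Suc n) / real (Suc n) \<le> c0 / real (Suc n) + (Q - (\<integral>x. \<phi> x \<partial>\<mu>) + ee \<epsilon>)" for n
        using c0[of "Suc n"] by (simp add: divide_le_eq add_divide_distrib[symmetric] distrib_right) (simp add: field_simps)
      then show "\<exists>N. \<forall>n\<ge>N. HP P (Suc n) / real (Suc n) \<le> c0 / real (Suc n) + (Q - (\<integral>x. \<phi> x \<partial>\<mu>) + ee \<epsilon>)" by blast
    qed
    then show ?thesis by simp
  qed
  have "isCont ee 0" unfolding ee_def by (intro continuous_intros) auto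
  moreover have "ee 0 = 0" by (simp add: ee_def)
  ultimately have "(ee \<longlongrightarrow> 0) (at_right 0)" by (metis isCont_def filterlim_at_split)
  then have "((\<lambda>\<epsilon>. Q - (\<integral>x. \<phi> x \<partial>\<mu>) + ee \<epsilon>) \<longlongrightarrow> Q - (\<integral>x. \<phi> x \<partial>\<mu>) + 0) (at_right 0)"
    by (intro tendsto_add tendsto_const)
  moreover have "\<forall>\<^sub>F \<epsilon> in at_right 0. entropy_wrt \<mu> P \<le> Q - (\<integral>x. \<phi> x \<partial>\<mu>) + ee \<epsilon>"
    using eventually_at_right_real[of 0 "1/2"] by (rule eventually_mono) (auto intro: le)
  ultimately have "entropy_wrt \<mu> P \<le> Q - (\<integral>x. \<phi> x \<partial>\<mu>) + 0"
    by (intro tendsto_lowerbound[of _ _ "at_right 0"]) auto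
  then show ?thesis by simp
qed

end

section \<open>Bernoulli measures on loops and the lower bound\<close>

lemma ext_integral_eq:
  assumes "integrable \<mu> f" shows "ext_integral \<mu> f = ereal (\<integral>x. f x \<partial>\<mu>)"
proof -
  have p: "(\<lambda>x. ennreal (max (f x) 0)) = (\<lambda>x. ennreal (f x))" "(\<lambda>x. ennreal (max (- f x) 0)) = (\<lambda>x. ennreal (- f x))"
    by (auto simp: fun_eq_iff max_def ennreal_neg)
  obtain r q where rq: "0 \<le> r" "0 \<le> q" "(\<integral>\<^sup>+x. ennreal (f x) \<partial>\<mu>) = ennreal r" "(\<integral>\<^sup>+x. ennreal (- f x) \<partial>\<mu>) = ennreal q" "integral\<^sup>L \<mu> f = r - q"
    by (rule integrableE[OF assms])
  then show ?thesis by (simp add: ext_integral_def p enn2ereal_ennreal)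
qed

context inv_tms
begin

text \<open>Replacing \<open>x\<close> by a chosen representative of its \<open>n\<close>-cylinder
  gives functions of \<open>n\<close> coordinates, which are measurable and converge pointwise to
  \<open>f\<close>.\<close>

lemma hoelder_measurable:
  assumes h: "hoelder_const S E \<theta> A f"
  shows "f \<in> borel_measurable \<mu>"
proof -
  have A: "0 \<le> A" "0 < \<theta>" "\<theta> < 1" using h by (auto simp: hoelder_const_def)
  define rep where "rep = (\<lambda>n x. SOME y. y \<in> tms S E \<and> prefix n y = prefix n x)"
  have rep: "rep n x \<in> tms S E" "prefix n (rep n x) = prefix n x" if "x \<in> tms S E" for n x
    using someI_ex[of "\<lambda>y. y \<in> tms S E \<and> prefix n y = prefix n x"] that unfolding rep_def by blast+
  show ?thesis
  proof (rule borel_measurable_LIMSEQ_real[where u = "\<lambda>n x. f (rep n x)"])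
    fix x assume "x \<in> space \<mu>"
    then have x: "x \<in> tms S E" by (simp add: space_mu)
    have "\<bar>f (rep n x) - f x\<bar> \<le> A * \<theta> ^ n" if "2 \<le> n" for n
    proof -
      have "rep n x i = x i" if "i < n" for i
        using arg_cong[OF rep(2)[OF x, of n], of "\<lambda>c. c ! i"] that by simp
      then show ?thesis using h rep(1)[OF x, of n] x that unfolding hoelder_const_def by blast
    qed
    then have "\<forall>\<^sub>F n in sequentially. norm (f (rep n x) - f x) \<le> A * \<theta> ^ n"
      by (auto simp: eventually_sequentially)
    moreover have "(\<lambda>n. A * \<theta> ^ n) \<longlonglongrightarrow> 0"
      by (rule tendsto_mult_right_zero[OF LIMSEQ_realpow_zero]) (use A in auto)
    ultimately have "(\<lambda>n. f (rep n x) - f x) \<longlonglongrightarrow> 0" by (rule Lim_null_comparison)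
    then show "(\<lambda>n. f (rep n x)) \<longlonglongrightarrow> f x" by (rule LIM_zero_cancel)
  next
    fix n
    show "(\<lambda>x. f (rep n x)) \<in> borel_measurable \<mu>"
    proof (rule measurableI)
      fix B :: "real set"
      show "(\<lambda>x. f (rep n x)) -` B \<inter> space \<mu> \<in> sets \<mu>"
      proof (rule dep_sets[of _ n])
        have "rep n x = rep n y" if "\<forall>i<n. x i = y i" for x y :: "nat \<Rightarrow> 'v"
        proof -
          have "prefix n x = prefix n y" using that by (auto simp: subsequence_def)
          then show ?thesis by (simp add: rep_def)
        qed
        then show "coord_dep (tms S E) n ((\<lambda>x. f (rep n x)) -` B \<inter> space \<mu>)"
          unfolding coord_dep_def space_mu by (metis Int_iff vimage_eq)
      qed (auto simp: space_mu)
    qed simp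
  qed
qed

end

section \<open>Random concatenations of loops of a common length\<close>

lemma decode_conc: "0 < N \<Longrightarrow> suffix N (decode N y) = decode N (\<lambda>i. y (Suc i))"
  by (rule ext) (simp add: decode_def)

lemma decode_tms:
  assumes N: "0 < N" and y: "\<And>i. y i \<in> paths S E a a N"
  shows "decode N y \<in> tms S E"
  unfolding tms_def
proof (intro CollectI allI)
  fix i
  let ?q = "i div N" and ?r = "i mod N"
  have r: "?r < N" using N by simp
  have l: "length (y j) = N" for j by (rule paths_length[OF y])
  have s: "successively (edge S E) (y ?q @ [a])" using y[of ?q] by (simp add: paths_def)
  have "y ?q \<noteq> []" using l[of ?q] N by auto
  have "decode N y i = (y ?q @ [a]) ! ?r" using r l by (simp add: decode_def nth_append)
  moreover have "decode N y (Suc i) = (y ?q @ [a]) ! Suc ?r"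
  proof (cases "Suc ?r < N")
    case True
    then have "Suc i mod N = Suc ?r" "Suc i div N = ?q" using N by (auto simp: mod_Suc div_Suc)
    then show ?thesis using True l by (simp add: decode_def nth_append)
  next
    case False
    then have "Suc ?r = N" using r by simp
    then have "Suc i mod N = 0" "Suc i div N = Suc ?q" using N by (auto simp: mod_Suc div_Suc)
    moreover have "y (Suc ?q) ! 0 = a" using y[of "Suc ?q"] l[of "Suc ?q"] N by (cases "y (Suc ?q)") (auto simp: paths_def)
    ultimately show ?thesis using \<open>Suc ?r = N\<close> l by (simp add: decode_def nth_append)
  qed
  ultimately show "edge S E (decode N y i) (decode N y (Suc i))"
    using successively_nth[OF s, of ?r] r l by simp
qed

text \<open>Loops in the finite set \<open>W\<close> are drawn independently with probability
  proportional to \<open>exp\<close> of their Birkhoff sums. All have the same length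
  \<open>N\<close>, so that \<open>decode\<close> can string them together.\<close>

locale loop_bernoulli =
  fixes S :: "'v set" and E :: "'v \<Rightarrow> 'v \<Rightarrow> bool" and \<phi> :: "(nat \<Rightarrow> 'v) \<Rightarrow> real" and \<theta> A :: real
    and W :: "'v list set" and a :: 'v and N :: nat
  assumes S: "countable S" and h: "hoelder_const S E \<theta> A \<phi>"
    and W: "finite W" "W \<noteq> {}" "W \<subseteq> paths S E a a N" and N: "0 < N"
begin

definition Z :: real where "Z = (\<Sum>c\<in>W. exp (birkhoff \<phi> N (c\<^sup>\<omega>)))"

lemma Z_pos: "0 < Z" unfolding Z_def using W by (intro sum_pos) auto

definition pw :: "'v list \<Rightarrow> real" where "pw c = exp (birkhoff \<phi> N (c\<^sup>\<omega>)) / Z"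

definition M1 :: "'v list measure" where "M1 = point_measure W (\<lambda>c. ennreal (pw c))"

lemma prob_M1: "prob_space M1"
  unfolding M1_def
proof (rule prob_space_point_measure[OF W(1)])
  have "(\<Sum>s\<in>W. pw s) = 1" using Z_pos by (simp add: pw_def Z_def sum_divide_distrib[symmetric])
  moreover have "(\<Sum>s\<in>W. ennreal (pw s)) = ennreal (\<Sum>s\<in>W. pw s)"
    using Z_pos by (intro sum_ennreal) (simp add: pw_def)
  ultimately show "(\<Sum>s\<in>W. ennreal (pw s)) = 1" by simp
qed simp

lemma space_M1: "space M1 = W" and sets_M1: "sets M1 = Pow W"
  by (simp_all add: M1_def space_point_measure sets_point_measure)

definition \<Omega> :: "(nat \<Rightarrow> 'v list) measure" where "\<Omega> = (\<Pi>\<^sub>M i\<in>UNIV. M1)"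

lemma prob_\<Omega>: "prob_space \<Omega>"
  unfolding \<Omega>_def by (rule prob_space_PiM) (rule prob_M1)

lemma space_\<Omega>: "space \<Omega> = {y. \<forall>i. y i \<in> W}"
  by (auto simp: \<Omega>_def space_PiM space_M1)

definition T :: "nat \<Rightarrow> (nat \<Rightarrow> 'v list) \<Rightarrow> nat \<Rightarrow> 'v" where "T k y = suffix k (decode N y)"

lemma T_tms: "y \<in> space \<Omega> \<Longrightarrow> T k y \<in> tms S E"
  unfolding T_def using W(3) N by (intro tms_suffix decode_tms[of _ _ _ _ a]) (auto simp: space_\<Omega>)

lemma measurable_T: "T k \<in> measurable \<Omega> (tms_measure S E)"
  unfolding tms_measure_def
proof (rule measurable_sigma_sets)
  let ?G = "{{x \<in> tms S E. \<forall>i<n. x i = w i} | n w. True}"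
  show "sets (sigma (tms S E) ?G) = sigma_sets (tms S E) ?G" by (rule sets_measure_of) auto
  show "?G \<subseteq> Pow (tms S E)" by auto
  show "T k \<in> space \<Omega> \<rightarrow> tms S E" using T_tms by auto
  fix B assume "B \<in> ?G"
  then obtain n w where B: "B = {x \<in> tms S E. \<forall>i<n. x i = w i}" by blast
  have "T k -` B \<inter> space \<Omega> = {y \<in> space \<Omega>. \<forall>i\<in>{..<n}. y ((k + i) div N) ! ((k + i) mod N) = w i}"
    using T_tms by (auto simp: B T_def decode_def)
  moreover have "{y \<in> space \<Omega>. y j ! l = v} \<in> sets \<Omega>" for j l v
  proof -
    have "(\<lambda>y. y j) \<in> measurable \<Omega> M1" unfolding \<Omega>_def by (rule measurable_component_singleton) simp
    then have "(\<lambda>y. y j) -` {c \<in> W. c ! l = v} \<inter> space \<Omega> \<in> sets \<Omega>"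
      by (rule measurable_sets) (auto simp: sets_M1)
    moreover have "(\<lambda>y. y j) -` {c \<in> W. c ! l = v} \<inter> space \<Omega> = {y \<in> space \<Omega>. y j ! l = v}" by (auto simp: space_\<Omega>)
    ultimately show ?thesis by simp
  qed
  ultimately show "T k -` B \<inter> space \<Omega> \<in> sets \<Omega>" by (auto intro!: sets.sets_Collect_finite_All)
qed

text \<open>The law of the concatenation is invariant only under \<open>N\<close> shifts; the
  uniformly random phase \<open>k\<close> averages it into a shift-invariant measure.\<close>

definition \<mu> :: "(nat \<Rightarrow> 'v) measure" where
  "\<mu> = distr (uniform_count_measure {..<N} \<Otimes>\<^sub>M \<Omega>) (tms_measure S E) (\<lambda>(k, y). T k y)"

lemma measurable_pair_T: "(\<lambda>(k, y). T k y) \<in> measurable (uniform_count_measure {..<N} \<Otimes>\<^sub>M \<Omega>) (tms_measure S E)"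
proof -
  have "(\<lambda>(k, y). T k y) \<in> measurable (count_space {..<N} \<Otimes>\<^sub>M \<Omega>) (tms_measure S E)"
    by (rule measurable_pair_measure_countable1) (use measurable_T in auto)
  moreover have "sets (uniform_count_measure {..<N} \<Otimes>\<^sub>M \<Omega>) = sets (count_space {..<N} \<Otimes>\<^sub>M \<Omega>)"
    by (rule sets_pair_measure_cong) (auto simp: sets_uniform_count_measure)
  ultimately show ?thesis using measurable_cong_sets by blast
qed

lemma emeasure_\<mu>:
  assumes B: "B \<in> sets (tms_measure S E)"
  shows "emeasure \<mu> B = (\<Sum>k<N. ennreal (1 / N) * emeasure \<Omega> (T k -` B \<inter> space \<Omega>))"
proof -
  interpret O: prob_space \<Omega> by (rule prob_\<Omega>)
  let ?U = "uniform_count_measure {..<N}"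
  let ?X = "(\<lambda>(k, y). T k y) -` B \<inter> space (?U \<Otimes>\<^sub>M \<Omega>)"
  have "emeasure \<mu> B = emeasure (?U \<Otimes>\<^sub>M \<Omega>) ?X"
    unfolding \<mu>_def by (rule emeasure_distr[OF measurable_pair_T B])
  also have "\<dots> = (\<integral>\<^sup>+k. emeasure \<Omega> (Pair k -` ?X) \<partial>?U)"
    by (rule O.emeasure_pair_measure_alt) (rule measurable_sets[OF measurable_pair_T B])
  also have "\<dots> = (\<Sum>k<N. ennreal (1 / N) * emeasure \<Omega> (Pair k -` ?X))"
    unfolding uniform_count_measure_def by (subst nn_integral_point_measure_finite) (auto simp: mult.commute)
  also have "\<dots> = (\<Sum>k<N. ennreal (1 / N) * emeasure \<Omega> (T k -` B \<inter> space \<Omega>))"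
  proof (rule sum.cong[OF refl])
    fix k assume "k \<in> {..<N}"
    then have "Pair k -` ?X = T k -` B \<inter> space \<Omega>" by (auto simp: space_pair_measure space_uniform_count_measure)
    then show "ennreal (1 / N) * emeasure \<Omega> (Pair k -` ?X) = ennreal (1 / N) * emeasure \<Omega> (T k -` B \<inter> space \<Omega>)" by simp
  qed
  finally show ?thesis .
qed

lemma T_Suc: "T (Suc k) y = shift (T k y)"
  by (auto simp: T_def shift_def fun_eq_iff)

lemma emeasure_T_N:
  assumes B: "B \<in> sets (tms_measure S E)"
  shows "emeasure \<Omega> (T N -` B \<inter> space \<Omega>) = emeasure \<Omega> (T 0 -` B \<inter> space \<Omega>)"
proof -
  have "distr (PiM UNIV (\<lambda>_. M1)) (\<Pi>\<^sub>M i\<in>UNIV. M1) (\<lambda>\<omega>. \<lambda>n\<in>UNIV. \<omega> (Suc n)) = (\<Pi>\<^sub>M i\<in>(UNIV::nat set). M1)"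
    by (rule distr_PiM_reindex) (auto simp: prob_M1)
  then have d: "distr \<Omega> \<Omega> (\<lambda>y n. y (Suc n)) = \<Omega>" by (simp add: \<Omega>_def restrict_def)
  have m: "(\<lambda>y n. y (Suc n)) \<in> measurable \<Omega> \<Omega>"
    unfolding \<Omega>_def by (rule measurable_PiM_single') (auto simp: space_PiM intro: measurable_component_singleton)
  have "emeasure \<Omega> (T 0 -` B \<inter> space \<Omega>) = emeasure (distr \<Omega> \<Omega> (\<lambda>y n. y (Suc n))) (T 0 -` B \<inter> space \<Omega>)" by (simp only: d)
  also have "\<dots> = emeasure \<Omega> ((\<lambda>y n. y (Suc n)) -` (T 0 -` B \<inter> space \<Omega>) \<inter> space \<Omega>)"
    by (rule emeasure_distr[OF m measurable_sets[OF measurable_T B]])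
  also have "(\<lambda>y n. y (Suc n)) -` (T 0 -` B \<inter> space \<Omega>) \<inter> space \<Omega> = T N -` B \<inter> space \<Omega>"
  proof -
    have "T N y = T 0 (\<lambda>n. y (Suc n))" for y unfolding T_def decode_conc[OF N] by (simp only: suffix_0)
    then show ?thesis by (auto simp: space_\<Omega>)
  qed
  finally show ?thesis by simp
qed

lemma inv_prob_\<mu>: "inv_prob S E \<mu>"
  unfolding inv_prob_def
proof (intro conjI ballI)
  interpret O: prob_space \<Omega> by (rule prob_\<Omega>)
  show sets: "sets \<mu> = sets (tms_measure S E)" by (simp add: \<mu>_def)
  have sp: "space \<mu> = tms S E" using sets_eq_imp_space_eq[OF sets] by (simp add: space_tms_measure)
  show "prob_space \<mu>"
  proof
    have "emeasure \<mu> (space \<mu>) = (\<Sum>k<N. ennreal (1 / N) * emeasure \<Omega> (T k -` tms S E \<inter> space \<Omega>))"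
      unfolding sp by (rule emeasure_\<mu>) (use sets.top[of "tms_measure S E"] in \<open>simp add: space_tms_measure\<close>)
    also have "\<dots> = (\<Sum>k<N. ennreal (1 / N) * 1)"
    proof (rule sum.cong[OF refl])
      fix k assume "k \<in> {..<N}"
      have "T k -` tms S E \<inter> space \<Omega> = space \<Omega>" using T_tms by auto
      then show "ennreal (1 / N) * emeasure \<Omega> (T k -` tms S E \<inter> space \<Omega>) = ennreal (1 / N) * 1" by (simp add: O.emeasure_space_1)
    qed
    also have "\<dots> = 1" using N by (simp add: ennreal_of_nat_eq_real_of_nat ennreal_mult[symmetric])
    finally show "emeasure \<mu> (space \<mu>) = 1" .
  qed
  fix B assume "B \<in> sets \<mu>"
  then have B: "B \<in> sets (tms_measure S E)" by (simp add: sets)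
  have pre: "T k -` (shift -` B \<inter> space \<mu>) \<inter> space \<Omega> = T (Suc k) -` B \<inter> space \<Omega>" for k
    using T_tms by (auto simp: T_Suc sp)
  have sB: "shift -` B \<inter> space \<mu> \<in> sets (tms_measure S E)"
  proof -
    have "shift \<in> measurable (tms_measure S E) (tms_measure S E)"
      unfolding tms_measure_def[of S E, THEN arg_cong[where f = "measurable _"]]
      unfolding tms_measure_def
    proof (rule measurable_sigma_sets)
      let ?G = "{{x \<in> tms S E. \<forall>i<n. x i = w i} | n w. True}"
      show "sets (sigma (tms S E) ?G) = sigma_sets (tms S E) ?G" by (rule sets_measure_of) auto
      show "?G \<subseteq> Pow (tms S E)" by auto
      show "shift \<in> space (sigma (tms S E) ?G) \<rightarrow> tms S E"
        using space_tms_measure[of S E, unfolded tms_measure_def] by (auto simp: tms_def shift_def)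
      fix C assume "C \<in> ?G"
      then obtain n w where C: "C = {x \<in> tms S E. \<forall>i<n. x i = w i}" by blast
      have "shift -` C \<inter> tms S E \<in> sets (tms_measure S E)"
      proof (rule coord_dep_sets[OF S, of _ _ "Suc n"])
        show "coord_dep (tms S E) (Suc n) (shift -` C \<inter> tms S E)"
          unfolding coord_dep_def C by (auto simp: shift_def tms_def)
      qed auto
      then show "shift -` C \<inter> space (sigma (tms S E) ?G) \<in> sets (sigma (tms S E) ?G)"
        using space_tms_measure[of S E] by (simp add: tms_measure_def)
    qed
    from measurable_sets[OF this B] show ?thesis by (simp add: sp space_tms_measure)
  qed
  let ?b = "\<lambda>k. ennreal (1 / N) * emeasure \<Omega> (T k -` B \<inter> space \<Omega>)"
  \<comment> \<open>A shift moves the phases up by one, and phase \<open>N\<close> has the same law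
    as phase \<open>0\<close>, so the average is unchanged. Finiteness of \<open>?b 0\<close> is
    required to cancel it.\<close>
  have "?b 0 + (\<Sum>k<N. ?b (Suc k)) = (\<Sum>k<N. ?b k) + ?b N"
    using sum.lessThan_Suc_shift[of ?b N] sum.lessThan_Suc[of ?b N] by simp
  also have "?b N = ?b 0" by (simp add: emeasure_T_N[OF B])
  finally have "?b 0 + (\<Sum>k<N. ?b (Suc k)) = ?b 0 + (\<Sum>k<N. ?b k)" by (simp add: add.commute)
  moreover have "?b 0 \<noteq> \<infinity>" by (simp add: O.emeasure_eq_measure ennreal_mult_eq_top_iff)
  ultimately have "(\<Sum>k<N. ?b (Suc k)) = (\<Sum>k<N. ?b k)" by (simp add: ennreal_add_left_cancel)
  then show "emeasure \<mu> (shift -` B \<inter> space \<mu>) = emeasure \<mu> B"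
    unfolding emeasure_\<mu>[OF sB] emeasure_\<mu>[OF B] pre .
qed

end

sublocale loop_bernoulli \<subseteq> inv_tms S E \<mu>
  by unfold_locales (rule S, rule inv_prob_\<mu>)

section \<open>Cylinder measures and entropy of the loop measure\<close>

context loop_bernoulli
begin

definition U :: "'v set" where "U = (\<Union>c\<in>W. set c)"

lemma U: "finite U" using W by (simp add: U_def)

lemma T_U: assumes "y \<in> space \<Omega>" shows "T k y i \<in> U"
proof -
  let ?j = "(k + i) div N" and ?r = "(k + i) mod N"
  have y: "y ?j \<in> W" using assms by (simp add: space_\<Omega>)
  then have "length (y ?j) = N" by (rule paths_length[OF subsetD[OF W(3)]])
  then have "y ?j ! ?r \<in> set (y ?j)" using N by simp
  then show ?thesis using y by (auto simp: U_def T_def decode_def)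
qed

definition XU :: "(nat \<Rightarrow> 'v) set" where "XU = {x \<in> tms S E. \<forall>i. x i \<in> U}"

lemma XU_AE: "AE x in \<mu>. x \<in> XU"
proof -
  have "XU = (\<Inter>i. {x \<in> space \<mu>. x i \<in> U})" by (auto simp: XU_def space_mu)
  then have s: "XU \<in> sets \<mu>" using coord_sets[of "\<lambda>v. v \<in> U"] by auto
  have c: "space \<mu> - XU \<in> sets (tms_measure S E)" using s sets_mu by auto
  have "emeasure \<mu> (space \<mu> - XU) = 0"
  proof -
    have "T k -` (space \<mu> - XU) \<inter> space \<Omega> = {}" for k using T_U T_tms by (auto simp: XU_def)
    then show ?thesis using emeasure_\<mu>[OF c] by simp
  qed
  then show ?thesis using s by (intro AE_I[of _ _ "space \<mu> - XU"]) auto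
qed

text \<open>Weak Hoelder continuity fixes \<open>\<phi>\<close> up to \<open>A\<close> once the
  first two symbols are known, and there are finitely many pairs of symbols from
  \<open>U\<close>.\<close>

lemma \<phi>_bounded: "\<exists>B\<ge>0. \<forall>x\<in>XU. \<bar>\<phi> x\<bar> \<le> B"
proof -
  have A: "0 \<le> A" "0 < \<theta>" "\<theta> < 1" using h by (auto simp: hoelder_const_def)
  define rep where "rep = (\<lambda>(u, v). SOME y. y \<in> tms S E \<and> y 0 = u \<and> y 1 = v)"
  define B where "B = (\<Sum>q\<in>U \<times> U. \<bar>\<phi> (rep q)\<bar>) + A"
  have "0 \<le> B" using A by (simp add: B_def sum_nonneg)
  moreover have "\<bar>\<phi> x\<bar> \<le> B" if x: "x \<in> XU" for x
  proof -
    let ?q = "(x 0, x 1)"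
    have q: "?q \<in> U \<times> U" and xt: "x \<in> tms S E" using x by (auto simp: XU_def)
    have "\<exists>y. y \<in> tms S E \<and> y 0 = x 0 \<and> y 1 = x 1" using xt by blast
    then have r: "rep ?q \<in> tms S E" "rep ?q 0 = x 0" "rep ?q 1 = x 1"
      using someI_ex[of "\<lambda>y. y \<in> tms S E \<and> y 0 = x 0 \<and> y 1 = x 1"] by (auto simp: rep_def)
    have "\<forall>i<2. x i = rep ?q i" using r by (auto simp: less_2_cases_iff)
    then have "\<bar>\<phi> x - \<phi> (rep ?q)\<bar> \<le> A * \<theta> ^ 2" using h xt r(1) unfolding hoelder_const_def by blast
    also have "\<dots> \<le> A" using A by (simp add: mult_left_le power_le_one)
    finally have "\<bar>\<phi> x\<bar> \<le> \<bar>\<phi> (rep ?q)\<bar> + A" by linarith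
    also have "\<bar>\<phi> (rep ?q)\<bar> \<le> (\<Sum>q\<in>U \<times> U. \<bar>\<phi> (rep q)\<bar>)" using U by (intro member_le_sum[OF q]) auto
    finally show ?thesis by (simp add: B_def)
  qed
  ultimately show ?thesis by blast
qed

lemma integrable_\<phi>: "integrable \<mu> \<phi>"
proof -
  obtain B where B: "\<forall>x\<in>XU. \<bar>\<phi> x\<bar> \<le> B" using \<phi>_bounded by blast
  show ?thesis
    by (rule integrable_const_bound[of _ B]) (use XU_AE B hoelder_measurable[OF h] in auto)
qed

text \<open>The partition by the first symbol, made finite by lumping together the symbols outside
  \<open>U\<close>; that last atom is null for \<open>\<mu>\<close>.\<close>

definition part :: "(nat \<Rightarrow> 'v) set set" where
  "part = (\<lambda>b. {x \<in> tms S E. x 0 = b}) ` U \<union> {{x \<in> tms S E. x 0 \<notin> U}}"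

lemma part: "finite_partition \<mu> part"
  unfolding finite_partition_def
proof (intro conjI)
  show "finite part" using U by (simp add: part_def)
  have s: "{x \<in> tms S E. Q (x 0)} \<in> sets \<mu>" for Q using coord_sets[of Q 0] by (simp add: space_mu)
  show "part \<subseteq> sets \<mu>" using s[of "\<lambda>v. v = _"] s[of "\<lambda>v. v \<notin> U"] by (auto simp: part_def)
  show "disjoint part" unfolding disjoint_def part_def by auto
  show "\<Union>part = space \<mu>" by (auto simp: part_def space_mu)
qed

lemma ncyl_name:
  assumes x: "x \<in> XU" shows "ncyl (name part n x) = {x' \<in> tms S E. \<forall>i<n. x' i = x i}"
proof -
  have at: "atom part (suffix k x) = {x' \<in> tms S E. x' 0 = x k}" for k
    by (rule atom_eq[OF part]) (use x tms_suffix in \<open>auto simp: part_def XU_def\<close>)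
  show ?thesis unfolding ncyl_def
    using tms_suffix by (auto simp: name_def at space_mu)
qed

text \<open>For each phase, a cylinder of length \<open>(j + 2) * N\<close> determines complete
  consecutive loops. Independence makes its probability at most the product of \<open>j\<close> loop
  weights, which is \<open>exp\<close> of a Birkhoff sum over \<open>Z ^ j\<close>, up to distortion
  and the incomplete ends.\<close>

lemma cylinder_bound:
  fixes B :: real
  assumes x: "x \<in> XU" and B: "\<forall>x\<in>XU. \<bar>\<phi> x\<bar> \<le> B" "0 \<le> B"
  shows "measure \<mu> {x' \<in> tms S E. \<forall>i<(j + 2) * N. x' i = x i} \<le> exp (birkhoff \<phi> ((j + 2) * N) x + 2 * N * B + j * (A / (1 - \<theta>))) / Z ^ j"
proof -
  interpret O: prob_space \<Omega> by (rule prob_\<Omega>)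
  have A: "0 \<le> A" "0 < \<theta>" "\<theta> < 1" using h by (auto simp: hoelder_const_def)
  define n where "n = (j + 2) * N"
  define Cy where "Cy = {x' \<in> tms S E. \<forall>i<n. x' i = x i}"
  define bnd where "bnd = exp (birkhoff \<phi> n x + 2 * N * B + j * (A / (1 - \<theta>))) / Z ^ j"
  have bnd: "0 \<le> bnd" using Z_pos by (simp add: bnd_def)
  have xt: "x \<in> tms S E" using x by (simp add: XU_def)
  have xk: "suffix k x \<in> XU" for k using x tms_suffix[OF xt] by (simp add: XU_def)
  have Cs: "Cy \<in> sets (tms_measure S E)"
    unfolding Cy_def by (rule coord_dep_sets[OF S, of _ _ n]) (auto simp: coord_dep_def)
  have each: "emeasure \<Omega> (T k -` Cy \<inter> space \<Omega>) \<le> ennreal bnd" if k: "k < N" for k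
  proof (cases "T k -` Cy \<inter> space \<Omega> = {}")
    case False
    then obtain y0 where y0: "y0 \<in> space \<Omega>" "T k y0 \<in> Cy" by blast
    \<comment> \<open>The loop number \<open>q\<close> as read off from \<open>x\<close> when the
      phase is \<open>k\<close>. Loop \<open>0\<close> is cut by the phase; loops \<open>1\<close>
      to \<open>j + 1\<close> are fully visible.\<close>
    define wd where "wd = (\<lambda>q. map x [q * N - k..<q * N - k + N])"
    have word: "y q = wd q" if y: "y \<in> space \<Omega>" "T k y \<in> Cy" and q: "1 \<le> q" "q \<le> j + 1" for y q
    proof (rule nth_equalityI)
      have yq: "y q \<in> W" using y by (simp add: space_\<Omega>)
      have "length (y q) = N" by (rule paths_length[OF subsetD[OF W(3) yq]])
      then show l: "length (y q) = length (wd q)" by (simp add: wd_def)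
      fix r assume "r < length (y q)"
      then have r: "r < N" using l by (simp add: wd_def)
      have qN: "N \<le> q * N" using q(1) by simp
      have i: "q * N - k + r < n"
      proof -
        have "q * N \<le> (j + 1) * N" using q(2) by (rule mult_le_mono1)
        then have "q * N + N \<le> n" by (simp add: n_def)
        then show ?thesis using r by linarith
      qed
      have "x (q * N - k + r) = T k y (q * N - k + r)" using y(2) i by (auto simp: Cy_def)
      also have "k + (q * N - k + r) = q * N + r" using k qN by linarith
      then have "T k y (q * N - k + r) = decode N y (q * N + r)" by (simp add: T_def)
      also have "\<dots> = y q ! r" using r by (simp add: decode_def)
      finally show "y q ! r = wd q ! r" using r by (simp add: wd_def)
    qed
    have wW: "wd q \<in> W" if "1 \<le> q" "q \<le> j + 1" for q
      using word[OF y0 that] y0 by (metis (mono_tags, lifting) mem_Collect_eq space_\<Omega>)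
    have "T k -` Cy \<inter> space \<Omega> \<subseteq> {y \<in> space \<Omega>. \<forall>q\<in>{1..j}. y q \<in> {wd q}}" using word by auto
    then have "emeasure \<Omega> (T k -` Cy \<inter> space \<Omega>) \<le> emeasure \<Omega> {y \<in> space \<Omega>. \<forall>q\<in>{1..j}. y q \<in> {wd q}}"
    proof (rule emeasure_mono)
      show "{y \<in> space \<Omega>. \<forall>q\<in>{1..j}. y q \<in> {wd q}} \<in> sets \<Omega>"
        unfolding \<Omega>_def using wW by (intro sets_Collect_single' sets.sets_Collect_finite_All) (auto simp: sets_M1)
    qed
    also have "\<dots> = (\<Prod>q\<in>{1..j}. emeasure M1 {wd q})"
    proof -
      interpret PP: product_prob_space "\<lambda>_::nat. M1" UNIV
        by (intro product_prob_spaceI prob_M1)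
      show ?thesis unfolding \<Omega>_def
        by (rule PP.emeasure_PiM_Collect) (use wW in \<open>auto simp: sets_M1\<close>)
    qed
    also have "\<dots> = (\<Prod>q\<in>{1..j}. ennreal (pw (wd q)))"
    proof (rule prod.cong[OF refl])
      fix q assume "q \<in> {1..j}"
      then have "wd q \<in> W" using wW by simp
      then show "emeasure M1 {wd q} = ennreal (pw (wd q))"
        unfolding M1_def using W(1) by (subst emeasure_point_measure_finite) auto
    qed
    also have "\<dots> = ennreal (\<Prod>q\<in>{1..j}. pw (wd q))" using Z_pos by (intro prod_ennreal) (simp add: pw_def)
    also have "\<dots> \<le> ennreal bnd"
    proof (rule ennreal_leI)
      \<comment> \<open>Loop \<open>j + 1\<close> is not counted in the product. It only guarantees
        that loop \<open>q + 1\<close> also starts with \<open>a\<close>, so that \<open>x\<close>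
        and the repeated loop agree on one symbol more than the \<open>N\<close> summed
        ones.\<close>
      have step: "birkhoff \<phi> N ((wd q)\<^sup>\<omega>) \<le> birkhoff \<phi> N (suffix (q * N - k) x) + A / (1 - \<theta>)" if q: "1 \<le> q" "q \<le> j" for q
      proof -
        have wq: "wd q \<in> paths S E a a N" using wW[of q] q W(3) by auto
        note it = iter_tms[OF wq N]
        have "wd (q + 1) \<in> paths S E a a N" using wW[of "q + 1"] q W(3) by auto
        then have "hd (wd (q + 1)) = a" using N by (auto simp: paths_def hd_append wd_def split: if_splits)
        then have xa: "x ((q + 1) * N - k) = a" using N by (simp add: wd_def upt_conv_Cons)
        have qN: "N \<le> q * N" using q(1) by simp
        have "(wd q)\<^sup>\<omega> i = suffix (q * N - k) x i" if "i < N + 1" for i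
        proof (cases "i < N")
          case True
          then show ?thesis using N by (simp add: wd_def)
        next
          case False
          then have "i = N" using that by simp
          moreover have "(wd q)\<^sup>\<omega> N = a" using it(2) N by (simp add: wd_def)
          moreover have "(q + 1) * N = q * N + N" by simp
          then have "q * N - k + N = (q + 1) * N - k" using k qN by linarith
          ultimately show ?thesis using xa by simp
        qed
        then have "\<bar>birkhoff \<phi> N ((wd q)\<^sup>\<omega>) - birkhoff \<phi> N (suffix (q * N - k) x)\<bar> \<le> A / (1 - \<theta>) * \<theta> ^ 1"
          by (intro birkhoff_distortion[OF h it(1) tms_suffix[OF xt]]) auto
        also have "\<dots> \<le> A / (1 - \<theta>)" using A by (simp add: divide_right_mono mult_left_le)
        finally show ?thesis by linarith
      qed
      have sumb: "(\<Sum>q\<in>{1..i}. birkhoff \<phi> N (suffix (q * N - k) x)) = birkhoff \<phi> (i * N) (suffix (N - k) x)" for i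
      proof (induction i)
        case (Suc i)
        have e: "suffix (Suc i * N - k) x = suffix (i * N) (suffix (N - k) x)"
        proof -
          have "Suc i * N - k = (N - k) + i * N" using k by simp
          then show ?thesis by (simp only: suffix_suffix)
        qed
        have "(\<Sum>q\<in>{1..Suc i}. birkhoff \<phi> N (suffix (q * N - k) x)) = (\<Sum>q\<in>{1..i}. birkhoff \<phi> N (suffix (q * N - k) x)) + birkhoff \<phi> N (suffix (Suc i * N - k) x)"
          by (subst sum.nat_ivl_Suc') (simp, rule add.commute)
        also have "\<dots> = birkhoff \<phi> (i * N) (suffix (N - k) x) + birkhoff \<phi> N (suffix (i * N) (suffix (N - k) x))"
          by (simp only: Suc e)
        also have "\<dots> = birkhoff \<phi> (i * N + N) (suffix (N - k) x)" by (rule birkhoff_add[symmetric])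
        also have "i * N + N = Suc i * N" by simp
        finally show ?case .
      qed (simp add: birkhoff_def)
      have bB: "- (real m * B) \<le> birkhoff \<phi> m (suffix i x)" for m i
      proof -
        have "(\<Sum>l<m. - B) \<le> birkhoff \<phi> m (suffix i x)" unfolding birkhoff_suffix
        proof (rule sum_mono)
          fix l
          have "suffix l (suffix i x) \<in> XU" using xk[of "i + l"] by simp
          then show "- B \<le> \<phi> (suffix l (suffix i x))" using B(1) by (simp only: abs_le_iff minus_le_iff)
        qed
        then show ?thesis by simp
      qed
      \<comment> \<open>The incomplete stretches have lengths \<open>N - k\<close> and
        \<open>N + k\<close>, hence the error \<open>2 * N * B\<close> for every phase.\<close>
      have nsplit: "n = (N - k) + (j * N + (N + k))" using k by (simp add: n_def)
      have "birkhoff \<phi> n x = birkhoff \<phi> (N - k) x + (birkhoff \<phi> (j * N) (suffix (N - k) x) + birkhoff \<phi> (N + k) (suffix (j * N) (suffix (N - k) x)))"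
        by (subst nsplit) (simp only: birkhoff_add)
      moreover have "- (real (N - k) * B) \<le> birkhoff \<phi> (N - k) x" using bB[of "N - k" 0] by simp
      moreover have "- (real (N + k) * B) \<le> birkhoff \<phi> (N + k) (suffix (j * N) (suffix (N - k) x))"
        using bB[of "N + k" "N - k + j * N"] by simp
      moreover have "real (N - k) * B + real (N + k) * B = 2 * N * B" using k by (simp add: of_nat_diff algebra_simps)
      ultimately have mid: "birkhoff \<phi> (j * N) (suffix (N - k) x) \<le> birkhoff \<phi> n x + 2 * N * B" by linarith
      have "(\<Prod>q\<in>{1..j}. pw (wd q)) = exp (\<Sum>q\<in>{1..j}. birkhoff \<phi> N ((wd q)\<^sup>\<omega>)) / Z ^ j"
        by (simp add: pw_def prod_dividef exp_sum)
      also have "\<dots> \<le> bnd" unfolding bnd_def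
      proof (rule divide_right_mono)
        have "(\<Sum>q\<in>{1..j}. birkhoff \<phi> N ((wd q)\<^sup>\<omega>)) \<le> (\<Sum>q\<in>{1..j}. birkhoff \<phi> N (suffix (q * N - k) x) + A / (1 - \<theta>))"
          using step by (intro sum_mono) auto
        also have "\<dots> = birkhoff \<phi> (j * N) (suffix (N - k) x) + j * (A / (1 - \<theta>))" unfolding sum.distrib sumb by simp
        finally show "exp (\<Sum>q\<in>{1..j}. birkhoff \<phi> N ((wd q)\<^sup>\<omega>)) \<le> exp (birkhoff \<phi> n x + 2 * N * B + j * (A / (1 - \<theta>)))"
          using mid by simp
      qed (use Z_pos in simp)
      finally show "(\<Prod>q\<in>{1..j}. pw (wd q)) \<le> bnd" .
    qed
    finally show ?thesis .
  qed simp
  have "emeasure \<mu> Cy \<le> (\<Sum>k<N. ennreal (1 / N) * ennreal bnd)"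
    unfolding emeasure_\<mu>[OF Cs] using each by (intro sum_mono mult_left_mono) auto
  also have "\<dots> = ennreal bnd" using N bnd by (simp add: ennreal_of_nat_eq_real_of_nat ennreal_mult[symmetric])
  finally have "measure \<mu> Cy \<le> bnd" using bnd by (simp add: emeasure_eq_measure)
  then show ?thesis by (simp add: Cy_def bnd_def n_def)
qed

text \<open>Minus the logarithm of the cylinder bound, integrated. Itineraries of measure zero are
  removed first, since their logarithm is the default value and would break the inequality.\<close>

lemma HP_lower:
  fixes B :: real
  assumes B: "\<forall>x\<in>XU. \<bar>\<phi> x\<bar> \<le> B" "0 \<le> B"
  shows "real j * (ln Z - A / (1 - \<theta>)) - 2 * N * B - real ((j + 2) * N) * (\<integral>x. \<phi> x \<partial>\<mu>) \<le> HP part ((j + 2) * N)"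
proof -
  define n where "n = (j + 2) * N"
  have null: "AE x in \<mu>. pm (name part n x) \<noteq> 0"
  proof -
    have "AE x in \<mu>. \<forall>xs\<in>{xs \<in> names part n. pm xs = 0}. x \<notin> ncyl xs"
    proof (rule AE_finite_allI)
      show "finite {xs \<in> names part n. pm xs = 0}" using finite_names[OF part] by simp
      fix xs assume xs: "xs \<in> {xs \<in> names part n. pm xs = 0}"
      then have "ncyl xs \<in> sets \<mu>" using ncyl_sets[OF part, of xs] by (simp add: names_def)
      then have "ncyl xs \<in> null_sets \<mu>" using xs by (auto simp: null_sets_def pm_def emeasure_eq_measure)
      then show "AE x in \<mu>. x \<notin> ncyl xs" by (rule AE_not_in)
    qed
    then show ?thesis
    proof (rule AE_mp, intro AE_I2 impI)
      fix x assume x: "x \<in> space \<mu>" and no: "\<forall>xs\<in>{xs \<in> names part n. pm xs = 0}. x \<notin> ncyl xs"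
      have "x \<in> ncyl (name part n x)" using ncyl_iff[OF part x name_in[OF part x]] by simp
      then show "pm (name part n x) \<noteq> 0" using no name_in[OF part x] by blast
    qed
  qed
  let ?low = "\<lambda>x. real j * (ln Z - A / (1 - \<theta>)) - 2 * N * B - birkhoff \<phi> n x"
  note ib = integrable_birkhoff[OF integrable_\<phi>, of n]
  have "(\<integral>x. ?low x \<partial>\<mu>) \<le> (\<integral>x. - ln (pm (name part n x)) \<partial>\<mu>)"
  proof (rule integral_mono_AE)
    show "integrable \<mu> ?low" using ib(1) by simp
    show "integrable \<mu> (\<lambda>x. - ln (pm (name part n x)))"
      by (rule sum_names_integral(1)[OF part, where g = "\<lambda>xs. - ln (pm xs)"])
    show "AE x in \<mu>. ?low x \<le> - ln (pm (name part n x))"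
      using null XU_AE
    proof eventually_elim
      case (elim x)
      have p: "0 < pm (name part n x)" using elim(1) pm_bounds[OF part, of "name part n x"] by simp
      have "pm (name part n x) \<le> exp (birkhoff \<phi> n x + 2 * N * B + j * (A / (1 - \<theta>))) / Z ^ j"
        using cylinder_bound[OF elim(2) B, of j] unfolding pm_def ncyl_name[OF elim(2)] n_def .
      then have "ln (pm (name part n x)) \<le> ln (exp (birkhoff \<phi> n x + 2 * N * B + j * (A / (1 - \<theta>))) / Z ^ j)"
        using p Z_pos by (subst ln_le_cancel_iff) auto
      also have "\<dots> = birkhoff \<phi> n x + 2 * N * B + j * (A / (1 - \<theta>)) - j * ln Z"
        using Z_pos by (simp add: ln_div ln_realpow)
      finally show ?case by (simp add: algebra_simps)
    qed
  qed
  also have "\<dots> = HP part n" by (simp add: HP_eq_integral[OF part])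
  finally show ?thesis using ib by (simp add: n_def prob_space)
qed

text \<open>Entropy is computed along the lengths \<open>(j + 2) * N\<close> only, which suffices
  because the full limit exists. The integral of \<open>\<phi>\<close> cancels between entropy and
  pressure.\<close>

theorem pressure_lower: "ereal ((ln Z - A / (1 - \<theta>)) / N) \<le> meas_pressure \<mu> \<phi>"
proof -
  obtain B where B: "\<forall>x\<in>XU. \<bar>\<phi> x\<bar> \<le> B" "0 \<le> B" using \<phi>_bounded by blast
  define I where "I = (\<integral>x. \<phi> x \<partial>\<mu>)"
  define b where "b = ln Z - A / (1 - \<theta>)"
  define n where "n = (\<lambda>j. (j + 2) * N)"
  have npos: "0 < n j" for j using N by (simp add: n_def)
  have sm: "strict_mono (\<lambda>j. n j - 1)"
  proof (rule strict_monoI_Suc)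
    fix j have "n j < n (Suc j)" using N by (simp add: n_def)
    then show "n j - 1 < n (Suc j) - 1" using npos[of j] by linarith
  qed
  have "(\<lambda>j. HP part (Suc (n j - 1)) / real (Suc (n j - 1))) \<longlonglongrightarrow> entropy_wrt \<mu> part"
    using LIMSEQ_subseq_LIMSEQ[OF entropy_tendsto[OF part] sm] by (simp add: comp_def)
  then have lim: "(\<lambda>j. HP part (n j) / real (n j)) \<longlonglongrightarrow> entropy_wrt \<mu> part" using npos by simp
  have t: "(\<lambda>j. b / N - (2 * b + 2 * N * B) / N * (1 / real (j + 2)) - I) \<longlonglongrightarrow> b / N - (2 * b + 2 * N * B) / N * 0 - I"
  proof (intro tendsto_intros)
    show "(\<lambda>j. 1 / real (j + 2)) \<longlonglongrightarrow> 0"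
      using LIMSEQ_ignore_initial_segment[OF lim_1_over_n, of 2] by simp
  qed
  have "b / N - (2 * b + 2 * N * B) / N * 0 - I \<le> entropy_wrt \<mu> part"
  proof (rule LIMSEQ_le[OF t lim])
    have "b / N - (2 * b + 2 * N * B) / N * (1 / real (j + 2)) - I \<le> HP part (n j) / real (n j)" for j
    proof -
      have "real j * b - 2 * N * B - real (n j) * I \<le> HP part (n j)" using HP_lower[OF B, of j] by (simp add: b_def n_def I_def)
      then have "(real j * b - 2 * N * B - real (n j) * I) / real (n j) \<le> HP part (n j) / real (n j)" by (rule divide_right_mono) simp
      moreover have "(real j * b - 2 * N * B - real (n j) * I) / real (n j) = b / N - (2 * b + 2 * N * B) / N * (1 / real (j + 2)) - I"
      proof -
        have r: "real (n j) = (real j + 2) * real N" by (simp add: n_def distrib_right)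
        have "real N \<noteq> 0" "real j + 2 \<noteq> 0" using N by auto
        then show ?thesis unfolding r by (simp add: divide_simps) (simp add: algebra_simps)
      qed
      ultimately show ?thesis by simp
    qed
    then show "\<exists>J. \<forall>j\<ge>J. b / N - (2 * b + 2 * N * B) / N * (1 / real (j + 2)) - I \<le> HP part (n j) / real (n j)" by blast
  qed
  then have "b / N - I \<le> entropy_wrt \<mu> part" by simp
  moreover have "ereal (entropy_wrt \<mu> part) \<le> ks_entropy \<mu>"
    unfolding ks_entropy_def using part by (intro SUP_upper) simp
  ultimately have "ereal (b / N - I) \<le> ks_entropy \<mu>" by (meson ereal_less_eq(3) order_trans)
  then have "ereal (b / N - I) + ereal I \<le> ks_entropy \<mu> + ereal I" by (rule add_right_mono)
  then show ?thesis by (simp add: meas_pressure_def ext_integral_eq[OF integrable_\<phi>] I_def b_def)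
qed

end

section \<open>Reduction of the periodic case to the mixing case\<close>

text \<open>The least positive difference \<open>d\<close> of two elements \<open>x\<close> and
  \<open>x + d\<close> divides every element, since a remainder would be a smaller difference; hence
  \<open>d = p\<close>. Combinations of \<open>x\<close> and \<open>x + p\<close> then reach every
  large multiple of \<open>p\<close>.\<close>

lemma semigroup_large_multiples:
  fixes G :: "nat set" and p :: nat
  assumes zero: "0 \<in> G" and add: "\<And>x y. x \<in> G \<Longrightarrow> y \<in> G \<Longrightarrow> x + y \<in> G"
    and ex: "\<exists>g\<in>G. 0 < g" and dvd: "\<And>g. g \<in> G \<Longrightarrow> p dvd g"
    and greatest: "\<And>d. (\<And>g. g \<in> G \<Longrightarrow> d dvd g) \<Longrightarrow> d dvd p"
  shows "\<exists>n0. \<forall>n\<ge>n0. p dvd n \<longrightarrow> n \<in> G"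
proof -
  have mult: "k * x \<in> G" if "x \<in> G" for k x
  proof (induction k)
    case 0 show ?case using zero by simp
  next
    case (Suc k) show ?case using add[OF that Suc] by simp
  qed
  define D where "D = {d. 0 < d \<and> (\<exists>x\<in>G. x + d \<in> G)}"
  obtain g0 where "g0 \<in> G" "0 < g0" using ex by blast
  then have "g0 \<in> D" using zero by (auto simp: D_def intro!: bexI[of _ 0])
  then have "D \<noteq> {}" by blast
  then have "Inf D \<in> D" by (rule Inf_nat_def1)
  moreover have "Inf D \<le> e" if "e \<in> D" for e using that by (rule cInf_lower) simp
  ultimately obtain d where d: "d \<in> D" "\<And>e. e \<in> D \<Longrightarrow> d \<le> e" by blast
  then obtain x where x: "0 < d" "x \<in> G" "x + d \<in> G" by (auto simp: D_def)
  have "d dvd g" if g: "g \<in> G" for g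
  proof (rule ccontr)
    assume "\<not> d dvd g"
    then have r: "0 < g mod d" "g mod d < d" using x by (auto simp: dvd_eq_mod_eq_0)
    define k where "k = g div d"
    have "k * d + g mod d = g" by (simp add: k_def)
    \<comment> \<open>Both \<open>k * (x + d)\<close> and \<open>k * x + g\<close> belong to
      \<open>G\<close>, so the remainder is itself a difference of two elements.\<close>
    then have "k * (x + d) + g mod d = k * x + g" by (simp only: distrib_left add.assoc)
    moreover have "k * x + g \<in> G" by (rule add[OF mult[OF x(2)] g])
    moreover have "k * (x + d) \<in> G" by (rule mult[OF x(3)])
    ultimately have "g mod d \<in> D" using r(1) unfolding D_def by (metis (mono_tags, lifting) mem_Collect_eq)
    then have "d \<le> g mod d" by (rule d(2))
    then show False using r(2) by simp
  qed
  then have "d dvd p" by (rule greatest)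
  moreover have "p dvd d" using dvd[OF x(2)] dvd[OF x(3)] by (simp add: dvd_add_right_iff)
  ultimately have dp: "d = p" by (simp add: dvd_antisym)
  obtain m where m: "x = p * m" using dvd[OF x(2)] by (auto simp: dvd_def)
  \<comment> \<open>Writing \<open>n = p * t\<close> and dividing \<open>t\<close> by
    \<open>m\<close>, the threshold forces the quotient \<open>q\<close> to be at least the
    remainder \<open>r\<close>; then \<open>r\<close> of the \<open>q\<close> summands can be
    enlarged from \<open>x\<close> to \<open>x + d\<close>.\<close>
  have "n \<in> G" if n: "n \<ge> p * (m * m + m)" "p dvd n" for n
  proof (cases "m = 0")
    case True
    then have "p \<in> G" using x m dp by simp
    moreover obtain t where "n = p * t" using n by (auto simp: dvd_def)
    ultimately show ?thesis using mult[of p t] by (simp add: mult.commute)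
  next
    case False
    obtain t where t: "n = p * t" using n by (auto simp: dvd_def)
    have "p > 0" using x dp by simp
    moreover have "p * (m * m + m) \<le> p * t" using n t by simp
    ultimately have tm: "t \<ge> m * m" by simp
    define q r where "q = t div m" and "r = t mod m"
    have "r < m" using False by (simp add: r_def)
    moreover have "m \<le> q" using tm False by (simp add: q_def less_eq_div_iff_mult_less_eq)
    ultimately have rq: "r \<le> q" by simp
    have "t = q * m + r" by (simp add: q_def r_def)
    also have "\<dots> = (q - r) * m + r * (m + 1)"
    proof -
      obtain e where "q = r + e" using rq le_Suc_ex by blast
      then show ?thesis by (simp add: distrib_left distrib_right)
    qed
    finally have t2: "t = (q - r) * m + r * (m + 1)" .
    have "n = p * ((q - r) * m + r * (m + 1))" using t t2 by simp
    also have "\<dots> = (q - r) * x + r * (x + d)" unfolding m dp by (simp only: distrib_left mult.left_commute mult_1_right mult.commute[of r p])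
    finally show ?thesis using add[OF mult[OF x(2)] mult[OF x(3)]] by simp
  qed
  then show ?thesis by blast
qed

section \<open>Recoding of words and points by blocks\<close>

definition blocks :: "nat \<Rightarrow> nat \<Rightarrow> 'v list \<Rightarrow> 'v list list" where
  "blocks p n c = map (\<lambda>j. take p (drop (p * j) c)) [0..<n]"

lemma length_blocks [simp]: "length (blocks p n c) = n"
  by (simp add: blocks_def)

lemma blocks_nth:
  assumes "length c = p * n" "j < n"
  shows "length (blocks p n c ! j) = p" "r < p \<Longrightarrow> blocks p n c ! j ! r = c ! (p * j + r)" "p * j + p \<le> p * n"
proof -
  have "p * (j + 1) \<le> p * n" using assms(2) by (intro mult_le_mono2) simp
  then show le: "p * j + p \<le> p * n" by simp
  show "length (blocks p n c ! j) = p" using assms le by (simp add: blocks_def)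
  show "blocks p n c ! j ! r = c ! (p * j + r)" if "r < p" using assms that le by (simp add: blocks_def)
qed

lemma concat_nth_uniform:
  assumes "\<And>w. w \<in> set cs \<Longrightarrow> length w = p" "j < length cs" "r < p"
  shows "concat cs ! (p * j + r) = cs ! j ! r"
  using assms
proof (induction cs arbitrary: j)
  case (Cons w cs)
  have w: "length w = p" using Cons by simp
  show ?case
  proof (cases j)
    case 0 then show ?thesis using w Cons by (simp add: nth_append)
  next
    case (Suc i)
    have "concat (w # cs) ! (p * j + r) = concat cs ! (p * i + r)" using w Suc by (simp add: nth_append)
    then show ?thesis using Cons Suc by simp
  qed
qed simp

lemma length_concat_uniform: "(\<And>w. w \<in> set cs \<Longrightarrow> length w = p) \<Longrightarrow> length (concat cs) = p * length cs"
  by (induction cs) auto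

lemma index_split: fixes i p n :: nat assumes "0 < p" "i < p * n" shows "i div p < n" "i mod p < p" "i = p * (i div p) + i mod p"
proof -
  show "i div p < n" using assms by (simp add: div_less_iff_less_mult mult.commute)
qed (use assms in auto)

lemma concat_blocks:
  assumes "length c = p * n" "0 < p" shows "concat (blocks p n c) = c"
proof (rule nth_equalityI)
  have u: "length w = p" if "w \<in> set (blocks p n c)" for w
    using that blocks_nth(1)[OF assms(1)] by (auto simp: in_set_conv_nth)
  show l: "length (concat (blocks p n c)) = length c" using length_concat_uniform[of "blocks p n c" p] u assms by simp
  fix i assume "i < length (concat (blocks p n c))"
  then have i: "i < p * n" using l assms by simp
  note s = index_split[OF assms(2) i]
  have "concat (blocks p n c) ! (p * (i div p) + i mod p) = blocks p n c ! (i div p) ! (i mod p)"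
    by (rule concat_nth_uniform) (use u s in auto)
  also have "\<dots> = c ! (p * (i div p) + i mod p)" using blocks_nth(2)[OF assms(1) s(1) s(2)] .
  finally show "concat (blocks p n c) ! i = c ! i" using s(3) by simp
qed

lemma concat_inj_uniform:
  assumes "\<And>w. w \<in> set cs \<Longrightarrow> length w = p" "\<And>w. w \<in> set ds \<Longrightarrow> length w = p" "length cs = length ds" "concat cs = concat ds"
  shows "cs = ds"
  using assms(3,1,2,4) by (induction cs ds rule: list_induct2) auto

lemma decode_concat:
  assumes "\<And>w. w \<in> set cs \<Longrightarrow> length w = p" "0 < p"
  shows "decode p (cs \<frown> y) = concat cs \<frown> decode p y"
proof
  fix i
  have l: "length (concat cs) = p * length cs" by (rule length_concat_uniform[OF assms(1)])
  show "decode p (cs \<frown> y) i = (concat cs \<frown> decode p y) i"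
  proof (cases "i < p * length cs")
    case True
    note s = index_split[OF assms(2) True]
    have "(concat cs \<frown> decode p y) i = concat cs ! i" using True l by simp
    also have "\<dots> = concat cs ! (p * (i div p) + i mod p)" using s(3) by simp
    also have "\<dots> = cs ! (i div p) ! (i mod p)" by (rule concat_nth_uniform[OF assms(1) s(1,2)])
    finally show ?thesis using s by (simp add: decode_def)
  next
    case False
    then have i: "i = p * length cs + (i - p * length cs)" by simp
    define k where "k = i - p * length cs"
    have "i div p = length cs + k div p" "i mod p = k mod p" using i assms(2) by (auto simp: k_def[symmetric])
    then show ?thesis using False l by (simp add: decode_def k_def[symmetric])
  qed
qed

lemma decode_iter:
  assumes "\<And>w. w \<in> set cs \<Longrightarrow> length w = p" "0 < p" "cs \<noteq> []"
  shows "decode p (cs\<^sup>\<omega>) = (concat cs)\<^sup>\<omega>"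
proof
  fix i
  have l: "length (concat cs) = p * length cs" by (rule length_concat_uniform[OF assms(1)])
  have lp: "0 < length cs" "0 < length (concat cs)" using assms l by auto
  have m: "i mod (p * length cs) = p * (i div p mod length cs) + i mod p" by (rule mod_mult2_eq)
  have "(concat cs)\<^sup>\<omega> i = concat cs ! (p * (i div p mod length cs) + i mod p)" using lp(2) l m by simp
  also have "\<dots> = cs ! (i div p mod length cs) ! (i mod p)"
    by (rule concat_nth_uniform) (use assms lp in auto)
  finally show "decode p (cs\<^sup>\<omega>) i = (concat cs)\<^sup>\<omega> i" using lp by (simp add: decode_def)
qed

lemma decode_suffix: "0 < p \<Longrightarrow> decode p (suffix n y) = suffix (p * n) (decode p y)"
  by (rule ext) (simp add: decode_def)

lemma birkhoff_induced:
  assumes "0 < period S E"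
  shows "birkhoff (induced_pot S E \<phi>) n y = birkhoff \<phi> (period S E * n) (decode (period S E) y)"
proof (induction n)
  case (Suc n)
  have "birkhoff (induced_pot S E \<phi>) (Suc n) y = birkhoff (induced_pot S E \<phi>) n y + induced_pot S E \<phi> (suffix n y)"
    by (simp only: birkhoff_suffix sum.lessThan_Suc)
  also have "induced_pot S E \<phi> (suffix n y) = birkhoff \<phi> (period S E) (suffix (period S E * n) (decode (period S E) y))"
    unfolding induced_pot_def by (simp only: decode_suffix[OF assms])
  also have "birkhoff (induced_pot S E \<phi>) n y + \<dots> = birkhoff \<phi> (period S E * n + period S E) (decode (period S E) y)"
    by (simp only: Suc birkhoff_add)
  finally show ?case by (simp add: add.commute)
qed (simp add: birkhoff_def)

section \<open>The recoded graph of a transitive graph is mixing\<close>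

locale transitive_tms =
  fixes S :: "'v set" and E :: "'v \<Rightarrow> 'v \<Rightarrow> bool"
  assumes S: "countable S" and trans: "top_transitive S E"
begin

abbreviation "p \<equiv> period S E"
abbreviation "V \<equiv> block_vertices S E"
abbreviation "F \<equiv> block_edge S E"
definition base :: 'v where "base = base_vertex S"

lemma base: "base \<in> S"
  using trans by (auto simp: base_def base_vertex_def top_transitive_def some_in_eq)

lemma conn: "a \<in> S \<Longrightarrow> b \<in> S \<Longrightarrow> \<exists>n>0. paths S E a b n \<noteq> {}"
  using trans unfolding top_transitive_def by (simp add: paths_relpowp)

definition loops :: "nat set" where "loops = {n. paths S E base base n \<noteq> {}}"

lemma period_eq: "p = Gcd {n. n > 0 \<and> n \<in> loops}"
  unfolding period_def loops_def base_def[symmetric] using paths_relpowp[OF base] by simp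

lemma loops_add: "m \<in> loops \<Longrightarrow> n \<in> loops \<Longrightarrow> m + n \<in> loops"
  unfolding loops_def using paths_append[of _ S E base base m _ base n] by blast

lemma loops_dvd: "n \<in> loops \<Longrightarrow> p dvd n"
  unfolding period_eq by (cases "n = 0") (auto intro: Gcd_dvd)

lemma loops_pos: "\<exists>n\<in>loops. 0 < n"
  using conn[OF base base] by (auto simp: loops_def)

lemma p_pos: "0 < p"
proof -
  obtain n where n: "n \<in> loops" "0 < n" using loops_pos by blast
  then show ?thesis using loops_dvd[OF n(1)] by (metis dvd_0_left gr0I less_irrefl)
qed

text \<open>The loop is inserted into a round trip from the base vertex through \<open>a\<close>;
  round trips with and without it have lengths divisible by \<open>p\<close>, hence so has the
  difference.\<close>

lemma loop_dvd:
  assumes "a \<in> S" "paths S E a a n \<noteq> {}" shows "p dvd n"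
proof -
  obtain k u where u: "u \<in> paths S E base a k" using conn[OF base assms(1)] by blast
  obtain l t where t: "t \<in> paths S E a base l" using conn[OF assms(1) base] by blast
  obtain c where c: "c \<in> paths S E a a n" using assms by blast
  have "p dvd k + l" using paths_append[OF u t] by (intro loops_dvd) (auto simp: loops_def)
  moreover have "p dvd k + (n + l)" using paths_append[OF u paths_append[OF c t]] by (intro loops_dvd) (auto simp: loops_def)
  then have "p dvd (k + l) + n" by (simp add: ac_simps)
  ultimately show ?thesis by (simp add: dvd_add_right_iff)
qed

lemma large_loops: "\<exists>n0. \<forall>n\<ge>n0. p dvd n \<longrightarrow> paths S E base base n \<noteq> {}"
proof -
  have "\<exists>n0. \<forall>n\<ge>n0. p dvd n \<longrightarrow> n \<in> loops"
  proof (rule semigroup_large_multiples)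
    show "0 \<in> loops" by (auto simp: loops_def paths_def)
    show "d dvd p" if "\<And>g. g \<in> loops \<Longrightarrow> d dvd g" for d
      unfolding period_eq using that by (auto intro: Gcd_greatest)
  qed (auto intro: loops_add loops_dvd loops_pos)
  then show ?thesis by (simp add: loops_def)
qed

lemma class0_iff: "b \<in> class0 S E \<longleftrightarrow> b \<in> S \<and> (\<exists>n. p dvd n \<and> paths S E base b n \<noteq> {})"
proof
  assume b: "b \<in> class0 S E"
  then have bS: "b \<in> S" by (simp add: class0_def)
  show "b \<in> S \<and> (\<exists>n. p dvd n \<and> paths S E base b n \<noteq> {})"
  proof (cases "b = base")
    case True
    then have "[] \<in> paths S E base b 0" by (simp add: paths_def)
    then show ?thesis using bS by auto
  next
    case False
    then show ?thesis using b paths_relpowp[OF bS] by (auto simp: class0_def base_def[symmetric])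
  qed
next
  assume "b \<in> S \<and> (\<exists>n. p dvd n \<and> paths S E base b n \<noteq> {})"
  then show "b \<in> class0 S E" using paths_relpowp[where b = b and S = S and E = E] by (auto simp: class0_def base_def[symmetric])
qed

lemma V_facts:
  assumes "w \<in> V" shows "length w = p" "w \<noteq> []" "hd w \<in> class0 S E" "hd w \<in> S" "last w \<in> S" "set w \<subseteq> S"
    "\<And>j. Suc j < p \<Longrightarrow> edge S E (w ! j) (w ! Suc j)"
  using assms p_pos by (auto simp: block_vertices_def class0_def intro!: subsetD[of "set w" S, OF _ last_in_set])

lemma countable_V: "countable V"
  by (rule countable_subset[of _ "lists S"]) (use S in \<open>auto simp: block_vertices_def\<close>)

lemma butlast_path:
  assumes w: "w \<in> V" shows "butlast w \<in> paths S E (hd w) (last w) (p - 1)"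
proof -
  have "butlast w @ [last w] = w" using V_facts(2)[OF w] by simp
  then show ?thesis using V_facts[OF w] by (auto simp: paths_def successively_conv_nth)
qed

text \<open>The block starting at position \<open>p * j\<close> begins in the same cyclic class as
  the path itself, so every block is a vertex of the recoded graph.\<close>

lemma blocks_paths:
  assumes c: "c \<in> paths S E a b (p * n)" and a: "a \<in> class0 S E" and n: "0 < n" and w': "w' \<in> V" "hd w' = b"
  shows "blocks p n c \<in> paths V F (take p c) w' n"
proof -
  have l: "length c = p * n" by (rule paths_length[OF c])
  have s: "successively (edge S E) (c @ [b])" using c by (simp add: paths_def)
  have e: "edge S E ((c @ [b]) ! i) ((c @ [b]) ! Suc i)" if "i < p * n" for i
    using successively_nth[OF s, of i] that l by simp
  obtain k u where u: "p dvd k" "u \<in> paths S E base a k" using a class0_iff by blast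
  have BV: "blocks p n c ! j \<in> V" if j: "j < n" for j
  proof -
    note b = blocks_nth[OF l j]
    have ne: "blocks p n c ! j \<noteq> []" using b(1) p_pos by auto
    have pj: "p * j < p * n" using j p_pos by simp
    have hd: "hd (blocks p n c ! j) = c ! (p * j)" using b(2)[of 0] p_pos ne by (simp add: hd_conv_nth)
    have "take (p * j) c @ drop (p * j) c \<in> paths S E a b (p * n)" using c by simp
    from paths_split(1)[OF this] have "take (p * j) c \<in> paths S E a (c ! (p * j)) (p * j)"
      using l pj by (simp add: hd_append hd_drop_conv_nth min_def split: if_splits)
    then have "u @ take (p * j) c \<in> paths S E base (c ! (p * j)) (k + p * j)" by (rule paths_append[OF u(2)])
    moreover have "c ! (p * j) \<in> S" using subsetD[OF paths_set[OF c] nth_mem[of "p * j" c]] l pj by simp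
    ultimately have "c ! (p * j) \<in> class0 S E" using u(1) unfolding class0_iff by (metis dvd_add dvd_triv_left empty_iff)
    moreover have "set (blocks p n c ! j) \<subseteq> S"
      using paths_set[OF c] j by (auto simp: blocks_def dest!: in_set_takeD in_set_dropD)
    moreover have "edge S E (blocks p n c ! j ! i) (blocks p n c ! j ! Suc i)" if "Suc i < p" for i
      using e[of "p * j + i"] b(2)[of i] b(2)[of "Suc i"] b(3) that l by (simp add: nth_append)
    ultimately show ?thesis using b(1) hd by (simp add: block_vertices_def)
  qed
  have "successively (edge V F) (blocks p n c @ [w'])"
    unfolding successively_conv_nth
  proof (intro allI impI)
    fix j assume "Suc j < length (blocks p n c @ [w'])"
    then have j: "j < n" by simp
    note b = blocks_nth[OF l j]
    have "blocks p n c ! j \<noteq> []" using b(1) p_pos by auto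
    then have last: "last (blocks p n c ! j) = c ! (p * j + (p - 1))" using b(1) b(2)[of "p - 1"] p_pos by (simp add: last_conv_nth)
    have i: "p * j + (p - 1) < p * n" using b(3) p_pos by linarith
    have si: "Suc (p * j + (p - 1)) = p * Suc j" using p_pos by simp
    have hd: "hd ((blocks p n c @ [w']) ! Suc j) = (c @ [b]) ! (p * Suc j)"
    proof (cases "Suc j < n")
      case True
      have "blocks p n c ! Suc j \<noteq> []" using blocks_nth(1)[OF l True] p_pos by auto
      moreover have "p * Suc j < p * n" using True p_pos by (simp only: mult_less_cancel1)
      ultimately show ?thesis using blocks_nth(2)[OF l True, of 0] p_pos True l by (simp add: nth_append hd_conv_nth)
    next
      case False
      then have "Suc j = n" using j by simp
      then show ?thesis using l w' by (simp add: nth_append)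
    qed
    have "edge S E (last (blocks p n c ! j)) (hd ((blocks p n c @ [w']) ! Suc j))"
      using e[OF i] unfolding si hd last using i l by (simp add: nth_append)
    moreover have "(blocks p n c @ [w']) ! Suc j \<in> V" using BV[of "Suc j"] w' j by (auto simp: nth_append not_less_eq less_Suc_eq)
    ultimately show "edge V F ((blocks p n c @ [w']) ! j) ((blocks p n c @ [w']) ! Suc j)"
      using BV[OF j] j by (simp add: edge_def[of V F] block_edge_def nth_append)
  qed
  moreover have "hd (blocks p n c @ [w']) = take p c" using n by (simp add: hd_append hd_conv_nth blocks_def upt_conv_Cons)
  ultimately show ?thesis by (simp add: paths_def)
qed

lemma concat_paths:
  assumes cs: "cs \<in> paths V F w w' n" and w': "w' \<in> V"
  shows "concat cs \<in> paths S E (hd w) (hd w') (p * n)" "\<And>v. v \<in> set cs \<Longrightarrow> length v = p"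
proof -
  show u: "length v = p" if "v \<in> set cs" for v using paths_set[OF cs] that V_facts(1) by blast
  show "concat cs \<in> paths S E (hd w) (hd w') (p * n)"
    using cs u
  proof (induction n arbitrary: cs w)
    case 0
    then show ?case by (auto simp: paths_def)
  next
    case (Suc n)
    then obtain v ds where cs: "cs = v # ds" by (cases cs) (auto simp: paths_def)
    have vw: "v = w" using Suc.prems cs by (simp add: paths_def)
    have "[v] @ ds \<in> paths V F w w' (Suc n)" using Suc.prems cs by simp
    note sp = paths_split[OF this]
    define z where "z = hd (ds @ [w'])"
    have ds: "ds \<in> paths V F z w' n" using sp(2) Suc.prems cs by (simp add: z_def paths_def)
    have ih: "concat ds \<in> paths S E (hd z) (hd w') (p * n)" using Suc.IH[OF ds] Suc.prems cs by simp
    have ed: "edge V F w z" using sp(1) vw by (simp add: paths_def z_def)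
    then have wV: "w \<in> V" and le: "edge S E (last w) (hd z)" by (auto simp: edge_def[of V F] block_edge_def)
    have "[last w] \<in> paths S E (last w) (hd z) 1" using le by (simp add: paths_def)
    then have "butlast w @ [last w] \<in> paths S E (hd w) (hd z) (p - 1 + 1)" by (rule paths_append[OF butlast_path[OF wV]])
    then have "w \<in> paths S E (hd w) (hd z) p" using V_facts(2)[OF wV] p_pos by simp
    then have "w @ concat ds \<in> paths S E (hd w) (hd w') (p + p * n)" by (rule paths_append[OF _ ih])
    then show ?case using cs vw by simp
  qed
qed

text \<open>A path must begin with the word \<open>w\<close> itself: it runs through
  \<open>butlast w\<close>, then from the last vertex of \<open>w\<close> to the base, through a
  base loop, and on to the head of \<open>w'\<close>. The base loop adjusts the length and exists
  for every large multiple of \<open>p\<close>.\<close>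

lemma block_mixing:
  assumes w: "w \<in> V" and w': "w' \<in> V"
  shows "\<exists>n0. \<forall>n\<ge>n0. paths V F w w' n \<noteq> {}"
proof -
  obtain n0 where n0: "\<And>n. n \<ge> n0 \<Longrightarrow> p dvd n \<Longrightarrow> paths S E base base n \<noteq> {}" using large_loops by blast
  obtain k1 u where k1: "0 < k1" "u \<in> paths S E (last w) base k1" using conn[OF V_facts(5)[OF w] base] by blast
  obtain k2 t where k2: "p dvd k2" "t \<in> paths S E base (hd w') k2" using V_facts(3)[OF w'] class0_iff by blast
  obtain k3 v where k3: "p dvd k3" "v \<in> paths S E base (hd w) k3" using V_facts(3)[OF w] class0_iff by blast
  \<comment> \<open>Closing the route into a loop at the base through \<open>hd w\<close> shows that
    the connecting length is a multiple of \<open>p\<close>.\<close>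
  have "p dvd k3 + (p - 1 + k1)"
    using paths_append[OF k3(2) paths_append[OF butlast_path[OF w] k1(2)]] loop_dvd[OF base] by blast
  then have pk: "p dvd p - 1 + k1" using k3(1) by (simp add: dvd_add_right_iff)
  define K where "K = (p - 1 + k1 + k2) + n0"
  have "paths V F w w' n \<noteq> {}" if n: "n \<ge> Suc K" for n
  proof -
    define m where "m = p * n - (p - 1 + k1 + k2)"
    have "n \<le> p * n" using p_pos by simp
    moreover have "p - 1 + k1 + k2 + n0 \<le> n" using n by (simp add: K_def)
    ultimately have big: "p - 1 + k1 + k2 + n0 \<le> p * n" by (rule order_trans[rotated])
    then have m0: "n0 \<le> m" by (simp add: m_def)
    have "p dvd m" unfolding m_def by (rule dvd_diff_nat[OF dvd_triv_left dvd_add[OF pk k2(1)]])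
    then obtain o' where o: "o' \<in> paths S E base base m" using n0[OF m0] by blast
    have "butlast w @ (u @ (o' @ t)) \<in> paths S E (hd w) (hd w') (p - 1 + (k1 + (m + k2)))"
      by (rule paths_append[OF butlast_path[OF w] paths_append[OF k1(2) paths_append[OF o k2(2)]]])
    moreover have "p - 1 + (k1 + (m + k2)) = p * n" using big by (simp add: m_def)
    ultimately have c: "butlast w @ (u @ (o' @ t)) \<in> paths S E (hd w) (hd w') (p * n)" by simp
    have "u \<noteq> []" "hd u = last w" using k1 by (auto simp: paths_def hd_append split: if_splits)
    then obtain us where "u = last w # us" by (cases u) auto
    then have "take p (butlast w @ (u @ (o' @ t))) = w"
      using V_facts(1,2)[OF w] p_pos by (simp add: take_Cons')
    then have "blocks p n (butlast w @ (u @ (o' @ t))) \<in> paths V F w w' n"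
      using blocks_paths[OF c V_facts(3)[OF w] _ w' refl] n by simp
    then show ?thesis by blast
  qed
  then show ?thesis by blast
qed

lemma V_ne: "V \<noteq> {}"
proof -
  obtain n where n: "n \<in> loops" "0 < n" using loops_pos by blast
  then obtain c where c: "c \<in> paths S E base base n" by (auto simp: loops_def)
  obtain k where k: "n = p * k" using loops_dvd[OF n(1)] by (auto simp: dvd_def)
  have kp: "0 < k" using n k by (cases k) auto
  have l: "length c = p * k" using paths_length[OF c] k by simp
  have pl: "p \<le> length c" using l kp by simp
  have s: "successively (edge S E) (c @ [base])" using c by (simp add: paths_def)
  have b0: "base \<in> class0 S E" using base by (simp add: class0_def base_def)
  have "hd (take p c) = base" using c pl p_pos n by (cases c) (auto simp: paths_def take_Cons' split: if_splits)
  moreover have "edge S E (take p c ! j) (take p c ! Suc j)" if "Suc j < p" for j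
    using successively_nth[OF s, of j] that pl by (simp add: nth_append)
  moreover have "set (take p c) \<subseteq> S" using paths_set[OF c] by (auto dest: in_set_takeD)
  ultimately have "take p c \<in> V" using b0 pl by (auto simp: block_vertices_def)
  then show ?thesis by blast
qed

lemma decode_block_tms:
  assumes y: "y \<in> tms V F" shows "decode p y \<in> tms S E" "decode p y 0 = hd (y 0)"
proof -
  have yV: "y j \<in> V" for j by (rule tms_in[OF y])
  show "decode p y 0 = hd (y 0)" using V_facts(2)[OF yV[of 0]] by (simp add: decode_def hd_conv_nth)
  show "decode p y \<in> tms S E" unfolding tms_def
  proof (intro CollectI allI)
    fix i
    let ?q = "i div p" and ?r = "i mod p"
    have r: "?r < p" using p_pos by simp
    show "edge S E (decode p y i) (decode p y (Suc i))"
    proof (cases "Suc ?r < p")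
      case True
      then have "Suc i mod p = Suc ?r" "Suc i div p = ?q" using p_pos by (auto simp: mod_Suc div_Suc)
      then show ?thesis using V_facts(7)[OF yV[of ?q] True] by (simp add: decode_def)
    next
      case False
      then have sr: "Suc ?r = p" using r by simp
      then have "Suc i mod p = 0" "Suc i div p = Suc ?q" using p_pos by (auto simp: mod_Suc div_Suc)
      moreover have "edge S E (last (y ?q)) (hd (y (Suc ?q)))" using tms_edge[OF y, of ?q] by (simp add: edge_def[of V F] block_edge_def)
      moreover have "last (y ?q) = y ?q ! ?r" using V_facts(1,2)[OF yV[of ?q]] sr by (metis Suc_eq_plus1 add_diff_cancel_right' last_conv_nth)
      moreover have "hd (y (Suc ?q)) = y (Suc ?q) ! 0" using V_facts(2)[OF yV[of "Suc ?q"]] by (simp add: hd_conv_nth)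
      ultimately show ?thesis by (simp add: decode_def)
    qed
  qed
qed

text \<open>Agreement of \<open>n\<close> blocks means agreement of \<open>p * n\<close> symbols,
  and each of the \<open>p\<close> shifted summands still sees at least
  \<open>p * n - p + 1 \<ge> n\<close> of them.\<close>

lemma hoelder_induced:
  assumes h: "hoelder_const S E \<theta> A \<phi>"
  shows "hoelder_const V F \<theta> (real p * A) (induced_pot S E \<phi>)"
  unfolding hoelder_const_def
proof (intro conjI allI impI ballI)
  have A: "0 \<le> A" "0 < \<theta>" "\<theta> < 1" using h by (auto simp: hoelder_const_def)
  show "0 \<le> real p * A" "0 < \<theta>" "\<theta> < 1" using A by auto
  fix n x y assume n: "2 \<le> (n::nat)" and x: "x \<in> tms V F" and y: "y \<in> tms V F" and eq: "\<forall>i<n. x i = y i"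
  have ag: "decode p x i = decode p y i" if "i < p * n" for i
    using eq index_split(1)[OF p_pos that] by (simp add: decode_def)
  have "\<bar>induced_pot S E \<phi> x - induced_pot S E \<phi> y\<bar> \<le> (\<Sum>k<p. \<bar>\<phi> (suffix k (decode p x)) - \<phi> (suffix k (decode p y))\<bar>)"
    unfolding induced_pot_def birkhoff_suffix sum_subtractf[symmetric] by (rule sum_abs)
  also have "\<dots> \<le> (\<Sum>k<p. A * \<theta> ^ n)"
  proof (rule sum_mono)
    fix k assume "k \<in> {..<p}"
    then have k: "k < p" by simp
    have "k + i < p * n" if "i < n" for i
    proof -
      have "p * 1 + 1 * (n - 1) \<le> p + p * (n - 1)" using p_pos by (intro add_mono mult_le_mono) auto
      also have "\<dots> = p * n" using n by (cases n) auto
      finally show ?thesis using k that by linarith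
    qed
    then have "\<forall>i<n. suffix k (decode p x) i = suffix k (decode p y) i" using ag by auto
    then show "\<bar>\<phi> (suffix k (decode p x)) - \<phi> (suffix k (decode p y))\<bar> \<le> A * \<theta> ^ n"
      using h n tms_suffix[OF decode_block_tms(1)[OF x]] tms_suffix[OF decode_block_tms(1)[OF y]] unfolding hoelder_const_def by blast
  qed
  finally show "\<bar>induced_pot S E \<phi> x - induced_pot S E \<phi> y\<bar> \<le> real p * A * \<theta> ^ n" by simp
qed

lemma induced_bounded:
  assumes "\<And>x. x \<in> tms S E \<Longrightarrow> \<bar>\<psi> x\<bar> \<le> N" "y \<in> tms V F"
  shows "\<bar>induced_pot S E \<psi> y\<bar> \<le> real p * N"
proof -
  have "\<bar>induced_pot S E \<psi> y\<bar> \<le> (\<Sum>k<p. \<bar>\<psi> (suffix k (decode p y))\<bar>)"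
    unfolding induced_pot_def birkhoff_suffix by (rule sum_abs)
  also have "\<dots> \<le> (\<Sum>k<p. N)" by (intro sum_mono assms(1) tms_suffix decode_block_tms(1)[OF assms(2)])
  finally show ?thesis by simp
qed

lemma mixing_induced: "hoelder_const S E \<theta> A \<phi> \<Longrightarrow> mixing_tms V F (induced_pot S E \<phi>) \<theta> (real p * A)"
  by unfold_locales (rule countable_V, rule V_ne, erule hoelder_induced, rule block_mixing)

section \<open>Growth bounds carried from the recoded shift back to the original one\<close>

lemma point_ex: assumes "b \<in> S" shows "\<exists>x. x \<in> tms S E \<and> x 0 = b"
proof -
  obtain n c where n: "0 < n" and c: "c \<in> paths S E b b n" using conn[OF assms assms] by blast
  have "c\<^sup>\<omega> \<in> tms S E" "c\<^sup>\<omega> 0 = b" using iter_tms[OF c n] by simp_all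
  then show ?thesis by blast
qed

definition pt :: "'v \<Rightarrow> nat \<Rightarrow> 'v" where "pt b = (SOME x. x \<in> tms S E \<and> x 0 = b)"

lemma pt: "b \<in> S \<Longrightarrow> pt b \<in> tms S E \<and> pt b 0 = b"
  unfolding pt_def by (rule someI_ex[OF point_ex])

text \<open>Fixed paths \<open>u\<close> and \<open>t\<close> complete each path from
  \<open>a\<close> to \<open>b\<close> to a loop at \<open>hd w\<close> whose first block is
  \<open>w\<close>. This works for arbitrary vertices, in whatever cyclic class: if any path of
  length \<open>n\<close> exists, the completed length is automatically a multiple of
  \<open>p\<close>. One block corresponds to \<open>p\<close> steps, hence the rate
  \<open>Q / p\<close>.\<close>

lemma path_growth:
  assumes h: "hoelder_const S E \<theta> A \<phi>" and w: "w \<in> V" and y: "y \<in> tms V F" "y 0 = w" and K: "0 < K"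
    and loop: "\<And>n. loop_sum V F (induced_pot S E \<phi>) w n y \<le> ennreal (K * exp (real n * Q))"
    and a: "a \<in> S" and b: "b \<in> S"
  shows "\<exists>K'\<ge>0. \<forall>n W. finite W \<longrightarrow> W \<subseteq> paths S E a b n \<longrightarrow> (\<Sum>c\<in>W. exp (birkhoff \<phi> n (c \<frown> pt b))) \<le> K' * exp (real n * (Q / real p))"
proof -
  define x where "x = decode p y"
  have x: "x \<in> tms S E" "x 0 = hd w" using decode_block_tms[OF y(1)] y(2) by (auto simp: x_def)
  obtain k0 u0 where u0: "0 < k0" "u0 \<in> paths S E (last w) a k0" using conn[OF V_facts(5)[OF w] a] by blast
  obtain l t where t: "t \<in> paths S E b (hd w) l" using conn[OF b V_facts(4)[OF w]] by blast
  define u where "u = butlast w @ u0"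
  define k where "k = p - 1 + k0"
  have u: "u \<in> paths S E (hd w) a k" unfolding u_def k_def by (rule paths_append[OF butlast_path[OF w] u0(2)])
  have "u0 \<noteq> []" "hd u0 = last w" using u0 by (auto simp: paths_def hd_append split: if_splits)
  then obtain us where us: "u0 = last w # us" by (cases u0) auto
  \<comment> \<open>Since \<open>u\<close> is \<open>butlast w\<close> followed by a path that
    starts at \<open>last w\<close>, its first \<open>p\<close> vertices spell out
    \<open>w\<close>.\<close>
  have tk: "take p (u @ c) = w" for c
    using V_facts(1,2)[OF w] p_pos us by (simp add: u_def take_Cons')
  have kp: "0 < k" using u0 by (simp add: k_def)
  define C where "C = A / (1 - \<theta>)"
  define \<kappa> where "\<kappa> = 2 * C - birkhoff \<phi> k (u \<frown> pt a) - birkhoff \<phi> l (t \<frown> x)"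
  define K' where "K' = exp \<kappa> * K * exp (real (k + l) * (Q / real p))"
  have K'0: "0 \<le> K'" using K by (simp add: K'_def)
  have "(\<Sum>c\<in>W. exp (birkhoff \<phi> n (c \<frown> pt b))) \<le> K' * exp (real n * (Q / real p))" if W: "finite W" "W \<subseteq> paths S E a b n" for n W
  proof (cases "W = {}")
    case True then show ?thesis using K'0 by simp
  next
    case False
    have ucp: "u @ c @ t \<in> paths S E (hd w) (hd w) (k + (n + l))" if "c \<in> W" for c
      using that W(2) by (intro paths_append[OF u paths_append[OF _ t]]) auto
    then have "p dvd k + (n + l)" using False loop_dvd[OF V_facts(4)[OF w]] by blast
    then obtain m where m: "k + (n + l) = p * m" by (auto simp: dvd_def)
    have m0: "0 < m" using m kp by (cases m) auto
    let ?j = "\<lambda>c. blocks p m (u @ c @ t)"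
    have jp: "?j c \<in> paths V F w w m" if "c \<in> W" for c
      using blocks_paths[OF ucp[OF that, unfolded m] V_facts(3)[OF w] m0 w refl] unfolding tk .
    have cj: "concat (?j c) = u @ c @ t" if "c \<in> W" for c
      by (rule concat_blocks) (use paths_length[OF ucp[OF that]] m p_pos in auto)
    have "ennreal (\<Sum>c\<in>W. exp (birkhoff \<phi> n (c \<frown> pt b))) = (\<integral>\<^sup>+c. ennreal (exp (birkhoff \<phi> n (c \<frown> pt b))) \<partial>count_space W)"
      using W(1) by (simp add: nn_integral_count_space_finite)
    also have "\<dots> \<le> (\<integral>\<^sup>+cs. ennreal (exp \<kappa>) * ennreal (exp (birkhoff (induced_pot S E \<phi>) m (cs \<frown> y))) \<partial>count_space (paths V F w w m))"
    proof (rule nn_integral_count_space_inj_le[where j = ?j])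
      show "inj_on ?j W"
      proof (rule inj_onI)
        fix c c' assume "c \<in> W" "c' \<in> W" "?j c = ?j c'"
        then have "u @ c @ t = u @ c' @ t" using cj by metis
        then show "c = c'" by simp
      qed
      show "?j ` W \<subseteq> paths V F w w m" using jp by blast
      fix c assume c: "c \<in> W"
      have "decode p (?j c \<frown> y) = (u @ c @ t) \<frown> x"
        using decode_concat[of "?j c" p y] concat_paths(2)[OF jp[OF c] w] p_pos cj[OF c] by (simp add: x_def)
      then have e: "birkhoff (induced_pot S E \<phi>) m (?j c \<frown> y) = birkhoff \<phi> (k + n + l) ((u @ c @ t) \<frown> x)"
        using birkhoff_induced[OF p_pos, of \<phi> m "?j c \<frown> y"] m by (simp add: add.assoc)
      have "birkhoff \<phi> n (c \<frown> pt b) \<le> \<kappa> + birkhoff \<phi> (k + n + l) ((u @ c @ t) \<frown> x)"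
        using birkhoff_glue[OF h u _ t x, of c n "pt b" "pt a"] c W(2) pt[OF a] pt[OF b] by (auto simp: \<kappa>_def C_def abs_le_iff)
      then show "ennreal (exp (birkhoff \<phi> n (c \<frown> pt b))) \<le> ennreal (exp \<kappa>) * ennreal (exp (birkhoff (induced_pot S E \<phi>) m (?j c \<frown> y)))"
        unfolding ennreal_exp_mult e by (intro ennreal_leI) simp
    qed
    also have "\<dots> = ennreal (exp \<kappa>) * loop_sum V F (induced_pot S E \<phi>) w m y" by (simp add: nn_integral_cmult loop_sum_def)
    also have "\<dots> \<le> ennreal (exp \<kappa>) * ennreal (K * exp (real m * Q))" using loop by (intro mult_left_mono) auto
    also have "\<dots> = ennreal (exp \<kappa> * (K * exp (real m * Q)))" by (rule ennreal_mult[symmetric]) (use K in auto)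
    also have "exp \<kappa> * (K * exp (real m * Q)) = K' * exp (real n * (Q / real p))"
    proof -
      have "real (p * m) = real (k + l) + real n" using m by (metis add.left_commute add.commute of_nat_add)
      then have "real m * Q = (real (k + l) + real n) * (Q / real p)" using p_pos by (simp add: field_simps)
      then have "real m * Q = real (k + l) * (Q / real p) + real n * (Q / real p)" by (simp only: distrib_right)
      then show ?thesis by (simp only: K'_def exp_add mult.assoc)
    qed
    finally show ?thesis using K'0 by (simp add: ennreal_le_iff)
  qed
  then show ?thesis using K'0 by blast
qed

lemma block_variational_upper:
  assumes h: "hoelder_const S E \<theta> A \<phi>" and w: "w \<in> V" and y: "y \<in> tms V F" "y 0 = w" and K: "0 < K"
    and loop: "\<And>n. loop_sum V F (induced_pot S E \<phi>) w n y \<le> ennreal (K * exp (real n * Q))"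
    and M: "\<And>x. x \<in> tms S E \<Longrightarrow> \<phi> x \<le> M" and \<mu>: "inv_prob S E \<mu>" and int: "integrable \<mu> \<phi>"
  shows "ks_entropy \<mu> + ereal (\<integral>x. \<phi> x \<partial>\<mu>) \<le> ereal (Q / real p)"
proof -
  interpret inv_tms S E \<mu> by unfold_locales (rule S, rule \<mu>)
  define R where "R a b K' \<longleftrightarrow> (\<forall>n W. finite W \<longrightarrow> W \<subseteq> paths S E a b n \<longrightarrow> (\<Sum>c\<in>W. exp (birkhoff \<phi> n (c \<frown> pt b))) \<le> K' * exp (real n * (Q / real p)))" for a b K'
  have "\<exists>K'\<ge>0. a \<in> S \<longrightarrow> b \<in> S \<longrightarrow> R a b K'" for a b
  proof (cases "a \<in> S \<and> b \<in> S")
    case True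
    then have ab: "a \<in> S" "b \<in> S" by auto
    show ?thesis using path_growth[OF h w y K loop ab] unfolding R_def by blast
  qed auto
  then have "\<exists>KK. \<forall>a b. 0 \<le> KK a b \<and> (a \<in> S \<longrightarrow> b \<in> S \<longrightarrow> R a b (KK a b))" by metis
  then obtain KK where KK0: "\<And>a b. 0 \<le> KK a b" and KKR: "\<And>a b. a \<in> S \<Longrightarrow> b \<in> S \<Longrightarrow> R a b (KK a b)" by blast
  have "entropy_wrt \<mu> P + (\<integral>x. \<phi> x \<partial>\<mu>) \<le> Q / real p" if "finite_partition \<mu> P" for P
  proof (rule variational_upper[where M = M and xb = pt and K = KK, OF that h])
    show "\<phi> x \<le> M" if "x \<in> tms S E" for x using that by (rule M)
    show "integrable \<mu> \<phi>" by (rule int)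
    show "pt b \<in> tms S E \<and> pt b 0 = b" if "b \<in> S" for b using that by (rule pt)
    show "0 \<le> KK a b" for a b by (rule KK0)
    show "(\<Sum>c\<in>W. exp (birkhoff \<phi> n (c \<frown> pt b))) \<le> KK a b * exp (real n * (Q / real p))"
      if "a \<in> S" "b \<in> S" "finite W" "W \<subseteq> paths S E a b n" for a b n W
      using KKR[OF that(1,2)] that(3,4) unfolding R_def by blast
  qed
  then have "ks_entropy \<mu> \<le> ereal (Q / real p - (\<integral>x. \<phi> x \<partial>\<mu>))"
    unfolding ks_entropy_def by (intro SUP_least) (simp add: algebra_simps)
  then have "ks_entropy \<mu> + ereal (\<integral>x. \<phi> x \<partial>\<mu>) \<le> ereal (Q / real p - (\<integral>x. \<phi> x \<partial>\<mu>)) + ereal (\<integral>x. \<phi> x \<partial>\<mu>)" by (rule add_right_mono)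
  then show ?thesis by simp
qed

end

section \<open>The square root bound\<close>

text \<open>For small \<open>s\<close> of the sign of \<open>\<Delta>\<close>, a nonzero linear term
  would outweigh the quadratic one.\<close>

lemma linear_le_quadratic_imp_zero:
  fixes \<Delta> c N \<epsilon> :: real
  assumes c: "0 \<le> c" and N: "0 \<le> N" and \<epsilon>: "0 < \<epsilon>"
    and le: "\<And>s. \<bar>s\<bar> * N \<le> \<epsilon> \<Longrightarrow> s * \<Delta> \<le> c * s\<^sup>2"
  shows "\<Delta> = 0"
proof (rule ccontr)
  assume nz: "\<Delta> \<noteq> 0"
  define t where "t = min (\<epsilon> / (N + 1)) (\<bar>\<Delta>\<bar> / (c + 1))"
  have t: "0 < t" using \<epsilon> N c nz by (simp add: t_def)
  have "t * N \<le> \<epsilon> / (N + 1) * N" using N by (intro mult_right_mono) (auto simp: t_def)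
  also have "\<dots> \<le> \<epsilon>" using N \<epsilon> by (simp add: field_simps)
  finally have "\<bar>sgn \<Delta> * t\<bar> * N \<le> \<epsilon>" using t nz by (simp add: abs_mult abs_sgn_eq)
  then have "sgn \<Delta> * t * \<Delta> \<le> c * (sgn \<Delta> * t)\<^sup>2" by (rule le)
  also have "sgn \<Delta> * t * \<Delta> = t * \<bar>\<Delta>\<bar>" by (simp add: abs_sgn[of \<Delta>] ac_simps)
  also have "(sgn \<Delta> * t)\<^sup>2 = t * t" using nz by (simp add: power2_eq_square sgn_if)
  finally have "\<bar>\<Delta>\<bar> \<le> c * t" using t by (simp add: mult.left_commute)
  also have "c * t \<le> c * (\<bar>\<Delta>\<bar> / (c + 1))" using c by (intro mult_left_mono) (auto simp: t_def)
  also have "\<dots> < \<bar>\<Delta>\<bar>" using c nz by (simp add: field_simps)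
  finally show False by simp
qed

text \<open>The optimal \<open>s\<close> has modulus \<open>sqrt D / N\<close> and is admissible
  only for \<open>sqrt D \<le> \<epsilon>\<close>. For larger \<open>D\<close> the trivial bound
  \<open>2 * N\<close> is already below \<open>2 / \<epsilon> * N * sqrt D\<close>. The cases
  \<open>N = 0\<close> and \<open>D = 0\<close>, where the optimal choice degenerates, are treated
  separately.\<close>

lemma sqrt_bound_of_quadratic:
  fixes \<Delta> D c N \<epsilon> :: real
  assumes c: "0 \<le> c" and N: "0 \<le> N" and \<epsilon>: "0 < \<epsilon>" and D: "0 \<le> D" and triv: "\<bar>\<Delta>\<bar> \<le> 2 * N"
    and le: "\<And>s. \<bar>s\<bar> * N \<le> \<epsilon> \<Longrightarrow> s * \<Delta> \<le> D + c * N\<^sup>2 * s\<^sup>2"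
  shows "\<bar>\<Delta>\<bar> \<le> (1 + c + 2 / \<epsilon>) * N * sqrt D"
proof -
  have pos: "0 \<le> N * sqrt D" using N D by simp
  consider "N = 0" | "D = 0" | "N > 0" "D > 0" "sqrt D \<le> \<epsilon>" | "\<epsilon> < sqrt D" using N D by fastforce
  then show ?thesis
  proof cases
    case 1 then show ?thesis using triv by simp
  next
    case 2
    have "\<Delta> = 0"
      by (rule linear_le_quadratic_imp_zero[of "c * N\<^sup>2" N \<epsilon>]) (use c N \<epsilon> le 2 in auto)
    then show ?thesis using 2 by simp
  next
    case 3
    show ?thesis
    proof (cases "\<Delta> = 0")
      case True then show ?thesis using pos c \<epsilon> by (simp add: mult.assoc)
    next
      case nz: False
      define s where "s = sgn \<Delta> * (sqrt D / N)"
      have "\<bar>s\<bar> * N = sqrt D" using nz 3 by (simp add: s_def abs_mult abs_sgn_eq)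
      then have "s * \<Delta> \<le> D + c * N\<^sup>2 * s\<^sup>2" using 3 by (intro le) simp
      also have "s * \<Delta> = sqrt D / N * \<bar>\<Delta>\<bar>" by (simp add: s_def abs_sgn[of \<Delta>] ac_simps)
      also have "s\<^sup>2 = D / N\<^sup>2" using nz 3 by (simp add: s_def power_mult_distrib power_divide sgn_if)
      also have "D + c * N\<^sup>2 * (D / N\<^sup>2) = (1 + c) * sqrt D * sqrt D" using 3 by (simp add: field_simps)
      finally have "sqrt D * \<bar>\<Delta>\<bar> \<le> sqrt D * ((1 + c) * (N * sqrt D))" using 3 by (simp add: field_simps)
      then have "\<bar>\<Delta>\<bar> \<le> (1 + c) * (N * sqrt D)" using 3 by simp
      also have "\<dots> \<le> (1 + c + 2 / \<epsilon>) * (N * sqrt D)" using \<epsilon> by (intro mult_right_mono pos) simp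
      finally show ?thesis by (simp add: mult.assoc)
    qed
  next
    case 4
    have "2 * N \<le> 2 / \<epsilon> * (N * sqrt D)"
    proof -
      have "N * \<epsilon> \<le> N * sqrt D" using N 4 by (intro mult_left_mono) auto
      then show ?thesis using \<epsilon> by (simp add: field_simps)
    qed
    also have "\<dots> \<le> (1 + c + 2 / \<epsilon>) * (N * sqrt D)" using c by (intro mult_right_mono pos) simp
    finally show ?thesis using triv by (simp add: mult.assoc)
  qed
qed

text \<open>The single number \<open>hnorm\<close> serves both as a bound for the values and as a
  Hoelder constant; \<open>exp (- \<beta>) \<le> \<theta>\<close> converts the rate of
  \<open>\<psi>\<close> to that of \<open>\<phi>\<close>.\<close>

lemma in_H_bounds:
  assumes H: "in_H S E \<beta> \<psi>" and \<beta>: "0 < \<beta>" "exp (- \<beta>) \<le> \<theta>" and \<theta>: "\<theta> < 1"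
  shows "\<And>x. x \<in> tms S E \<Longrightarrow> \<bar>\<psi> x\<bar> \<le> hnorm S E \<beta> \<psi>" "hoelder_const S E \<theta> (hnorm S E \<beta> \<psi>) \<psi>"
proof -
  let ?X = "insert 0 ((\<lambda>x. \<bar>\<psi> x\<bar>) ` tms S E)"
  let ?Y = "insert 0 {\<bar>\<psi> x - \<psi> y\<bar> * exp (\<beta> * real (agree_time x y)) | x y. x \<in> tms S E \<and> y \<in> tms S E \<and> x \<noteq> y}"
  have X: "t \<le> Sup ?X" if "t \<in> ?X" for t by (rule cSup_upper[OF that]) (use H in \<open>simp add: in_H_def\<close>)
  have Y: "t \<le> Sup ?Y" if "t \<in> ?Y" for t by (rule cSup_upper[OF that]) (use H in \<open>simp add: in_H_def\<close>)
  have X0: "0 \<le> Sup ?X" and Y0: "0 \<le> Sup ?Y" by (rule X, simp) (rule Y, simp)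
  have N: "hnorm S E \<beta> \<psi> = Sup ?X + Sup ?Y" by (rule hnorm_def)
  show b: "\<bar>\<psi> x\<bar> \<le> hnorm S E \<beta> \<psi>" if "x \<in> tms S E" for x
    using X[of "\<bar>\<psi> x\<bar>"] that Y0 unfolding N by simp
  have \<theta>0: "0 < \<theta>" using \<beta>(2) exp_gt_zero[of "- \<beta>"] by linarith
  show "hoelder_const S E \<theta> (hnorm S E \<beta> \<psi>) \<psi>"
    unfolding hoelder_const_def
  proof (intro conjI allI impI ballI \<theta> \<theta>0)
    show N0: "0 \<le> hnorm S E \<beta> \<psi>" using X0 Y0 unfolding N by simp
    fix n x y assume xy: "x \<in> tms S E" "y \<in> tms S E" "\<forall>i<n. x i = y i"
    show "\<bar>\<psi> x - \<psi> y\<bar> \<le> hnorm S E \<beta> \<psi> * \<theta> ^ n"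
    proof (cases "x = y")
      case True then show ?thesis using N0 \<theta>0 by simp
    next
      case False
      define t where "t = agree_time x y"
      have nt: "n \<le> t" unfolding t_def by (rule agree_time_ge[OF False]) (use xy in blast)
      have "\<bar>\<psi> x - \<psi> y\<bar> * exp (\<beta> * real t) \<le> Sup ?Y" unfolding t_def by (rule Y) (use xy False in blast)
      then have "\<bar>\<psi> x - \<psi> y\<bar> * exp (\<beta> * real t) \<le> hnorm S E \<beta> \<psi>" using X0 unfolding N by linarith
      then have "\<bar>\<psi> x - \<psi> y\<bar> \<le> hnorm S E \<beta> \<psi> * exp (- \<beta> * real t)" by (simp add: exp_minus field_simps)
      also have "exp (- \<beta> * real t) \<le> exp (real n * (- \<beta>))" using nt \<beta> by (simp add: mult.commute)
      also have "exp (real n * (- \<beta>)) = exp (- \<beta>) ^ n" by (rule exp_of_nat_mult)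
      also have "exp (- \<beta>) ^ n \<le> \<theta> ^ n" using \<beta> by (intro power_mono) auto
      finally show ?thesis using N0 by (simp add: mult_left_mono)
    qed
  qed
qed

section \<open>Finiteness of pressure and the two halves of the variational principle\<close>

context transitive_tms
begin

lemma induced_lin: "induced_pot S E (\<lambda>x. f x + s * g x) = (\<lambda>y. induced_pot S E f y + s * induced_pot S E g y)"
  by (rule ext) (simp add: induced_pot_def birkhoff_lin)

lemma induced_zero: "induced_pot S E (\<lambda>_. 0) = (\<lambda>_. 0)"
  by (rule ext) (simp add: induced_pot_def birkhoff_def)

lemma mixing_zero:
  assumes "hoelder_const S E \<theta> A \<phi>" shows "mixing_tms V F (\<lambda>_. 0) \<theta> 0"
proof -
  have "hoelder_const S E \<theta> 0 (\<lambda>_. 0)" using assms by (simp add: hoelder_const_def)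
  from mixing_induced[OF this] show ?thesis by (simp only: induced_zero mult_zero_right)
qed

text \<open>From \<open>\<phi> \<le> M\<close> each loop sum is at most
  \<open>exp (n * p * M)\<close> times the number of loops, whose growth is the finite entropy; the
  lower bound comes from mixing.\<close>

lemma pressure_finite:
  assumes h: "hoelder_const S E \<theta> A \<phi>" and M: "\<And>x. x \<in> tms S E \<Longrightarrow> \<phi> x \<le> M"
    and ent: "gpres_mixing V F (\<lambda>_. 0) \<le> ereal L"
  shows "\<exists>P. gpres_mixing V F (induced_pot S E \<phi>) = ereal P"
proof -
  interpret f: mixing_tms V F "induced_pot S E \<phi>" \<theta> "real p * A" by (rule mixing_induced[OF h])
  interpret z: mixing_tms V F "\<lambda>_. 0" \<theta> 0 by (rule mixing_zero[OF h])
  obtain a where a: "a \<in> V" using V_ne by blast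
  have bound: "birkhoff (induced_pot S E \<phi>) n y \<le> real n * (real p * M)" if "y \<in> tms V F" for n y
  proof -
    have "birkhoff (induced_pot S E \<phi>) n y = (\<Sum>k<p * n. \<phi> (suffix k (decode p y)))"
      unfolding birkhoff_induced[OF p_pos] by (rule birkhoff_suffix)
    also have "\<dots> \<le> (\<Sum>k<p * n. M)" by (intro sum_mono M tms_suffix decode_block_tms(1)[OF that])
    finally show ?thesis by (simp add: ac_simps)
  qed
  have Z: "Zn V F (induced_pot S E \<phi>) n a \<le> ennreal (exp (real n * (real p * M + L)))" if n: "0 < n" for n
  proof -
    have "Zn V F (induced_pot S E \<phi>) n a = (\<integral>\<^sup>+c. ennreal (exp (birkhoff (induced_pot S E \<phi>) n (c\<^sup>\<omega>))) \<partial>count_space (paths V F a a n))"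
      by (rule Zn_paths[OF countable_V n])
    also have "\<dots> \<le> (\<integral>\<^sup>+c. ennreal (exp (real n * (real p * M))) * ennreal (exp (birkhoff (\<lambda>_. 0) n (c\<^sup>\<omega>))) \<partial>count_space (paths V F a a n))"
    proof (rule nn_integral_mono)
      fix c assume "c \<in> space (count_space (paths V F a a n))"
      then have c: "c \<in> paths V F a a n" by simp
      show "ennreal (exp (birkhoff (induced_pot S E \<phi>) n (c\<^sup>\<omega>))) \<le> ennreal (exp (real n * (real p * M))) * ennreal (exp (birkhoff (\<lambda>_. 0) n (c\<^sup>\<omega>)))"
        unfolding ennreal_exp_mult using bound[OF iter_tms(1)[OF c n], of n] by (intro ennreal_leI) (simp add: birkhoff_def)
    qed
    also have "\<dots> = ennreal (exp (real n * (real p * M))) * Zn V F (\<lambda>_. 0) n a"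
      unfolding Zn_paths[OF countable_V n] by (rule nn_integral_cmult) simp
    also have "\<dots> \<le> ennreal (exp (real n * (real p * M))) * ennreal (exp (5 * z.C + L * real n))"
      using z.pressure_limit(3)[OF a ent, of n] n by (intro mult_left_mono) auto
    also have "\<dots> = ennreal (exp (real n * (real p * M + L)))"
      unfolding ennreal_exp_mult z.C_def by (simp add: algebra_simps)
    finally show ?thesis .
  qed
  have "eln (Zn V F (induced_pot S E \<phi>) (Suc n) a) / ereal (real (Suc n)) \<le> ereal (real p * M + L)" for n
  proof -
    have "eln (Zn V F (induced_pot S E \<phi>) (Suc n) a) \<le> ereal (real (Suc n) * (real p * M + L))"
      unfolding eln_le_iff by (rule Z) simp
    then have "eln (Zn V F (induced_pot S E \<phi>) (Suc n) a) / ereal (real (Suc n)) \<le> ereal (real (Suc n) * (real p * M + L)) / ereal (real (Suc n))"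
      by (rule ereal_divide_right_mono) simp
    also have "\<dots> = ereal (real p * M + L)" by (simp del: of_nat_Suc)
    finally show ?thesis .
  qed
  then have "gpres_mixing V F (induced_pot S E \<phi>) \<le> ereal (real p * M + L)"
    by (intro LIMSEQ_le_const2[OF f.pressure_limit(1)[OF a]]) blast
  then show ?thesis using f.pressure_limit(2) by (cases "gpres_mixing V F (induced_pot S E \<phi>)") auto
qed

text \<open>Here \<open>loop_sum\<close> is bounded at rate \<open>Q\<close> for every
  \<open>n\<close>: one \<open>C\<close> for passing to \<open>Zn\<close> and \<open>5 * C\<close>
  from its growth bound give \<open>6 * C\<close>.\<close>

lemma pressure_upper:
  assumes h: "hoelder_const S E \<theta> A \<phi>" and Q: "gpres_mixing V F (induced_pot S E \<phi>) \<le> ereal Q"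
    and M: "\<And>x. x \<in> tms S E \<Longrightarrow> \<phi> x \<le> M" and \<mu>: "inv_prob S E \<mu>" and int: "integrable \<mu> \<phi>"
  shows "ks_entropy \<mu> + ereal (\<integral>x. \<phi> x \<partial>\<mu>) \<le> ereal (Q / real p)"
proof -
  interpret f: mixing_tms V F "induced_pot S E \<phi>" \<theta> "real p * A" by (rule mixing_induced[OF h])
  obtain w where w: "w \<in> V" using V_ne by blast
  obtain y where y: "y \<in> tms V F" "y 0 = w" using f.point[OF w] by blast
  have loop: "loop_sum V F (induced_pot S E \<phi>) w n y \<le> ennreal (exp (6 * f.C) * exp (real n * Q))" for n
  proof (cases "n = 0")
    case True
    then show ?thesis using f.A(4) by (simp add: loop_sum_0 flip: ennreal_1)
  next
    case False
    then have n: "0 < n" "1 \<le> n" by auto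
    have "loop_sum V F (induced_pot S E \<phi>) w n y \<le> ennreal (exp f.C) * Zn V F (induced_pot S E \<phi>) n w"
      using loop_sum_Zn(1)[OF countable_V f.h y n(1)] unfolding f.C_def .
    also have "\<dots> \<le> ennreal (exp f.C) * ennreal (exp (5 * f.C + Q * real n))"
      using f.pressure_limit(3)[OF w Q n(2)] by (intro mult_left_mono) auto
    also have "\<dots> = ennreal (exp (6 * f.C) * exp (real n * Q))"
      unfolding ennreal_exp_mult exp_add[symmetric] by (simp add: mult.commute)
    finally show ?thesis .
  qed
  show ?thesis
  proof (rule block_variational_upper[where K = "exp (6 * f.C)" and M = M, OF h w y])
    show "0 < exp (6 * f.C)" by simp
    show "\<phi> x \<le> M" if "x \<in> tms S E" for x using that by (rule M)
  qed (rule loop, rule \<mu>, rule int)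
qed

lemma entropy_upper:
  assumes h: "hoelder_const S E \<theta> A \<phi>" and L: "gpres_mixing V F (\<lambda>_. 0) \<le> ereal L" and \<mu>: "inv_prob S E \<mu>"
  shows "ks_entropy \<mu> \<le> ereal (L / real p)"
proof -
  have h0: "hoelder_const S E \<theta> 0 (\<lambda>_. 0)" using h by (simp add: hoelder_const_def)
  have "ks_entropy \<mu> + ereal (\<integral>x. 0 \<partial>\<mu>) \<le> ereal (L / real p)"
    by (rule pressure_upper[where M = 0, OF h0 _ _ \<mu>]) (simp_all add: induced_zero L)
  then show ?thesis by (simp add: zero_ereal_def[symmetric])
qed

text \<open>For one large \<open>n\<close>, finitely many loops of the recoded graph already carry
  most of the growth of \<open>Zn\<close>. Unfolded to loops of length \<open>p * n\<close> they
  define a Bernoulli measure with nearly maximal pressure.\<close>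

lemma pressure_lower:
  assumes h: "hoelder_const S E \<theta> A \<phi>" and P: "gpres_mixing V F (induced_pot S E \<phi>) = ereal P" and e: "0 < e"
  shows "\<exists>\<mu>. inv_prob S E \<mu> \<and> ereal (P / real p - e) \<le> meas_pressure \<mu> \<phi>"
proof -
  interpret f: mixing_tms V F "induced_pot S E \<phi>" \<theta> "real p * A" by (rule mixing_induced[OF h])
  have A: "0 \<le> A" "\<theta> < 1" using h by (auto simp: hoelder_const_def)
  obtain w where w: "w \<in> V" using V_ne by blast
  \<comment> \<open>Half of the error covers the growth rate at finite \<open>n\<close>, the other
    half the distortion \<open>A / (1 - \<theta>)\<close>, which is at most
    \<open>n * \<delta>\<close> for large \<open>n\<close>; dividing by \<open>p * n\<close> the
    total loss is \<open>e\<close>.\<close>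
  define \<delta> where "\<delta> = real p * e / 2"
  have \<delta>: "0 < \<delta>" using e p_pos by (simp add: \<delta>_def)
  have "\<forall>\<^sub>F n in sequentially. ereal (P - \<delta>) < eln (Zn V F (induced_pot S E \<phi>) (Suc n) w) / ereal (real (Suc n))"
    by (rule order_tendstoD(1)[OF f.pressure_limit(1)[OF w]]) (use P \<delta> in simp)
  then obtain n0 where n0: "\<And>n. n \<ge> n0 \<Longrightarrow> ereal (P - \<delta>) < eln (Zn V F (induced_pot S E \<phi>) (Suc n) w) / ereal (real (Suc n))"
    unfolding eventually_sequentially by blast
  obtain n1 :: nat where n1: "A / (1 - \<theta>) / \<delta> \<le> real n1" using real_arch_simple by blast
  define n where "n = Suc (n0 + n1)"
  have n: "0 < n" by (simp add: n_def)
  have big: "A / (1 - \<theta>) \<le> real n * \<delta>"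
  proof -
    have "A / (1 - \<theta>) / \<delta> \<le> real n" using n1 by (simp add: n_def)
    then show ?thesis using pos_divide_le_eq[OF \<delta>] by blast
  qed
  have "ennreal (exp (real n * (P - \<delta>))) < Zn V F (induced_pot S E \<phi>) n w"
  proof (rule ccontr)
    assume "\<not> ?thesis"
    then have "eln (Zn V F (induced_pot S E \<phi>) n w) \<le> ereal (real n * (P - \<delta>))" by (simp add: eln_le_iff)
    then have "eln (Zn V F (induced_pot S E \<phi>) n w) / ereal (real n) \<le> ereal (real n * (P - \<delta>)) / ereal (real n)"
      using n by (intro ereal_divide_right_mono) simp_all
    also have "\<dots> = ereal (P - \<delta>)" using n by simp
    finally show False using n0[of "n0 + n1"] by (simp add: n_def del: of_nat_Suc)
  qed
  also have "Zn V F (induced_pot S E \<phi>) n w = infsum (\<lambda>c. ennreal (exp (birkhoff (induced_pot S E \<phi>) n (c\<^sup>\<omega>)))) (paths V F w w n)"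
    unfolding Zn_paths[OF countable_V n] by (rule infsum_ennreal_nn_integral[OF countable_paths[OF countable_V], symmetric])
  also have "\<dots> = (SUP W\<in>{W. finite W \<and> W \<subseteq> paths V F w w n}. \<Sum>c\<in>W. ennreal (exp (birkhoff (induced_pot S E \<phi>) n (c\<^sup>\<omega>))))"
    by (rule nonneg_infsum_complete) simp
  finally obtain W0 where W0: "finite W0" "W0 \<subseteq> paths V F w w n"
    "ennreal (exp (real n * (P - \<delta>))) < (\<Sum>c\<in>W0. ennreal (exp (birkhoff (induced_pot S E \<phi>) n (c\<^sup>\<omega>))))"
    unfolding less_SUP_iff by blast
  have ne: "W0 \<noteq> {}" using W0(3) by auto
  have len: "length v = p" if "cs \<in> W0" "v \<in> set cs" for cs v
    using concat_paths(2)[OF subsetD[OF W0(2) that(1)] w that(2)] .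
  have lcs: "length cs = n" if "cs \<in> W0" for cs using paths_length[OF subsetD[OF W0(2) that]] .
  have inj: "inj_on concat W0"
  proof (rule inj_onI)
    fix cs ds assume cd: "cs \<in> W0" "ds \<in> W0" "concat cs = concat ds"
    show "cs = ds"
      by (rule concat_inj_uniform[of cs p ds]) (use cd len lcs in auto)
  qed
  interpret B: loop_bernoulli S E \<phi> \<theta> A "concat ` W0" "hd w" "p * n"
  proof
    show "concat ` W0 \<subseteq> paths S E (hd w) (hd w) (p * n)" using concat_paths(1)[OF _ w] W0(2) by blast
  qed (use S h W0(1) ne n p_pos in auto)
  have "B.Z = (\<Sum>cs\<in>W0. exp (birkhoff (induced_pot S E \<phi>) n (cs\<^sup>\<omega>)))"
    unfolding B.Z_def sum.reindex[OF inj]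
  proof (rule sum.cong[OF refl])
    fix cs assume cs: "cs \<in> W0"
    have "decode p (cs\<^sup>\<omega>) = (concat cs)\<^sup>\<omega>"
      by (rule decode_iter[OF len[OF cs] p_pos]) (use lcs[OF cs] n in auto)
    then show "((\<lambda>c. exp (birkhoff \<phi> (p * n) (c\<^sup>\<omega>))) \<circ> concat) cs = exp (birkhoff (induced_pot S E \<phi>) n (cs\<^sup>\<omega>))"
      by (simp only: birkhoff_induced[OF p_pos] o_def)
  qed
  then have "exp (real n * (P - \<delta>)) < B.Z" using W0(3) by (simp add: sum_nonneg ennreal_less_iff)
  then have "real n * (P - \<delta>) \<le> ln B.Z" using B.Z_pos by (simp add: ln_ge_iff)
  then have "real n * (P - \<delta>) - real n * \<delta> \<le> ln B.Z - A / (1 - \<theta>)" using big by linarith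
  then have "(real n * (P - \<delta>) - real n * \<delta>) / real (p * n) \<le> (ln B.Z - A / (1 - \<theta>)) / real (p * n)"
    by (rule divide_right_mono) simp
  also have "(real n * (P - \<delta>) - real n * \<delta>) / real (p * n) = P / real p - e"
    using n p_pos by (simp add: \<delta>_def field_simps)
  finally have "ereal (P / real p - e) \<le> ereal ((ln B.Z - A / (1 - \<theta>)) / real (p * n))" by simp
  also have "\<dots> \<le> meas_pressure B.\<mu> \<phi>" by (rule B.pressure_lower)
  finally show ?thesis using B.inv_prob_\<mu> by blast
qed

text \<open>Finite entropy excludes \<open>\<infinity> - \<infinity>\<close>, and the positive part
  of \<open>\<phi>\<close> is bounded, so a pressure other than \<open>- \<infinity>\<close> forces
  the negative part to be integrable. All further reasoning can then use real integrals.\<close>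

lemma finite_meas_pressure:
  assumes h: "hoelder_const S E \<theta> A \<phi>" and L: "gpres_mixing V F (\<lambda>_. 0) \<le> ereal L" and \<mu>: "inv_prob S E \<mu>"
    and M: "\<And>x. x \<in> tms S E \<Longrightarrow> \<phi> x \<le> M" and ninf: "meas_pressure \<mu> \<phi> \<noteq> - \<infinity>"
  shows "\<exists>k. ks_entropy \<mu> = ereal k \<and> integrable \<mu> \<phi> \<and> meas_pressure \<mu> \<phi> = ereal (k + (\<integral>x. \<phi> x \<partial>\<mu>))"
proof -
  interpret inv_tms S E \<mu> by unfold_locales (rule S, rule \<mu>)
  have "finite_partition \<mu> {space \<mu>}" by (auto simp: finite_partition_def disjoint_def)
  then have "ereal (entropy_wrt \<mu> {space \<mu>}) \<le> ks_entropy \<mu>" unfolding ks_entropy_def by (intro SUP_upper) simp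
  then obtain k where k: "ks_entropy \<mu> = ereal k" using entropy_upper[OF h L \<mu>] by (cases "ks_entropy \<mu>") auto
  have p: "(\<lambda>x. ennreal (max (\<phi> x) 0)) = (\<lambda>x. ennreal (\<phi> x))" "(\<lambda>x. ennreal (max (- \<phi> x) 0)) = (\<lambda>x. ennreal (- \<phi> x))"
    by (auto simp: fun_eq_iff max_def ennreal_neg)
  have "(\<integral>\<^sup>+x. ennreal (\<phi> x) \<partial>\<mu>) \<le> (\<integral>\<^sup>+x. ennreal M \<partial>\<mu>)" using M by (intro nn_integral_mono ennreal_leI) (simp add: space_mu)
  also have "\<dots> < \<infinity>" by (simp add: emeasure_space_1)
  finally have pos: "(\<integral>\<^sup>+x. ennreal (\<phi> x) \<partial>\<mu>) \<noteq> \<infinity>" by simp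
  then obtain r where r: "0 \<le> r" "(\<integral>\<^sup>+x. ennreal (\<phi> x) \<partial>\<mu>) = ennreal r" by (cases "\<integral>\<^sup>+x. ennreal (\<phi> x) \<partial>\<mu>") auto
  have neg: "(\<integral>\<^sup>+x. ennreal (- \<phi> x) \<partial>\<mu>) \<noteq> \<infinity>"
  proof
    assume "(\<integral>\<^sup>+x. ennreal (- \<phi> x) \<partial>\<mu>) = \<infinity>"
    then have "meas_pressure \<mu> \<phi> = - \<infinity>" unfolding meas_pressure_def ext_integral_def p k using r by simp
    then show False using ninf by simp
  qed
  have int: "integrable \<mu> \<phi>" unfolding real_integrable_def using hoelder_measurable[OF h] pos neg by simp
  then show ?thesis using k ext_integral_eq[OF int] by (simp add: meas_pressure_def)
qed

end

theorem theorem7p3: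
  fixes S :: "'v set" and E :: "'v \<Rightarrow> 'v \<Rightarrow> bool"
    and \<phi> :: "(nat \<Rightarrow> 'v) \<Rightarrow> real" and \<theta> \<beta> :: real
    and m :: "(nat \<Rightarrow> 'v) measure"
  assumes "countable S"
    and "top_transitive S E"
    and "gurevich_entropy S E < \<infinity>"
    and "weakly_hoelder S E \<theta> \<phi>"
    and "SPR S E \<phi>"
    and "bdd_above (\<phi> ` tms S E)"
    and "equilibrium_measure S E \<phi> m"
    and "\<beta> > 0" and "exp (- \<beta>) \<le> \<theta>"
  shows "\<exists>C>0. \<forall>\<psi> \<mu> q. in_H S E \<beta> \<psi> \<and> inv_prob S E \<mu> \<and> meas_pressure \<mu> \<phi> = ereal q \<longrightarrow>
           \<bar>(\<integral>x. \<psi> x \<partial>\<mu>) - (\<integral>x. \<psi> x \<partial>m)\<bar>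
             \<le> C * hnorm S E \<beta> \<psi> * sqrt (real_of_ereal (gurevich_pressure S E \<phi>) - q)"
proof -
  interpret transitive_tms S E by unfold_locales (rule assms(1), rule assms(2))
  obtain A where h: "hoelder_const S E \<theta> A \<phi>" using assms(4) weakly_hoelder_const by blast
  have \<theta>: "\<theta> < 1" using h by (simp add: hoelder_const_def)
  obtain M where M: "\<And>x. x \<in> tms S E \<Longrightarrow> \<phi> x \<le> M" using assms(6) by (auto simp: bdd_above_def)
  have rp: "0 < real p" using p_pos by simp
  interpret z: mixing_tms V F "\<lambda>_. 0" \<theta> 0 by (rule mixing_zero[OF h])
  have "gpres_mixing V F (\<lambda>_. 0) \<noteq> \<infinity>"
    using assms(3) rp by (auto simp: gurevich_entropy_def gurevich_pressure_def induced_zero)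
  then obtain L where L: "gpres_mixing V F (\<lambda>_. 0) \<le> ereal L"
    using z.pressure_limit(2) by (cases "gpres_mixing V F (\<lambda>_. 0)") auto
  obtain P where P: "gpres_mixing V F (induced_pot S E \<phi>) = ereal P" using pressure_finite[OF h M L] by blast
  have GP: "real_of_ereal (gurevich_pressure S E \<phi>) = P / real p"
    unfolding gurevich_pressure_def P by simp
  interpret f: mixing_tms V F "induced_pot S E \<phi>" \<theta> "real p * A" by (rule mixing_induced[OF h])
  obtain w C' \<epsilon>0 where w: "w \<in> V" and C': "0 < C'" and \<epsilon>0: "0 < \<epsilon>0"
    and pert: "\<And>g N. hoelder_const V F \<theta> N g \<Longrightarrow> \<forall>y\<in>tms V F. \<bar>g y\<bar> \<le> N \<Longrightarrow>
     \<exists>\<kappa>. \<forall>s. \<bar>s\<bar> * N \<le> \<epsilon>0 \<longrightarrow> (\<exists>K>0. \<forall>n. \<forall>y\<in>tms V F. y 0 = w \<longrightarrow>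
        loop_sum V F (\<lambda>y. induced_pot S E \<phi> y + s * g y) w n y \<le> ennreal (K * exp (real n * (P + s * \<kappa> + C' * N\<^sup>2 * s\<^sup>2))))"
    using f.spr_perturbation[OF P assms(5)[unfolded SPR_def]] by blast
  obtain y where y: "y \<in> tms V F" "y 0 = w" using f.point[OF w] by blast
  have upper: "k + (\<integral>x. \<phi> x \<partial>\<mu>) \<le> P / real p" if "inv_prob S E \<mu>" "integrable \<mu> \<phi>" "ks_entropy \<mu> = ereal k" for \<mu> k
    using pressure_upper[OF h _ M that(1,2), of P] P that(3) by simp
  have m: "inv_prob S E m" and sup: "meas_pressure m \<phi> = (SUP \<mu>\<in>{\<mu>. inv_prob S E \<mu>}. meas_pressure \<mu> \<phi>)"
    using assms(7) by (auto simp: equilibrium_measure_def)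
  \<comment> \<open>An equilibrium measure attains the supremum, which is identified with the
    Gurevich pressure only here, through the measures on loops.\<close>
  have low: "ereal (P / real p - e) \<le> meas_pressure m \<phi>" if e: "0 < e" for e
  proof -
    obtain \<mu> where "inv_prob S E \<mu>" "ereal (P / real p - e) \<le> meas_pressure \<mu> \<phi>" using pressure_lower[OF h P e] by blast
    then show ?thesis unfolding sup by (intro SUP_upper2[of \<mu>]) auto
  qed
  have "meas_pressure m \<phi> \<noteq> - \<infinity>" using low[of 1] by auto
  then obtain km where km: "ks_entropy m = ereal km" "integrable m \<phi>" "meas_pressure m \<phi> = ereal (km + (\<integral>x. \<phi> x \<partial>m))"
    using finite_meas_pressure[OF h L m M] by blast
  have "P / real p \<le> km + (\<integral>x. \<phi> x \<partial>m)"
  proof (rule field_le_epsilon)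
    fix e :: real assume "0 < e"
    then show "P / real p \<le> km + (\<integral>x. \<phi> x \<partial>m) + e" using low[of e] km(3) by simp
  qed
  then have eq: "km + (\<integral>x. \<phi> x \<partial>m) = P / real p" using upper[OF m km(2,1)] by simp
  \<comment> \<open>The induced observable is a sum of \<open>p\<close> terms and has bound
    \<open>p * N\<close>. The condition on \<open>s\<close> is therefore rescaled by
    \<open>p\<close>, and \<open>C' * (p * N)^2 / p\<close> becomes \<open>c * N^2\<close> with
    \<open>c = C' * p\<close>.\<close>
  define \<epsilon> where "\<epsilon> = \<epsilon>0 / real p"
  have \<epsilon>: "0 < \<epsilon>" using \<epsilon>0 rp by (simp add: \<epsilon>_def)
  define c where "c = C' * real p"
  have c: "0 < c" using C' rp by (simp add: c_def)
  have main: "\<bar>(\<integral>x. \<psi> x \<partial>\<mu>) - (\<integral>x. \<psi> x \<partial>m)\<bar> \<le> (1 + c + 2 / \<epsilon>) * hnorm S E \<beta> \<psi> * sqrt (P / real p - q)"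
    if \<psi>: "in_H S E \<beta> \<psi>" and \<mu>: "inv_prob S E \<mu>" and q: "meas_pressure \<mu> \<phi> = ereal q" for \<psi> \<mu> q
  proof -
    define N where "N = hnorm S E \<beta> \<psi>"
    have \<psi>b: "\<And>x. x \<in> tms S E \<Longrightarrow> \<bar>\<psi> x\<bar> \<le> N" and h\<psi>: "hoelder_const S E \<theta> N \<psi>"
      using in_H_bounds[OF \<psi> assms(8,9) \<theta>] unfolding N_def by blast+
    have N0: "0 \<le> N" using h\<psi> by (simp add: hoelder_const_def)
    have bd: "integrable \<nu> \<psi>" "\<bar>\<integral>x. \<psi> x \<partial>\<nu>\<bar> \<le> N" if \<nu>: "inv_prob S E \<nu>" for \<nu>
    proof -
      interpret n: inv_tms S E \<nu> by unfold_locales (rule assms(1), rule \<nu>)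
      show int: "integrable \<nu> \<psi>"
        by (rule n.integrable_const_bound[of _ N]) (use \<psi>b n.hoelder_measurable[OF h\<psi>] in \<open>auto simp: n.space_mu\<close>)
      have "\<bar>\<integral>x. \<psi> x \<partial>\<nu>\<bar> \<le> (\<integral>x. \<bar>\<psi> x\<bar> \<partial>\<nu>)" by (rule integral_abs_bound)
      also have "\<dots> \<le> (\<integral>x. N \<partial>\<nu>)" by (rule integral_mono) (use int \<psi>b n.space_mu in auto)
      finally show "\<bar>\<integral>x. \<psi> x \<partial>\<nu>\<bar> \<le> N" by (simp add: n.prob_space)
    qed
    obtain \<kappa> where \<kappa>: "\<And>s. \<bar>s\<bar> * (real p * N) \<le> \<epsilon>0 \<Longrightarrow> \<exists>K>0. \<forall>n. \<forall>y\<in>tms V F. y 0 = w \<longrightarrow>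
        loop_sum V F (\<lambda>y. induced_pot S E \<phi> y + s * induced_pot S E \<psi> y) w n y \<le> ennreal (K * exp (real n * (P + s * \<kappa> + C' * (real p * N)\<^sup>2 * s\<^sup>2)))"
      using pert[OF hoelder_induced[OF h\<psi>]] induced_bounded[where \<psi> = \<psi> and N = N] \<psi>b by blast
    \<comment> \<open>Stated for all invariant \<open>\<nu>\<close> with the same
      \<open>\<kappa>\<close>: for \<open>m\<close> the pressure defect vanishes and
      \<open>\<kappa>\<close> is determined, for \<open>\<mu>\<close> the inequality is then the
      input of the square root bound.\<close>
    have lin: "s * ((\<integral>x. \<psi> x \<partial>\<nu>) - \<kappa> / real p) \<le> (P / real p - (k + (\<integral>x. \<phi> x \<partial>\<nu>))) + c * N\<^sup>2 * s\<^sup>2"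
      if \<nu>: "inv_prob S E \<nu>" "integrable \<nu> \<phi>" "ks_entropy \<nu> = ereal k" and s: "\<bar>s\<bar> * N \<le> \<epsilon>" for \<nu> k s
    proof -
      have "\<bar>s\<bar> * (real p * N) \<le> \<epsilon>0" using s rp by (simp add: \<epsilon>_def field_simps)
      from \<kappa>[OF this] obtain K where K: "0 < K"
        "\<And>n. loop_sum V F (\<lambda>y. induced_pot S E \<phi> y + s * induced_pot S E \<psi> y) w n y \<le> ennreal (K * exp (real n * (P + s * \<kappa> + C' * (real p * N)\<^sup>2 * s\<^sup>2)))"
        using y by blast
      have "ks_entropy \<nu> + ereal (\<integral>x. \<phi> x + s * \<psi> x \<partial>\<nu>) \<le> ereal ((P + s * \<kappa> + C' * (real p * N)\<^sup>2 * s\<^sup>2) / real p)"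
      proof (rule block_variational_upper[where K = K and M = "M + \<bar>s\<bar> * N", OF hoelder_const_lin[OF h h\<psi>] w y K(1)])
        show "loop_sum V F (induced_pot S E (\<lambda>x. \<phi> x + s * \<psi> x)) w n y \<le> ennreal (K * exp (real n * (P + s * \<kappa> + C' * (real p * N)\<^sup>2 * s\<^sup>2)))" for n
          unfolding induced_lin by (rule K(2))
        show "\<phi> x + s * \<psi> x \<le> M + \<bar>s\<bar> * N" if "x \<in> tms S E" for x
        proof -
          have "s * \<psi> x \<le> \<bar>s\<bar> * \<bar>\<psi> x\<bar>" by (metis abs_ge_self abs_mult)
          also have "\<dots> \<le> \<bar>s\<bar> * N" using \<psi>b[OF that] by (rule mult_left_mono) simp
          finally show ?thesis using M[OF that] by simp
        qed
        show "inv_prob S E \<nu>" by (rule \<nu>(1))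
        show "integrable \<nu> (\<lambda>x. \<phi> x + s * \<psi> x)" using \<nu>(2) bd(1)[OF \<nu>(1)] by simp
      qed
      then have "k + ((\<integral>x. \<phi> x \<partial>\<nu>) + s * (\<integral>x. \<psi> x \<partial>\<nu>)) \<le> (P + s * \<kappa> + C' * (real p * N)\<^sup>2 * s\<^sup>2) / real p"
        using \<nu>(2,3) bd(1)[OF \<nu>(1)] by simp
      also have "\<dots> = P / real p + s * (\<kappa> / real p) + c * N\<^sup>2 * s\<^sup>2"
        using rp by (simp add: c_def field_simps power2_eq_square)
      finally show ?thesis by (simp add: right_diff_distrib)
    qed
    have "(\<integral>x. \<psi> x \<partial>m) - \<kappa> / real p = 0"
    proof (rule linear_le_quadratic_imp_zero[of "c * N\<^sup>2" N \<epsilon>])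
      show "s * ((\<integral>x. \<psi> x \<partial>m) - \<kappa> / real p) \<le> c * N\<^sup>2 * s\<^sup>2" if "\<bar>s\<bar> * N \<le> \<epsilon>" for s
        using lin[OF m km(2,1) that] eq by simp
    qed (use c N0 \<epsilon> in auto)
    then have \<kappa>eq: "\<kappa> / real p = (\<integral>x. \<psi> x \<partial>m)" by simp
    obtain k where k: "ks_entropy \<mu> = ereal k" "integrable \<mu> \<phi>" "meas_pressure \<mu> \<phi> = ereal (k + (\<integral>x. \<phi> x \<partial>\<mu>))"
      using finite_meas_pressure[OF h L \<mu> M] q by auto
    have qk: "q = k + (\<integral>x. \<phi> x \<partial>\<mu>)" using k(3) q by simp
    show ?thesis unfolding N_def[symmetric]
    proof (rule sqrt_bound_of_quadratic)
      show "0 \<le> P / real p - q" using upper[OF \<mu> k(2,1)] qk by simp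
      show "\<bar>(\<integral>x. \<psi> x \<partial>\<mu>) - (\<integral>x. \<psi> x \<partial>m)\<bar> \<le> 2 * N" using bd(2)[OF \<mu>] bd(2)[OF m] by linarith
      show "s * ((\<integral>x. \<psi> x \<partial>\<mu>) - (\<integral>x. \<psi> x \<partial>m)) \<le> P / real p - q + c * N\<^sup>2 * s\<^sup>2" if "\<bar>s\<bar> * N \<le> \<epsilon>" for s
        using lin[OF \<mu> k(2,1) that] unfolding \<kappa>eq qk .
    qed (use c N0 \<epsilon> in auto)
  qed
  show ?thesis
  proof (intro exI[of _ "1 + c + 2 / \<epsilon>"] conjI allI impI)
    show "0 < 1 + c + 2 / \<epsilon>" using c \<epsilon> by (simp add: add_pos_pos)
  qed (use main GP in auto)
qed

end
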